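(* Let $(A,\mathbf B)$ be a normalized table algebra, regarded as an algebra over $\mathcal A=\mathbb Z[v,v^{-1}]$, let $\delta=v+v^{-1}$, and let $n$ be a nonnegative integer. Then the $\mathcal A$-algebra $P_n^A$, equipped with its canonical basis $\mathbf B_n^A$ and the trace $\tau$, is a tabular algebra with trace. That is, there is a table datum $(\Lambda,\Gamma,B,M,C,* )$ for $P_n^A$ with $\operatorname{Im}(C)=\mathbf B_n^A$ such that axioms (A1), (A2), (A3), (A4) hold and such that axiom (A5) holds with $\tau$ as the tabular trace.
   Context: Normalized table algebras. A normalized table algebra over a ring $R$ is a pair $(A,\mathbf B)$, where $A$ is an associative unital $R$-algebra and $\mathbf B=\{b_i:i\in I\}$ is a free $R$-basis of $A$ containing $1$, such that: (T1) the structure constants of $A$ with respect to $\mathbf B$ are nonnegative integers; (T2) there is a linear algebra anti-automorphism $a\mapsto\overline a$ of $A$ whose square is the identity and which maps $\mathbf B$ to $\mathbf B$ (write $\overline{b_i}=b_{\overline i}$); (T3) writing $\kappa(b,a)$ for the coefficient of $b\in\mathbf B$ in $a\in A$, one has $\kappa(b_m,b_ib_j)=\kappa(b_i,b_m\overline{b_j})$ for all $i,j,m$. Put $t(a)=\kappa(1,a)$; then $t(ab)=t(ba)$. For $a\in A$, $\operatorname{supp}(a)$ is the set of elements of $\mathbf B$ occurring with nonzero coefficient in $a$. Since the structure constants are integers, a normalized table algebra over $\mathbb Z$ can be regarded, by extension of scalars, as an algebra over $\mathcal A$ with basis $\mathbf B$. The algebra $P_n^A$. The standard $n$-box is the rectangle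 $[0,n+1]\times[0,1]$ with marked points $1,\dots,n$ at $(1,1),\dots,(n,1)$ and $n+1,\dots,2n$ at $(n,0),\dots,(1,0)$, so that point $2n+1-i$ lies directly below point $i$. The canonical basis $\mathbf B_n^A$ is the set of diagrams consisting of $n$ disjoint curves (edges) in the rectangle joining the $2n$ marked points in pairs, without closed loops, up to isotopy (equivalently, non-crossing perfect matchings of the cyclically ordered set $\{1,\dots,2n\}$), each edge carrying one label from $\mathbf B$. Each edge joins an even-numbered point to an odd-numbered point and is oriented from the even point to the odd point. $P_n^A$ is the free $\mathcal A$-module on $\mathbf B_n^A$. The product $T_1T_2$ of two canonical basis elements is obtained by placing $T_1$ above $T_2$, gluing point $2n+1-i$ of $T_1$ to point $i$ of $T_2$ for $1\le i\le n$ (orientations match). If, traversing a resulting edge or loop along its orientation, one meets labels $a_1,\dots,a_k$ in this order, they are replaced by the single label $a_k\cdots a_1\in A$. Each closed loop with label $a$ is removed and replaced by the scalar factor $\delta\,t(a)$, and the labels on edges are expanded multilinearly in terms of $\mathbf B$. The product is extended bilinearly. The trace. For a canonical basis element $x$ of $P_n^A$, join point $i$ to point $2n+1-i$ for each $1\le i\le n$ by non-intersecting curves outside the box (suitably oriented), so that only closed loops remain; let $\operatorname{tr}(x)$ be the product over these loops of $\delta\,t(a)$, where $a$ is the product of the labels on the loop, that is, $a=a_k\cdots a_1\in A$ if, traversing the loop along its orientation from some starting point, one meets the labels $a_1,\dots,a_k$ in this order (the value $t(a)$ does not depend on the starting point, because $t(ab)=t(ba)$). Extend linearly and set $\tau(x)=v^{-n}\operatorname{tr}(x)$.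 Tabular algebras. A tabular algebra is an $\mathcal A$-algebra $\mathfrak A$ with a table datum $(\Lambda,\Gamma,B,M,C,* )$ where: (A1) $\Lambda$ is a finite poset; for each $\lambda\in\Lambda$, $(\Gamma(\lambda),B(\lambda))$ is a normalized table algebra over $\mathbb Z$ and $M(\lambda)$ is a finite set. The map $C:\coprod_{\lambda\in\Lambda}(M(\lambda)\times B(\lambda)\times M(\lambda))\to\mathfrak A$ is injective with image an $\mathcal A$-basis of $\mathfrak A$ (a tabular basis). $\operatorname{Im}(C)$ contains a set of mutually orthogonal idempotents $\{1_\varepsilon:\varepsilon\in\mathcal E\}$ such that $\mathfrak A=\sum_{\varepsilon,\varepsilon'\in\mathcal E}1_\varepsilon\mathfrak A1_{\varepsilon'}$ and for each $X\in\operatorname{Im}(C)$ we have $X=1_\varepsilon X1_{\varepsilon'}$ for some $\varepsilon,\varepsilon'\in\mathcal E$. (A2) Write $C_{S,T}^b=C(S,b,T)$ for $S,T\in M(\lambda)$, $b\in B(\lambda)$, and extend linearly to write $C_{S,T}^g=\sum_i c_iC_{S,T}^{b_i}$ for $g=\sum_i c_ib_i$ (with scalars $c_i$, possibly involving $v$). Then $*$ is an $\mathcal A$-linear involutory anti-automorphism of $\mathfrak A$ with $(C_{S,T}^b)^*=C_{T,S}^{\overline b}$, where $\overline{\ }$ is the table algebra anti-automorphism of $\Gamma(\lambda)$. Let $\mathbf c_\lambda$ be the image under $C$ of $M(\lambda)\times B(\lambda)\times M(\lambda)$. (A3) If $\lambda\in\Lambda$, $g\in\Gamma(\lambda)$ and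 $S,T\in M(\lambda)$, then for all $a\in\mathfrak A$, $a\,C_{S,T}^g\equiv\sum_{S'\in M(\lambda)}C_{S',T}^{r_a(S',S)g}\pmod{\mathfrak A(<\lambda)}$, where $r_a(S',S)\in\mathcal A\otimes_{\mathbb Z}\Gamma(\lambda)$ is independent of $T$ and $g$, and $\mathfrak A(<\lambda)$ is the $\mathcal A$-span of $\bigcup_{\mu<\lambda}\mathbf c_\mu$. For $X,Y,Z\in\operatorname{Im}(C)$ let $g_{X,Y,Z}\in\mathcal A$ be the structure constants, $XY=\sum_Zg_{X,Y,Z}Z$. Define $\mathbf a(Z)=\max_{X,Y\in\operatorname{Im}(C)}\deg(g_{X,Y,Z})$, where the degree of a Laurent polynomial is the highest power of $v$ occurring with nonzero coefficient, and let $\gamma_{X,Y,Z}\in\mathbb Z$ be the coefficient of $v^{\mathbf a(Z)}$ in $g_{X,Y,Z}$. Let $\mathcal A^-=\mathbb Z[v^{-1}]$. A tabular algebra with trace is a tabular algebra satisfying in addition: (A4) Let $K=C_{S,T}^b$, $K'=C_{U,V}^{b'}$, $K''=C_{X,Y}^{b''}$ lie in $\operatorname{Im}(C)$. Then $\deg(g_{K,K',K''})=\mathbf a(K'')$ if and only if $X=S$, $T=U$, $Y=V$ (so that all three elements belong to the same $\lambda$) and $b''\in\operatorname{supp}(bb')$. If these conditions hold and $b=b'=b''=1$, then $\gamma_{K,K',K''}=1$. (A5) There is an $\mathcal A$-linear function $\tau:\mathfrak A\to\mathcal A$ (the tabular trace) with $\tau(x)=\tau(x^* )$ and $\tau(xy)=\tau(yx)$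 for all $x,y\in\mathfrak A$, such that for every $\lambda\in\Lambda$, $S,T\in M(\lambda)$, $b\in B(\lambda)$ and $X=C_{S,T}^b$, $\tau(v^{\mathbf a(X)}X)$ is congruent modulo $v^{-1}\mathcal A^-$ to $1$ if $S=T$ and $b=1$, and to $0$ otherwise.
   Formalization: The formal theorem assumes that B is finite or n ≤ 1; for infinite B and n ≥ 2 the claim fails, since (A1) requires each M(λ) to be finite while (A4) forces infinitely many labelled half-diagrams to be distinguished. *)

theory Defs
  imports
    "HOL-Algebra.Algebraic_Closure_Type"
    "HOL-Library.Poly_Mapping"
    "HOL-Library.FuncSet"
begin

section \<open>Algebras and bases\<close>

text \<open>
  The library locale \<^locale>\<open>algebra\<close> is restricted to commutative algebras, so the
  associative, unital, not necessarily commutative version is introduced here.  The ground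
  ring is a whole type of class \<^class>\<open>comm_ring_1\<close>.
\<close>

locale associative_algebra =
  module "ring_of_type_algebra" A + ring A
  for A :: "('r::comm_ring_1, 'a) module" (structure) +
  assumes smult_mult_left:
      "x \<in> carrier A \<Longrightarrow> y \<in> carrier A \<Longrightarrow> (r \<odot> x) \<otimes> y = r \<odot> (x \<otimes> y)"
    and smult_mult_right:
      "x \<in> carrier A \<Longrightarrow> y \<in> carrier A \<Longrightarrow> x \<otimes> (r \<odot> y) = r \<odot> (x \<otimes> y)"

definition lincomb :: "('r::comm_ring_1, 'a) module \<Rightarrow> ('a \<Rightarrow>\<^sub>0 'r) \<Rightarrow> 'a" where
  "lincomb A c = (\<Oplus>\<^bsub>A\<^esub>x\<in>Poly_Mapping.keys c. Poly_Mapping.lookup c x \<odot>\<^bsub>A\<^esub> x)"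

definition lin_span :: "('r::comm_ring_1, 'a) module \<Rightarrow> 'a set \<Rightarrow> 'a set" where
  "lin_span A K = {lincomb A c | c. Poly_Mapping.keys c \<subseteq> K}"

definition free_basis :: "('r::comm_ring_1, 'a) module \<Rightarrow> 'a set \<Rightarrow> bool" where
  "free_basis A B \<longleftrightarrow>
     B \<subseteq> carrier A \<and> (\<forall>x\<in>carrier A. \<exists>!c. Poly_Mapping.keys c \<subseteq> B \<and> lincomb A c = x)"

definition coords :: "('r::comm_ring_1, 'a) module \<Rightarrow> 'a set \<Rightarrow> 'a \<Rightarrow> ('a \<Rightarrow>\<^sub>0 'r)" where
  "coords A B x = (THE c. Poly_Mapping.keys c \<subseteq> B \<and> lincomb A c = x)"

definition kappa :: "('r::comm_ring_1, 'a) module \<Rightarrow> 'a set \<Rightarrow> 'a \<Rightarrow> 'a \<Rightarrow> 'r" where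
  "kappa A B b x = Poly_Mapping.lookup (coords A B x) b"

definition supp :: "('r::comm_ring_1, 'a) module \<Rightarrow> 'a set \<Rightarrow> 'a \<Rightarrow> 'a set" where
  "supp A B x = Poly_Mapping.keys (coords A B x)"

definition involutory_anti_automorphism ::
    "('r::comm_ring_1, 'a) module \<Rightarrow> ('a \<Rightarrow> 'a) \<Rightarrow> bool" where
  "involutory_anti_automorphism A f \<longleftrightarrow>
     f \<in> carrier A \<rightarrow> carrier A \<and>
     (\<forall>x\<in>carrier A. \<forall>y\<in>carrier A. f (x \<oplus>\<^bsub>A\<^esub> y) = f x \<oplus>\<^bsub>A\<^esub> f y) \<and>
     (\<forall>r. \<forall>x\<in>carrier A. f (r \<odot>\<^bsub>A\<^esub> x) = r \<odot>\<^bsub>A\<^esub> f x) \<and>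
     (\<forall>x\<in>carrier A. \<forall>y\<in>carrier A. f (x \<otimes>\<^bsub>A\<^esub> y) = f y \<otimes>\<^bsub>A\<^esub> f x) \<and>
     (\<forall>x\<in>carrier A. f (f x) = x)"

text \<open>
  The algebra structure on the free module with basis \<open>Bs\<close> (embedded as
  \<open>x \<mapsto> Poly_Mapping.single x 1\<close>) whose product is the bilinear extension of a given
  product \<open>mul\<close> of basis elements.
\<close>

definition scale :: "'r::comm_ring_1 \<Rightarrow> ('x \<Rightarrow>\<^sub>0 'r) \<Rightarrow> ('x \<Rightarrow>\<^sub>0 'r)" where
  "scale r f = Poly_Mapping.map (\<lambda>c. r * c) f"

definition free_algebra :: "'x set \<Rightarrow> ('x \<Rightarrow> 'x \<Rightarrow> ('x \<Rightarrow>\<^sub>0 'r)) \<Rightarrow> 'x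
    \<Rightarrow> ('r::comm_ring_1, 'x \<Rightarrow>\<^sub>0 'r) module" where
  "free_algebra Bs mul u =
     \<lparr>carrier = {f. Poly_Mapping.keys f \<subseteq> Bs},
      monoid.mult = (\<lambda>f g. \<Sum>x\<in>Poly_Mapping.keys f. \<Sum>y\<in>Poly_Mapping.keys g.
                scale (Poly_Mapping.lookup f x * Poly_Mapping.lookup g y) (mul x y)),
      one = Poly_Mapping.single u 1,
      zero = 0,
      add = (+),
      module.smult = scale\<rparr>"


section \<open>Normalized table algebras\<close>

locale normalized_table_algebra = associative_algebra A
  for A :: "('r::comm_ring_1, 'a) module" (structure) and B :: "'a set" and bar :: "'a \<Rightarrow> 'a" +
  assumes basis: "free_basis A B"
    and one_in_basis: "\<one> \<in> B"
    and T1: "b \<in> B \<Longrightarrow> b' \<in> B \<Longrightarrow> b'' \<in> B \<Longrightarrow> kappa A B b'' (b \<otimes> b') \<in> \<nat>"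
    and T2_anti: "involutory_anti_automorphism A bar"
    and T2_basis: "b \<in> B \<Longrightarrow> bar b \<in> B"
    and T3: "b \<in> B \<Longrightarrow> b' \<in> B \<Longrightarrow> b'' \<in> B \<Longrightarrow>
               kappa A B b'' (b \<otimes> b') = kappa A B b (b'' \<otimes> bar b')"

definition table_trace :: "('r::comm_ring_1, 'a) module \<Rightarrow> 'a set \<Rightarrow> 'a \<Rightarrow> 'r" where
  "table_trace A B a = kappa A B \<one>\<^bsub>A\<^esub> a"


section \<open>Laurent polynomials and extension of scalars\<close>

text \<open>
  The ring of Laurent polynomials in \<open>v\<close> with integer coefficients, as the monoid algebra of
  the additive group of exponents; the key \<open>k\<close> stands for the \<open>k\<close>-th power of \<open>v\<close>.
\<close>

type_synonym laurent = "int \<Rightarrow>\<^sub>0 int"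

definition vpow :: "int \<Rightarrow> laurent" where
  "vpow k = Poly_Mapping.single k 1"

definition delta :: laurent where
  "delta = vpow 1 + vpow (-1)"

text \<open>
  The degree of the zero polynomial should be \<open>-\<infinity>\<close>; \<open>ldeg 0\<close> is unspecified
  and below every use of \<open>ldeg p\<close> is accompanied by \<open>p \<noteq> 0\<close>.
\<close>

definition ldeg :: "laurent \<Rightarrow> int" where
  "ldeg p = Max (Poly_Mapping.keys p)"

definition Aminus :: "laurent set" where
  "Aminus = {p. Poly_Mapping.keys p \<subseteq> {..0}}"

text \<open>
  For an algebra \<open>G\<close> over the integers with basis \<open>B\<close>, the scalar extension to Laurent
  polynomials is the free module on \<open>B\<close> with the structure constants of \<open>G\<close>.
\<close>

definition of_int_coords :: "(int, 'g) module \<Rightarrow> 'g set \<Rightarrow> 'g \<Rightarrow> ('g \<Rightarrow>\<^sub>0 laurent)" where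
  "of_int_coords G B g = Poly_Mapping.map of_int (coords G B g)"

definition extend_scalars ::
    "(int, 'g) module \<Rightarrow> 'g set \<Rightarrow> (laurent, 'g \<Rightarrow>\<^sub>0 laurent) module" where
  "extend_scalars G B = free_algebra B (\<lambda>x y. of_int_coords G B (x \<otimes>\<^bsub>G\<^esub> y)) \<one>\<^bsub>G\<^esub>"


section \<open>Tabular algebras\<close>

text \<open>
  The partial order on \<open>\<Lambda>\<close> is the relation \<open>le\<close>, with \<open>(\<mu>, \<lambda>) \<in> le\<close> meaning
  \<open>\<mu> \<le> \<lambda>\<close>.  The disjoint union over \<open>\<Lambda>\<close> of the sets \<open>M(\<lambda>) \<times> B(\<lambda>) \<times> M(\<lambda>)\<close> consists
  of quadruples \<open>(\<lambda>, S, b, T)\<close>.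
\<close>

definition table_index ::
    "'l set \<Rightarrow> ('l \<Rightarrow> 'g set) \<Rightarrow> ('l \<Rightarrow> 's set) \<Rightarrow> ('l \<times> 's \<times> 'g \<times> 's) set" where
  "table_index \<Lambda> B M = (SIGMA l:\<Lambda>. M l \<times> B l \<times> M l)"

definition tabular_basis ::
    "'l set \<Rightarrow> ('l \<Rightarrow> 'g set) \<Rightarrow> ('l \<Rightarrow> 's set) \<Rightarrow> ('l \<times> 's \<times> 'g \<times> 's \<Rightarrow> 'x) \<Rightarrow> 'x set" where
  "tabular_basis \<Lambda> B M C = C ` table_index \<Lambda> B M"

text \<open>
  The linear extension of \<open>C\<close> in its middle argument, applied to an element of the
  scalar extension of \<open>\<Gamma>(\<lambda>)\<close>.
\<close>

definition C_ext :: "(laurent, 'x) module \<Rightarrow> ('l \<times> 's \<times> 'g \<times> 's \<Rightarrow> 'x)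
    \<Rightarrow> 'l \<Rightarrow> 's \<Rightarrow> ('g \<Rightarrow>\<^sub>0 laurent) \<Rightarrow> 's \<Rightarrow> 'x" where
  "C_ext U C l S g T =
     (\<Oplus>\<^bsub>U\<^esub>b\<in>Poly_Mapping.keys g. Poly_Mapping.lookup g b \<odot>\<^bsub>U\<^esub> C (l, S, b, T))"

locale tabular_algebra = associative_algebra U
  for U :: "(laurent, 'x) module" (structure)
    and \<Lambda> :: "'l set"
    and le :: "'l rel"
    and \<Gamma> :: "'l \<Rightarrow> (int, 'g) module"
    and B :: "'l \<Rightarrow> 'g set"
    and bar :: "'l \<Rightarrow> 'g \<Rightarrow> 'g"
    and M :: "'l \<Rightarrow> 's set"
    and C :: "'l \<times> 's \<times> 'g \<times> 's \<Rightarrow> 'x"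
    and star :: "'x \<Rightarrow> 'x" +
  assumes A1_poset: "finite \<Lambda>" "partial_order_on \<Lambda> le"
    and A1_table: "l \<in> \<Lambda> \<Longrightarrow> normalized_table_algebra (\<Gamma> l) (B l) (bar l)"
    and A1_finite: "l \<in> \<Lambda> \<Longrightarrow> finite (M l)"
    and A1_inj: "inj_on C (table_index \<Lambda> B M)"
    and A1_basis: "free_basis U (tabular_basis \<Lambda> B M C)"
    and A1_idempotents:
      "\<exists>E \<subseteq> tabular_basis \<Lambda> B M C.
         (\<forall>e\<in>E. e \<otimes> e = e) \<and>
         (\<forall>e\<in>E. \<forall>f\<in>E. e \<noteq> f \<longrightarrow> e \<otimes> f = \<zero>) \<and>
         carrier U = lin_span U {e \<otimes> a \<otimes> f | e a f. e \<in> E \<and> a \<in> carrier U \<and> f \<in> E} \<and>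
         (\<forall>K \<in> tabular_basis \<Lambda> B M C. \<exists>e\<in>E. \<exists>f\<in>E. K = e \<otimes> K \<otimes> f)"
    and A2_anti: "involutory_anti_automorphism U star"
    and A2_star:
      "(l, S, b, T) \<in> table_index \<Lambda> B M \<Longrightarrow> star (C (l, S, b, T)) = C (l, T, bar l b, S)"
    and A3:
      "l \<in> \<Lambda> \<Longrightarrow> a \<in> carrier U \<Longrightarrow>
         \<exists>r. (\<forall>S'\<in>M l. \<forall>S\<in>M l. r S' S \<in> carrier (extend_scalars (\<Gamma> l) (B l))) \<and>
             (\<forall>S\<in>M l. \<forall>T\<in>M l. \<forall>g\<in>carrier (\<Gamma> l).
                a \<otimes> C_ext U C l S (of_int_coords (\<Gamma> l) (B l) g) T
                \<ominus> (\<Oplus>S'\<in>M l. C_ext U C l S'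
                      (r S' S \<otimes>\<^bsub>extend_scalars (\<Gamma> l) (B l)\<^esub> of_int_coords (\<Gamma> l) (B l) g) T)
                \<in> lin_span U (C ` {(m, q) \<in> table_index \<Lambda> B M. (m, l) \<in> le \<and> m \<noteq> l}))"

definition structure_const :: "(laurent, 'x) module \<Rightarrow> 'x set \<Rightarrow> 'x \<Rightarrow> 'x \<Rightarrow> 'x \<Rightarrow> laurent" where
  "structure_const U Bs K L N = kappa U Bs N (K \<otimes>\<^bsub>U\<^esub> L)"

definition degrees :: "(laurent, 'x) module \<Rightarrow> 'x set \<Rightarrow> 'x \<Rightarrow> int set" where
  "degrees U Bs N = {ldeg (structure_const U Bs K L N) | K L.
     K \<in> Bs \<and> L \<in> Bs \<and> structure_const U Bs K L N \<noteq> 0}"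

definition a_fun :: "(laurent, 'x) module \<Rightarrow> 'x set \<Rightarrow> 'x \<Rightarrow> int" where
  "a_fun U Bs N = (GREATEST k. k \<in> degrees U Bs N)"

definition gamma_const :: "(laurent, 'x) module \<Rightarrow> 'x set \<Rightarrow> 'x \<Rightarrow> 'x \<Rightarrow> 'x \<Rightarrow> int" where
  "gamma_const U Bs K L N = Poly_Mapping.lookup (structure_const U Bs K L N) (a_fun U Bs N)"

text \<open>
  The condition \<open>a_defined\<close> says that the maximum defining \<open>a_fun\<close> exists.  In \<open>A4\<close>, indices
  of the disjoint union are compared, hence the explicit equality of the elements of \<open>\<Lambda>\<close>.
\<close>

locale tabular_algebra_with_trace = tabular_algebra U \<Lambda> le \<Gamma> B bar M C star
  for U :: "(laurent, 'x) module" (structure)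
    and \<Lambda> :: "'l set"
    and le :: "'l rel"
    and \<Gamma> :: "'l \<Rightarrow> (int, 'g) module"
    and B :: "'l \<Rightarrow> 'g set"
    and bar :: "'l \<Rightarrow> 'g \<Rightarrow> 'g"
    and M :: "'l \<Rightarrow> 's set"
    and C :: "'l \<times> 's \<times> 'g \<times> 's \<Rightarrow> 'x"
    and star :: "'x \<Rightarrow> 'x"
    and \<tau> :: "'x \<Rightarrow> laurent" +
  assumes a_defined:
      "N \<in> tabular_basis \<Lambda> B M C \<Longrightarrow>
         \<exists>k\<in>degrees U (tabular_basis \<Lambda> B M C) N.
           \<forall>j\<in>degrees U (tabular_basis \<Lambda> B M C) N. j \<le> k"
    and A4_degree:
      "(l, S, b, T) \<in> table_index \<Lambda> B M \<Longrightarrow> (l', S', b', T') \<in> table_index \<Lambda> B M \<Longrightarrow>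
       (l'', S'', b'', T'') \<in> table_index \<Lambda> B M \<Longrightarrow>
       g = structure_const U (tabular_basis \<Lambda> B M C) (C (l, S, b, T)) (C (l', S', b', T')) (C (l'', S'', b'', T'')) \<Longrightarrow>
         (g \<noteq> 0 \<and> ldeg g = a_fun U (tabular_basis \<Lambda> B M C) (C (l'', S'', b'', T''))) \<longleftrightarrow>
         (l' = l \<and> l'' = l \<and> S'' = S \<and> T = S' \<and> T'' = T' \<and>
          b'' \<in> supp (\<Gamma> l) (B l) (b \<otimes>\<^bsub>\<Gamma> l\<^esub> b'))"
    and A4_gamma:
      "l \<in> \<Lambda> \<Longrightarrow> S \<in> M l \<Longrightarrow> T \<in> M l \<Longrightarrow> V \<in> M l \<Longrightarrow>
         gamma_const U (tabular_basis \<Lambda> B M C) (C (l, S, \<one>\<^bsub>\<Gamma> l\<^esub>, T)) (C (l, T, \<one>\<^bsub>\<Gamma> l\<^esub>, V)) (C (l, S, \<one>\<^bsub>\<Gamma> l\<^esub>, V)) = 1"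
    and A5_add: "x \<in> carrier U \<Longrightarrow> y \<in> carrier U \<Longrightarrow> \<tau> (x \<oplus> y) = \<tau> x + \<tau> y"
    and A5_smult: "x \<in> carrier U \<Longrightarrow> \<tau> (r \<odot> x) = r * \<tau> x"
    and A5_star: "x \<in> carrier U \<Longrightarrow> \<tau> (star x) = \<tau> x"
    and A5_trace: "x \<in> carrier U \<Longrightarrow> y \<in> carrier U \<Longrightarrow> \<tau> (x \<otimes> y) = \<tau> (y \<otimes> x)"
    and A5_congruence:
      "(l, S, b, T) \<in> table_index \<Lambda> B M \<Longrightarrow> K = C (l, S, b, T) \<Longrightarrow>
         \<tau> (vpow (a_fun U (tabular_basis \<Lambda> B M C) K) \<odot> K) - (if S = T \<and> b = \<one>\<^bsub>\<Gamma> l\<^esub> then 1 else 0)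
           \<in> (\<lambda>p. vpow (-1) * p) ` Aminus"


section \<open>Labelled planar diagrams\<close>

text \<open>
  An edge \<open>(p, q, b)\<close> is oriented from \<open>p\<close> to \<open>q\<close> and carries the label \<open>b\<close>.  A diagram is the
  set of its edges, the marked points being \<open>1, \<dots>, 2n\<close> in cyclic order around the box.
\<close>

type_synonym 'a diagram = "(nat \<times> nat \<times> 'a) set"

definition crossing :: "nat \<times> nat \<Rightarrow> nat \<times> nat \<Rightarrow> bool" where
  "crossing = (\<lambda>(p, q) (p', q').
     min p q < min p' q' \<and> min p' q' < max p q \<and> max p q < max p' q')"

definition diagrams :: "nat \<Rightarrow> 'a set \<Rightarrow> 'a diagram set" where
  "diagrams n B = {D.
     D \<subseteq> {p \<in> {1..2 * n}. even p} \<times> {q \<in> {1..2 * n}. odd q} \<times> B \<and>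
     (\<forall>x\<in>{1..2 * n}. \<exists>!e. e \<in> D \<and> (x = fst e \<or> x = fst (snd e))) \<and>
     (\<forall>(p, q, b)\<in>D. \<forall>(p', q', b')\<in>D. \<not> crossing (p, q) (p', q'))}"

text \<open>
  \<open>walk E x w y\<close>: some path of length at least one in the graph with labelled oriented edges
  \<open>E\<close> leads from \<open>x\<close> to \<open>y\<close> and meets the labels \<open>w\<close> in this order.
\<close>

inductive walk :: "('p \<times> 'p \<times> 'a) set \<Rightarrow> 'p \<Rightarrow> 'a list \<Rightarrow> 'p \<Rightarrow> bool" for E where
  edge: "(x, y, a) \<in> E \<Longrightarrow> walk E x [a] y"
| step: "(x, y, a) \<in> E \<Longrightarrow> walk E y w z \<Longrightarrow> walk E x (a # w) z"

text \<open>The labels \<open>[a\<^sub>1, \<dots>, a\<^sub>k]\<close> met in this order are replaced by the product \<open>a\<^sub>k \<cdots> a\<^sub>1\<close>.\<close>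

definition word_label :: "('r, 'a) module \<Rightarrow> 'a list \<Rightarrow> 'a" where
  "word_label A w = fold (\<lambda>a x. a \<otimes>\<^bsub>A\<^esub> x) w \<one>\<^bsub>A\<^esub>"

text \<open>
  A loop is given by its set of vertices.  In the graphs below every vertex has at most one
  outgoing and at most one incoming edge, so the loop through \<open>x\<close> consists of the vertices
  reachable from \<open>x\<close>, and one round trip has as many edges as there are vertices.  The least
  vertex serves as starting point.
\<close>

definition loops :: "(nat \<times> nat \<times> 'a) set \<Rightarrow> nat set set" where
  "loops E = {{y. \<exists>w. walk E x w y} | x. \<exists>w. walk E x w x}"

definition loop_label :: "('r, 'a) module \<Rightarrow> (nat \<times> nat \<times> 'a) set \<Rightarrow> nat set \<Rightarrow> 'a" where
  "loop_label A E L = word_label A (THE w. walk E (Min L) w (Min L) \<and> length w = card L)"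

definition loop_factor :: "(int, 'a) module \<Rightarrow> 'a set \<Rightarrow> (nat \<times> nat \<times> 'a) set \<Rightarrow> laurent" where
  "loop_factor A B E = (\<Prod>L\<in>loops E. delta * of_int (table_trace A B (loop_label A E L)))"

text \<open>
  Gluing: the marked points of the composite keep their numbers \<open>1, \<dots>, 2n\<close>, and the point
  resulting from gluing \<open>2n+1-i\<close> of the upper to \<open>i\<close> of the lower diagram is numbered \<open>2n+i\<close>.
\<close>

definition upper_point :: "nat \<Rightarrow> nat \<Rightarrow> nat" where
  "upper_point n p = (if p \<le> n then p else 2 * n + (2 * n + 1 - p))"

definition lower_point :: "nat \<Rightarrow> nat \<Rightarrow> nat" where
  "lower_point n p = (if p \<le> n then 2 * n + p else p)"

definition glue :: "nat \<Rightarrow> 'a diagram \<Rightarrow> 'a diagram \<Rightarrow> 'a diagram" where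
  "glue n T1 T2 = (\<lambda>(p, q, b). (upper_point n p, upper_point n q, b)) ` T1
                \<union> (\<lambda>(p, q, b). (lower_point n p, lower_point n q, b)) ` T2"

definition strands :: "nat \<Rightarrow> 'a diagram \<Rightarrow> (nat \<times> nat) set" where
  "strands n E = {(p, q) \<in> {1..2 * n} \<times> {1..2 * n}. \<exists>w. walk E p w q}"

definition strand_label :: "('r, 'a) module \<Rightarrow> 'a diagram \<Rightarrow> nat \<times> nat \<Rightarrow> 'a" where
  "strand_label A E s = word_label A (THE w. walk E (fst s) w (snd s))"

text \<open>
  The multilinear expansion runs over the functions \<open>f\<close> choosing for each strand of the
  composite a basis element in the support of its label.
\<close>

definition diagram_mult :: "nat \<Rightarrow> (int, 'a) module \<Rightarrow> 'a set \<Rightarrow> 'a diagram \<Rightarrow> 'a diagram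
    \<Rightarrow> ('a diagram \<Rightarrow>\<^sub>0 laurent)" where
  "diagram_mult n A B T1 T2 = (let E = glue n T1 T2; P = strands n E in
     \<Sum>f \<in> (\<Pi>\<^sub>E s\<in>P. supp A B (strand_label A E s)).
       Poly_Mapping.single ((\<lambda>(p, q). (p, q, f (p, q))) ` P)
         (loop_factor A B E * of_int (\<Prod>s\<in>P. kappa A B (f s) (strand_label A E s))))"

definition identity_diagram :: "nat \<Rightarrow> 'a \<Rightarrow> 'a diagram" where
  "identity_diagram n u = (\<lambda>p. (p, 2 * n + 1 - p, u)) ` {p \<in> {1..2 * n}. even p}"

definition P_algebra :: "nat \<Rightarrow> (int, 'a) module \<Rightarrow> 'a set
    \<Rightarrow> (laurent, 'a diagram \<Rightarrow>\<^sub>0 laurent) module" where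
  "P_algebra n A B =
     free_algebra (diagrams n B) (diagram_mult n A B) (identity_diagram n \<one>\<^bsub>A\<^esub>)"

definition canonical_basis :: "nat \<Rightarrow> 'a set \<Rightarrow> ('a diagram \<Rightarrow>\<^sub>0 laurent) set" where
  "canonical_basis n B = (\<lambda>D. Poly_Mapping.single D 1) ` diagrams n B"

text \<open>Closing up a diagram identifies the points \<open>i\<close> and \<open>2n+1-i\<close>; both are renamed to \<open>i \<le> n\<close>.\<close>

definition closure_point :: "nat \<Rightarrow> nat \<Rightarrow> nat" where
  "closure_point n p = (if p \<le> n then p else 2 * n + 1 - p)"

definition close_up :: "nat \<Rightarrow> 'a diagram \<Rightarrow> 'a diagram" where
  "close_up n D = (\<lambda>(p, q, b). (closure_point n p, closure_point n q, b)) ` D"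

definition P_trace :: "nat \<Rightarrow> (int, 'a) module \<Rightarrow> 'a set \<Rightarrow> ('a diagram \<Rightarrow>\<^sub>0 laurent) \<Rightarrow> laurent" where
  "P_trace n A B x = vpow (- int n) *
     (\<Sum>D\<in>Poly_Mapping.keys x. Poly_Mapping.lookup x D * loop_factor A B (close_up n D))"

end

theory Submission
  imports Defs "HOL-Combinatorics.Orbits"
begin

text \<open>
  A diagram consists of an upper half \<open>S\<close>, a lower half \<open>T\<close> and the labels \<open>xs\<close> of its
  \<open>l\<close> through strings.  For fixed \<open>l\<close> the labels form a table algebra, the \<open>l\<close>-fold tensor
  power of \<open>A\<close> with every second factor reversed, and this gives the table datum.

  Products are computed by contracting the middle points of the glued graph one at a time.  As
  the coefficients of the result are multilinear in the labels, associativity reduces to the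
  fact that contractions at different points commute.  The arcs of the upper half of the first
  factor and of the lower half of the second one persist in the product, so the number of
  through strings cannot grow.  A structure constant is an integral multiple of \<open>\<delta>\<^sup>k\<close>, where
  \<open>k\<close> is the number of closed loops.  Every loop meets both halves that are glued; hence \<open>k\<close> is
  at most the number of arcs of either, and if both bounds are attained then each loop consists
  of one arc of each half, and \<open>t(bar a b)\<close> being the Kronecker symbol forces the labels, and
  therefore the halves, to agree.  The same count for closed diagrams yields the congruence for
  the trace.
\<close>

section \<open>Free algebras\<close>

text \<open>The product is defined only for labels in \<open>B\<close>, so an iterated product
  expands labels, multiplies and expands again. Being linear in every label, it allows intermediate
  expansions to be undone, and both bracketings of a triple product are compared on one graph with
  two interfaces. Strands and loops are specified by walks and definite descriptions. They are
  handled through two quantities, \<open>net\<close> and \<open>loop_factor\<close>, whose change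
  under removal of one inner vertex is known; relabelling, reversal, insertion into a larger graph
  and linearity are then all proved by induction on the number of inner vertices. The exponents come
  from \<open>n = 2 |S| + l\<close> for a half \<open>S\<close> with \<open>l\<close> free points:
  \<open>a\<close> has the value \<open>|S|\<close> at \<open>C(S,b,T)\<close>, the closure has at
  most \<open>|S| + l\<close> loops, and the exponent \<open>-n\<close> of the trace cancels
  \<open>|S| + (|S| + l)\<close>. Since the arcs of the halves carry labels, the finiteness of the
  sets \<open>M(l)\<close> is what the hypothesis on \<open>B\<close> and \<open>n\<close>
  secures.\<close>

abbreviation "lookup \<equiv> Poly_Mapping.lookup"
abbreviation "keys \<equiv> Poly_Mapping.keys"
abbreviation "single \<equiv> Poly_Mapping.single"

text \<open>Products, involutions and their composites are all written as nested linear extensions,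
  so that associativity and anti-multiplicativity become identities between composites of
  \<open>lin\<close>.\<close>

definition lin :: "('x \<Rightarrow> ('y \<Rightarrow>\<^sub>0 'r::comm_ring_1)) \<Rightarrow> ('x \<Rightarrow>\<^sub>0 'r) \<Rightarrow> ('y \<Rightarrow>\<^sub>0 'r)" where
  "lin h f = (\<Sum>x\<in>keys f. scale (lookup f x) (h x))"

lemma lookup_scale [simp]: "lookup (scale r f) x = r * lookup f x"
  by (simp add: scale_def Poly_Mapping.map.rep_eq when_def)

lemma keys_scale: "keys (scale r f) \<subseteq> keys f"
  by (auto simp: in_keys_iff)

lemma scale_add: "scale r (f + g) = scale r f + scale r g"
  by (rule poly_mapping_eqI) (simp add: lookup_add algebra_simps)

lemma scale_add_left: "scale (r + s) f = scale r f + scale s f"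
  by (rule poly_mapping_eqI) (simp add: lookup_add algebra_simps)

lemma scale_scale [simp]: "scale r (scale s f) = scale (r * s) f"
  by (rule poly_mapping_eqI) (simp add: algebra_simps)

lemma scale_one [simp]: "scale 1 f = f"
  by (rule poly_mapping_eqI) simp

lemma scale_zero [simp]: "scale 0 f = 0" "scale r 0 = 0"
  by (rule poly_mapping_eqI, simp)+

lemma scale_single [simp]: "scale r (single x c) = single x (r * c)"
  by (rule poly_mapping_eqI) (simp add: lookup_single when_def)

lemma scale_sum: "scale r (sum h W) = (\<Sum>x\<in>W. scale r (h x))"
  by (rule poly_mapping_eqI) (simp add: lookup_sum sum_distrib_left)

lemma lookup_lin: "lookup (lin h f) y =
    (\<Sum>x\<in>keys f. lookup f x * lookup (h x) y)"
  by (simp add: lin_def lookup_sum)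

lemma lin_superset:
  assumes "finite W" "keys f \<subseteq> W"
  shows "lin h f = (\<Sum>x\<in>W. scale (lookup f x) (h x))"
  unfolding lin_def using assms by (intro sum.mono_neutral_left) (auto simp: in_keys_iff)

lemma lin_add: "lin h (f + g) = lin h f + lin h g"
proof -
  let ?W = "keys f \<union> keys g"
  have "keys (f + g) \<subseteq> ?W" by (rule keys_add)
  then have "lin h (f + g) = (\<Sum>x\<in>?W. scale (lookup (f + g) x) (h x))"
    by (intro lin_superset) auto
  then show ?thesis
    by (simp add: lin_superset[of ?W f] lin_superset[of ?W g] lookup_add scale_add_left sum.distrib)
qed

lemma lin_scale: "lin h (scale r f) = scale r (lin h f)"
  using lin_superset[of "keys f" "scale r f" h] keys_scale[of r f]
  by (simp add: lin_def scale_sum)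

lemma lin_zero [simp]: "lin h 0 = 0"
  by (simp add: lin_def)

lemma lin_single [simp]: "lin h (single x c) = scale c (h x)"
  by (simp add: lin_def)

lemma lin_sum: "lin h (sum k W) = (\<Sum>x\<in>W. lin h (k x))"
  by (induction W rule: infinite_finite_induct) (auto simp: lin_add)

lemma lin_lin: "lin h (lin k f) = lin (\<lambda>x. lin h (k x)) f"
  by (simp add: lin_def[of k f] lin_sum lin_scale) (simp add: lin_def)

lemma lin_cong: "f = g \<Longrightarrow> (\<And>x. x \<in> keys g \<Longrightarrow> h x = k x) \<Longrightarrow> lin h f = lin k g"
  by (simp add: lin_def)

text \<open>Interchange of two finite sums; the two nestings agree because the scalars commute. It
  brings the variables of a product into the order in which an identity between basis elements
  applies.\<close>

lemma lin_swap: "lin (\<lambda>x. lin (h x) g) f = lin (\<lambda>y. lin (\<lambda>x. h x y) f) g"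
  by (simp add: lin_def scale_sum) (subst sum.swap, simp add: mult.commute)

lemma lin_fun_add: "lin (\<lambda>x. h x + k x) f = lin h f + lin k f"
  by (simp add: lin_def scale_add sum.distrib)

lemma lin_fun_scale: "lin (\<lambda>x. scale r (h x)) f = scale r (lin h f)"
  by (simp add: lin_def scale_sum mult.commute)

lemma lin_basis: "lin (\<lambda>x. single x 1) f = f"
  by (rule poly_mapping_eqI)
    (simp add: lookup_lin lookup_single when_def sum.If_cases in_keys_iff
      sum.delta[OF finite_keys] if_distrib[of "\<lambda>x. _ * x"] cong: if_cong)

lemma keys_lin: "keys (lin h f) \<subseteq> (\<Union>x\<in>keys f. keys (h x))"
  unfolding lin_def by (rule order_trans[OF keys_sum]) (use keys_scale in fastforce)

lemma carrier_free_algebra [simp]: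
    "carrier (free_algebra Bs mul u) = {f. keys f \<subseteq> Bs}"
  and one_free_algebra [simp]: "\<one>\<^bsub>free_algebra Bs mul u\<^esub> = single u 1"
  and zero_free_algebra [simp]: "\<zero>\<^bsub>free_algebra Bs mul u\<^esub> = 0"
  and add_free_algebra [simp]: "f \<oplus>\<^bsub>free_algebra Bs mul u\<^esub> g = f + g"
  and smult_free_algebra [simp]: "r \<odot>\<^bsub>free_algebra Bs mul u\<^esub> f = scale r f"
  by (simp_all add: free_algebra_def)

lemma mult_free_algebra:
  "f \<otimes>\<^bsub>free_algebra Bs mul u\<^esub> g = lin (\<lambda>x. lin (mul x) g) f"
  by (simp add: free_algebra_def lin_def scale_sum)

lemma mult_single_free_algebra [simp]:
  "single x 1 \<otimes>\<^bsub>free_algebra Bs mul u\<^esub> single y 1 = mul x y"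
  by (simp add: mult_free_algebra)

text \<open>It suffices to know the unit laws and associativity on basis elements. The locale serves
  twice: over Laurent polynomials for the diagrams and over the integers for the tensor powers.
  \<open>Bs\<close> may be infinite, as elements have finite support.\<close>

locale free_algebra_data =
  fixes Bs :: "'x set" and mul :: "'x \<Rightarrow> 'x \<Rightarrow> ('x \<Rightarrow>\<^sub>0 'r::comm_ring_1)" and u :: 'x
  assumes unit_mem: "u \<in> Bs"
    and keys_mul: "x \<in> Bs \<Longrightarrow> y \<in> Bs \<Longrightarrow> keys (mul x y) \<subseteq> Bs"
    and unit_left: "x \<in> Bs \<Longrightarrow> mul u x = single x 1"
    and unit_right: "x \<in> Bs \<Longrightarrow> mul x u = single x 1"
    and mul_assoc: "x \<in> Bs \<Longrightarrow> y \<in> Bs \<Longrightarrow> z \<in> Bs \<Longrightarrow>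
      lin (\<lambda>w. mul w z) (mul x y) = lin (mul x) (mul y z)"
begin

abbreviation "F \<equiv> free_algebra Bs mul u"
abbreviation "Sg \<equiv> (\<lambda>x. single x (1::'r)) ` Bs"

lemma mult_closed_free:
  assumes "keys f \<subseteq> Bs" "keys g \<subseteq> Bs"
  shows "keys (lin (\<lambda>x. lin (mul x) g) f) \<subseteq> Bs"
proof -
  have "keys (lin (mul x) g) \<subseteq> Bs" if "x \<in> Bs" for x
    using keys_lin[of "mul x" g] keys_mul[OF that] assms by blast
  then show ?thesis using keys_lin[of "\<lambda>x. lin (mul x) g" f] assms by blast
qed

lemma mult_assoc_free:
  assumes k: "keys f \<subseteq> Bs" "keys g \<subseteq> Bs" "keys h \<subseteq> Bs"
  shows "f \<otimes>\<^bsub>F\<^esub> g \<otimes>\<^bsub>F\<^esub> h = f \<otimes>\<^bsub>F\<^esub> (g \<otimes>\<^bsub>F\<^esub> h)"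
proof -
  have *: "lin (\<lambda>w. lin (mul w) h) (mul x y) = lin (mul x) (lin (mul y) h)"
    if "x \<in> Bs" "y \<in> Bs" for x y
  proof -
    have "lin (\<lambda>z. lin (\<lambda>w. mul w z) (mul x y)) h = lin (\<lambda>z. lin (mul x) (mul y z)) h"
      by (rule lin_cong) (use that k mul_assoc in auto)
    then show ?thesis by (subst lin_swap) (simp add: lin_lin)
  qed
  have "lin (\<lambda>x. lin (\<lambda>w. lin (mul w) h) (lin (mul x) g)) f = lin (\<lambda>x. lin (mul x) (lin (\<lambda>y. lin (mul y) h) g)) f"
    unfolding lin_lin[of _ _ g] by (intro lin_cong[OF refl] *) (use k in auto)
  then show ?thesis unfolding mult_free_algebra lin_lin[of _ _ f] .
qed

lemma monoid_free: "monoid F"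
proof (rule monoidI)
  fix f g assume "f \<in> carrier F" "g \<in> carrier F"
  then show "f \<otimes>\<^bsub>F\<^esub> g \<in> carrier F"
    using mult_closed_free by (simp add: mult_free_algebra)
next
  fix f g h assume "f \<in> carrier F" "g \<in> carrier F" "h \<in> carrier F"
  then show "f \<otimes>\<^bsub>F\<^esub> g \<otimes>\<^bsub>F\<^esub> h = f \<otimes>\<^bsub>F\<^esub> (g \<otimes>\<^bsub>F\<^esub> h)"
    using mult_assoc_free by auto
next
  show "\<one>\<^bsub>F\<^esub> \<in> carrier F" using unit_mem by simp
next
  fix f assume k: "f \<in> carrier F"
  show "\<one>\<^bsub>F\<^esub> \<otimes>\<^bsub>F\<^esub> f = f"
    using k unit_left lin_cong[OF refl, of f "mul u" "\<lambda>x. single x 1"]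
    by (auto simp: mult_free_algebra lin_basis)
  show "f \<otimes>\<^bsub>F\<^esub> \<one>\<^bsub>F\<^esub> = f"
    using k unit_right lin_cong[OF refl, of f "\<lambda>x. mul x u" "\<lambda>x. single x 1"]
    by (auto simp: mult_free_algebra lin_basis)
qed

lemma abelian_group_free: "abelian_group F"
proof (rule abelian_groupI)
  fix f g assume "f \<in> carrier F" "g \<in> carrier F"
  then show "f \<oplus>\<^bsub>F\<^esub> g \<in> carrier F" using keys_add[of f g] by auto
next
  fix f assume "f \<in> carrier F"
  then show "\<exists>y\<in>carrier F. y \<oplus>\<^bsub>F\<^esub> f = \<zero>\<^bsub>F\<^esub>"
    by (intro bexI[of _ "- f"]) (auto simp: in_keys_iff)
qed (auto simp: algebra_simps)

lemma associative_algebra_free: "associative_algebra F"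
proof -
  have c: "carrier (ring_of_type_algebra :: 'r ring) = UNIV"
    "x \<oplus>\<^bsub>ring_of_type_algebra\<^esub> y = x + y" "x \<otimes>\<^bsub>ring_of_type_algebra\<^esub> y = x * y"
    "\<one>\<^bsub>ring_of_type_algebra\<^esub> = (1::'r)"
    for x y :: 'r by (simp_all add: ring_of_type_algebra_def)
  have "module (ring_of_type_algebra :: 'r ring) F"
    by (intro moduleI cring_from_type_algebra abelian_group_free)
      (auto simp: c scale_add scale_add_left dest: subsetD[OF keys_scale])
  moreover have "Ring.ring F"
    by (intro ringI abelian_group_free monoid_free)
      (auto simp: mult_free_algebra lin_add lin_fun_add)
  moreover have "associative_algebra_axioms F"
    by unfold_locales (auto simp: mult_free_algebra lin_scale lin_fun_scale)
  ultimately show ?thesis by (simp add: associative_algebra_def)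
qed

text \<open>This includes infinite \<open>W\<close>, where both kinds of sum are zero by
  convention.\<close>

lemma finsum_free:
  assumes "\<And>x. x \<in> W \<Longrightarrow> keys (h x) \<subseteq> Bs"
  shows "(\<Oplus>\<^bsub>F\<^esub>x\<in>W. h x) = sum h W"
proof -
  interpret abelian_group F by (rule abelian_group_free)
  show ?thesis using assms
    by (induction W rule: infinite_finite_induct) (auto simp: finsum_insert finsum_infinite)
qed

lemma minus_free:
  assumes "keys f \<subseteq> Bs" "keys g \<subseteq> Bs"
  shows "f \<ominus>\<^bsub>F\<^esub> g = f - g"
proof -
  interpret abelian_group F by (rule abelian_group_free)
  have "\<ominus>\<^bsub>F\<^esub> g = - g"
    by (rule minus_equality) (use assms in \<open>auto simp: in_keys_iff\<close>)
  then show ?thesis by (simp add: a_minus_def)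
qed

lemma lincomb_free:
  assumes "\<And>x. x \<in> keys c \<Longrightarrow> keys x \<subseteq> Bs"
  shows "lincomb F c = lin (\<lambda>x. x) c"
  using assms keys_scale unfolding lincomb_def lin_def smult_free_algebra
  by (intro finsum_free) fastforce

text \<open>In \<open>free_basis\<close> and \<open>coords\<close> coordinates are indexed by
  elements of the algebra, hence here by the vectors \<open>single x 1\<close> and not by
  \<open>x\<close>. This translates between the two indexings.\<close>

definition emb :: "('x \<Rightarrow>\<^sub>0 'r) \<Rightarrow> ('x \<Rightarrow>\<^sub>0 'r) \<Rightarrow>\<^sub>0 'r" where
  "emb f = lin (\<lambda>x. single (single x 1) 1) f"

lemma single_one_eq [simp]:
  "(single x (1::'r) = single y 1) \<longleftrightarrow> x = y"
  by (metis keys_single one_neq_zero singleton_inject)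

lemma lookup_emb: "lookup (emb f) (single x 1) = lookup f x"
  by (simp add: emb_def lookup_lin lookup_single when_def in_keys_iff
      sum.delta[OF finite_keys] if_distrib[of "\<lambda>x. _ * x"] cong: if_cong)

lemma keys_emb: "keys (emb f) = (\<lambda>x. single x 1) ` keys f"
proof
  show "keys (emb f) \<subseteq> (\<lambda>x. single x 1) ` keys f"
    using keys_lin[of "\<lambda>x. single (single x 1) 1" f]
    by (auto simp: emb_def)
qed (auto simp: in_keys_iff lookup_emb)

lemma lookup_lincomb_free:
  assumes "keys c \<subseteq> Sg"
  shows "lookup (lincomb F c) x = lookup c (single x 1)"
proof -
  have "lincomb F c = lin (\<lambda>x. x) c" using assms by (intro lincomb_free) auto
  also have "lookup \<dots> x =
     (\<Sum>y\<in>keys c. if y = single x 1 then lookup c y else 0)"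
    unfolding lookup_lin using assms by (intro sum.cong) (auto simp: lookup_single when_def)
  also have "\<dots> = lookup c (single x 1)"
    by (simp add: in_keys_iff)
  finally show ?thesis .
qed

lemma coords_unique:
  assumes "keys c \<subseteq> Sg"
  shows "c = emb (lincomb F c)"
proof (rule poly_mapping_eqI)
  fix y
  show "lookup c y = lookup (emb (lincomb F c)) y"
  proof (cases "\<exists>x. y = single x 1")
    case True
    then show ?thesis using assms by (auto simp: lookup_emb lookup_lincomb_free)
  next
    case False
    then have "y \<notin> keys c" "y \<notin> keys (emb (lincomb F c))"
      using assms by (auto simp: keys_emb)
    then show ?thesis by (simp add: in_keys_iff)
  qed
qed

lemma lincomb_emb:
  assumes "keys f \<subseteq> Bs"
  shows "lincomb F (emb f) = f"
  using assms by (intro poly_mapping_eqI) (subst lookup_lincomb_free, auto simp: keys_emb lookup_emb)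

lemma free_basis_free: "free_basis F Sg"
  unfolding free_basis_def
proof (intro conjI ballI)
  show "Sg \<subseteq> carrier F" by auto
  fix f assume "f \<in> carrier F"
  then have f: "keys f \<subseteq> Bs" by simp
  show "\<exists>!c. keys c \<subseteq> Sg \<and> lincomb F c = f"
    by (rule ex1I[of _ "emb f"]) (use f in \<open>auto simp: keys_emb lincomb_emb dest: coords_unique\<close>)
qed

lemma coords_free:
  assumes "keys f \<subseteq> Bs"
  shows "coords F Sg f = emb f"
  unfolding coords_def
  by (rule the_equality) (use assms in \<open>auto simp: keys_emb lincomb_emb dest: coords_unique\<close>)

lemma kappa_free:
  assumes "keys f \<subseteq> Bs"
  shows "kappa F Sg (single x 1) f = lookup f x"
  using assms by (simp add: kappa_def coords_free lookup_emb)

lemma supp_free: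
  assumes "keys f \<subseteq> Bs"
  shows "supp F Sg f = (\<lambda>x. single x 1) ` keys f"
  using assms by (simp add: supp_def coords_free keys_emb)

lemma lin_span_free:
  assumes "K \<subseteq> Bs"
  shows "lin_span F ((\<lambda>x. single x 1) ` K) = {f. keys f \<subseteq> K}" (is "?L = ?R")
proof
  show "?L \<subseteq> ?R"
  proof
    fix f assume "f \<in> ?L"
    then obtain c where c: "f = lincomb F c" "keys c \<subseteq> (\<lambda>x. single x 1) ` K"
      by (auto simp: lin_span_def)
    then have "keys c \<subseteq> Sg" using assms by auto
    then show "f \<in> ?R" using c by (auto simp: in_keys_iff lookup_lincomb_free)
  qed
  show "?R \<subseteq> ?L"
  proof
    fix f assume "f \<in> ?R"
    then show "f \<in> ?L" using assms
      unfolding lin_span_def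
      by (intro CollectI exI[of _ "emb f"]) (auto simp: keys_emb lincomb_emb)
  qed
qed

text \<open>With the unit as only idempotent, the decomposition required in (A1) reduces to
  this.\<close>

lemma lin_span_carrier: "lin_span F (carrier F) = carrier F"
proof
  show "lin_span F (carrier F) \<subseteq> carrier F"
  proof
    fix f assume "f \<in> lin_span F (carrier F)"
    then obtain c where c: "f = lincomb F c" "keys c \<subseteq> carrier F"
      by (auto simp: lin_span_def)
    then have f: "f = lin (\<lambda>x. x) c" using lincomb_free[of c] by auto
    show "f \<in> carrier F" using keys_lin[of "\<lambda>x. x" c] c(2) unfolding f by auto
  qed
  show "carrier F \<subseteq> lin_span F (carrier F)"
  proof
    fix f assume f: "f \<in> carrier F"
    then have "lincomb F (single f 1) = f"
      by (subst lincomb_free) auto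
    then show "f \<in> lin_span F (carrier F)"
      using f by (auto simp: lin_span_def intro!: exI[of _ "single f 1"])
  qed
qed

end

section \<open>Integral table algebras\<close>

locale int_table_algebra = normalized_table_algebra A B bar
  for A :: "(int, 'a) module" (structure) and B :: "'a set" and bar :: "'a \<Rightarrow> 'a"
begin

abbreviation "\<kappa> \<equiv> kappa A B"
abbreviation "t \<equiv> table_trace A B"

lemma basis_carrier [simp, intro]: "b \<in> B \<Longrightarrow> b \<in> carrier A"
  using basis by (auto simp: free_basis_def)

lemma smult_closed' [simp, intro]: "x \<in> carrier A \<Longrightarrow> (k::int) \<odot> x \<in> carrier A"
  by (rule smult_closed) (simp add: ring_of_type_algebra_def)

lemma
  shows keys_coords: "x \<in> carrier A \<Longrightarrow> keys (coords A B x) \<subseteq> B"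
    and lincomb_coords: "x \<in> carrier A \<Longrightarrow> lincomb A (coords A B x) = x"
proof -
  assume x: "x \<in> carrier A"
  then have "\<exists>!c. keys c \<subseteq> B \<and> lincomb A c = x"
    using basis by (simp add: free_basis_def)
  from theI'[OF this] show "keys (coords A B x) \<subseteq> B" "lincomb A (coords A B x) = x"
    by (simp_all add: coords_def)
qed

lemma coords_eqI:
  assumes "keys c \<subseteq> B" "lincomb A c = x" "x \<in> carrier A"
  shows "coords A B x = c"
  using basis keys_coords[OF assms(3)] lincomb_coords[OF assms(3)] assms
  unfolding free_basis_def by blast

lemma lincomb_superset:
  assumes "finite S" "keys c \<subseteq> S" "S \<subseteq> carrier A"
  shows "lincomb A c = (\<Oplus>x\<in>S. lookup c x \<odot> x)"
proof -
  have z: "(0::int) \<odot> x = \<zero>" if "x \<in> carrier A" for x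
    using smult_l_null[OF that] by (simp add: ring_of_type_algebra_def)
  show ?thesis unfolding lincomb_def
    using assms by (intro add.finprod_mono_neutral_cong_left) (auto simp: in_keys_iff z)
qed

lemma smult_l_distr':
  "x \<in> carrier A \<Longrightarrow> ((k::int) + l) \<odot> x = k \<odot> x \<oplus> l \<odot> x"
  using smult_l_distr[of k l x] by (simp add: ring_of_type_algebra_def)

lemma smult_assoc': "x \<in> carrier A \<Longrightarrow> ((k::int) * l) \<odot> x = k \<odot> (l \<odot> x)"
  using smult_assoc1[of k l x] by (simp add: ring_of_type_algebra_def)

lemma lincomb_add:
  assumes "keys c \<subseteq> B" "keys d \<subseteq> B"
  shows "lincomb A (c + d) = lincomb A c \<oplus> lincomb A d"
proof -
  let ?S = "keys c \<union> keys d"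
  have *: "finite ?S" "?S \<subseteq> carrier A" using assms by auto
  have "lincomb A (c + d) = (\<Oplus>x\<in>?S. lookup c x \<odot> x \<oplus> lookup d x \<odot> x)"
    unfolding lincomb_superset[OF *(1) keys_add *(2)]
    by (rule finsum_cong') (use *(2) in \<open>auto simp: lookup_add smult_l_distr'\<close>)
  also have "\<dots> = lincomb A c \<oplus> lincomb A d"
    unfolding lincomb_superset[OF *(1) _ *(2), of c, simplified]
      lincomb_superset[OF *(1) _ *(2), of d, simplified]
    by (rule finsum_addf) (use *(2) in auto)
  finally show ?thesis .
qed

lemma lincomb_scale:
  assumes "keys c \<subseteq> B"
  shows "lincomb A (scale k c) = k \<odot> lincomb A c"
proof -
  let ?S = "keys c"
  have *: "finite ?S" "?S \<subseteq> carrier A" using assms by auto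
  have "lincomb A (scale k c) = (\<Oplus>x\<in>?S. k \<odot> (lookup c x \<odot> x))"
    using * keys_scale[of k c] by (simp add: lincomb_superset[of ?S "scale k c"])
      (intro finsum_cong', auto simp: smult_assoc')
  also have "\<dots> = k \<odot> (\<Oplus>x\<in>?S. lookup c x \<odot> x)"
    using * by (subst finsum_smult_ldistr) (auto simp: ring_of_type_algebra_def)
  finally show ?thesis by (simp add: lincomb_def)
qed

lemma coords_add:
  "x \<in> carrier A \<Longrightarrow> y \<in> carrier A \<Longrightarrow> coords A B (x \<oplus> y) = coords A B x + coords A B y"
  using keys_coords[of x] keys_coords[of y] keys_add[of "coords A B x" "coords A B y"]
  by (intro coords_eqI) (auto simp: lincomb_add lincomb_coords)

lemma coords_smult: "x \<in> carrier A \<Longrightarrow> coords A B (k \<odot> x) = scale k (coords A B x)"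
  using keys_coords[of x] keys_scale[of k "coords A B x"]
  by (intro coords_eqI) (auto simp: lincomb_scale lincomb_coords)

lemma coords_basis: "b \<in> B \<Longrightarrow> coords A B b = single b 1"
proof -
  have "(1::int) \<odot> x = x" if "x \<in> carrier A" for x
    using smult_one[OF that] by (simp add: ring_of_type_algebra_def)
  then show "b \<in> B \<Longrightarrow> ?thesis" by (intro coords_eqI) (auto simp: lincomb_def)
qed

lemma kappa_add: "x \<in> carrier A \<Longrightarrow> y \<in> carrier A \<Longrightarrow> \<kappa> b (x \<oplus> y) = \<kappa> b x + \<kappa> b y"
  by (simp add: kappa_def coords_add lookup_add)

lemma kappa_smult: "x \<in> carrier A \<Longrightarrow> \<kappa> b (k \<odot> x) = k * \<kappa> b x"
  by (simp add: kappa_def coords_smult)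

lemma kappa_basis: "b' \<in> B \<Longrightarrow> \<kappa> b b' = (if b = b' then 1 else 0)"
  by (simp add: kappa_def coords_basis lookup_single when_def)

lemma supp_iff: "b \<in> supp A B x \<longleftrightarrow> \<kappa> b x \<noteq> 0"
  by (simp add: supp_def kappa_def in_keys_iff)

lemma finite_supp [simp]: "finite (supp A B x)"
  by (simp add: supp_def)

lemma supp_subset: "x \<in> carrier A \<Longrightarrow> supp A B x \<subseteq> B"
  by (simp add: supp_def keys_coords)

text \<open>Identities linear in an element of \<open>A\<close> are reduced to \<open>B\<close>
  through such maps. Values lie in an arbitrary commutative ring because both integers and Laurent
  polynomials occur.\<close>

definition linear_functional :: "('a \<Rightarrow> 'c::comm_ring_1) \<Rightarrow> bool" where
  "linear_functional \<phi> \<longleftrightarrow>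
     (\<forall>x\<in>carrier A. \<forall>y\<in>carrier A. \<phi> (x \<oplus> y) = \<phi> x + \<phi> y) \<and>
     (\<forall>x\<in>carrier A. \<forall>k. \<phi> (k \<odot> x) = of_int k * \<phi> x)"

lemma linear_functionalI:
  "(\<And>x y. x \<in> carrier A \<Longrightarrow> y \<in> carrier A \<Longrightarrow> \<phi> (x \<oplus> y) = \<phi> x + \<phi> y) \<Longrightarrow>
   (\<And>x k. x \<in> carrier A \<Longrightarrow> \<phi> (k \<odot> x) = of_int k * \<phi> x) \<Longrightarrow> linear_functional \<phi>"
  by (simp add: linear_functional_def)

text \<open>Multilinear expansion in a single variable; \<open>graph_coeff_expand\<close> iterates
  it over edges.\<close>

lemma linear_functional_expand:
  assumes "linear_functional \<phi>" "x \<in> carrier A"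
  shows "\<phi> x = (\<Sum>b\<in>supp A B x. of_int (\<kappa> b x) * \<phi> b)"
proof -
  have z: "\<phi> \<zero> = 0"
    using assms(1) unfolding linear_functional_def
    by (metis add.r_one add_cancel_left_left zero_closed l_zero)
  have *: "\<phi> (\<Oplus>b\<in>S. c b \<odot> b) = (\<Sum>b\<in>S. of_int (c b) * \<phi> b)"
    if "finite S" "S \<subseteq> carrier A" for S and c :: "'a \<Rightarrow> int"
    using that
  proof (induction S)
    case (insert x S)
    have "(\<Oplus>b\<in>S. c b \<odot> b) \<in> carrier A" using insert by (intro finsum_closed) auto
    moreover have "(\<Oplus>b\<in>insert x S. c b \<odot> b) = c x \<odot> x \<oplus> (\<Oplus>b\<in>S. c b \<odot> b)"
      using insert by (subst finsum_insert) auto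
    ultimately show ?case
      using insert assms(1) by (simp add: linear_functional_def)
  qed (simp add: z)
  have "x = (\<Oplus>b\<in>supp A B x. \<kappa> b x \<odot> b)"
    using lincomb_coords[OF assms(2)] by (simp add: lincomb_def supp_def kappa_def)
  then show ?thesis using *[of "supp A B x" "\<lambda>b. \<kappa> b x"] supp_subset[OF assms(2)] by auto
qed

lemma linear_functional_eqI:
  assumes "linear_functional \<phi>" "linear_functional \<psi>" "\<And>b. b \<in> B \<Longrightarrow> \<phi> b = \<psi> b"
    "x \<in> carrier A"
  shows "\<phi> x = \<psi> x"
  using supp_subset[OF assms(4)] assms(3)
  unfolding linear_functional_expand[OF assms(1,4)] linear_functional_expand[OF assms(2,4)]
  by (intro sum.cong) auto

lemma linear_kappa: "linear_functional (\<lambda>x. of_int (\<kappa> b x))"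
  by (auto intro!: linear_functionalI simp: kappa_add kappa_smult)

lemma linear_kappa': "linear_functional (\<kappa> b)"
  by (auto intro!: linear_functionalI simp: kappa_add kappa_smult)

lemma linear_mult_left:
  "linear_functional \<phi> \<Longrightarrow> c \<in> carrier A \<Longrightarrow> linear_functional (\<lambda>x. \<phi> (c \<otimes> x))"
  by (auto simp: linear_functional_def r_distr smult_mult_right)

lemma linear_mult_right:
  "linear_functional \<phi> \<Longrightarrow> c \<in> carrier A \<Longrightarrow> linear_functional (\<lambda>x. \<phi> (x \<otimes> c))"
  by (auto simp: linear_functional_def l_distr smult_mult_left)

lemma bar_closed [simp, intro]: "x \<in> carrier A \<Longrightarrow> bar x \<in> carrier A"
  and bar_add: "x \<in> carrier A \<Longrightarrow> y \<in> carrier A \<Longrightarrow> bar (x \<oplus> y) = bar x \<oplus> bar y"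
  and bar_smult: "x \<in> carrier A \<Longrightarrow> bar (k \<odot> x) = k \<odot> bar x"
  and bar_mult: "x \<in> carrier A \<Longrightarrow> y \<in> carrier A \<Longrightarrow> bar (x \<otimes> y) = bar y \<otimes> bar x"
  and bar_bar [simp]: "x \<in> carrier A \<Longrightarrow> bar (bar x) = x"
  using T2_anti by (auto simp: involutory_anti_automorphism_def)

lemma linear_bar: "linear_functional \<phi> \<Longrightarrow> linear_functional (\<lambda>x. \<phi> (bar x))"
  by (auto simp: linear_functional_def bar_add bar_smult)

lemma linear_const: "linear_functional \<phi> \<Longrightarrow> linear_functional (\<lambda>x. c * \<phi> x)"
  by (auto simp: linear_functional_def algebra_simps)

lemma linear_const': "linear_functional \<phi> \<Longrightarrow> linear_functional (\<lambda>x. \<phi> x * c)"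
  by (auto simp: linear_functional_def algebra_simps)

lemma one_basis [simp]: "\<one> \<in> B" by (rule one_in_basis)

lemma bar_one [simp]: "bar \<one> = \<one>"
  by (metis bar_bar bar_closed bar_mult l_one one_closed r_one)

lemma bar_basis_iff [simp]: "x \<in> carrier A \<Longrightarrow> bar x \<in> B \<longleftrightarrow> x \<in> B"
  using T2_basis by force

lemma linear_trace: "linear_functional (\<lambda>x. of_int (t x))"
  unfolding table_trace_def by (rule linear_kappa)

lemma linear_trace': "linear_functional t"
  unfolding table_trace_def by (rule linear_kappa')

lemma trace_basis: "b \<in> B \<Longrightarrow> t b = (if b = \<one> then 1 else 0)"
  by (simp add: table_trace_def kappa_basis)

text \<open>(T3) with \<open>b'' = \<one>\<close> turns the coefficient of \<open>\<one>\<close> in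
  \<open>b \<otimes> b'\<close> into that of \<open>b\<close> in \<open>bar b'\<close>.\<close>

lemma trace_mult_basis: "b \<in> B \<Longrightarrow> b' \<in> B \<Longrightarrow> t (b \<otimes> b') = (if b' = bar b then 1 else 0)"
  unfolding table_trace_def by (subst T3) (auto simp: kappa_basis)

text \<open>By linearity in both variables it suffices to compare basis elements, where
  \<open>b' = bar b\<close> is a symmetric condition.\<close>

lemma trace_commute:
  assumes "x \<in> carrier A" "y \<in> carrier A" shows "t (x \<otimes> y) = t (y \<otimes> x)"
proof (rule linear_functional_eqI[OF linear_mult_right linear_mult_left])
  fix b assume b: "b \<in> B"
  show "t (b \<otimes> y) = t (y \<otimes> b)"
    by (rule linear_functional_eqI[OF linear_mult_left linear_mult_right])
      (use b assms linear_trace' in \<open>auto simp: trace_mult_basis\<close>)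
qed (use assms linear_trace' in auto)

lemma trace_bar: "x \<in> carrier A \<Longrightarrow> t (bar x) = t x"
proof (rule linear_functional_eqI[OF linear_bar[OF linear_trace'] linear_trace'])
  fix b assume "b \<in> B"
  then show "t (bar b) = t b"
    using bar_bar[of b] bar_one by (auto simp: trace_basis T2_basis simp del: bar_bar)
qed

text \<open>\<open>B\<close> is orthonormal for the form \<open>t (x \<otimes> bar y)\<close>, so
  coefficients are values of the trace. In this way the symmetries of \<open>t\<close> pass to
  \<open>\<kappa>\<close>.\<close>

lemma kappa_trace: "b \<in> B \<Longrightarrow> x \<in> carrier A \<Longrightarrow> \<kappa> b x = t (x \<otimes> bar b)"
proof (rule linear_functional_eqI[OF linear_kappa' linear_mult_right[OF linear_trace']])
  fix b' assume "b \<in> B" "b' \<in> B"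
  then show "\<kappa> b b' = t (b' \<otimes> bar b)"
    using bar_bar[of b] bar_bar[of b']
    by (auto simp: trace_mult_basis kappa_basis T2_basis simp del: bar_bar)
qed auto

lemma kappa_bar: "b \<in> B \<Longrightarrow> x \<in> carrier A \<Longrightarrow> \<kappa> (bar b) (bar x) = \<kappa> b x"
  using trace_bar[of "bar b \<otimes> x"] trace_commute[of "bar b" x]
  by (simp add: kappa_trace T2_basis bar_mult)

end

section \<open>Contraction of labelled graphs\<close>

definition srcs :: "('p \<times> 'p \<times> 'a) set \<Rightarrow> 'p set" where
  "srcs E = {p. \<exists>q a. (p, q, a) \<in> E}"

definition tgts :: "('p \<times> 'p \<times> 'a) set \<Rightarrow> 'p set" where
  "tgts E = {q. \<exists>p a. (p, q, a) \<in> E}"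

definition inner :: "('p \<times> 'p \<times> 'a) set \<Rightarrow> 'p set" where
  "inner E = srcs E \<inter> tgts E"

definition verts :: "('p \<times> 'p \<times> 'a) set \<Rightarrow> 'p set" where
  "verts E = srcs E \<union> tgts E"

text \<open>The kind of graph shared by diagrams, glued graphs and closures: every component is a
  path or a cycle.\<close>

definition partial_bij :: "('p \<times> 'p \<times> 'a) set \<Rightarrow> bool" where
  "partial_bij E \<longleftrightarrow> finite E \<and>
     (\<forall>p q a q' a'. (p, q, a) \<in> E \<and> (p, q', a') \<in> E \<longrightarrow> q = q' \<and> a = a') \<and>
     (\<forall>p q a p' a'. (p, q, a) \<in> E \<and> (p', q, a') \<in> E \<longrightarrow> p = p')"

lemma partial_bijD:
  assumes "partial_bij E"
  shows "finite E"
    and "(p, q, a) \<in> E \<Longrightarrow> (p, q', a') \<in> E \<Longrightarrow> q' = q"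
    and "(p, q, a) \<in> E \<Longrightarrow> (p, q', a') \<in> E \<Longrightarrow> a' = a"
    and "(p, q, a) \<in> E \<Longrightarrow> (p', q, a') \<in> E \<Longrightarrow> p' = p"
    and "(p, q, a) \<in> E \<Longrightarrow> (p', q, a') \<in> E \<Longrightarrow> a' = a"
proof -
  show "finite E" using assms by (simp add: partial_bij_def)
  show 1: "(p, q, a) \<in> E \<Longrightarrow> (p, q', a') \<in> E \<Longrightarrow> q' = q" for p q a q' a'
    using assms unfolding partial_bij_def by metis
  show 2: "(p, q, a) \<in> E \<Longrightarrow> (p, q', a') \<in> E \<Longrightarrow> a' = a" for p q a q' a'
    using assms unfolding partial_bij_def by metis
  show 3: "(p, q, a) \<in> E \<Longrightarrow> (p', q, a') \<in> E \<Longrightarrow> p' = p" for p q a p' a'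
    using assms unfolding partial_bij_def by metis
  show "(p, q, a) \<in> E \<Longrightarrow> (p', q, a') \<in> E \<Longrightarrow> a' = a"
    using 2[of p q a q a'] 3[of p q a p' a'] by auto
qed

lemma finite_srcs: "finite E \<Longrightarrow> finite (srcs E)"
proof -
  have "srcs E = fst ` E" by (force simp: srcs_def)
  then show "finite E \<Longrightarrow> finite (srcs E)" by simp
qed

lemma finite_inner: "partial_bij E \<Longrightarrow> finite (inner E)"
  using finite_srcs[of E] by (simp add: inner_def partial_bijD)

text \<open>A total function, unspecified outside \<open>srcs E\<close>; its iterates are meaningful
  only along walks. It connects loops with the orbits of a function.\<close>

definition next_vertex :: "('p \<times> 'p \<times> 'a) set \<Rightarrow> 'p \<Rightarrow> 'p" where
  "next_vertex E p = fst (THE e. (p, e) \<in> E)"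

definition out_label :: "('p \<times> 'p \<times> 'a) set \<Rightarrow> 'p \<Rightarrow> 'a" where
  "out_label E p = snd (THE e. (p, e) \<in> E)"

lemma
  assumes "partial_bij E" "(p, q, a) \<in> E"
  shows next_vertex_eq: "next_vertex E p = q" and out_label_eq: "out_label E p = a"
proof -
  have "(THE e. (p, e) \<in> E) = (q, a)"
    using assms partial_bijD(2,3)[OF assms(1)] by (intro the_equality) force+
  then show "next_vertex E p = q" "out_label E p = a"
    by (simp_all add: next_vertex_def out_label_def)
qed

text \<open>Successors are unique, so a walk is determined by its start and its length.\<close>

lemma walk_funpow:
  assumes "partial_bij E" "walk E x w y"
  shows "y = (next_vertex E ^^ length w) x" (is ?a)
    and "w = map (\<lambda>i. out_label E ((next_vertex E ^^ i) x)) [0..<length w]" (is ?b)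
    and "i < length w \<Longrightarrow> (next_vertex E ^^ i) x \<in> srcs E" (is "_ \<Longrightarrow> ?c i")
    and "w \<noteq> []"
proof -
  from assms(2) have "?a \<and> ?b \<and> (\<forall>i<length w. ?c i) \<and> w \<noteq> []"
  proof induction
    case (edge x y a)
    then show ?case
      using next_vertex_eq[OF assms(1)] out_label_eq[OF assms(1)] by (auto simp: srcs_def)
  next
    case (step x y a w z)
    have n: "next_vertex E x = y" "out_label E x = a"
      using next_vertex_eq[OF assms(1) step(1)] out_label_eq[OF assms(1) step(1)] by auto
    have *: "(next_vertex E ^^ Suc i) x = (next_vertex E ^^ i) y" for i
      by (simp only: funpow_Suc_right o_apply n)
    have "map (\<lambda>i. out_label E ((next_vertex E ^^ i) x)) [0..<length (a # w)] =
        a # map (\<lambda>i. out_label E ((next_vertex E ^^ i) y)) [0..<length w]"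
      by (simp only: length_Cons map_upt_Suc *) (simp add: n)
    moreover have "\<forall>i<length (a # w). (next_vertex E ^^ i) x \<in> srcs E"
    proof (intro allI impI)
      fix i assume i: "i < length (a # w)"
      show "(next_vertex E ^^ i) x \<in> srcs E"
      proof (cases i)
        case 0 then show ?thesis using step.hyps(1) by (auto simp: srcs_def)
      next
        case (Suc j)
        then have "(next_vertex E ^^ i) x = (next_vertex E ^^ j) y" by (simp only: *)
        with step.IH i Suc show ?thesis by simp
      qed
    qed
    moreover have "z = (next_vertex E ^^ length (a # w)) x"
      using step.IH by (simp only: length_Cons *)
    ultimately show ?case using step.IH by simp
  qed
  then show ?a ?b "i < length w \<Longrightarrow> ?c i" "w \<noteq> []" by auto
qed

lemma walk_det:
  assumes "partial_bij E" "walk E x w y" "walk E x w' y'" "length w = length w'"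
  shows "w = w' \<and> y = y'"
  using walk_funpow(1,2)[OF assms(1,2)] walk_funpow(1,2)[OF assms(1,3)] assms(4) by simp

lemma walk_append: "walk E x u y \<Longrightarrow> walk E y v z \<Longrightarrow> walk E x (u @ v) z"
  by (induction rule: walk.induct) (auto intro: walk.intros)

lemma walk_split:
  "walk E x w y \<Longrightarrow> 0 < i \<Longrightarrow> i < length w \<Longrightarrow> \<exists>z. walk E x (take i w) z \<and> walk E z (drop i w) y"
proof (induction arbitrary: i rule: walk.induct)
  case (step x y a w z)
  show ?case
  proof (cases "i = 1")
    case True then show ?thesis using step by (auto intro: walk.intros)
  next
    case False
    then obtain j where j: "i = Suc j" "0 < j" "j < length w" using step.prems by (cases i) auto
    from step.IH[OF j(2,3)] obtain v where "walk E y (take j w) v" "walk E v (drop j w) z" by auto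
    then show ?thesis using step.hyps j by (auto intro: walk.intros)
  qed
qed auto

lemma walk_srcs: "walk E x w y \<Longrightarrow> x \<in> srcs E"
  by (cases rule: walk.cases) (auto simp: srcs_def)

lemma walk_tgts: "walk E x w y \<Longrightarrow> y \<in> tgts E"
  by (induction rule: walk.induct) (auto simp: tgts_def)

text \<open>Of two walks of different length with the same start, the shorter one would end where
  the longer one continues, hence at a source. This makes the description in
  \<open>strand_label\<close> unambiguous.\<close>

lemma walk_ends_unique:
  assumes "partial_bij E" "walk E x w y" "walk E x w' y'" "y \<notin> srcs E" "y' \<notin> srcs E"
  shows "w = w' \<and> y = y'"
proof -
  have "\<not> length w < length w'" "\<not> length w' < length w"
    using walk_funpow(1)[OF assms(1,2)] walk_funpow(3)[OF assms(1,3), of "length w"]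
      walk_funpow(1)[OF assms(1,3)] walk_funpow(3)[OF assms(1,2), of "length w'"] assms(4,5) by auto
  then show ?thesis using walk_det[OF assms(1-3)] by simp
qed

text \<open>Walks have positive length, so \<open>x \<in> reach E x\<close> says that
  \<open>x\<close> lies on a loop.\<close>

definition reach :: "('p \<times> 'p \<times> 'a) set \<Rightarrow> 'p \<Rightarrow> 'p set" where
  "reach E x = {y. \<exists>w. walk E x w y}"

lemma loops_reach: "loops E = {reach E x | x. x \<in> reach E x}"
  by (simp add: loops_def reach_def)

lemma reach_trans: "y \<in> reach E x \<Longrightarrow> z \<in> reach E y \<Longrightarrow> z \<in> reach E x"
  by (auto simp: reach_def intro: walk_append)

text \<open>A walk starting on a cycle never gets stuck: its end is also reached after fewer steps
  than a given closed walk has, and is therefore a source.\<close>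

lemma closed_walks:
  assumes "partial_bij E" "x \<in> reach E x"
  shows "\<exists>w y. walk E x w y \<and> length w = Suc n"
proof (induction n)
  case 0
  from assms(2) obtain w where "walk E x w x" by (auto simp: reach_def)
  then obtain y a where "(x, y, a) \<in> E" using walk_srcs by (fastforce simp: srcs_def)
  then have "walk E x [a] y" by (rule walk.edge)
  then show ?case by force
next
  case (Suc n)
  then obtain w y where w: "walk E x w y" "length w = Suc n" by auto
  from assms(2) obtain v where v: "walk E x v x" by (auto simp: reach_def)
  let ?k = "Suc n mod length v"
  have "(next_vertex E ^^ ?k) x = y"
    using walk_funpow(1)[OF assms(1) v] walk_funpow(1)[OF assms(1) w(1)] w(2)
      funpow_mod_eq[of "length v" "next_vertex E" x "Suc n"] by simp
  moreover have "?k < length v" using walk_funpow(4)[OF assms(1) v] by simp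
  ultimately have "y \<in> srcs E" using walk_funpow(3)[OF assms(1) v] by blast
  then obtain z a where "(y, z, a) \<in> E" by (auto simp: srcs_def)
  then have "walk E x (w @ [a]) z" by (intro walk_append[OF w(1)] walk.edge)
  then show ?case using w(2) by fastforce
qed

lemma reach_orbit:
  assumes "partial_bij E" "x \<in> reach E x"
  shows "reach E x = orbit (next_vertex E) x"
proof
  show "reach E x \<subseteq> orbit (next_vertex E) x"
  proof
    fix y assume "y \<in> reach E x"
    then obtain w where "walk E x w y" by (auto simp: reach_def)
    from walk_funpow(1,4)[OF assms(1) this] show "y \<in> orbit (next_vertex E) x"
      unfolding orbit_altdef by (intro CollectI exI[of _ "length w"]) simp
  qed
  show "orbit (next_vertex E) x \<subseteq> reach E x"
  proof
    fix y assume "y \<in> orbit (next_vertex E) x"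
    then obtain n where n: "y = (next_vertex E ^^ Suc n) x"
      unfolding orbit_altdef by (auto simp: gr0_conv_Suc)
    from closed_walks[OF assms] obtain w z where "walk E x w z" "length w = Suc n" by metis
    moreover from this have "y = z" using walk_funpow(1)[OF assms(1), of x w z] n by simp
    ultimately show "y \<in> reach E x" by (auto simp: reach_def)
  qed
qed

text \<open>The period of \<open>x\<close> under \<open>next_vertex\<close> is both the number of
  vertices on the loop and the length of the first return; this justifies the length condition in
  \<open>loop_label\<close>.\<close>

lemma
  assumes "partial_bij E" "x \<in> reach E x"
  shows finite_reach: "finite (reach E x)"
    and ex1_round_trip: "\<exists>!w. walk E x w x \<and> length w = card (reach E x)"
    and inj_on_round_trip: "inj_on (\<lambda>i. (next_vertex E ^^ i) x) {0..<card (reach E x)}"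
proof -
  let ?f = "next_vertex E" and ?P = "funpow_dist1 (next_vertex E) x x"
  have x: "x \<in> orbit ?f x" using assms(2) reach_orbit[OF assms] by simp
  have inj: "inj_on (\<lambda>i. (?f ^^ i) x) {0..<?P}" by (rule inj_on_funpow_dist1[OF x])
  have c: "card (reach E x) = ?P"
    using card_image[OF inj] orbit_conv_funpow_dist1[OF x] reach_orbit[OF assms] by simp
  show "finite (reach E x)" using finite_orbit[OF x] reach_orbit[OF assms] by simp
  show "inj_on (\<lambda>i. (?f ^^ i) x) {0..<card (reach E x)}" using inj c by simp
  from closed_walks[OF assms] obtain w y where w: "walk E x w y" "length w = ?P" by metis
  have "y = x" using walk_funpow(1)[OF assms(1) w(1)] funpow_dist1_prop[OF x] w(2) by simp
  show "\<exists>!w. walk E x w x \<and> length w = card (reach E x)"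
  proof (rule ex1I)
    show "walk E x w x \<and> length w = card (reach E x)" using w c \<open>y = x\<close> by simp
    fix w' assume "walk E x w' x \<and> length w' = card (reach E x)"
    then show "w' = w" using walk_det[OF assms(1) _ w(1), of w' x] w(2) c by simp
  qed
qed

text \<open>Reachability is symmetric on a loop: repeat a closed walk at \<open>x\<close> until it
  is longer than the given walk to \<open>y\<close> and cut it at that length; by determinism the
  cut is at \<open>y\<close>.\<close>

lemma reach_closed:
  assumes "partial_bij E" "x \<in> reach E x" "y \<in> reach E x"
  shows "reach E y = reach E x" "x \<in> reach E y"
proof -
  have o: "reach E x = orbit (next_vertex E) x" by (rule reach_orbit[OF assms(1,2)])
  obtain n where n: "walk E x n y" using assms(3) by (auto simp: reach_def)
  obtain v where v: "walk E x v x" using assms(2) by (auto simp: reach_def)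
  have "\<exists>v. walk E x v x \<and> length v > k" for k
  proof (induction k)
    case 0 then show ?case using v walk_funpow(4)[OF assms(1) v] by auto
  next
    case (Suc k)
    then obtain u where "walk E x u x" "length u > k" by auto
    then have "walk E x (u @ v) x \<and> length (u @ v) > Suc k"
      using walk_append[of E x u x v x] v walk_funpow(4)[OF assms(1) v] by (cases v) auto
    then show ?case by blast
  qed
  then obtain u where u: "walk E x u x" "length n < length u" by auto
  have "0 < length n" using walk_funpow(4)[OF assms(1) n] by auto
  from walk_split[OF u(1) this u(2)] obtain z where z: "walk E x (take (length n) u) z"
      "walk E z (drop (length n) u) x" by auto
  have "z = y" using walk_det[OF assms(1) z(1) n] u by simp
  then show xy: "x \<in> reach E y" using z by (auto simp: reach_def)
  show "reach E y = reach E x" using reach_trans[OF xy] reach_trans[OF assms(3)] by (intro equalityI subsetI)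
qed

section \<open>Labels of walks and values of loops\<close>

context int_table_algebra
begin

definition label_graph :: "(nat \<times> nat \<times> 'a) set \<Rightarrow> bool" where
  "label_graph E \<longleftrightarrow> partial_bij E \<and> (\<forall>p q a. (p, q, a) \<in> E \<longrightarrow> a \<in> carrier A)"

lemma label_graphD:
  assumes "label_graph E"
  shows "partial_bij E" "(p, q, a) \<in> E \<Longrightarrow> a \<in> carrier A"
  using assms by (auto simp: label_graph_def)

text \<open>When \<open>x -> m -> y\<close> is merged, the later label becomes the left factor. The
  condition \<open>x \<noteq> m\<close> discards an edge from \<open>m\<close> to itself; the factor
  of that loop is recorded by \<open>contract_factor\<close>.\<close>

definition contract :: "nat \<Rightarrow> (nat \<times> nat \<times> 'a) set \<Rightarrow> (nat \<times> nat \<times> 'a) set" where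
  "contract m E = {(p, q, a) \<in> E. p \<noteq> m \<and> q \<noteq> m} \<union>
     {(x, y, b \<otimes> a) | x y a b. (x, m, a) \<in> E \<and> (m, y, b) \<in> E \<and> x \<noteq> m}"

text \<open>The strands that remain after all inner vertices and all loops are removed, with their
  product labels.\<close>

definition net :: "(nat \<times> nat \<times> 'a) set \<Rightarrow> (nat \<times> nat \<times> 'a) set" where
  "net E = {(p, q, word_label A w) | p q w. walk E p w q \<and> p \<notin> tgts E \<and> q \<notin> srcs E}"

definition round_trip :: "(nat \<times> nat \<times> 'a) set \<Rightarrow> nat \<Rightarrow> 'a list" where
  "round_trip E x = (THE w. walk E x w x \<and> length w = card (reach E x))"

lemma walk_carrier:
  assumes "label_graph E" "walk E x w y" shows "set w \<subseteq> carrier A"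
  using assms(2) by induction (use label_graphD(2)[OF assms(1)] in auto)

lemma fold_word_label:
  assumes "set w \<subseteq> carrier A" "c \<in> carrier A"
  shows "fold (\<lambda>a x. a \<otimes> x) w c = word_label A w \<otimes> c \<and> word_label A w \<in> carrier A"
proof -
  have "fold (\<lambda>a x. a \<otimes> x) w c \<in> carrier A" if "c \<in> carrier A" for c
    using assms(1) that by (induction w arbitrary: c) auto
  moreover have "fold (\<lambda>a x. a \<otimes> x) w (c \<otimes> d) = fold (\<lambda>a x. a \<otimes> x) w c \<otimes> d"
    if "c \<in> carrier A" "d \<in> carrier A" for c d
    using assms(1) that by (induction w arbitrary: c) (auto simp: m_assoc[symmetric])
  ultimately show ?thesis using assms(2) unfolding word_label_def
    by (metis l_one one_closed)
qed

lemma word_label_closed [simp, intro]: "set w \<subseteq> carrier A \<Longrightarrow> word_label A w \<in> carrier A"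
  using fold_word_label[of w \<one>] by simp

lemma word_label_Nil [simp]: "word_label A [] = \<one>"
  by (simp add: word_label_def)

lemma word_label_Cons:
  "set w \<subseteq> carrier A \<Longrightarrow> a \<in> carrier A \<Longrightarrow> word_label A (a # w) = word_label A w \<otimes> a"
  using fold_word_label[of w a] by (simp add: word_label_def)

lemma word_label_append:
  "set u \<subseteq> carrier A \<Longrightarrow> set w \<subseteq> carrier A \<Longrightarrow>
     word_label A (u @ w) = word_label A w \<otimes> word_label A u"
  by (induction u) (auto simp: word_label_Cons m_assoc)

lemma round_trip:
  assumes "partial_bij E" "x \<in> reach E x"
  shows "walk E x (round_trip E x) x" "length (round_trip E x) = card (reach E x)"
  using theI'[OF ex1_round_trip[OF assms]] by (simp_all add: round_trip_def)

lemma round_trip_eqI: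
  assumes "partial_bij E" "walk E x w x" "length w = card (reach E x)"
  shows "round_trip E x = w"
proof -
  have "x \<in> reach E x" using assms(2) by (auto simp: reach_def)
  then show ?thesis using walk_det[OF assms(1) round_trip(1)[OF assms(1)] assms(2)]
      round_trip(2)[OF assms(1)] assms by simp
qed

text \<open>\<open>loop_label\<close> starts at the least vertex, which a contraction may remove and
  a relabelling may move. Here the starting vertex is free.\<close>

definition loop_value :: "(nat \<times> nat \<times> 'a) set \<Rightarrow> nat \<Rightarrow> int" where
  "loop_value E x = t (word_label A (round_trip E x))"

text \<open>Changing the start rotates the word, and \<open>t\<close> is invariant under rotation by
  \<open>trace_commute\<close>.\<close>

lemma loop_value_cong:
  assumes E: "label_graph E" and x: "x \<in> reach E x" and y: "y \<in> reach E x"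
  shows "loop_value E y = loop_value E x"
proof (cases "y = x")
  case False
  note pb = label_graphD(1)[OF E]
  let ?w = "round_trip E x"
  have "y \<in> orbit (next_vertex E) x" using reach_orbit[OF pb x] y by simp
  moreover have "(next_vertex E ^^ length ?w) x = x" "0 < length ?w"
    using walk_funpow(1,4)[OF pb round_trip(1)[OF pb x]] by auto
  ultimately obtain i where i: "y = (next_vertex E ^^ i) x" "i < length ?w"
    by (auto simp: orbit_altdef_bounded)
  with False have "0 < i" by (cases i) auto
  from walk_split[OF round_trip(1)[OF pb x] this i(2)] obtain z
    where z: "walk E x (take i ?w) z" "walk E z (drop i ?w) x" by auto
  have "z = y" using walk_funpow(1)[OF pb z(1)] i by (simp add: min_def)
  with z have z: "walk E x (take i ?w) y" "walk E y (drop i ?w) x" by auto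
  have "round_trip E y = drop i ?w @ take i ?w"
    using walk_append[OF z(2,1)] i(2) round_trip(2)[OF pb x] reach_closed(1)[OF pb x y]
    by (intro round_trip_eqI pb) auto
  moreover have "round_trip E x = take i ?w @ drop i ?w" by simp
  moreover have "set (take i ?w) \<subseteq> carrier A" "set (drop i ?w) \<subseteq> carrier A"
    using walk_carrier[OF E z(1)] walk_carrier[OF E z(2)] by auto
  ultimately show ?thesis unfolding loop_value_def
    by (metis trace_commute word_label_append word_label_closed)
qed simp

lemma loop_label_value:
  assumes E: "label_graph E" and x: "x \<in> reach E x"
  shows "t (loop_label A E (reach E x)) = loop_value E x"
proof -
  note pb = label_graphD(1)[OF E]
  let ?m = "Min (reach E x)"
  have m: "?m \<in> reach E x" using finite_reach[OF pb x] x by (intro Min_in) auto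
  have "round_trip E ?m = (THE w. walk E ?m w ?m \<and> length w = card (reach E x))"
    unfolding round_trip_def reach_closed(1)[OF pb x m] ..
  then have "t (loop_label A E (reach E x)) = loop_value E ?m"
    by (simp add: loop_label_def loop_value_def)
  then show ?thesis using loop_value_cong[OF E x m] by simp
qed

text \<open>The vertex \<open>x'\<close> need not be the image of \<open>x\<close>; any vertex on
  the corresponding loop may be chosen, as loop values do not depend on the start.\<close>

lemma loop_factor_cong:
  assumes E: "label_graph E" and E': "label_graph E'"
    and f: "bij_betw f (loops E) (loops E')"
    and v: "\<And>x. x \<in> reach E x \<Longrightarrow> \<exists>x'. x' \<in> reach E' x' \<and> reach E' x' = f (reach E x) \<and>
               loop_value E' x' = loop_value E x"
  shows "loop_factor A B E = loop_factor A B E'"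
proof -
  have "loop_factor A B E = (\<Prod>L\<in>loops E. delta * of_int (t (loop_label A E' (f L))))"
    unfolding loop_factor_def
  proof (intro prod.cong refl)
    fix L assume "L \<in> loops E"
    then obtain x where x: "L = reach E x" "x \<in> reach E x" by (auto simp: loops_reach)
    from v[OF x(2)] obtain x' where x': "x' \<in> reach E' x'" "reach E' x' = f (reach E x)"
      "loop_value E' x' = loop_value E x" by auto
    show "delta * of_int (t (loop_label A E L)) = delta * of_int (t (loop_label A E' (f L)))"
      using loop_label_value[OF E x(2)] loop_label_value[OF E' x'(1)] x x' by simp
  qed
  also have "\<dots> = loop_factor A B E'"
    unfolding loop_factor_def by (rule prod.reindex_bij_betw[OF f])
  finally show ?thesis .
qed

section \<open>Contraction at one inner vertex\<close>

context
  fixes E m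
  assumes E: "label_graph E" and m: "m \<in> inner E"
begin

lemmas pb = label_graphD(1)[OF E]

lemma contract_edge: "p \<noteq> m \<Longrightarrow> q \<noteq> m \<Longrightarrow> (p, q, a) \<in> E \<Longrightarrow> (p, q, a) \<in> contract m E"
  by (auto simp: contract_def)

lemma contract_new: "x \<noteq> m \<Longrightarrow> (x, m, a) \<in> E \<Longrightarrow> (m, y, b) \<in> E \<Longrightarrow> (x, y, b \<otimes> a) \<in> contract m E"
  by (auto simp: contract_def)

lemma contract_cases:
  assumes "(p, q, c) \<in> contract m E"
  obtains "(p, q, c) \<in> E" "p \<noteq> m" "q \<noteq> m"
  | a b where "(p, m, a) \<in> E" "(m, q, b) \<in> E" "c = b \<otimes> a" "p \<noteq> m" "q \<noteq> m"
proof (cases "(p, q, c) \<in> E \<and> p \<noteq> m \<and> q \<noteq> m")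
  case False
  then obtain a b where ab: "(p, m, a) \<in> E" "(m, q, b) \<in> E" "c = b \<otimes> a" "p \<noteq> m"
    using assms by (auto simp: contract_def)
  \<comment> \<open>If \<open>q\<close> were \<open>m\<close>, the edge from \<open>m\<close> to
    itself would be the only one entering \<open>m\<close>, forcing \<open>p = m\<close>.\<close>
  then have "q \<noteq> m" using partial_bijD(4)[OF pb, of m m b p a] by auto
  then show thesis using that(2) ab by blast
qed (use that in blast)

lemma finite_contract: "finite (contract m E)"
proof -
  let ?f = "\<lambda>((p, q, a), (p', q', b)). (p, q', b \<otimes> a)"
  have "contract m E \<subseteq> E \<union> ?f ` (E \<times> E)"
  proof
    fix e assume "e \<in> contract m E"
    then consider "e \<in> E" | x y a b where "e = (x, y, b \<otimes> a)" "(x, m, a) \<in> E" "(m, y, b) \<in> E"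
      by (auto simp: contract_def)
    then show "e \<in> E \<union> ?f ` (E \<times> E)"
    proof cases
      case 2
      then have "e = ?f ((x, m, a), (m, y, b))" by simp
      then show ?thesis using 2 by blast
    qed simp
  qed
  then show ?thesis by (rule finite_subset) (simp add: partial_bijD(1)[OF pb])
qed

lemma label_graph_contract: "label_graph (contract m E)"
  unfolding label_graph_def partial_bij_def
proof (intro conjI allI impI; (elim conjE)?)
  fix p q a q' a' assume *: "(p, q, a) \<in> contract m E" "(p, q', a') \<in> contract m E"
  show "q = q'"
    by (rule contract_cases[OF *(1)]; rule contract_cases[OF *(2)])
      (use partial_bijD(2)[OF pb] in metis)+
  show "a = a'"
    by (rule contract_cases[OF *(1)]; rule contract_cases[OF *(2)])
      (use partial_bijD(2,3)[OF pb] in metis)+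
next
  fix p q a p' a' assume *: "(p, q, a) \<in> contract m E" "(p', q, a') \<in> contract m E"
  show "p = p'"
    by (rule contract_cases[OF *(1)]; rule contract_cases[OF *(2)])
      (use partial_bijD(4)[OF pb] in metis)+
next
  fix p q a assume *: "(p, q, a) \<in> contract m E"
  show "a \<in> carrier A"
    by (rule contract_cases[OF *]) (use label_graphD(2)[OF E] in auto)
qed (rule finite_contract)

lemma srcs_contract: "srcs (contract m E) = srcs E - {m}"
proof
  show "srcs (contract m E) \<subseteq> srcs E - {m}"
    by (auto simp: srcs_def elim: contract_cases)
  obtain y b where y: "(m, y, b) \<in> E" using m by (auto simp: inner_def srcs_def)
  show "srcs E - {m} \<subseteq> srcs (contract m E)"
  proof
    fix p assume "p \<in> srcs E - {m}"
    then obtain q a where "(p, q, a) \<in> E" "p \<noteq> m" by (auto simp: srcs_def)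
    then show "p \<in> srcs (contract m E)"
      using contract_edge[of p q a] contract_new[of p a y b] y by (cases "q = m") (auto simp: srcs_def)
  qed
qed

lemma tgts_contract: "tgts (contract m E) = tgts E - {m}"
proof
  show "tgts (contract m E) \<subseteq> tgts E - {m}"
    by (auto simp: tgts_def elim: contract_cases)
  obtain x a where x: "(x, m, a) \<in> E" using m by (auto simp: inner_def tgts_def)
  show "tgts E - {m} \<subseteq> tgts (contract m E)"
  proof
    fix q assume "q \<in> tgts E - {m}"
    then obtain p b where p: "(p, q, b) \<in> E" "q \<noteq> m" by (auto simp: tgts_def)
    show "q \<in> tgts (contract m E)"
    proof (cases "p = m")
      case True
      then have "x \<noteq> m" using p x partial_bijD(2)[OF pb] by metis
      then show ?thesis using contract_new[of x a q b] x p True by (auto simp: tgts_def)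
    qed (use contract_edge[OF _ p(2,1)] in \<open>auto simp: tgts_def\<close>)
  qed
qed

lemma inner_contract: "inner (contract m E) = inner E - {m}"
  by (auto simp: inner_def srcs_contract tgts_contract)

lemma walk_contractD:
  assumes "walk (contract m E) p w' q"
  shows "\<exists>w. walk E p w q \<and> word_label A w = word_label A w'"
  using assms
proof induction
  case (edge x y a)
  then show ?case
  proof (cases rule: contract_cases)
    case 1 then show ?thesis by (intro exI[of _ "[a]"] conjI walk.edge) auto
  next
    case (2 a' b)
    then show ?thesis using label_graphD(2)[OF E]
      by (intro exI[of _ "[a', b]"]) (auto intro: walk.intros simp: word_label_Cons)
  qed
next
  case (step x y a w' z)
  then obtain w where w: "walk E y w z" "word_label A w = word_label A w'" by auto
  have cw: "set w \<subseteq> carrier A" "set w' \<subseteq> carrier A"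
    using walk_carrier[OF E w(1)] walk_carrier[OF label_graph_contract step(2)] by auto
  from step(1) show ?case
  proof (cases rule: contract_cases)
    case 1
    then show ?thesis using w cw label_graphD(2)[OF E]
      by (intro exI[of _ "a # w"]) (auto intro: walk.intros simp: word_label_Cons)
  next
    case (2 a' b)
    then have "walk E x (a' # b # w) z" using w by (auto intro: walk.intros)
    then show ?thesis using w cw 2 label_graphD(2)[OF E]
      by (intro exI[of _ "a' # b # w"]) (auto simp: word_label_Cons m_assoc)
  qed
qed

text \<open>Induction on the length and not on the walk, because passing through \<open>m\<close>
  consumes two edges at once.\<close>

lemma walk_contractI:
  assumes "walk E p w q" "p \<noteq> m" "q \<noteq> m"
  shows "\<exists>w'. walk (contract m E) p w' q \<and> word_label A w' = word_label A w"
  using assms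
proof (induction "length w" arbitrary: p w rule: less_induct)
  case less
  from less.prems(1) show ?case
  proof (cases rule: walk.cases)
    case (edge a)
    then show ?thesis using less.prems contract_edge by (intro exI[of _ w]) (auto intro: walk.intros)
  next
    case (step z a u)
    have cu: "set u \<subseteq> carrier A" "a \<in> carrier A"
      using walk_carrier[OF E step(3)] label_graphD(2)[OF E step(2)] by auto
    show ?thesis
    proof (cases "z = m")
      case False
      then obtain u' where u': "walk (contract m E) z u' q" "word_label A u' = word_label A u"
        using less.hyps[of u z] step less.prems by auto
      have "set u' \<subseteq> carrier A" by (rule walk_carrier[OF label_graph_contract u'(1)])
      then show ?thesis
        using u' step False less.prems cu contract_edge[of p z a]
        by (intro exI[of _ "a # u'"]) (auto intro: walk.intros simp: word_label_Cons)
    next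
      case True
      from step(3) show ?thesis
      proof (cases rule: walk.cases)
        case (edge b)
        then have "(p, q, b \<otimes> a) \<in> contract m E" using True less.prems step by (intro contract_new) auto
        then show ?thesis using edge step cu
          by (intro exI[of _ "[b \<otimes> a]"]) (auto intro: walk.intros simp: word_label_Cons)
      next
        case step': (step y b v)
        have n: "(p, y, b \<otimes> a) \<in> contract m E" using True less.prems step step' by (intro contract_new) auto
        have "y \<noteq> m" using contract_cases[OF n] by blast
        then obtain v' where v': "walk (contract m E) y v' q" "word_label A v' = word_label A v"
          using less.hyps[of v y] step step' less.prems by auto
        have "set v' \<subseteq> carrier A" by (rule walk_carrier[OF label_graph_contract v'(1)])
        then show ?thesis
          using v' step step' cu n
          by (intro exI[of _ "(b \<otimes> a) # v'"]) (auto intro: walk.intros simp: word_label_Cons m_assoc)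
      qed
    qed
  qed
qed

text \<open>The ends of a strand are not inner, so neither of them is \<open>m\<close>, and walks
  between vertices other than \<open>m\<close> correspond to each other with equal product
  labels.\<close>

lemma net_contract: "net (contract m E) = net E"
proof -
  have "p \<noteq> m \<and> q \<noteq> m" if "p \<notin> tgts E" "q \<notin> srcs E" for p q
    using that m by (auto simp: inner_def)
  moreover have "p \<noteq> m \<and> q \<noteq> m" if "walk (contract m E) p w q" for p q w
    using walk_srcs[OF that] walk_tgts[OF that] by (simp add: srcs_contract tgts_contract)
  ultimately show ?thesis
    unfolding net_def srcs_contract tgts_contract
    using walk_contractI walk_contractD by (auto simp: set_eq_iff) metis+
qed

lemma reach_contract: "x \<noteq> m \<Longrightarrow> reach (contract m E) x = reach E x - {m}"
proof -
  assume "x \<noteq> m"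
  moreover have "y \<noteq> m" if "walk (contract m E) x w y" for y w
    using walk_tgts[OF that] by (simp add: tgts_contract)
  ultimately show ?thesis
    unfolding reach_def using walk_contractI walk_contractD by (auto simp: set_eq_iff) metis+
qed

lemma m_notin_reach_contract: "m \<notin> reach (contract m E) x" "x \<in> reach (contract m E) x \<Longrightarrow> x \<noteq> m"
  using walk_tgts[of "contract m E"] by (auto simp: reach_def tgts_contract)

text \<open>Here the word itself is preserved and not only its product, as round trips are
  identified by their length.\<close>

lemma walk_contract_avoid:
  assumes "walk E p w q" "p \<noteq> m" "\<And>i. i < length w \<Longrightarrow> (next_vertex E ^^ Suc i) p \<noteq> m"
  shows "walk (contract m E) p w q"
  using assms
proof (induction rule: walk.induct)
  case (edge x y a)
  have "y \<noteq> m" using edge.prems(2)[of 0] next_vertex_eq[OF pb edge.hyps] by simp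
  then show ?case using edge contract_edge by (auto intro: walk.intros)
next
  case (step x y a w z)
  have n: "next_vertex E x = y" by (rule next_vertex_eq[OF pb step.hyps(1)])
  then have "y \<noteq> m" using step.prems(2)[of 0] by simp
  moreover have "(next_vertex E ^^ Suc i) y \<noteq> m" if "i < length w" for i
    using step.prems(2)[of "Suc i"] that n by (simp only: funpow_Suc_right o_apply) simp
  ultimately have "walk (contract m E) y w z" by (intro step.IH)
  then show ?case
    using walk.step[OF contract_edge[OF step.prems(1) \<open>y \<noteq> m\<close> step.hyps(1)]] by blast
qed

lemma loop_value_contract_avoid:
  assumes "x \<in> reach E x" "m \<notin> reach E x" "x \<noteq> m"
  shows "loop_value (contract m E) x = loop_value E x"
proof -
  have "walk (contract m E) x (round_trip E x) x"
  proof (rule walk_contract_avoid[OF round_trip(1)[OF pb assms(1)] assms(3)])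
    fix i
    have "(next_vertex E ^^ Suc i) x \<in> reach E x"
      unfolding reach_orbit[OF pb assms(1)] orbit_altdef by blast
    then show "(next_vertex E ^^ Suc i) x \<noteq> m" using assms(2) by metis
  qed
  then have "round_trip (contract m E) x = round_trip E x"
    using round_trip(2)[OF pb assms(1)] assms reach_contract[OF assms(3)]
    by (intro round_trip_eqI label_graphD(1)[OF label_graph_contract]) auto
  then show ?thesis by (simp add: loop_value_def)
qed

text \<open>The round trip starts at the predecessor of \<open>m\<close>: then \<open>m\<close> is
  its second vertex, the first two labels merge, and the rest avoids \<open>m\<close>.\<close>

lemma loop_value_contract:
  assumes x: "x \<in> reach E x" and e: "(x, m, a) \<in> E" and "x \<noteq> m"
  shows "loop_value (contract m E) x = loop_value E x"
proof -
  have m_reach: "m \<in> reach E x" using walk.edge[OF e] by (auto simp: reach_def)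
  have fin: "finite (reach E x)" by (rule finite_reach[OF pb x])
  let ?w = "round_trip E x" and ?f = "next_vertex E"
  have w: "walk E x ?w x" "length ?w = card (reach E x)" by (rule round_trip[OF pb x])+
  from w(1) show ?thesis
  proof (cases rule: walk.cases)
    case (edge a) then show ?thesis using partial_bijD(2)[OF pb e] \<open>x \<noteq> m\<close> by metis
  next
    case (step y a' u)
    have [simp]: "y = m" "a' = a" using partial_bijD(2,3)[OF pb e step(2)] by auto
    have u: "walk E m u x" using step by simp
    have ac: "a \<in> carrier A" by (rule label_graphD(2)[OF E e])
    have "walk (contract m E) x ((hd u \<otimes> a) # tl u) x \<and> hd u \<in> carrier A \<and> set (tl u) \<subseteq> carrier A \<and> u \<noteq> []"
      using u
    proof (cases rule: walk.cases)
      case (edge b)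
      then show ?thesis using contract_new[OF \<open>x \<noteq> m\<close> e, of x b] label_graphD(2)[OF E edge(2)]
        by (auto intro: walk.intros)
    next
      case step': (step y' b v)
      have n: "(x, y', b \<otimes> a) \<in> contract m E" using step' by (intro contract_new \<open>x \<noteq> m\<close> e)
      then have y': "y' \<noteq> m" using contract_cases by blast
      have f2: "?f x = m" "?f m = y'" using next_vertex_eq[OF pb] e step' by auto
      have "walk (contract m E) y' v x"
      proof (rule walk_contract_avoid[OF step'(3) y'])
        fix i assume i: "i < length v"
        have len: "card (reach E x) = length v + 2" using w(2) step step' by simp
        have eq: "(?f ^^ Suc i) y' = (?f ^^ (i + 3)) x"
          by (simp only: numeral_3_eq_3 add_Suc_right add_0_right funpow_Suc_right o_apply f2)
        show "(?f ^^ Suc i) y' \<noteq> m"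
        \<comment> \<open>Since \<open>y'\<close> is reached after two steps, the vertex in question
          comes after \<open>i + 3\<close> steps of the round trip. It is either the final return to
          \<open>x\<close>, or different from \<open>m\<close>, which comes after one step, by
          injectivity.\<close>
        proof (cases "i + 3 = length v + 2")
          case True
          then have "(?f ^^ Suc i) y' = (?f ^^ length ?w) x" using eq w(2) len by metis
          then have "(?f ^^ Suc i) y' = x" using walk_funpow(1)[OF pb w(1)] by metis
          then show ?thesis using \<open>x \<noteq> m\<close> by metis
        next
          case False
          with i have "i + 3 < card (reach E x)" "1 < card (reach E x)" using len by auto
          then have "(?f ^^ (i + 3)) x \<noteq> (?f ^^ 1) x"
            using inj_onD[OF inj_on_round_trip[OF pb x], of "i + 3" 1] by auto
          then show ?thesis unfolding eq using f2 by simp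
        qed
      qed
      then show ?thesis using n step' walk_carrier[OF E step'(3)] label_graphD(2)[OF E step'(2)]
        by (auto intro: walk.intros)
    qed
    then have *: "walk (contract m E) x ((hd u \<otimes> a) # tl u) x" "hd u \<in> carrier A"
      "set (tl u) \<subseteq> carrier A" "u \<noteq> []" by auto
    have "length ((hd u \<otimes> a) # tl u) = card (reach E x) - 1" using w(2) step *(4) by simp
    also have "\<dots> = card (reach (contract m E) x)"
      using reach_contract[OF \<open>x \<noteq> m\<close>] m_reach fin by simp
    finally have "round_trip (contract m E) x = (hd u \<otimes> a) # tl u"
      using *(1) by (intro round_trip_eqI label_graphD(1)[OF label_graph_contract])
    moreover obtain b v where bv: "u = b # v" using *(4) by (cases u) auto
    moreover have "?w = a # b # v" using step bv by simp
    ultimately show ?thesis unfolding loop_value_def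
      using * ac by (simp add: word_label_Cons m_assoc)
  qed
qed

lemma contract_loop_lift:
  assumes "x \<in> reach (contract m E) x"
  shows "x \<in> reach E x" "x \<noteq> m" "reach (contract m E) x = reach E x - {m}"
  using assms m_notin_reach_contract(2)[OF assms] reach_contract[of x] by auto

text \<open>Without an edge from \<open>m\<close> to itself every loop has a vertex other than
  \<open>m\<close>, so removing \<open>m\<close> from vertex sets is a bijection of loops. On the
  loop through \<open>m\<close> the predecessor of \<open>m\<close> serves as starting
  vertex.\<close>

lemma loop_factor_contract:
  assumes noself: "\<And>a. (m, m, a) \<notin> E"
  shows "loop_factor A B (contract m E) = loop_factor A B E"
proof (rule loop_factor_cong[OF E label_graph_contract, symmetric])
  have ex: "\<exists>x. x \<in> reach E x \<and> x \<noteq> m \<and> L = reach E x \<and> x \<in> reach (contract m E) x \<and>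
     reach (contract m E) x = L - {m} \<and> loop_value (contract m E) x = loop_value E x"
    if "L \<in> loops E" for L
  proof -
    from that obtain x where x: "L = reach E x" "x \<in> reach E x" by (auto simp: loops_reach)
    show ?thesis
    proof (cases "m \<in> L")
      case False
      then have "x \<noteq> m" using x by auto
      then show ?thesis
        using x False reach_contract[of x] loop_value_contract_avoid[of x]
        by (intro exI[of _ x]) simp
    next
      case True
      then have L: "L = reach E m" "m \<in> reach E m"
        using reach_closed(1)[OF pb x(2), of m] x True by simp_all
      obtain x' a where e: "(x', m, a) \<in> E" using m by (auto simp: inner_def tgts_def)
      have n: "x' \<noteq> m" using noself e by auto
      from L(2) obtain w where w: "walk E m w m" by (auto simp: reach_def)
      have "x' \<in> reach E m"
      proof -
        obtain u b where u: "w = u @ [b]" using walk_funpow(4)[OF pb w] by (metis rev_exhaust)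
        have "u \<noteq> []"
        proof
          assume "u = []"
          with w u have "walk E m [b] m" by simp
          then show False by (cases rule: walk.cases) (use noself walk_funpow(4)[OF pb] in auto)
        qed
        then obtain z where z: "walk E m u z" "walk E z [b] m"
          using walk_split[OF w, of "length u"] u by auto
        from z(2) have "(z, m, b) \<in> E" by (cases rule: walk.cases) (use walk_funpow(4)[OF pb] in auto)
        then have "z = x'" using partial_bijD(4)[OF pb e] by metis
        then show ?thesis using z(1) by (auto simp: reach_def)
      qed
      then have "reach E x' = L" "x' \<in> reach E x'" using reach_closed(1)[OF pb L(2), of x'] L by simp_all
      then show ?thesis using n reach_contract[OF n] loop_value_contract[OF _ e n]
        by (intro exI[of _ x']) simp
    qed
  qed
  show "bij_betw (\<lambda>L. L - {m}) (loops E) (loops (contract m E))"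
    unfolding bij_betw_def
  proof
    show "inj_on (\<lambda>L. L - {m}) (loops E)"
    proof (rule inj_onI)
      fix L L' assume L: "L \<in> loops E" "L' \<in> loops E" "L - {m} = L' - {m}"
      from ex[OF L(1)] obtain x where x: "x \<in> reach E x" "x \<noteq> m" "L = reach E x" by auto
      from ex[OF L(2)] obtain y where y: "y \<in> reach E y" "L' = reach E y" by auto
      have "x \<in> L'" using x L(3) by blast
      then show "L = L'" using reach_closed(1)[OF pb y(1), of x] x y by simp
    qed
    show "(\<lambda>L. L - {m}) ` loops E = loops (contract m E)"
    proof
      show "(\<lambda>L. L - {m}) ` loops E \<subseteq> loops (contract m E)"
      proof
        fix K assume "K \<in> (\<lambda>L. L - {m}) ` loops E"
        then obtain L where "L \<in> loops E" "K = L - {m}" by auto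
        with ex[of L] show "K \<in> loops (contract m E)" unfolding loops_reach by blast
      qed
      show "loops (contract m E) \<subseteq> (\<lambda>L. L - {m}) ` loops E"
      proof
        fix K assume "K \<in> loops (contract m E)"
        then obtain x where x: "K = reach (contract m E) x" "x \<in> reach (contract m E) x"
          by (auto simp: loops_reach)
        show "K \<in> (\<lambda>L. L - {m}) ` loops E"
          using contract_loop_lift[OF x(2)] x(1) by (intro image_eqI[of _ _ "reach E x"]) (auto simp: loops_reach)
      qed
    qed
  qed
  fix x assume "x \<in> reach E x"
  then have "reach E x \<in> loops E" by (auto simp: loops_reach)
  from ex[OF this] show "\<exists>x'. x' \<in> reach (contract m E) x' \<and> reach (contract m E) x' = reach E x - {m} \<and>
      loop_value (contract m E) x' = loop_value E x"
  proof (elim exE conjE)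
    fix x' assume x': "x' \<in> reach E x'" "reach E x = reach E x'" "x' \<in> reach (contract m E) x'"
      "reach (contract m E) x' = reach E x - {m}" "loop_value (contract m E) x' = loop_value E x'"
    have "loop_value E x' = loop_value E x"
      using \<open>x \<in> reach E x\<close> x' by (intro loop_value_cong[OF E]) auto
    then show ?thesis using x' by auto
  qed
qed

text \<open>An edge from \<open>m\<close> to itself isolates \<open>m\<close>, so all other loops
  avoid \<open>m\<close> and keep their words.\<close>

lemma loop_factor_contract_self:
  assumes e: "(m, m, a) \<in> E"
  shows "loop_factor A B E = delta * of_int (t a) * loop_factor A B (contract m E)"
proof -
  have "walk E m w y \<Longrightarrow> y = m" for w y
  proof -
    assume "walk E m w y"
    moreover have "(next_vertex E ^^ i) m = m" for i
      using next_vertex_eq[OF pb e] by (induction i) auto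
    ultimately show ?thesis using walk_funpow(1)[OF pb] by metis
  qed
  then have rm: "reach E m = {m}" using walk.edge[OF e] by (auto simp: reach_def)
  have notm: "m \<notin> reach E x" if "x \<in> reach E x" "x \<noteq> m" for x
    using reach_closed[OF pb that(1), of m] rm that by auto
  have l: "loops E = insert {m} (loops (contract m E))"
  proof
    show "loops E \<subseteq> insert {m} (loops (contract m E))"
    proof
      fix L assume "L \<in> loops E"
      then obtain x where x: "L = reach E x" "x \<in> reach E x" by (auto simp: loops_reach)
      show "L \<in> insert {m} (loops (contract m E))"
        using x rm notm[OF x(2)] reach_contract[of x] by (cases "x = m") (auto simp: loops_reach)
    qed
    show "insert {m} (loops (contract m E)) \<subseteq> loops E"
    proof -
      have "reach (contract m E) x \<in> loops E" if "x \<in> reach (contract m E) x" for x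
        using contract_loop_lift[OF that] notm[of x] by (auto simp: loops_reach)
      moreover have "{m} \<in> loops E" using rm unfolding loops_reach by force
      ultimately show ?thesis by (auto simp: loops_reach)
    qed
  qed
  have "{m} \<notin> loops (contract m E)"
    using m_notin_reach_contract(1) by (auto simp: loops_reach)
  moreover have "finite (loops (contract m E))"
  proof -
    have "loops E \<subseteq> Pow (tgts E)" using walk_tgts by (fastforce simp: loops_reach reach_def)
    moreover have "finite (tgts E)"
    proof -
      have "tgts E = (fst \<circ> snd) ` E" by (force simp: tgts_def)
      then show ?thesis using partial_bijD(1)[OF pb] by simp
    qed
    ultimately have "finite (loops E)" by (metis finite_Pow_iff finite_subset)
    then show ?thesis using l by simp
  qed
  ultimately have "loop_factor A B E = delta * of_int (t (loop_label A E {m})) *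
      (\<Prod>L\<in>loops (contract m E). delta * of_int (t (loop_label A E L)))"
    unfolding loop_factor_def l by simp
  also have "t (loop_label A E {m}) = t a"
  proof -
    have "round_trip E m = [a]" by (rule round_trip_eqI[OF pb walk.edge[OF e]]) (simp add: rm)
    then show ?thesis using loop_label_value[OF E, of m] label_graphD(2)[OF E e]
      by (simp add: rm loop_value_def word_label_Cons)
  qed
  also have "(\<Prod>L\<in>loops (contract m E). delta * of_int (t (loop_label A E L))) =
      loop_factor A B (contract m E)"
    unfolding loop_factor_def
  proof (intro prod.cong refl)
    fix L assume "L \<in> loops (contract m E)"
    then obtain x where x: "L = reach (contract m E) x" "x \<in> reach (contract m E) x"
      by (auto simp: loops_reach)
    note l = contract_loop_lift[OF x(2)]
    have m: "m \<notin> reach E x" by (rule notm[OF l(1,2)])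
    have "L = reach E x" using l m x by auto
    then show "delta * of_int (t (loop_label A E L)) = delta * of_int (t (loop_label A (contract m E) L))"
      using loop_label_value[OF E l(1)] loop_label_value[OF label_graph_contract x(2)] x(1)
        loop_value_contract_avoid[OF l(1) m l(2)] by simp
  qed
  finally show ?thesis .
qed

end

end

section \<open>Relabelling of vertices\<close>

definition map_graph :: "('p \<Rightarrow> 'q) \<Rightarrow> ('p \<times> 'p \<times> 'a) set \<Rightarrow> ('q \<times> 'q \<times> 'a) set" where
  "map_graph \<phi> E = (\<lambda>(p, q, a). (\<phi> p, \<phi> q, a)) ` E"

lemma map_graphI: "(p, q, a) \<in> E \<Longrightarrow> (\<phi> p, \<phi> q, a) \<in> map_graph \<phi> E"
  unfolding map_graph_def by force

lemma map_graphE: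
  assumes "(x, y, a) \<in> map_graph \<phi> E"
  obtains p q where "(p, q, a) \<in> E" "x = \<phi> p" "y = \<phi> q"
  using assms by (auto simp: map_graph_def)

lemma srcs_map_graph: "srcs (map_graph \<phi> E) = \<phi> ` srcs E"
  unfolding srcs_def by (auto elim!: map_graphE dest: map_graphI)

lemma tgts_map_graph: "tgts (map_graph \<phi> E) = \<phi> ` tgts E"
  unfolding tgts_def by (auto elim!: map_graphE dest: map_graphI)

lemma map_graph_id: "map_graph (\<lambda>x. x) E = E"
  by (auto simp: map_graph_def)

lemma map_graph_comp: "map_graph \<phi> (map_graph \<psi> E) = map_graph (\<lambda>x. \<phi> (\<psi> x)) E"
  unfolding map_graph_def image_image by (rule image_cong) auto

lemma map_graph_Un: "map_graph \<phi> (E \<union> F) = map_graph \<phi> E \<union> map_graph \<phi> F"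
  by (simp add: map_graph_def image_Un)

lemma map_graph_insert: "map_graph \<phi> (insert (p, q, a) E) = insert (\<phi> p, \<phi> q, a) (map_graph \<phi> E)"
  by (simp add: map_graph_def)

lemma map_graph_empty [simp]: "map_graph \<phi> {} = {}"
  by (simp add: map_graph_def)

lemma map_graph_cong: "(\<And>v. v \<in> verts E \<Longrightarrow> \<phi> v = \<psi> v) \<Longrightarrow> map_graph \<phi> E = map_graph \<psi> E"
  unfolding map_graph_def by (rule image_cong) (auto simp: verts_def srcs_def tgts_def, blast+)

lemma srcs_Un: "srcs (E \<union> F) = srcs E \<union> srcs F"
  and tgts_Un: "tgts (E \<union> F) = tgts E \<union> tgts F"
  and srcs_insert: "srcs (insert (p, q, a) E) = insert p (srcs E)"
  and tgts_insert: "tgts (insert (p, q, a) E) = insert q (tgts E)"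
  by (auto simp: srcs_def tgts_def)

lemma verts_Un: "verts (E \<union> F) = verts E \<union> verts F"
  by (auto simp: verts_def srcs_Un tgts_Un)

lemma srcs_empty [simp]: "srcs {} = {}" and tgts_empty [simp]: "tgts {} = {}"
  by (auto simp: srcs_def tgts_def)

lemma partial_bij_subset: "partial_bij E \<Longrightarrow> F \<subseteq> E \<Longrightarrow> partial_bij F"
  unfolding partial_bij_def by (meson finite_subset subsetD)

lemma partial_bijI:
  assumes "finite E"
    and "\<And>p q a q' a'. (p, q, a) \<in> E \<Longrightarrow> (p, q', a') \<in> E \<Longrightarrow> q = q' \<and> a = a'"
    and "\<And>p q a p' a'. (p, q, a) \<in> E \<Longrightarrow> (p', q, a') \<in> E \<Longrightarrow> p = p'"
  shows "partial_bij E"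
  using assms unfolding partial_bij_def by blast

lemma partial_bij_Un:
  assumes "partial_bij E" "partial_bij F" "srcs E \<inter> srcs F = {}" "tgts E \<inter> tgts F = {}"
  shows "partial_bij (E \<union> F)"
proof (rule partial_bijI)
  show "finite (E \<union> F)" using assms by (simp add: partial_bijD)
  fix p q a q' a' assume "(p, q, a) \<in> E \<union> F" "(p, q', a') \<in> E \<union> F"
  then consider "(p, q, a) \<in> E" "(p, q', a') \<in> E" | "(p, q, a) \<in> F" "(p, q', a') \<in> F"
    using assms(3) by (auto simp: srcs_def)
  then show "q = q' \<and> a = a'"
    by cases (use partial_bijD(2,3)[OF assms(1)] partial_bijD(2,3)[OF assms(2)] in metis)+
next
  fix p q a p' a' assume "(p, q, a) \<in> E \<union> F" "(p', q, a') \<in> E \<union> F"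
  then consider "(p, q, a) \<in> E" "(p', q, a') \<in> E" | "(p, q, a) \<in> F" "(p', q, a') \<in> F"
    using assms(4) by (auto simp: tgts_def)
  then show "p = p'"
    by cases (use partial_bijD(4)[OF assms(1)] partial_bijD(4)[OF assms(2)] in metis)+
qed

lemma partial_bij_insert:
  assumes "partial_bij E" "p \<notin> srcs E" "q \<notin> tgts E"
  shows "partial_bij (insert (p, q, a) E)"
proof -
  have "partial_bij ({(p, q, a)} \<union> E)"
    using assms by (intro partial_bij_Un) (auto intro: partial_bijI simp: srcs_insert tgts_insert)
  then show ?thesis by simp
qed

lemma partial_bij_map_graph:
  assumes "partial_bij E" "inj_on \<phi> (srcs E)" "inj_on \<phi> (tgts E)"
  shows "partial_bij (map_graph \<phi> E)"
  unfolding partial_bij_def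
proof (intro conjI allI impI; (elim conjE)?)
  show "finite (map_graph \<phi> E)" using partial_bijD(1)[OF assms(1)] by (simp add: map_graph_def)
  fix p q a q' a' assume "(p, q, a) \<in> map_graph \<phi> E" "(p, q', a') \<in> map_graph \<phi> E"
  then obtain x y x' y' where e: "(x, y, a) \<in> E" "(x', y', a') \<in> E" "p = \<phi> x" "q = \<phi> y" "p = \<phi> x'" "q' = \<phi> y'"
    by (elim map_graphE)
  then have "x' = x" using assms(2) by (auto dest!: inj_onD simp: srcs_def)
  then show "q = q'" "a = a'" using e partial_bijD(2,3)[OF assms(1)] by metis+
next
  fix p q a p' a' assume "(p, q, a) \<in> map_graph \<phi> E" "(p', q, a') \<in> map_graph \<phi> E"
  then obtain x y x' y' where e: "(x, y, a) \<in> E" "(x', y', a') \<in> E" "p = \<phi> x" "q = \<phi> y" "p' = \<phi> x'" "q = \<phi> y'"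
    by (elim map_graphE)
  then have "y' = y" using assms(3) by (auto dest!: inj_onD simp: tgts_def)
  then show "p = p'" using e partial_bijD(4)[OF assms(1)] by metis
qed

section \<open>Induction over contractions and insertion into larger graphs\<close>

context int_table_algebra
begin

text \<open>Removing an inner vertex decreases the number of inner vertices. In the base case a
  graph is its own net and has no loops, so quantities built from \<open>net\<close> and
  \<open>loop_factor\<close> are explicit there.\<close>

lemma contract_induct [consumes 1, case_names base step]:
  assumes "label_graph E"
    and "\<And>E. label_graph E \<Longrightarrow> inner E = {} \<Longrightarrow> P E"
    and "\<And>E m. label_graph E \<Longrightarrow> m \<in> inner E \<Longrightarrow> label_graph (contract m E) \<Longrightarrow> P (contract m E) \<Longrightarrow> P E"
  shows "P E"
  using assms(1)
proof (induction "card (inner E)" arbitrary: E rule: less_induct)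
  case less
  show ?case
  proof (cases "inner E = {}")
    case False
    then obtain m where m: "m \<in> inner E" by auto
    have "card (inner (contract m E)) < card (inner E)"
      unfolding inner_contract[OF less.prems m]
      by (rule card_Diff1_less[OF finite_inner[OF label_graphD(1)[OF less.prems]] m])
    then show ?thesis using less.hyps assms(3)[OF less.prems m] label_graph_contract[OF less.prems m] by blast
  qed (use assms(2) less.prems in auto)
qed

lemma walk_no_inner:
  assumes "inner E = {}" "walk E p w q"
  shows "\<exists>a. w = [a] \<and> (p, q, a) \<in> E"
  using assms(2)
proof (cases rule: walk.cases)
  case (step y a u)
  then have "y \<in> inner E" using walk_srcs[OF step(3)] by (auto simp: inner_def tgts_def)
  then show ?thesis using assms(1) by auto
qed auto

lemma net_no_inner:
  assumes "label_graph E" "inner E = {}" shows "net E = E"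
proof -
  have w: "word_label A [a] = a" if "(p, q, a) \<in> E" for p q a
    using label_graphD(2)[OF assms(1) that] by (simp add: word_label_Cons)
  have d: "p \<notin> tgts E" "q \<notin> srcs E" if "(p, q, a) \<in> E" for p q a
    using assms(2) that by (auto simp: inner_def srcs_def tgts_def)
  show ?thesis
  proof
    show "net E \<subseteq> E" unfolding net_def using walk_no_inner[OF assms(2)] w by (auto; metis)
    show "E \<subseteq> net E"
    proof
      fix e assume "e \<in> E"
      moreover obtain p q a where e: "e = (p, q, a)" by (cases e)
      ultimately have "(p, q, a) \<in> E" by simp
      then show "e \<in> net E" using walk.edge[of p q a E] w[of p q a] d[of p q a] e
        unfolding net_def by (intro CollectI exI[of _ p] exI[of _ q] exI[of _ "[a]"]) auto
    qed
  qed
qed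

lemma loop_factor_no_inner:
  assumes "inner E = {}" shows "loop_factor A B E = 1"
proof -
  have "loops E = {}"
    using walk_no_inner[OF assms] assms unfolding loops_def inner_def srcs_def tgts_def by blast
  then show ?thesis by (simp add: loop_factor_def)
qed

lemma
  assumes "label_graph E"
  shows label_graph_net: "label_graph (net E)"
    and srcs_net: "srcs (net E) = srcs E - tgts E"
    and tgts_net: "tgts (net E) = tgts E - srcs E"
    and inner_net: "inner (net E) = {}"
proof -
  have "label_graph (net E) \<and> srcs (net E) = srcs E - tgts E \<and> tgts (net E) = tgts E - srcs E"
    using assms
  proof (induction rule: contract_induct)
    case (base E)
    then show ?case by (auto simp: net_no_inner inner_def)
  next
    case (step E m)
    then show ?case using srcs_contract[OF step(1,2)] tgts_contract[OF step(1,2)]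
      by (auto simp: net_contract inner_def)
  qed
  then show "label_graph (net E)" "srcs (net E) = srcs E - tgts E" "tgts (net E) = tgts E - srcs E"
    "inner (net E) = {}" by (auto simp: inner_def)
qed

lemma verts_contract: "label_graph E \<Longrightarrow> m \<in> inner E \<Longrightarrow> verts (contract m E) \<subseteq> verts E"
  by (auto simp: verts_def srcs_contract tgts_contract)

lemma label_graph_subset: "label_graph E \<Longrightarrow> F \<subseteq> E \<Longrightarrow> label_graph F"
  by (auto simp: label_graph_def intro: partial_bij_subset)

lemma label_graph_insert:
  "label_graph E \<Longrightarrow> p \<notin> srcs E \<Longrightarrow> q \<notin> tgts E \<Longrightarrow> a \<in> carrier A \<Longrightarrow> label_graph (insert (p, q, a) E)"
  by (auto simp: label_graph_def intro: partial_bij_insert)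

lemma label_graph_Un:
  "label_graph E \<Longrightarrow> label_graph F \<Longrightarrow> srcs E \<inter> srcs F = {} \<Longrightarrow> tgts E \<inter> tgts F = {} \<Longrightarrow>
     label_graph (E \<union> F)"
  by (auto simp: label_graph_def intro: partial_bij_Un)

lemma label_graph_map:
  "label_graph E \<Longrightarrow> inj_on \<phi> (srcs E) \<Longrightarrow> inj_on \<phi> (tgts E) \<Longrightarrow> label_graph (map_graph \<phi> E)"
  by (auto simp: label_graph_def elim!: map_graphE intro: partial_bij_map_graph)

text \<open>\<open>\<phi>\<close> has to separate only \<open>m\<close> from the other vertices. It
  may identify outer vertices of \<open>E\<close> with vertices of \<open>F\<close> or with each
  other, as happens in gluing and closing up.\<close>

lemma contract_plug:
  assumes m: "m \<in> inner E" and inj: "\<And>v. v \<in> verts E \<Longrightarrow> \<phi> v = \<phi> m \<Longrightarrow> v = m"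
    and F: "\<phi> m \<notin> verts F"
  shows "contract (\<phi> m) (map_graph \<phi> E \<union> F) = map_graph \<phi> (contract m E) \<union> F"
proof -
  have iff: "\<phi> v = \<phi> m \<longleftrightarrow> v = m" if "v \<in> verts E" for v using inj that by auto
  have v: "p \<in> verts E" "q \<in> verts E" if "(p, q, a) \<in> E" for p q a
    using that by (auto simp: verts_def srcs_def tgts_def)
  have F': "p \<noteq> \<phi> m" "q \<noteq> \<phi> m" if "(p, q, a) \<in> F" for p q a
    using that F by (auto simp: verts_def srcs_def tgts_def)
  have F'': "(p, \<phi> m, a) \<notin> F" "(\<phi> m, p, a) \<notin> F" for p a
    using F' by blast+
  show ?thesis
  proof (intro equalityI subsetI)
    fix e assume e: "e \<in> contract (\<phi> m) (map_graph \<phi> E \<union> F)"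
    obtain x y c where [simp]: "e = (x, y, c)" by (cases e)
    from e consider "(x, y, c) \<in> F" | "(x, y, c) \<in> map_graph \<phi> E" "x \<noteq> \<phi> m" "y \<noteq> \<phi> m"
      | a b where "(x, \<phi> m, a) \<in> map_graph \<phi> E" "(\<phi> m, y, b) \<in> map_graph \<phi> E" "x \<noteq> \<phi> m" "c = b \<otimes> a"
      using F'' by (auto simp: contract_def)
    then show "e \<in> map_graph \<phi> (contract m E) \<union> F"
    proof cases
      case 2
      then obtain p q where pq: "(p, q, c) \<in> E" "x = \<phi> p" "y = \<phi> q" by (elim map_graphE)
      then have "(p, q, c) \<in> contract m E" using 2 by (auto simp: contract_def)
      then show ?thesis using pq by (auto intro: map_graphI)
    next
      case 3
      obtain p m1 where p: "(p, m1, a) \<in> E" "x = \<phi> p" "\<phi> m = \<phi> m1" using 3(1) by (elim map_graphE)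
      obtain m2 q where q: "(m2, q, b) \<in> E" "y = \<phi> q" "\<phi> m = \<phi> m2" using 3(2) by (elim map_graphE)
      have "m1 = m" by (rule inj) (use p(3) v(2)[OF p(1)] in simp_all)
      then have pm: "(p, m, a) \<in> E" using p(1) by simp
      have "m2 = m" by (rule inj) (use q(3) v(1)[OF q(1)] in simp_all)
      then have mq: "(m, q, b) \<in> E" using q(1) by simp
      have "p \<noteq> m" using p(2) 3(3) by blast
      then have "(p, q, c) \<in> contract m E" using pm mq 3(4) unfolding contract_def by blast
      then show ?thesis using p(2) q(2) by (auto intro: map_graphI)
    qed simp
  next
    fix e assume e: "e \<in> map_graph \<phi> (contract m E) \<union> F"
    obtain x y c where [simp]: "e = (x, y, c)" by (cases e)
    from e consider "(x, y, c) \<in> F" | p q where "(p, q, c) \<in> contract m E" "x = \<phi> p" "y = \<phi> q"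
      by (auto elim: map_graphE)
    then show "e \<in> contract (\<phi> m) (map_graph \<phi> E \<union> F)"
    proof cases
      case 1 then show ?thesis using F' by (auto simp: contract_def)
    next
      case 2
      from 2(1) consider "(p, q, c) \<in> E" "p \<noteq> m" "q \<noteq> m"
        | a b where "(p, m, a) \<in> E" "(m, q, b) \<in> E" "c = b \<otimes> a" "p \<noteq> m"
        by (auto simp: contract_def)
      then show ?thesis
      proof cases
        case 1
        then have "(x, y, c) \<in> map_graph \<phi> E" "x \<noteq> \<phi> m" "y \<noteq> \<phi> m"
          using 2 iff v by (auto intro: map_graphI)
        then show ?thesis by (auto simp: contract_def)
      next
        case (2 a b)
        then have "(x, \<phi> m, a) \<in> map_graph \<phi> E" "(\<phi> m, y, b) \<in> map_graph \<phi> E" "x \<noteq> \<phi> m"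
          using \<open>x = \<phi> p\<close> \<open>y = \<phi> q\<close> iff v by (auto intro: map_graphI)
        then show ?thesis using 2 by (auto simp: contract_def)
      qed
    qed
  qed
qed

definition contract_factor :: "nat \<Rightarrow> (nat \<times> nat \<times> 'a) set \<Rightarrow> laurent" where
  "contract_factor m E = (if \<exists>a. (m, m, a) \<in> E then delta * of_int (t (out_label E m)) else 1)"

lemma loop_factor_step:
  assumes "label_graph E" "m \<in> inner E"
  shows "loop_factor A B E = contract_factor m E * loop_factor A B (contract m E)"
proof (cases "\<exists>a. (m, m, a) \<in> E")
  case True
  then obtain a where "(m, m, a) \<in> E" by auto
  then show ?thesis
    using loop_factor_contract_self[OF assms] out_label_eq[OF label_graphD(1)[OF assms(1)]]
    by (auto simp: contract_factor_def)
qed (use loop_factor_contract[OF assms] in \<open>auto simp: contract_factor_def\<close>)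

text \<open>Inner vertices of \<open>E\<close> stay inner in the larger graph, so they can be
  contracted before or after the insertion. In associativity \<open>E\<close> is the composite of
  two of three diagrams; for the trace it is a composite about to be closed.\<close>

lemma plug:
  assumes "label_graph E" "label_graph (map_graph \<phi> E \<union> F)"
    and "\<And>m v. m \<in> inner E \<Longrightarrow> v \<in> verts E \<Longrightarrow> \<phi> v = \<phi> m \<Longrightarrow> v = m"
    and "\<And>m. m \<in> inner E \<Longrightarrow> \<phi> m \<notin> verts F"
  shows "loop_factor A B (map_graph \<phi> E \<union> F) = loop_factor A B E * loop_factor A B (map_graph \<phi> (net E) \<union> F)"
    and "net (map_graph \<phi> E \<union> F) = net (map_graph \<phi> (net E) \<union> F)"
    and "label_graph (map_graph \<phi> (net E) \<union> F)"
proof -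
  have "loop_factor A B (map_graph \<phi> E \<union> F) = loop_factor A B E * loop_factor A B (map_graph \<phi> (net E) \<union> F)
     \<and> net (map_graph \<phi> E \<union> F) = net (map_graph \<phi> (net E) \<union> F) \<and> label_graph (map_graph \<phi> (net E) \<union> F)"
    using assms
  proof (induction rule: contract_induct)
    case (base E)
    then show ?case by (simp add: net_no_inner loop_factor_no_inner)
  next
    case (step E m)
    let ?G = "map_graph \<phi> E \<union> F"
    have c: "contract (\<phi> m) ?G = map_graph \<phi> (contract m E) \<union> F"
      by (rule contract_plug) (use step in auto)
    have i: "\<phi> m \<in> inner ?G"
      using step(2) by (auto simp: inner_def srcs_Un tgts_Un srcs_map_graph tgts_map_graph)
    note lg = label_graph_contract[OF step(5) i, unfolded c]
    have pG: "partial_bij ?G" and pE: "partial_bij E" using step(1,5) by (auto simp: label_graphD)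
    have f: "contract_factor (\<phi> m) ?G = contract_factor m E"
    proof (cases "\<exists>a. (m, m, a) \<in> E")
      case True
      then obtain a where a: "(m, m, a) \<in> E" by auto
      then have "(\<phi> m, \<phi> m, a) \<in> ?G" by (auto intro: map_graphI)
      then show ?thesis using a out_label_eq[OF pG] out_label_eq[OF pE]
        by (auto simp: contract_factor_def)
    next
      case False
      have "(\<phi> m, \<phi> m, a) \<notin> ?G" for a
      proof
        assume "(\<phi> m, \<phi> m, a) \<in> ?G"
        moreover have "(\<phi> m, \<phi> m, a) \<notin> F"
          using step(7)[OF step(2)] by (auto simp: verts_def srcs_def)
        ultimately obtain p q where pq: "(p, q, a) \<in> E" "\<phi> m = \<phi> p" "\<phi> m = \<phi> q"
          by (auto elim: map_graphE)
        then have "p \<in> verts E" "q \<in> verts E" by (auto simp: verts_def srcs_def tgts_def)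
        have "p = m" by (rule step(6)[OF step(2) \<open>p \<in> verts E\<close>]) (use pq in simp)
        moreover have "q = m" by (rule step(6)[OF step(2) \<open>q \<in> verts E\<close>]) (use pq in simp)
        ultimately show False using False pq(1) by blast
      qed
      then show ?thesis using False by (simp add: contract_factor_def)
    qed
    have IH: "loop_factor A B (map_graph \<phi> (contract m E) \<union> F) =
        loop_factor A B (contract m E) * loop_factor A B (map_graph \<phi> (net (contract m E)) \<union> F)
     \<and> net (map_graph \<phi> (contract m E) \<union> F) = net (map_graph \<phi> (net (contract m E)) \<union> F)
     \<and> label_graph (map_graph \<phi> (net (contract m E)) \<union> F)"
      by (rule step.IH[OF lg])
        (use step(6,7) verts_contract[OF step(1,2)] inner_contract[OF step(1,2)] in auto)
    then show ?case
      using loop_factor_step[OF step(5) i] loop_factor_step[OF step(1,2)] net_contract[OF step(5) i]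
        net_contract[OF step(1,2)] c f by simp
  qed
  then show "loop_factor A B (map_graph \<phi> E \<union> F) = loop_factor A B E * loop_factor A B (map_graph \<phi> (net E) \<union> F)"
    "net (map_graph \<phi> E \<union> F) = net (map_graph \<phi> (net E) \<union> F)"
    "label_graph (map_graph \<phi> (net E) \<union> F)" by auto
qed

lemma verts_net: "label_graph E \<Longrightarrow> verts (net E) \<subseteq> verts E"
  by (auto simp: verts_def srcs_net tgts_net)

text \<open>The case \<open>F = {}\<close> of \<open>plug\<close>. An injective
  \<open>\<phi>\<close> creates no new inner vertices, so the relabelled net is already
  reduced.\<close>

lemma
  assumes "label_graph E" "inj_on \<phi> (verts E)"
  shows label_graph_relabel: "label_graph (map_graph \<phi> E)"
    and loop_factor_relabel: "loop_factor A B (map_graph \<phi> E) = loop_factor A B E"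
    and net_relabel: "net (map_graph \<phi> E) = map_graph \<phi> (net E)"
proof -
  have inj: "inj_on \<phi> (srcs E)" "inj_on \<phi> (tgts E)"
    using assms(2) by (auto simp: verts_def intro: inj_on_subset)
  show lg: "label_graph (map_graph \<phi> E)" by (rule label_graph_map[OF assms(1) inj])
  have iv: "inner E \<subseteq> verts E" by (auto simp: inner_def verts_def)
  have c: "v = m" if "m \<in> inner E" "v \<in> verts E" "\<phi> v = \<phi> m" for m v
    using inj_onD[OF assms(2) that(3,2)] iv that(1) by auto
  have lg': "label_graph (map_graph \<phi> E \<union> {})" using lg by simp
  have n: "\<phi> m \<notin> verts {}" for m by (simp add: verts_def)
  have p: "loop_factor A B (map_graph \<phi> E \<union> {}) = loop_factor A B E * loop_factor A B (map_graph \<phi> (net E) \<union> {})"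
    "net (map_graph \<phi> E \<union> {}) = net (map_graph \<phi> (net E) \<union> {})"
    "label_graph (map_graph \<phi> (net E) \<union> {})"
    by (rule plug[OF assms(1) lg']; (rule c | rule n); assumption)+
  note p = p[unfolded Un_empty_right]
  have "inner (map_graph \<phi> (net E)) = {}"
    using inner_net[OF assms(1)] verts_net[OF assms(1)] assms(2)
    unfolding inner_def verts_def srcs_map_graph tgts_map_graph
    by (simp add: inj_on_image_Int[symmetric])
  note n = loop_factor_no_inner[OF this] net_no_inner[OF p(3) this]
  show "loop_factor A B (map_graph \<phi> E) = loop_factor A B E" unfolding p(1) n(1) by simp
  show "net (map_graph \<phi> E) = map_graph \<phi> (net E)" unfolding p(2) n(2) ..
qed

section \<open>Reversal of orientation\<close>

definition opposite :: "(nat \<times> nat \<times> 'a) set \<Rightarrow> (nat \<times> nat \<times> 'a) set" where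
  "opposite E = (\<lambda>(p, q, a). (q, p, bar a)) ` E"

lemma opposite_iff: "label_graph E \<Longrightarrow> (q, p, a) \<in> opposite E \<longleftrightarrow> (p, q, bar a) \<in> E \<and> a \<in> carrier A"
proof
  assume E: "label_graph E" and "(p, q, bar a) \<in> E \<and> a \<in> carrier A"
  then have "(p, q, bar a) \<in> E" "a = bar (bar a)" by auto
  then show "(q, p, a) \<in> opposite E" unfolding opposite_def by force
qed (auto simp: opposite_def dest: label_graphD(2))

lemma srcs_opposite [simp]: "srcs (opposite E) = tgts E"
  and tgts_opposite [simp]: "tgts (opposite E) = srcs E"
  by (force simp: opposite_def srcs_def tgts_def)+

lemma inner_opposite [simp]: "inner (opposite E) = inner E"
  by (auto simp: inner_def)

lemma verts_opposite [simp]: "verts (opposite E) = verts E"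
  by (auto simp: verts_def)

lemma opposite_Un: "opposite (E \<union> F) = opposite E \<union> opposite F"
  by (simp add: opposite_def image_Un)

lemma opposite_map_graph: "opposite (map_graph \<phi> E) = map_graph \<phi> (opposite E)"
  unfolding opposite_def map_graph_def image_image by (rule image_cong) auto

lemma label_graph_opposite: "label_graph E \<Longrightarrow> label_graph (opposite E)"
proof -
  assume E: "label_graph E"
  note p = partial_bijD[OF label_graphD(1)[OF E]]
  have "partial_bij (opposite E)"
  proof (rule partial_bijI)
    show "finite (opposite E)" using p(1) by (simp add: opposite_def)
    fix x y a x' a' assume "(x, y, a) \<in> opposite E" "(x', y, a') \<in> opposite E"
    then have "(y, x, bar a) \<in> E" "(y, x', bar a') \<in> E" by (simp_all add: opposite_iff[OF E])
    then show "x = x'" by (rule p(2)[symmetric])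
  next
    fix x y a y' a' assume "(x, y, a) \<in> opposite E" "(x, y', a') \<in> opposite E"
    then have *: "(y, x, bar a) \<in> E" "(y', x, bar a') \<in> E" "a \<in> carrier A" "a' \<in> carrier A"
      by (simp_all add: opposite_iff[OF E])
    then have "bar (bar a') = bar (bar a)" using p(5)[OF *(1,2)] by simp
    then show "y = y' \<and> a = a'" using p(4)[OF *(1,2)] *(3,4) by simp
  qed
  then show ?thesis by (simp add: label_graph_def opposite_iff[OF E])
qed

text \<open>\<open>bar\<close> reverses products, just as reversing a walk reverses the order of its
  labels.\<close>

lemma contract_opposite:
  assumes "label_graph E" "m \<in> inner E"
  shows "contract m (opposite E) = opposite (contract m E)"
proof -
  note lo = label_graph_opposite[OF assms(1)]
  have mo: "m \<in> inner (opposite E)" using assms by simp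
  note lc = label_graph_contract[OF assms]
  show ?thesis
  proof (intro equalityI subsetI)
    fix e assume e: "e \<in> contract m (opposite E)"
    obtain x y c where [simp]: "e = (x, y, c)" by (cases e)
    have "(x, y, c) \<in> contract m (opposite E)" using e by simp
    then show "e \<in> opposite (contract m E)"
    proof (cases rule: contract_cases[OF lo mo, consumes 1, case_names 1 2])
      case 1
      then have "(y, x, bar c) \<in> E" "c \<in> carrier A" by (simp_all add: opposite_iff assms)
      moreover from this have "(y, x, bar c) \<in> contract m E" using 1 by (intro contract_edge[OF assms])
      ultimately show ?thesis by (simp add: opposite_iff lc)
    next
      case (2 a b)
      then have "(y, x, bar a \<otimes> bar b) \<in> contract m E"
        by (intro contract_new[OF assms]) (auto simp: opposite_iff assms)
      then show ?thesis using 2 by (auto simp: opposite_iff assms lc bar_mult)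
    qed
  next
    fix e assume e: "e \<in> opposite (contract m E)"
    obtain x y c where [simp]: "e = (x, y, c)" by (cases e)
    have "(y, x, bar c) \<in> contract m E" and c: "c \<in> carrier A" using e by (auto simp: opposite_iff lc)
    then show "e \<in> contract m (opposite E)"
    proof (cases rule: contract_cases[OF assms, consumes 1, case_names 1 2])
      case 1
      then show ?thesis using c by (auto intro!: contract_edge[OF lo mo] simp: opposite_iff assms)
    next
      case (2 a b)
      have ab: "a \<in> carrier A" "b \<in> carrier A" using 2 label_graphD(2)[OF assms(1)] by auto
      have "(x, y, bar a \<otimes> bar b) \<in> contract m (opposite E)"
        by (rule contract_new[OF lo mo]) (use 2 ab in \<open>auto simp: opposite_iff assms\<close>)
      moreover have "bar a \<otimes> bar b = c" using 2 ab c by (metis bar_bar bar_mult)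
      ultimately show ?thesis by simp
    qed
  qed
qed

lemma
  assumes "label_graph E"
  shows loop_factor_opposite: "loop_factor A B (opposite E) = loop_factor A B E"
    and net_opposite: "net (opposite E) = opposite (net E)"
proof -
  have "loop_factor A B (opposite E) = loop_factor A B E \<and> net (opposite E) = opposite (net E)"
    using assms
  proof (induction rule: contract_induct)
    case (base E)
    then show ?case by (simp add: loop_factor_no_inner net_no_inner label_graph_opposite)
  next
    case (step E m)
    note lo = label_graph_opposite[OF step(1)]
    have mo: "m \<in> inner (opposite E)" using step by simp
    have "contract_factor m (opposite E) = contract_factor m E"
    proof (cases "\<exists>a. (m, m, a) \<in> E")
      case True
      then obtain a where a: "(m, m, a) \<in> E" by auto
      then have "(m, m, bar a) \<in> opposite E" by (force simp: opposite_def)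
      then show ?thesis
        using a out_label_eq[OF label_graphD(1)[OF lo]] out_label_eq[OF label_graphD(1)[OF step(1)]]
          label_graphD(2)[OF step(1) a] by (auto simp: contract_factor_def trace_bar)
    next
      case False
      then have "\<nexists>a. (m, m, a) \<in> opposite E" by (auto simp: opposite_def)
      then show ?thesis using False by (simp add: contract_factor_def)
    qed
    then show ?case
      using step.IH loop_factor_step[OF lo mo] loop_factor_step[OF step(1,2)] net_contract[OF lo mo]
        net_contract[OF step(1,2)] contract_opposite[OF step(1,2)] by simp
  qed
  then show "loop_factor A B (opposite E) = loop_factor A B E" "net (opposite E) = opposite (net E)" by simp_all
qed

end

section \<open>Coefficients of diagrams and their linearity in the labels\<close>

definition shape :: "('p \<times> 'p \<times> 'a) set \<Rightarrow> ('p \<times> 'p) set" where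
  "shape E = {(p, q). \<exists>a. (p, q, a) \<in> E}"

definition graph_of :: "('p \<times> 'p) set \<Rightarrow> ('p \<times> 'p \<Rightarrow> 'a) \<Rightarrow> ('p \<times> 'p \<times> 'a) set" where
  "graph_of P lab = (\<lambda>(p, q). (p, q, lab (p, q))) ` P"

lemma graph_of_iff: "(p, q, a) \<in> graph_of P lab \<longleftrightarrow> (p, q) \<in> P \<and> a = lab (p, q)"
  by (auto simp: graph_of_def)

lemma shape_graph_of [simp]: "shape (graph_of P lab) = P"
  by (auto simp: shape_def graph_of_iff)

lemma srcs_graph_of: "srcs (graph_of P lab) = fst ` P" and tgts_graph_of: "tgts (graph_of P lab) = snd ` P"
  by (force simp: srcs_def tgts_def graph_of_iff)+

lemma partial_bij_graph_of:
  assumes "finite P" "inj_on fst P" "inj_on snd P"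
  shows "partial_bij (graph_of P lab)"
proof (rule partial_bijI)
  show "finite (graph_of P lab)" using assms(1) by (simp add: graph_of_def)
  fix p q a q' a' assume "(p, q, a) \<in> graph_of P lab" "(p, q', a') \<in> graph_of P lab"
  then show "q = q' \<and> a = a'"
    using inj_onD[OF assms(2), of "(p, q)" "(p, q')"] by (simp add: graph_of_iff)
next
  fix p q a p' a' assume "(p, q, a) \<in> graph_of P lab" "(p', q, a') \<in> graph_of P lab"
  then show "p = p'"
    using inj_onD[OF assms(3), of "(p, q)" "(p', q)"] by (simp add: graph_of_iff)
qed

lemma graph_of_shape:
  assumes "partial_bij E"
  shows "graph_of (shape E) (\<lambda>s. out_label E (fst s)) = E"
proof
  show "graph_of (shape E) (\<lambda>s. out_label E (fst s)) \<subseteq> E"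
    using out_label_eq[OF assms] by (force simp: graph_of_def shape_def)
  show "E \<subseteq> graph_of (shape E) (\<lambda>s. out_label E (fst s))"
  proof
    fix e assume e: "e \<in> E"
    obtain p q a where [simp]: "e = (p, q, a)" by (cases e)
    show "e \<in> graph_of (shape E) (\<lambda>s. out_label E (fst s))"
      using e out_label_eq[OF assms] by (auto simp: graph_of_iff shape_def)
  qed
qed

lemma shape_partial_bij:
  assumes "partial_bij E"
  shows "finite (shape E)" "inj_on fst (shape E)" "inj_on snd (shape E)"
proof -
  have "shape E = (\<lambda>(p, q, a). (p, q)) ` E" by (force simp: shape_def)
  then show "finite (shape E)" using partial_bijD(1)[OF assms] by simp
  show "inj_on fst (shape E)"
    using partial_bijD(2)[OF assms] by (auto simp: shape_def intro!: inj_onI)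
  show "inj_on snd (shape E)"
    using partial_bijD(4)[OF assms] by (auto simp: shape_def intro!: inj_onI)
qed

lemma
  assumes pb: "partial_bij E" and e: "(x, y, c) \<in> E"
  shows srcs_remove: "srcs (E - {(x, y, c)}) = srcs E - {x}"
    and tgts_remove: "tgts (E - {(x, y, c)}) = tgts E - {y}"
proof -
  have "(p, q, a) \<in> E - {(x, y, c)} \<longleftrightarrow> (p, q, a) \<in> E \<and> p \<noteq> x"
    "(p, q, a) \<in> E - {(x, y, c)} \<longleftrightarrow> (p, q, a) \<in> E \<and> q \<noteq> y" for p q a
    using partial_bijD(2,3)[OF pb e] partial_bijD(4,5)[OF pb e] by blast+
  then show "srcs (E - {(x, y, c)}) = srcs E - {x}" "tgts (E - {(x, y, c)}) = tgts E - {y}"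
    unfolding srcs_def tgts_def by blast+
qed

lemma shape_insert: "shape (insert (p, q, a) E) = insert (p, q) (shape E)"
  by (auto simp: shape_def)

context int_table_algebra
begin

text \<open>The coefficient with which \<open>Z\<close> occurs when the labels of \<open>N\<close>
  are expanded in \<open>B\<close>. Labels of \<open>Z\<close> are addressed by the source of the
  edge.\<close>

definition match_coeff :: "(nat \<times> nat \<times> 'a) set \<Rightarrow> (nat \<times> nat \<times> 'a) set \<Rightarrow> int" where
  "match_coeff N Z = (if shape N = shape Z then \<Prod>(p, q, a)\<in>N. \<kappa> (out_label Z p) a else 0)"

text \<open>
  The coefficient of the diagram \<open>Z\<close> in the element of \<open>P\<^sub>n\<^sup>A\<close> represented by a graph \<open>E\<close> with
  arbitrary labels in \<open>A\<close>.
\<close>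

definition graph_coeff :: "(nat \<times> nat \<times> 'a) set \<Rightarrow> (nat \<times> nat \<times> 'a) set \<Rightarrow> laurent" where
  "graph_coeff E Z = loop_factor A B E * of_int (match_coeff (net E) Z)"

lemma graph_coeff_step:
  "label_graph E \<Longrightarrow> m \<in> inner E \<Longrightarrow> graph_coeff E Z = contract_factor m E * graph_coeff (contract m E) Z"
  by (simp add: graph_coeff_def loop_factor_step[of E m] net_contract mult.assoc)

lemma graph_coeff_no_inner:
  "label_graph E \<Longrightarrow> inner E = {} \<Longrightarrow> graph_coeff E Z = of_int (match_coeff E Z)"
  by (simp add: graph_coeff_def loop_factor_no_inner net_no_inner)

lemma contract_factor_insert:
  "label_graph E \<Longrightarrow> label_graph (insert (p, q, a) E) \<Longrightarrow> m \<noteq> p \<Longrightarrow>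
     contract_factor m (insert (p, q, a) E) = contract_factor m E"
proof (cases "\<exists>b. (m, m, b) \<in> E")
  case True
  assume *: "label_graph E" "label_graph (insert (p, q, a) E)" "m \<noteq> p"
  from True obtain b where b: "(m, m, b) \<in> E" by auto
  then show ?thesis
    using out_label_eq[OF label_graphD(1)[OF *(1)] b] *(3)
      out_label_eq[OF label_graphD(1)[OF *(2)], of m m b]
    by (auto simp: contract_factor_def)
next
  case False
  assume "m \<noteq> p"
  then show ?thesis using False by (auto simp: contract_factor_def)
qed

lemma contract_factor_other: "(\<And>b. (m, m, b) \<notin> E) \<Longrightarrow> contract_factor m E = 1"
  by (simp add: contract_factor_def)

lemma linear_functional_cong:
  "(\<And>x. x \<in> carrier A \<Longrightarrow> \<phi> x = \<psi> x) \<Longrightarrow> linear_functional \<phi> \<longleftrightarrow> linear_functional \<psi>"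
  by (simp add: linear_functional_def)

lemma contract_insert_src:
  assumes "partial_bij E" "(x, p, c) \<in> E" "p \<notin> srcs E" "p \<noteq> q"
  shows "contract p (insert (p, q, a) E) = insert (x, q, a \<otimes> c) (E - {(x, p, c)})"
proof -
  let ?G = "insert (p, q, a) E"
  have p: "(p, v, w) \<notin> E" for v w using assms(3) by (auto simp: srcs_def)
  have *: "(u, p, w) \<in> E \<longleftrightarrow> u = x \<and> w = c" for u w
    using partial_bijD(4,5)[OF assms(1,2)] assms(2) by blast
  have "{(u, v, w) \<in> ?G. u \<noteq> p \<and> v \<noteq> p} = E - {(x, p, c)}"
    using p * by auto
  moreover have "{(u, v, b \<otimes> d) | u v d b. (u, p, d) \<in> ?G \<and> (p, v, b) \<in> ?G \<and> u \<noteq> p} = {(x, q, a \<otimes> c)}"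
    using p[of q a] p * assms(2,4) by auto
  ultimately show ?thesis unfolding contract_def by simp
qed

lemma contract_insert_tgt:
  assumes "partial_bij E" "(q, y, c) \<in> E" "q \<notin> tgts E" "p \<noteq> q"
  shows "contract q (insert (p, q, a) E) = insert (p, y, c \<otimes> a) (E - {(q, y, c)})"
proof -
  let ?G = "insert (p, q, a) E"
  have p: "(v, q, w) \<notin> E" for v w using assms(3) by (auto simp: tgts_def)
  have *: "(q, u, w) \<in> E \<longleftrightarrow> u = y \<and> w = c" for u w
    using partial_bijD(2,3)[OF assms(1,2)] assms(2) by blast
  have "{(u, v, w) \<in> ?G. u \<noteq> q \<and> v \<noteq> q} = E - {(q, y, c)}"
    using p * by auto
  moreover have "{(u, v, b \<otimes> d) | u v d b. (u, q, d) \<in> ?G \<and> (q, v, b) \<in> ?G \<and> u \<noteq> q} = {(p, y, c \<otimes> a)}"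
    using p * assms(2,4) by auto
  ultimately show ?thesis unfolding contract_def by simp
qed

text \<open>Induction on the number of inner vertices of the completed graph. Contracting an end of
  the new edge multiplies its label on one side by a fixed element; contracting another vertex gives
  a constant factor. In the end the label enters through \<open>t\<close> if it closes up to a loop
  and through some \<open>\<kappa>\<close> otherwise.\<close>

lemma graph_coeff_linear:
  assumes "label_graph E" "p \<notin> srcs E" "q \<notin> tgts E"
  shows "linear_functional (\<lambda>a. graph_coeff (insert (p, q, a) E) Z)"
  using assms
proof (induction "card (insert p (srcs E) \<inter> insert q (tgts E))" arbitrary: E p q rule: less_induct)
  case less
  let ?G = "\<lambda>a. insert (p, q, a) E"
  let ?I = "\<lambda>p q E. insert p (srcs E) \<inter> insert q (tgts E)"
  have lg: "label_graph (?G a)" if "a \<in> carrier A" for a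
    using less.prems that by (intro label_graph_insert) auto
  have inner: "inner (?G a) = ?I p q E" for a
    by (simp add: inner_def srcs_insert tgts_insert)
  have fin: "finite (?I p q E)" using finite_inner[OF label_graphD(1)[OF lg[OF one_closed]]] inner by simp
  note pb = label_graphD(1)[OF less.prems(1)]
  have dec: "card (?I p' q' E') < card (?I p q E)"
    if "?I p' q' E' \<subseteq> ?I p q E - {m}" "m \<in> ?I p q E" for p' q' m and E' :: "(nat \<times> nat \<times> 'a) set"
    using that fin by (intro psubset_card_mono) auto
  consider (none) "?I p q E = {}" | (loop) "p = q"
    | (out) "p \<noteq> q" "p \<in> tgts E" | (into) "p \<noteq> q" "q \<in> srcs E"
    | (other) m where "m \<in> inner E" "m \<noteq> p" "m \<noteq> q" "p \<noteq> q"
    by (auto simp: inner_def)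
  then show ?case
  proof cases
    case none
    have nin: "(p, q, a) \<notin> E" for a using less.prems(2) by (auto simp: srcs_def)
    have "graph_coeff (?G a) Z = of_int (if insert (p, q) (shape E) = shape Z
        then \<kappa> (out_label Z p) a * (\<Prod>(p, q, a)\<in>E. \<kappa> (out_label Z p) a) else 0)"
      if a: "a \<in> carrier A" for a
      using none inner partial_bijD(1)[OF pb] nin
      by (simp add: graph_coeff_no_inner[OF lg[OF a]] match_coeff_def shape_insert)
    then have "linear_functional (\<lambda>a. graph_coeff (?G a) Z) \<longleftrightarrow>
      linear_functional (\<lambda>a. of_int (\<kappa> (out_label Z p) a) *
        (of_int (if insert (p, q) (shape E) = shape Z
           then (\<Prod>(p, q, a)\<in>E. \<kappa> (out_label Z p) a) else 0) :: laurent))"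
      by (intro linear_functional_cong) auto
    then show ?thesis using linear_const'[OF linear_kappa] by blast
  next
    case loop
    have c: "contract p (?G a) = E" for a
      using loop less.prems(2,3) unfolding contract_def srcs_def tgts_def by auto
    have "graph_coeff (?G a) Z = of_int (t a) * (delta * graph_coeff E Z)" if a: "a \<in> carrier A" for a
      using graph_coeff_step[OF lg[OF a], of p Z] loop inner c out_label_eq[OF label_graphD(1)[OF lg[OF a]], of p p a]
      by (auto simp: contract_factor_def mult.assoc mult.left_commute)
    then have "linear_functional (\<lambda>a. graph_coeff (?G a) Z) \<longleftrightarrow>
       linear_functional (\<lambda>a. of_int (t a) * (delta * graph_coeff E Z))"
      by (intro linear_functional_cong) auto
    then show ?thesis using linear_const'[OF linear_trace] by blast
  next
    case out
    then obtain x c where x: "(x, p, c) \<in> E" by (auto simp: tgts_def)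
    have xp: "x \<noteq> p" using x less.prems(2) by (auto simp: srcs_def)
    let ?E = "E - {(x, p, c)}"
    have cc: "c \<in> carrier A" by (rule label_graphD(2)[OF less.prems(1) x])
    have s: "srcs ?E = srcs E - {x}" "tgts ?E = tgts E - {p}"
      by (rule srcs_remove[OF pb x], rule tgts_remove[OF pb x])
    have c: "contract p (?G a) = insert (x, q, a \<otimes> c) ?E" for a
      by (rule contract_insert_src) (use pb x less.prems(2) out in auto)
    have "graph_coeff (?G a) Z = graph_coeff (insert (x, q, a \<otimes> c) ?E) Z" if a: "a \<in> carrier A" for a
      using graph_coeff_step[OF lg[OF a], of p Z] out inner c less.prems(2)
        contract_factor_other[of p "?G a"] by (auto simp: srcs_def)
    then have eq: "linear_functional (\<lambda>a. graph_coeff (?G a) Z) \<longleftrightarrow>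
       linear_functional (\<lambda>a. graph_coeff (insert (x, q, a \<otimes> c) ?E) Z)"
      by (intro linear_functional_cong)
    have "linear_functional (\<lambda>a. graph_coeff (insert (x, q, a) ?E) Z)"
    proof (rule less.hyps)
      show "card (?I x q ?E) < card (?I p q E)"
        by (rule dec[of _ _ _ p]) (use s x out less.prems(2) in \<open>auto simp: srcs_def\<close>)
    qed (use label_graph_subset[OF less.prems(1)] s less.prems in auto)
    then show ?thesis unfolding eq using linear_mult_right cc by blast
  next
    case into
    then obtain y c where y: "(q, y, c) \<in> E" by (auto simp: srcs_def)
    have yq: "y \<noteq> q" using y less.prems(3) by (auto simp: tgts_def)
    let ?E = "E - {(q, y, c)}"
    have cc: "c \<in> carrier A" by (rule label_graphD(2)[OF less.prems(1) y])
    have s: "srcs ?E = srcs E - {q}" "tgts ?E = tgts E - {y}"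
      by (rule srcs_remove[OF pb y], rule tgts_remove[OF pb y])
    have c: "contract q (?G a) = insert (p, y, c \<otimes> a) ?E" for a
      by (rule contract_insert_tgt) (use pb y less.prems(3) into in auto)
    have "graph_coeff (?G a) Z = graph_coeff (insert (p, y, c \<otimes> a) ?E) Z" if a: "a \<in> carrier A" for a
      using graph_coeff_step[OF lg[OF a], of q Z] into inner c less.prems(3)
        contract_factor_other[of q "?G a"] by (auto simp: tgts_def)
    then have eq: "linear_functional (\<lambda>a. graph_coeff (?G a) Z) \<longleftrightarrow>
       linear_functional (\<lambda>a. graph_coeff (insert (p, y, c \<otimes> a) ?E) Z)"
      by (intro linear_functional_cong)
    have "linear_functional (\<lambda>a. graph_coeff (insert (p, y, a) ?E) Z)"
    proof (rule less.hyps)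
      show "card (?I p y ?E) < card (?I p q E)"
        by (rule dec[of _ _ _ q]) (use s y into less.prems(3) in \<open>auto simp: tgts_def\<close>)
    qed (use label_graph_subset[OF less.prems(1)] s less.prems in auto)
    then show ?thesis unfolding eq using linear_mult_left cc by blast
  next
    case (other m)
    have mI: "m \<in> ?I p q E" using other by (auto simp: inner_def)
    have c: "contract m (?G a) = insert (p, q, a) (contract m E)" for a
      using other unfolding contract_def by auto
    note cE = label_graph_contract[OF less.prems(1) other(1)]
      srcs_contract[OF less.prems(1) other(1)] tgts_contract[OF less.prems(1) other(1)]
    have "graph_coeff (?G a) Z = contract_factor m E * graph_coeff (insert (p, q, a) (contract m E)) Z"
      if a: "a \<in> carrier A" for a
      using graph_coeff_step[OF lg[OF a], of m Z] mI inner c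
        contract_factor_insert[OF less.prems(1) lg[OF a] other(2)] by simp
    then have eq: "linear_functional (\<lambda>a. graph_coeff (?G a) Z) \<longleftrightarrow>
       linear_functional (\<lambda>a. contract_factor m E * graph_coeff (insert (p, q, a) (contract m E)) Z)"
      by (intro linear_functional_cong)
    have "linear_functional (\<lambda>a. graph_coeff (insert (p, q, a) (contract m E)) Z)"
    proof (rule less.hyps)
      show "card (?I p q (contract m E)) < card (?I p q E)"
        by (rule dec[OF _ mI]) (use cE other in auto)
    qed (use cE less.prems in auto)
    then show ?thesis unfolding eq by (rule linear_const)
  qed
qed

text \<open>One edge is expanded at a time by linearity; it then joins \<open>F\<close>, which is
  why \<open>F\<close> varies in the induction. \<open>\<phi>\<close> records where the edges lie
  inside the larger graph.\<close>

lemma graph_coeff_expand: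
  fixes \<phi> :: "nat \<Rightarrow> nat"
  assumes "finite P" "inj_on (\<phi> \<circ> fst) P" "inj_on (\<phi> \<circ> snd) P" "label_graph F"
    "(\<phi> \<circ> fst) ` P \<inter> srcs F = {}" "(\<phi> \<circ> snd) ` P \<inter> tgts F = {}"
    "\<And>s. s \<in> P \<Longrightarrow> lab s \<in> carrier A"
  shows "graph_coeff (map_graph \<phi> (graph_of P lab) \<union> F) Z =
    (\<Sum>f\<in>(\<Pi>\<^sub>E s\<in>P. supp A B (lab s)). of_int (\<Prod>s\<in>P. \<kappa> (f s) (lab s)) *
       graph_coeff (map_graph \<phi> (graph_of P f) \<union> F) Z)"
  using assms
proof (induction P arbitrary: F rule: finite_induct)
  case empty
  then show ?case by (simp add: graph_of_def)
next
  case (insert s P)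
  obtain p q where s [simp]: "s = (p, q)" by (cases s)
  let ?c = "\<lambda>b F. graph_coeff (insert (\<phi> p, \<phi> q, b) F) Z"
  have ins: "map_graph \<phi> (graph_of (insert s P) f) \<union> F = map_graph \<phi> (graph_of P f) \<union> insert (\<phi> p, \<phi> q, f s) F"
    for f by (simp add: graph_of_def map_graph_insert)
  have ps: "\<phi> p \<notin> srcs F" "\<phi> q \<notin> tgts F" using insert.prems by auto
  have pP: "\<phi> p \<notin> (\<phi> \<circ> fst) ` P" "\<phi> q \<notin> (\<phi> \<circ> snd) ` P"
    using insert.prems(1,2) insert.hyps(2) by (auto simp: inj_on_def)
  have inj: "inj_on (\<phi> \<circ> fst) P" "inj_on (\<phi> \<circ> snd) P"
    by (rule inj_on_subset[OF insert.prems(1) subset_insertI], rule inj_on_subset[OF insert.prems(2) subset_insertI])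
  have IH: "graph_coeff (map_graph \<phi> (graph_of P lab) \<union> insert (\<phi> p, \<phi> q, b) F) Z =
    (\<Sum>f\<in>(\<Pi>\<^sub>E s\<in>P. supp A B (lab s)). of_int (\<Prod>s\<in>P. \<kappa> (f s) (lab s)) *
       graph_coeff (map_graph \<phi> (graph_of P f) \<union> insert (\<phi> p, \<phi> q, b) F) Z)" if "b \<in> carrier A" for b
  proof (rule insert.IH)
    show "label_graph (insert (\<phi> p, \<phi> q, b) F)"
      using insert.prems(3) ps that by (intro label_graph_insert)
  qed (use inj insert.prems pP in \<open>auto simp: srcs_insert tgts_insert\<close>)
  have lin: "linear_functional (\<lambda>b. graph_coeff (map_graph \<phi> (graph_of P lab) \<union> insert (\<phi> p, \<phi> q, b) F) Z)"
  proof -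
    have pbP: "partial_bij (graph_of P lab)"
    proof (rule partial_bij_graph_of[OF insert.hyps(1)])
      show "inj_on fst P" "inj_on snd P" using inj by (auto dest: inj_on_imageI2)
    qed
    have "label_graph (graph_of P lab)"
      using pbP insert.prems(6) by (auto simp: label_graph_def graph_of_iff)
    then have "label_graph (map_graph \<phi> (graph_of P lab))"
      by (rule label_graph_map) (use inj in \<open>auto simp: srcs_graph_of tgts_graph_of comp_inj_on_iff inj_on_def\<close>)
    then have "label_graph (map_graph \<phi> (graph_of P lab) \<union> F)"
      using insert.prems by (intro label_graph_Un)
        (auto simp: srcs_map_graph tgts_map_graph srcs_graph_of tgts_graph_of image_comp)
    then have "linear_functional (\<lambda>b. graph_coeff (insert (\<phi> p, \<phi> q, b) (map_graph \<phi> (graph_of P lab) \<union> F)) Z)"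
      using ps pP by (intro graph_coeff_linear)
        (auto simp: srcs_map_graph tgts_map_graph srcs_graph_of tgts_graph_of image_comp srcs_Un tgts_Un)
    then show ?thesis by simp
  qed
  have fP: "(\<Sum>f\<in>(\<Pi>\<^sub>E s\<in>insert s P. supp A B (lab s)). h f) =
     (\<Sum>b\<in>supp A B (lab s). \<Sum>f\<in>(\<Pi>\<^sub>E s\<in>P. supp A B (lab s)). h (f(s := b)))" for h :: "_ \<Rightarrow> laurent"
    unfolding PiE_insert_eq
    by (subst sum.reindex[OF inj_combinator[OF insert.hyps(2)]])
      (simp add: sum.cartesian_product case_prod_unfold)
  have gr: "graph_of P (f(s := b)) = graph_of P f" for f b
    unfolding graph_of_def by (rule image_cong) (use insert.hyps(2) in auto)
  have pr: "(\<Prod>r\<in>insert s P. \<kappa> ((f(s := b)) r) (lab r)) = \<kappa> b (lab s) * (\<Prod>s\<in>P. \<kappa> (f s) (lab s))" for f b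
  proof -
    have "(\<Prod>r\<in>P. \<kappa> ((f(s := b)) r) (lab r)) = (\<Prod>s\<in>P. \<kappa> (f s) (lab s))"
      by (rule prod.cong) (use insert.hyps(2) in auto)
    then show ?thesis unfolding prod.insert[OF insert.hyps] fun_upd_same by (rule arg_cong)
  qed
  have "graph_coeff (map_graph \<phi> (graph_of (insert s P) lab) \<union> F) Z =
     (\<Sum>b\<in>supp A B (lab s). of_int (\<kappa> b (lab s)) * graph_coeff (map_graph \<phi> (graph_of P lab) \<union> insert (\<phi> p, \<phi> q, b) F) Z)"
    unfolding ins using insert.prems(6) by (intro linear_functional_expand[OF lin]) auto
  also have "\<dots> = (\<Sum>b\<in>supp A B (lab s). \<Sum>f\<in>(\<Pi>\<^sub>E s\<in>P. supp A B (lab s)).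
       of_int (\<kappa> b (lab s)) * (of_int (\<Prod>s\<in>P. \<kappa> (f s) (lab s)) *
       graph_coeff (map_graph \<phi> (graph_of P f) \<union> insert (\<phi> p, \<phi> q, b) F) Z))"
  proof (rule sum.cong[OF refl])
    fix b assume "b \<in> supp A B (lab s)"
    moreover have "lab s \<in> carrier A" by (rule insert.prems(6)) simp
    ultimately have "b \<in> carrier A" using supp_subset basis_carrier by blast
    from IH[OF this] show "of_int (\<kappa> b (lab s)) * graph_coeff (map_graph \<phi> (graph_of P lab) \<union> insert (\<phi> p, \<phi> q, b) F) Z =
       (\<Sum>f\<in>(\<Pi>\<^sub>E s\<in>P. supp A B (lab s)).
       of_int (\<kappa> b (lab s)) * (of_int (\<Prod>s\<in>P. \<kappa> (f s) (lab s)) *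
       graph_coeff (map_graph \<phi> (graph_of P f) \<union> insert (\<phi> p, \<phi> q, b) F) Z))"
      by (simp only: sum_distrib_left)
  qed
  also have "\<dots> = (\<Sum>b\<in>supp A B (lab s). \<Sum>f\<in>(\<Pi>\<^sub>E s\<in>P. supp A B (lab s)).
       of_int (\<Prod>r\<in>insert s P. \<kappa> ((f(s := b)) r) (lab r)) *
       graph_coeff (map_graph \<phi> (graph_of (insert s P) (f(s := b))) \<union> F) Z)"
    unfolding pr ins gr by (simp only: fun_upd_same of_int_mult mult.assoc)
  also have "\<dots> = (\<Sum>f\<in>(\<Pi>\<^sub>E s\<in>insert s P. supp A B (lab s)). of_int (\<Prod>s\<in>insert s P. \<kappa> (f s) (lab s)) *
       graph_coeff (map_graph \<phi> (graph_of (insert s P) f) \<union> F) Z)"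
    by (rule fP[symmetric])
  finally show ?case .
qed

definition expansion :: "(nat \<times> nat) set \<Rightarrow> (nat \<times> nat \<Rightarrow> 'a) \<Rightarrow> laurent \<Rightarrow> (nat \<times> nat \<times> 'a) set \<Rightarrow>\<^sub>0 laurent" where
  "expansion P lab c = (\<Sum>f\<in>(\<Pi>\<^sub>E s\<in>P. supp A B (lab s)).
     single (graph_of P f) (c * of_int (\<Prod>s\<in>P. \<kappa> (f s) (lab s))))"

text \<open>At most one choice of labels yields \<open>Z\<close>, namely the labels of
  \<open>Z\<close> itself.\<close>

lemma lookup_expansion:
  assumes "finite P" "inj_on fst P" "inj_on snd P" "partial_bij Z"
  shows "lookup (expansion P lab c) Z = c * of_int (match_coeff (graph_of P lab) Z)"
proof -
  let ?Pi = "\<Pi>\<^sub>E s\<in>P. supp A B (lab s)" and ?g = "restrict (\<lambda>s. out_label Z (fst s)) P"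
  have fin: "finite ?Pi" using assms(1) by (intro finite_PiE) auto
  have l: "lookup (expansion P lab c) Z =
    (\<Sum>f\<in>?Pi. if graph_of P f = Z then c * of_int (\<Prod>s\<in>P. \<kappa> (f s) (lab s)) else 0)"
    by (simp only: expansion_def lookup_sum lookup_single when_def)
  have g: "graph_of P ?g = Z" if "shape Z = P"
  proof -
    have "graph_of P ?g = graph_of (shape Z) (\<lambda>s. out_label Z (fst s))"
      unfolding graph_of_def that by (rule image_cong) auto
    then show ?thesis using graph_of_shape[OF assms(4)] by simp
  qed
  have f: "f = ?g" if "f \<in> ?Pi" "graph_of P f = Z" for f
  proof (rule ext)
    fix s show "f s = ?g s"
    proof (cases "s \<in> P")
      case True
      obtain p q where [simp]: "s = (p, q)" by (cases s)
      have "(p, q, f s) \<in> Z" using that(2) True by (auto simp: graph_of_iff)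
      then show ?thesis using True out_label_eq[OF assms(4)] by auto
    qed (use PiE_arb[OF that(1), of s] in simp)
  qed
  show ?thesis
  proof (cases "shape Z = P")
    case False
    then have "graph_of P f \<noteq> Z" for f using shape_graph_of by metis
    then show ?thesis using False unfolding l by (simp add: match_coeff_def)
  next
    case True
    have m: "match_coeff (graph_of P lab) Z = (\<Prod>s\<in>P. \<kappa> (?g s) (lab s))"
    proof -
      have "(\<Prod>(p, q, a)\<in>graph_of P lab. \<kappa> (out_label Z p) a) = (\<Prod>s\<in>P. \<kappa> (?g s) (lab s))"
        unfolding graph_of_def by (subst prod.reindex) (auto intro!: inj_onI prod.cong)
      then show ?thesis using True by (simp add: match_coeff_def)
    qed
    have eq: "(if graph_of P f = Z then c * of_int (\<Prod>s\<in>P. \<kappa> (f s) (lab s)) else 0) =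
      (if f = ?g then c * of_int (\<Prod>s\<in>P. \<kappa> (?g s) (lab s)) else 0)" if "f \<in> ?Pi" for f
    proof (cases "graph_of P f = Z")
      case *: True
      then have "f = ?g" by (rule f[OF that])
      then show ?thesis using g[OF True] by (simp only: simp_thms if_True)
    next
      case False
      then have "f \<noteq> ?g" using g[OF True] by blast
      then show ?thesis using False by (simp only: if_False)
    qed
    have "lookup (expansion P lab c) Z =
       (\<Sum>f\<in>?Pi. if f = ?g then c * of_int (\<Prod>s\<in>P. \<kappa> (?g s) (lab s)) else 0)"
      unfolding l by (rule sum.cong[OF refl eq])
    also have "\<dots> = (if ?g \<in> ?Pi then c * of_int (\<Prod>s\<in>P. \<kappa> (?g s) (lab s)) else 0)"
      using fin by simp
    also have "\<dots> = c * of_int (\<Prod>s\<in>P. \<kappa> (?g s) (lab s))"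
    \<comment> \<open>If the labels of \<open>Z\<close> are not an admissible choice, some
      \<open>\<kappa>\<close> vanishes, and the formula holds with value zero.\<close>
    proof (cases "?g \<in> ?Pi")
      case False
      then obtain s where "s \<in> P" "?g s \<notin> supp A B (lab s)" by (auto simp: PiE_def Pi_def)
      then have "(\<Prod>s\<in>P. \<kappa> (?g s) (lab s)) = 0"
        using assms(1) by (intro prod_zero) (auto simp: supp_iff)
      then show ?thesis by simp
    qed simp
    finally show ?thesis using m by simp
  qed
qed

end

section \<open>Composition of diagrams\<close>

definition evens :: "nat \<Rightarrow> nat set" where "evens n = {p \<in> {1..2 * n}. even p}"
definition odds :: "nat \<Rightarrow> nat set" where "odds n = {p \<in> {1..2 * n}. odd p}"

text \<open>Sources and targets get separate positions because a middle vertex of a glued graph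
  stands for two marked points: the end of its incoming and the start of its outgoing edge. For
  diagrams both maps are the identity.\<close>

definition noncrossing :: "(nat \<Rightarrow> nat) \<Rightarrow> (nat \<Rightarrow> nat) \<Rightarrow> (nat \<times> nat \<times> 'a) set \<Rightarrow> bool" where
  "noncrossing s r E \<longleftrightarrow>
     (\<forall>p q a p' q' a'. (p, q, a) \<in> E \<longrightarrow> (p', q', a') \<in> E \<longrightarrow> \<not> crossing (s p, r q) (s p', r q'))"

lemma noncrossingD:
  "noncrossing s r E \<Longrightarrow> (p, q, a) \<in> E \<Longrightarrow> (p', q', a') \<in> E \<Longrightarrow> \<not> crossing (s p, r q) (s p', r q')"
  unfolding noncrossing_def by blast

lemma srcsI: "(p, q, a) \<in> E \<Longrightarrow> p \<in> srcs E" and tgtsI: "(p, q, a) \<in> E \<Longrightarrow> q \<in> tgts E"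
  by (auto simp: srcs_def tgts_def)

text \<open>Parity decides which end of an edge a marked point is, so the single incidence condition
  in \<open>diagrams\<close> splits into conditions on sources and on targets.\<close>

lemma diagrams_iff:
  "D \<in> diagrams n L \<longleftrightarrow> partial_bij D \<and> srcs D = evens n \<and> tgts D = odds n \<and>
     (\<forall>p q a. (p, q, a) \<in> D \<longrightarrow> a \<in> L) \<and> noncrossing (\<lambda>p. p) (\<lambda>p. p) D" (is "?l \<longleftrightarrow> ?r")
proof
  assume ?l
  then have sub: "\<And>p q a. (p, q, a) \<in> D \<Longrightarrow> p \<in> evens n \<and> q \<in> odds n \<and> a \<in> L"
    and ex1: "\<And>x. x \<in> {1..2 * n} \<Longrightarrow> \<exists>!e. e \<in> D \<and> (x = fst e \<or> x = fst (snd e))"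
    and nc: "noncrossing (\<lambda>p. p) (\<lambda>p. p) D"
    by (auto simp: diagrams_def evens_def odds_def noncrossing_def)
  have r: "evens n \<subseteq> {1..2 * n}" "odds n \<subseteq> {1..2 * n}" by (auto simp: evens_def odds_def)
  have out: "(p, q, a) = (p, q', a')" if "(p, q, a) \<in> D" "(p, q', a') \<in> D" for p q a q' a'
  proof -
    have "p \<in> {1..2 * n}" using sub[OF that(1)] r by auto
    then have u: "e = e'" if "e \<in> D \<and> (p = fst e \<or> p = fst (snd e))" "e' \<in> D \<and> (p = fst e' \<or> p = fst (snd e'))"
      for e e' using ex1[of p] that by blast
    show ?thesis by (rule u) (use that in simp_all)
  qed
  have into: "(p, q, a) = (p', q, a')" if "(p, q, a) \<in> D" "(p', q, a') \<in> D" for p q a p' a'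
  proof -
    have "q \<in> {1..2 * n}" using sub[OF that(1)] r by auto
    then have u: "e = e'" if "e \<in> D \<and> (q = fst e \<or> q = fst (snd e))" "e' \<in> D \<and> (q = fst e' \<or> q = fst (snd e'))"
      for e e' using ex1[of q] that by blast
    show ?thesis by (rule u) (use that in simp_all)
  qed
  have "srcs D = evens n"
  proof
    show "srcs D \<subseteq> evens n" using sub by (auto simp: srcs_def)
    show "evens n \<subseteq> srcs D"
    proof
      fix x assume x: "x \<in> evens n"
      then obtain e where "e \<in> D" "x = fst e \<or> x = fst (snd e)" using ex1[of x] r by blast
      moreover obtain p q a where "e = (p, q, a)" by (cases e)
      ultimately show "x \<in> srcs D" using sub[of p q a] x by (auto simp: srcs_def evens_def odds_def)
    qed
  qed
  moreover have "tgts D = odds n"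
  proof
    show "tgts D \<subseteq> odds n" using sub by (auto simp: tgts_def)
    show "odds n \<subseteq> tgts D"
    proof
      fix x assume x: "x \<in> odds n"
      then obtain e where "e \<in> D" "x = fst e \<or> x = fst (snd e)" using ex1[of x] r by blast
      moreover obtain p q a where "e = (p, q, a)" by (cases e)
      ultimately show "x \<in> tgts D" using sub[of p q a] x by (auto simp: tgts_def evens_def odds_def)
    qed
  qed
  moreover have "partial_bij D"
  proof (rule partial_bijI)
    have "inj_on fst D" using out by (auto intro!: inj_onI)
    moreover have "fst ` D \<subseteq> {1..2 * n}" using sub r by fastforce
    ultimately show "finite D" by (meson finite_atLeastAtMost finite_imageD finite_subset)
  qed (use out into in blast)+
  ultimately show ?r using sub nc by blast
next
  assume r: ?r
  then have pb: "partial_bij D" by blast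
  have sub: "p \<in> evens n \<and> q \<in> odds n \<and> a \<in> L" if "(p, q, a) \<in> D" for p q a
    using r that by (auto simp: srcs_def tgts_def)
  have "\<exists>!e. e \<in> D \<and> (x = fst e \<or> x = fst (snd e))" if x: "x \<in> {1..2 * n}" for x
  proof (cases "even x")
    case True
    then have "x \<in> srcs D" using x r by (auto simp: evens_def)
    then obtain q a where e: "(x, q, a) \<in> D" by (auto simp: srcs_def)
    show ?thesis
    proof (rule ex1I[of _ "(x, q, a)"])
      fix e assume *: "e \<in> D \<and> (x = fst e \<or> x = fst (snd e))"
      obtain p' q' a' where [simp]: "e = (p', q', a')" by (cases e)
      have "x = p'" using * sub[of p' q' a'] True by (auto simp: odds_def)
      then show "e = (x, q, a)" using partial_bijD(2,3)[OF pb e] * by auto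
    qed (use e in simp)
  next
    case False
    then have "x \<in> tgts D" using x r by (auto simp: odds_def)
    then obtain p a where e: "(p, x, a) \<in> D" by (auto simp: tgts_def)
    show ?thesis
    proof (rule ex1I[of _ "(p, x, a)"])
      fix e assume *: "e \<in> D \<and> (x = fst e \<or> x = fst (snd e))"
      obtain p' q' a' where [simp]: "e = (p', q', a')" by (cases e)
      have "x = q'" using * sub[of p' q' a'] False by (auto simp: evens_def)
      then show "e = (p, x, a)" using partial_bijD(4,5)[OF pb e] * by auto
    qed (use e in simp)
  qed
  moreover have nc: "noncrossing (\<lambda>p. p) (\<lambda>p. p) D" using r by blast
  have "\<not> crossing (p, q) (p', q')" if "(p, q, a) \<in> D" "(p', q', a') \<in> D" for p q a p' q' a'
    using noncrossingD[OF nc that] .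
  then have "\<forall>(p, q, a)\<in>D. \<forall>(p', q', a')\<in>D. \<not> crossing (p, q) (p', q')" by fast
  moreover have "D \<subseteq> {p \<in> {1..2 * n}. even p} \<times> {q \<in> {1..2 * n}. odd q} \<times> L"
    using sub by (auto simp: evens_def odds_def)
  ultimately show ?l unfolding diagrams_def by blast
qed

lemma crossing_iff:
  "crossing (a, b) (c, d) \<longleftrightarrow> a < c \<and> c < b \<and> b < d \<or> a < d \<and> d < b \<and> b < c \<or>
     b < c \<and> c < a \<and> a < d \<or> b < d \<and> d < a \<and> a < c"
  unfolding crossing_def by (simp add: min_def max_def) linarith

text \<open>A curve from \<open>\<alpha>\<close> to \<open>\<beta>\<close> can follow the two arcs
  and the gap between \<open>\<mu>\<close> and \<open>\<nu>\<close>. A third arc that avoids both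
  arcs and has no end in the gap cannot separate \<open>\<alpha>\<close> from
  \<open>\<beta>\<close>.\<close>

lemma crossing_splice:
  fixes \<alpha> \<beta> \<mu> \<nu> x y :: nat
  assumes "\<not> crossing (\<alpha>, \<nu>) (x, y)" "\<not> crossing (x, y) (\<alpha>, \<nu>)"
    "\<not> crossing (\<mu>, \<beta>) (x, y)" "\<not> crossing (x, y) (\<mu>, \<beta>)"
    "\<And>z. z \<in> {\<alpha>, \<beta>, x, y} \<Longrightarrow> z < \<mu> \<and> z < \<nu> \<or> z > \<mu> \<and> z > \<nu>"
  shows "\<not> crossing (\<alpha>, \<beta>) (x, y)" "\<not> crossing (x, y) (\<alpha>, \<beta>)"
proof -
  have a: "\<alpha> < \<mu> \<and> \<alpha> < \<nu> \<or> \<alpha> > \<mu> \<and> \<alpha> > \<nu>" "\<beta> < \<mu> \<and> \<beta> < \<nu> \<or> \<beta> > \<mu> \<and> \<beta> > \<nu>"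
    "x < \<mu> \<and> x < \<nu> \<or> x > \<mu> \<and> x > \<nu>" "y < \<mu> \<and> y < \<nu> \<or> y > \<mu> \<and> y > \<nu>"
    using assms(5) by simp_all
  show "\<not> crossing (\<alpha>, \<beta>) (x, y)"
    using assms(1-4) a unfolding crossing_iff by (smt (verit))
  show "\<not> crossing (x, y) (\<alpha>, \<beta>)"
    using assms(1-4) a unfolding crossing_iff by (smt (verit))
qed

context int_table_algebra
begin

text \<open>\<open>crossing_splice\<close> with the two positions of \<open>m\<close> bounding the
  gap: the incoming edge ends at \<open>r m\<close>, the outgoing one starts at
  \<open>s m\<close>.\<close>

lemma noncrossing_contract:
  assumes E: "label_graph E" and m: "m \<in> inner E" and nc: "noncrossing s r E"
    and pos: "\<And>p. p \<in> srcs E \<Longrightarrow> p \<noteq> m \<Longrightarrow> s p < s m \<and> s p < r m \<or> s p > s m \<and> s p > r m"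
      "\<And>q. q \<in> tgts E \<Longrightarrow> q \<noteq> m \<Longrightarrow> r q < s m \<and> r q < r m \<or> r q > s m \<and> r q > r m"
  shows "noncrossing s r (contract m E)"
  unfolding noncrossing_def
proof (intro allI impI)
  fix p q a p' q' a' assume e: "(p, q, a) \<in> contract m E" and e': "(p', q', a') \<in> contract m E"
  note pb = label_graphD(1)[OF E]
  have n: "\<not> crossing (s p, r q) (s p', r q')" if "(p, q, a) \<in> E" "(p', q', a') \<in> E" for p q a p' q' a'
    by (rule noncrossingD[OF nc that])
  have io: "p \<in> srcs E" "q \<in> tgts E" if "(p, q, a) \<in> E" for p q a
    using that by (auto simp: srcs_def tgts_def)
  have splice: "\<not> crossing (s x, r y) (s p, r q) \<and> \<not> crossing (s p, r q) (s x, r y)"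
    if x: "(x, m, b) \<in> E" "(m, y, c) \<in> E" "x \<noteq> m" "y \<noteq> m" and p: "(p, q, a) \<in> E" "p \<noteq> m" "q \<noteq> m"
    for x y b c p q a
  proof -
    have "z < s m \<and> z < r m \<or> z > s m \<and> z > r m" if "z \<in> {s x, r y, s p, r q}" for z
      using that pos(1)[OF io(1)[OF x(1)] x(3)] pos(2)[OF io(2)[OF x(2)] x(4)]
        pos(1)[OF io(1)[OF p(1)] p(2)] pos(2)[OF io(2)[OF p(1)] p(3)] by blast
    note c = crossing_splice[OF n[OF x(1) p(1)] n[OF p(1) x(1)] n[OF x(2) p(1)] n[OF p(1) x(2)] this]
    show ?thesis using c by blast
  qed
  show "\<not> crossing (s p, r q) (s p', r q')"
  proof (rule contract_cases[OF E m e])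
    assume 1: "(p, q, a) \<in> E" "p \<noteq> m" "q \<noteq> m"
    show ?thesis
    proof (rule contract_cases[OF E m e'])
      assume "(p', q', a') \<in> E"
      then show ?thesis by (rule n[OF 1(1)])
    next
      fix a2 b2 assume "(p', m, a2) \<in> E" "(m, q', b2) \<in> E" "p' \<noteq> m" "q' \<noteq> m"
      from splice[OF this 1] show ?thesis by blast
    qed
  next
    fix a1 b1 assume 1: "(p, m, a1) \<in> E" "(m, q, b1) \<in> E" "p \<noteq> m" "q \<noteq> m"
    show ?thesis
    proof (rule contract_cases[OF E m e'])
      assume "(p', q', a') \<in> E" "p' \<noteq> m" "q' \<noteq> m"
      from splice[OF 1 this] show ?thesis by blast
    next
      fix a2 b2 assume 2: "(p', m, a2) \<in> E" "(m, q', b2) \<in> E"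
      have "p' = p" "q' = q" using partial_bijD(4)[OF pb 1(1) 2(1)] partial_bijD(2)[OF pb 1(2) 2(2)] by auto
      then show ?thesis by (simp add: crossing_def)
    qed
  qed
qed

text \<open>Diagrams with arbitrary labels in \<open>A\<close> and without planarity. In contrast to
  \<open>diagrams n B\<close>, this class is closed under taking the net of a gluing.\<close>

definition pre_diagram :: "nat \<Rightarrow> (nat \<times> nat \<times> 'a) set \<Rightarrow> bool" where
  "pre_diagram n D \<longleftrightarrow> label_graph D \<and> srcs D = evens n \<and> tgts D = odds n"

lemma diagram_pre_diagram: "D \<in> diagrams n B \<Longrightarrow> pre_diagram n D"
  by (auto simp: diagrams_iff pre_diagram_def label_graph_def)

lemma glue_map_graph: "glue n T1 T2 = map_graph (upper_point n) T1 \<union> map_graph (lower_point n) T2"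
  by (simp add: glue_def map_graph_def)

lemma inj_upper: "S \<subseteq> {1..2 * n} \<Longrightarrow> inj_on (upper_point n) S"
proof (rule inj_onI)
  fix x y assume "S \<subseteq> {1..2 * n}" "x \<in> S" "y \<in> S" "upper_point n x = upper_point n y"
  moreover from this have "x \<in> {1..2 * n}" "y \<in> {1..2 * n}" by blast+
  ultimately show "x = y" by (auto simp: upper_point_def split: if_splits)
qed

lemma inj_lower: "S \<subseteq> {1..2 * n} \<Longrightarrow> inj_on (lower_point n) S"
proof (rule inj_onI)
  fix x y assume "S \<subseteq> {1..2 * n}" "x \<in> S" "y \<in> S" "lower_point n x = lower_point n y"
  moreover from this have "x \<in> {1..2 * n}" "y \<in> {1..2 * n}" by blast+
  ultimately show "x = y" by (auto simp: lower_point_def split: if_splits)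
qed

lemma evens_odds_subset: "evens n \<subseteq> {1..2 * n}" "odds n \<subseteq> {1..2 * n}"
  by (auto simp: evens_def odds_def)

text \<open>On glued points \<open>upper_point\<close> changes the parity and
  \<open>lower_point\<close> keeps it. Thus an odd middle vertex is a source in the upper diagram
  and a target in the lower one, and an even one conversely.\<close>

lemma image_points:
  "upper_point n ` evens n \<union> lower_point n ` evens n = evens n \<union> {2 * n + 1..3 * n}" (is ?a)
  "upper_point n ` odds n \<union> lower_point n ` odds n = odds n \<union> {2 * n + 1..3 * n}" (is ?b)
  "upper_point n ` evens n \<inter> lower_point n ` evens n = {}" (is ?c)
  "upper_point n ` odds n \<inter> lower_point n ` odds n = {}" (is ?d)
proof -
  have "odd (upper_point n p) \<or> upper_point n p \<le> n" "even (lower_point n p)" "lower_point n p > n"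
    if "p \<in> evens n" for p
    using that by (auto simp: evens_def upper_point_def lower_point_def)
  then show ?c by (metis (no_types, lifting) disjoint_iff imageE leD)
  have "even (upper_point n p) \<or> upper_point n p \<le> n" "odd (lower_point n p)" "lower_point n p > n"
    if "p \<in> odds n" for p
    using that by (auto simp: odds_def upper_point_def lower_point_def)
  then show ?d by (metis (no_types, lifting) disjoint_iff imageE leD)
  show ?a
  proof
    show "upper_point n ` evens n \<union> lower_point n ` evens n \<subseteq> evens n \<union> {2 * n + 1..3 * n}"
      by (auto simp: evens_def upper_point_def lower_point_def)
    show "evens n \<union> {2 * n + 1..3 * n} \<subseteq> upper_point n ` evens n \<union> lower_point n ` evens n"
    proof
      fix x assume "x \<in> evens n \<union> {2 * n + 1..3 * n}"
      then consider "x \<in> evens n" "x \<le> n" | "x \<in> evens n" "x > n" | "x \<in> {2 * n + 1..3 * n}" "even x"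
        | "x \<in> {2 * n + 1..3 * n}" "odd x" by fastforce
      then show "x \<in> upper_point n ` evens n \<union> lower_point n ` evens n"
      proof cases
        case 3 then show ?thesis
          by (intro UnI2 image_eqI[of _ _ "x - 2 * n"]) (auto simp: evens_def lower_point_def)
      next
        case 4 then show ?thesis
          by (intro UnI1 image_eqI[of _ _ "4 * n + 1 - x"]) (auto simp: evens_def upper_point_def)
      qed (auto simp: upper_point_def lower_point_def intro: image_eqI)
    qed
  qed
  show ?b
  proof
    show "upper_point n ` odds n \<union> lower_point n ` odds n \<subseteq> odds n \<union> {2 * n + 1..3 * n}"
      by (auto simp: odds_def upper_point_def lower_point_def)
    show "odds n \<union> {2 * n + 1..3 * n} \<subseteq> upper_point n ` odds n \<union> lower_point n ` odds n"
    proof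
      fix x assume "x \<in> odds n \<union> {2 * n + 1..3 * n}"
      then consider "x \<in> odds n" "x \<le> n" | "x \<in> odds n" "x > n" | "x \<in> {2 * n + 1..3 * n}" "even x"
        | "x \<in> {2 * n + 1..3 * n}" "odd x" by fastforce
      then show "x \<in> upper_point n ` odds n \<union> lower_point n ` odds n"
      proof cases
        case 4 then show ?thesis
          by (intro UnI2 image_eqI[of _ _ "x - 2 * n"]) (auto simp: odds_def lower_point_def)
      next
        case 3 then show ?thesis
          by (intro UnI1 image_eqI[of _ _ "4 * n + 1 - x"]) (auto simp: odds_def upper_point_def)
      qed (auto simp: upper_point_def lower_point_def intro: image_eqI)
    qed
  qed
qed

lemma
  assumes "pre_diagram n T1" "pre_diagram n T2"
  shows label_graph_glue: "label_graph (glue n T1 T2)"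
    and srcs_glue: "srcs (glue n T1 T2) = evens n \<union> {2 * n + 1..3 * n}"
    and tgts_glue: "tgts (glue n T1 T2) = odds n \<union> {2 * n + 1..3 * n}"
proof -
  note a = assms[unfolded pre_diagram_def]
  have "label_graph (map_graph (upper_point n) T1)" "label_graph (map_graph (lower_point n) T2)"
    using a inj_upper[OF evens_odds_subset(1)] inj_upper[OF evens_odds_subset(2)]
      inj_lower[OF evens_odds_subset(1)] inj_lower[OF evens_odds_subset(2)]
    by (simp_all add: label_graph_map)
  then show "label_graph (glue n T1 T2)" unfolding glue_map_graph
    by (rule label_graph_Un) (use a image_points in \<open>auto simp: srcs_map_graph tgts_map_graph\<close>)
  show "srcs (glue n T1 T2) = evens n \<union> {2 * n + 1..3 * n}" "tgts (glue n T1 T2) = odds n \<union> {2 * n + 1..3 * n}"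
    using a image_points(1,2) by (simp_all add: glue_map_graph srcs_Un tgts_Un srcs_map_graph tgts_map_graph)
qed

lemma evens_odds: "evens n \<inter> odds n = {}" "evens n \<inter> {2 * n + 1..3 * n} = {}" "odds n \<inter> {2 * n + 1..3 * n} = {}"
  by (auto simp: evens_def odds_def)

lemma inner_glue:
  "pre_diagram n T1 \<Longrightarrow> pre_diagram n T2 \<Longrightarrow> inner (glue n T1 T2) = {2 * n + 1..3 * n}"
  using evens_odds[of n] by (auto simp: inner_def srcs_glue tgts_glue)

lemma verts_glue: "pre_diagram n T1 \<Longrightarrow> pre_diagram n T2 \<Longrightarrow> verts (glue n T1 T2) \<subseteq> {1..3 * n}"
  using evens_odds_subset[of n] by (auto simp: verts_def srcs_glue tgts_glue)

lemma pre_diagram_net_glue: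
  assumes "pre_diagram n T1" "pre_diagram n T2"
  shows "pre_diagram n (net (glue n T1 T2))"
  unfolding pre_diagram_def
  using label_graph_net srcs_net tgts_net label_graph_glue[OF assms] srcs_glue[OF assms] tgts_glue[OF assms]
    evens_odds[of n] by auto

lemma verts_pre_diagram: "pre_diagram n D \<Longrightarrow> verts D \<subseteq> {1..2 * n}"
  using evens_odds_subset by (auto simp: verts_def pre_diagram_def)

text \<open>The two boxes are laid side by side on a line, the upper diagram at
  \<open>1..2n\<close>, the lower one at \<open>2n+1..4n\<close>. The middle vertex
  \<open>2n+i\<close> occurs twice, at \<open>2n+1-i\<close> and at \<open>2n+i\<close>; its parity
  decides which occurrence is the source.\<close>

definition source_position :: "nat \<Rightarrow> nat \<Rightarrow> nat" where
  "source_position n v = (if v \<le> n then v else if v \<le> 2 * n then 2 * n + v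
     else if odd v then 4 * n + 1 - v else v)"

definition target_position :: "nat \<Rightarrow> nat \<Rightarrow> nat" where
  "target_position n v = (if v \<le> n then v else if v \<le> 2 * n then 2 * n + v
     else if even v then 4 * n + 1 - v else v)"

lemma noncrossing_glue:
  assumes T: "pre_diagram n T1" "pre_diagram n T2"
    and nc: "noncrossing (\<lambda>p. p) (\<lambda>p. p) T1" "noncrossing (\<lambda>p. p) (\<lambda>p. p) T2"
  shows "noncrossing (source_position n) (target_position n) (glue n T1 T2)"
proof -
  have up: "source_position n (upper_point n p) = p" "target_position n (upper_point n q) = q"
    and low: "source_position n (lower_point n p) = 2 * n + p" "target_position n (lower_point n q) = 2 * n + q"
    if "p \<in> evens n" "q \<in> odds n" for p q
    using that by (auto simp: evens_def odds_def upper_point_def lower_point_def source_position_def target_position_def)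
  have io: "p \<in> evens n" "q \<in> odds n" if "(p, q, a) \<in> T1 \<or> (p, q, a) \<in> T2" for p q a
    using that T srcsI[of p q a T1] tgtsI[of p q a T1] srcsI[of p q a T2] tgtsI[of p q a T2]
    by (auto simp: pre_diagram_def)
  have le: "p \<le> 2 * n" "q \<le> 2 * n" "1 \<le> p" "1 \<le> q" if "(p, q, a) \<in> T1 \<or> (p, q, a) \<in> T2" for p q a
    using io[OF that] by (auto simp: evens_def odds_def)
  have c: "crossing (2 * n + p, 2 * n + q) (2 * n + p', 2 * n + q') \<longleftrightarrow> crossing (p, q) (p', q')" for p q p' q'
    by (auto simp: crossing_def min_def max_def)
  show ?thesis
    unfolding noncrossing_def
  proof (intro allI impI)
    fix p q a p' q' a' assume "(p, q, a) \<in> glue n T1 T2" "(p', q', a') \<in> glue n T1 T2"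
    then consider
      x y x' y' where "p = upper_point n x" "q = upper_point n y" "p' = upper_point n x'" "q' = upper_point n y'" "(x, y, a) \<in> T1" "(x', y', a') \<in> T1"
    | x y x' y' where "p = lower_point n x" "q = lower_point n y" "p' = lower_point n x'" "q' = lower_point n y'" "(x, y, a) \<in> T2" "(x', y', a') \<in> T2"
    | x y x' y' where "p = upper_point n x" "q = upper_point n y" "p' = lower_point n x'" "q' = lower_point n y'" "(x, y, a) \<in> T1" "(x', y', a') \<in> T2"
    | x y x' y' where "p = lower_point n x" "q = lower_point n y" "p' = upper_point n x'" "q' = upper_point n y'" "(x, y, a) \<in> T2" "(x', y', a') \<in> T1"
      unfolding glue_map_graph by (auto elim!: map_graphE)
    then show "\<not> crossing (source_position n p, target_position n q) (source_position n p', target_position n q')"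
    proof cases
      case 1
      then have "\<not> crossing (x, y) (x', y')" using noncrossingD[OF nc(1)] by blast
      then show ?thesis using 1 io[of x y a] io[of x' y' a'] by (simp add: up)
    next
      case 2
      then have "\<not> crossing (x, y) (x', y')" using noncrossingD[OF nc(2)] by blast
      then show ?thesis using 2 io[of x y a] io[of x' y' a'] by (simp add: low c)
    next
      case 3
      then show ?thesis using io[of x y a] io[of x' y' a'] le[of x y a] le[of x' y' a']
        by (simp add: up low crossing_def min_def max_def)
    next
      case 4
      then show ?thesis using io[of x y a] io[of x' y' a'] le[of x y a] le[of x' y' a']
        by (simp add: up low crossing_def min_def max_def)
    qed
  qed
qed

text \<open>
  The middle points are contracted from left to right on the lower diagram; each time the two
  ends to be joined are adjacent among the remaining positions.
\<close>

lemma noncrossing_net_glue: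
  assumes T: "pre_diagram n T1" "pre_diagram n T2"
    and nc: "noncrossing (\<lambda>p. p) (\<lambda>p. p) T1" "noncrossing (\<lambda>p. p) (\<lambda>p. p) T2"
  shows "noncrossing (\<lambda>p. p) (\<lambda>p. p) (net (glue n T1 T2))"
proof -
  let ?G = "glue n T1 T2" and ?s = "source_position n" and ?r = "target_position n"
  have "j \<le> n \<Longrightarrow> \<exists>E. label_graph E \<and> net E = net ?G \<and> noncrossing ?s ?r E \<and>
      srcs E = evens n \<union> {2 * n + j + 1..3 * n} \<and> tgts E = odds n \<union> {2 * n + j + 1..3 * n}" for j
  proof (induction j)
    case 0
    then show ?case
      using label_graph_glue[OF T] srcs_glue[OF T] tgts_glue[OF T] noncrossing_glue[OF assms] by auto
  next
    case (Suc j)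
    then obtain E where E: "label_graph E" "net E = net ?G" "noncrossing ?s ?r E"
      "srcs E = evens n \<union> {2 * n + j + 1..3 * n}" "tgts E = odds n \<union> {2 * n + j + 1..3 * n}" by auto
    let ?m = "2 * n + j + 1"
    have m: "?m \<in> inner E" using E Suc.prems by (auto simp: inner_def)
    \<comment> \<open>The positions from \<open>2n-j+1\<close> to \<open>2n+j\<close> belong to
      middle vertices that are already removed.\<close>
    have pos: "?s ?m = 2 * n - j \<and> ?r ?m = 2 * n + j + 1 \<or> ?s ?m = 2 * n + j + 1 \<and> ?r ?m = 2 * n - j"
      using Suc.prems by (auto simp: source_position_def target_position_def)
    have s: "?s p < 2 * n - j \<or> ?s p > 2 * n + j + 1" if "p \<in> srcs E" "p \<noteq> ?m" for p
      using that Suc.prems unfolding E(4) by (auto simp: evens_def source_position_def)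
    have r: "?r p < 2 * n - j \<or> ?r p > 2 * n + j + 1" if "p \<in> tgts E" "p \<noteq> ?m" for p
      using that Suc.prems unfolding E(5) by (auto simp: odds_def target_position_def)
    have "noncrossing ?s ?r (contract ?m E)"
    proof (rule noncrossing_contract[OF E(1) m E(3)])
      fix p assume "p \<in> srcs E" "p \<noteq> ?m"
      from s[OF this] pos show "?s p < ?s ?m \<and> ?s p < ?r ?m \<or> ?s p > ?s ?m \<and> ?s p > ?r ?m" by linarith
    next
      fix p assume "p \<in> tgts E" "p \<noteq> ?m"
      from r[OF this] pos show "?r p < ?s ?m \<and> ?r p < ?r ?m \<or> ?r p > ?s ?m \<and> ?r p > ?r ?m" by linarith
    qed
    moreover have "evens n \<union> {2 * n + j + 1..3 * n} - {?m} = evens n \<union> {2 * n + Suc j + 1..3 * n}"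
      "odds n \<union> {2 * n + j + 1..3 * n} - {?m} = odds n \<union> {2 * n + Suc j + 1..3 * n}"
      by (auto simp: evens_def odds_def)
    ultimately show ?case
      using label_graph_contract[OF E(1) m] net_contract[OF E(1) m] srcs_contract[OF E(1) m]
        tgts_contract[OF E(1) m] E(2,4,5) by (intro exI[of _ "contract ?m E"]) simp
  qed
  from this[of n] obtain E where E: "label_graph E" "net E = net ?G" "noncrossing ?s ?r E"
    "srcs E = evens n" "tgts E = odds n" by auto
  have "net E = E" by (rule net_no_inner[OF E(1)]) (use E evens_odds in \<open>auto simp: inner_def\<close>)
  then have G: "net ?G = E" using E by simp
  show ?thesis unfolding G noncrossing_def
  proof (intro allI impI)
    fix p q a p' q' a' assume e: "(p, q, a) \<in> E" "(p', q', a') \<in> E"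
    then have nx: "\<not> crossing (?s p, ?r q) (?s p', ?r q')" by (rule noncrossingD[OF E(3)])
    have "p \<in> evens n" "p' \<in> evens n" "q \<in> odds n" "q' \<in> odds n" using e E(4,5) by (auto simp: srcs_def tgts_def)
    then have l: "p \<le> 2 * n" "p' \<le> 2 * n" "q \<le> 2 * n" "q' \<le> 2 * n" by (auto simp: evens_def odds_def)
    \<comment> \<open>The outer points of the lower diagram are shifted by \<open>2n\<close>. This
      renumbering is monotone and does not affect crossings.\<close>
    define h where "h v = (if v \<le> n then v else 2 * n + v)" for v
    have h: "?s p = h p" "?s p' = h p'" "?r q = h q" "?r q' = h q'"
      using l by (auto simp: h_def source_position_def target_position_def)
    have mono: "strict_mono h" by (auto simp: h_def strict_mono_def)
    have "min (h x) (h y) = h (min x y)" "max (h x) (h y) = h (max x y)" for x y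
      by (auto simp: h_def min_def max_def)
    then show "\<not> crossing (p, q) (p', q')"
      using nx strict_mono_less[OF mono] unfolding crossing_def h by simp
  qed
qed

text \<open>The points \<open>1..2n\<close> are exactly the vertices of the glued graph that are not
  inner, so \<open>strands\<close> and \<open>net\<close> describe the same maximal walks.\<close>

lemma
  assumes T: "pre_diagram n T1" "pre_diagram n T2"
  shows shape_net_glue: "shape (net (glue n T1 T2)) = strands n (glue n T1 T2)"
    and graph_of_strands: "graph_of (strands n (glue n T1 T2)) (strand_label A (glue n T1 T2)) = net (glue n T1 T2)"
proof -
  let ?G = "glue n T1 T2"
  note pb = label_graphD(1)[OF label_graph_glue[OF T]]
  have outer: "p \<notin> tgts ?G \<and> q \<notin> srcs ?G \<longleftrightarrow> p \<in> {1..2 * n} \<and> q \<in> {1..2 * n}" if "walk ?G p w q" for p w q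
    using walk_srcs[OF that] walk_tgts[OF that] evens_odds[of n] evens_odds_subset[of n]
    unfolding srcs_glue[OF T] tgts_glue[OF T] by (auto simp: evens_def odds_def)
  have the: "(THE w. walk ?G p w q) = w" if "walk ?G p w q" "q \<in> {1..2 * n}" "p \<in> {1..2 * n}" for p w q
  proof (rule the_equality)
    show "walk ?G p w q" by (rule that(1))
    fix w' assume "walk ?G p w' q"
    moreover have "q \<notin> srcs ?G" using outer[OF that(1)] that by blast
    ultimately show "w' = w" using walk_ends_unique[OF pb _ that(1)] by blast
  qed
  show sh: "shape (net ?G) = strands n ?G"
  proof (intro equalityI subsetI)
    fix x assume "x \<in> shape (net ?G)"
    then show "x \<in> strands n ?G" using outer by (fastforce simp: shape_def net_def strands_def)
  next
    fix x assume "x \<in> strands n ?G"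
    then show "x \<in> shape (net ?G)" using outer by (fastforce simp: shape_def net_def strands_def)
  qed
  show "graph_of (strands n ?G) (strand_label A ?G) = net ?G"
  proof (intro equalityI subsetI)
    fix e assume e: "e \<in> graph_of (strands n ?G) (strand_label A ?G)"
    obtain p q a where [simp]: "e = (p, q, a)" by (cases e)
    from e obtain w where w: "walk ?G p w q" "p \<in> {1..2 * n}" "q \<in> {1..2 * n}" "a = strand_label A ?G (p, q)"
      by (auto simp: graph_of_iff strands_def)
    then show "e \<in> net ?G" using outer[OF w(1)] the[OF w(1)]
      by (auto simp: net_def strand_label_def)
  next
    fix e assume e: "e \<in> net ?G"
    obtain p q a where [simp]: "e = (p, q, a)" by (cases e)
    from e obtain w where w: "walk ?G p w q" "p \<notin> tgts ?G \<and> q \<notin> srcs ?G" "a = word_label A w"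
      by (auto simp: net_def)
    then show "e \<in> graph_of (strands n ?G) (strand_label A ?G)" using outer[OF w(1)] the[OF w(1)]
      by (auto simp: graph_of_iff strands_def strand_label_def)
  qed
qed

lemma diagram_mult_expansion:
  "diagram_mult n A B T1 T2 = expansion (strands n (glue n T1 T2)) (strand_label A (glue n T1 T2))
     (loop_factor A B (glue n T1 T2))"
  by (simp add: diagram_mult_def expansion_def Let_def graph_of_def)

lemma strands_glue:
  assumes "pre_diagram n T1" "pre_diagram n T2"
  shows "finite (strands n (glue n T1 T2))" "inj_on fst (strands n (glue n T1 T2))"
    "inj_on snd (strands n (glue n T1 T2))" "fst ` strands n (glue n T1 T2) = evens n"
    "snd ` strands n (glue n T1 T2) = odds n"
    "\<And>s. s \<in> strands n (glue n T1 T2) \<Longrightarrow> strand_label A (glue n T1 T2) s \<in> carrier A"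
proof -
  note N = pre_diagram_net_glue[OF assms, unfolded pre_diagram_def]
  note sh = shape_partial_bij[OF label_graphD(1), of "net (glue n T1 T2)", unfolded shape_net_glue[OF assms]]
  show "finite (strands n (glue n T1 T2))" "inj_on fst (strands n (glue n T1 T2))"
    "inj_on snd (strands n (glue n T1 T2))" using sh N by auto
  show "fst ` strands n (glue n T1 T2) = evens n" "snd ` strands n (glue n T1 T2) = odds n"
    using N srcs_graph_of[of "strands n (glue n T1 T2)" "strand_label A (glue n T1 T2)"]
      tgts_graph_of[of "strands n (glue n T1 T2)" "strand_label A (glue n T1 T2)"]
    unfolding graph_of_strands[OF assms] by auto
  fix s assume s: "s \<in> strands n (glue n T1 T2)"
  obtain p q where [simp]: "s = (p, q)" by (cases s)
  have "(p, q, strand_label A (glue n T1 T2) s) \<in> net (glue n T1 T2)"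
    using s unfolding graph_of_strands[OF assms, symmetric] by (auto simp: graph_of_iff)
  then show "strand_label A (glue n T1 T2) s \<in> carrier A" using N label_graphD(2) by blast
qed

text \<open>For given \<open>Z\<close> at most one term of the defining sum over label choices
  contributes. All structure constants are computed through this formula.\<close>

lemma lookup_diagram_mult:
  assumes "pre_diagram n T1" "pre_diagram n T2" "partial_bij Z"
  shows "lookup (diagram_mult n A B T1 T2) Z = graph_coeff (glue n T1 T2) Z"
  unfolding diagram_mult_expansion
  using lookup_expansion[OF strands_glue(1-3)[OF assms(1,2)] assms(3)]
  by (simp add: graph_of_strands[OF assms(1,2)] graph_coeff_def)

lemma choice_diagram:
  assumes T: "T1 \<in> diagrams n B" "T2 \<in> diagrams n B"
    and f: "f \<in> (\<Pi>\<^sub>E s\<in>strands n (glue n T1 T2). supp A B (strand_label A (glue n T1 T2) s))"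
  shows "graph_of (strands n (glue n T1 T2)) f \<in> diagrams n B"
  unfolding diagrams_iff
proof (intro conjI allI impI)
  note p = diagram_pre_diagram[OF T(1)] diagram_pre_diagram[OF T(2)]
  note s = strands_glue[OF p]
  show "partial_bij (graph_of (strands n (glue n T1 T2)) f)"
    by (rule partial_bij_graph_of[OF s(1-3)])
  show "srcs (graph_of (strands n (glue n T1 T2)) f) = evens n"
    "tgts (graph_of (strands n (glue n T1 T2)) f) = odds n" using s by (simp_all add: srcs_graph_of tgts_graph_of)
  show "a \<in> B" if "(x, y, a) \<in> graph_of (strands n (glue n T1 T2)) f" for x y a
  proof -
    have xy: "(x, y) \<in> strands n (glue n T1 T2)" "a = f (x, y)" using that by (auto simp: graph_of_iff)
    then have "a \<in> supp A B (strand_label A (glue n T1 T2) (x, y))" using PiE_mem[OF f xy(1)] by simp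
    then show "a \<in> B" using supp_subset[OF s(6)[OF xy(1)]] by blast
  qed
  have "noncrossing (\<lambda>p. p) (\<lambda>p. p) (net (glue n T1 T2))"
    by (rule noncrossing_net_glue[OF p]) (use T in \<open>simp_all add: diagrams_iff\<close>)
  then show "noncrossing (\<lambda>p. p) (\<lambda>p. p) (graph_of (strands n (glue n T1 T2)) f)"
    unfolding graph_of_strands[OF p, symmetric] by (simp add: noncrossing_def graph_of_iff)
qed

lemma keys_expansion:
  "keys (expansion P lab c) \<subseteq> graph_of P ` (\<Pi>\<^sub>E s\<in>P. supp A B (lab s))"
  unfolding expansion_def by (rule order_trans[OF keys_sum]) auto

lemma keys_diagram_mult:
  assumes "T1 \<in> diagrams n B" "T2 \<in> diagrams n B"
  shows "keys (diagram_mult n A B T1 T2) \<subseteq> diagrams n B"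
  unfolding diagram_mult_expansion using keys_expansion choice_diagram[OF assms] by fast

end

section \<open>Associativity\<close>

lemma verts_map_graph: "verts (map_graph \<phi> E) = \<phi> ` verts E"
  by (simp add: verts_def srcs_map_graph tgts_map_graph image_Un)

context int_table_algebra
begin

lemma graph_coeff_plug:
  assumes "label_graph E" "label_graph (map_graph \<phi> E \<union> F)"
    and "\<And>m v. m \<in> inner E \<Longrightarrow> v \<in> verts E \<Longrightarrow> \<phi> v = \<phi> m \<Longrightarrow> v = m"
    and "\<And>m. m \<in> inner E \<Longrightarrow> \<phi> m \<notin> verts F"
  shows "graph_coeff (map_graph \<phi> E \<union> F) Z = loop_factor A B E * graph_coeff (map_graph \<phi> (net E) \<union> F) Z"
proof -
  have 1: "loop_factor A B (map_graph \<phi> E \<union> F) = loop_factor A B E * loop_factor A B (map_graph \<phi> (net E) \<union> F)"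
    by (rule plug(1)[OF assms(1,2)]; (rule assms(3) | rule assms(4)); assumption)
  have 2: "net (map_graph \<phi> E \<union> F) = net (map_graph \<phi> (net E) \<union> F)"
    by (rule plug(2)[OF assms(1,2)]; (rule assms(3) | rule assms(4)); assumption)
  show ?thesis unfolding graph_coeff_def 1 2 by (rule mult.assoc)
qed

lemma graph_coeff_relabel:
  assumes "label_graph E" "inj_on \<phi> (verts E)" "\<And>v. v \<in> verts (net E) \<Longrightarrow> \<phi> v = v"
  shows "graph_coeff (map_graph \<phi> E) Z = graph_coeff E Z"
proof -
  have "map_graph \<phi> (net E) = map_graph (\<lambda>v. v) (net E)" by (rule map_graph_cong) (rule assms(3))
  then show ?thesis unfolding graph_coeff_def loop_factor_relabel[OF assms(1,2)] net_relabel[OF assms(1,2)]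
    by (simp add: map_graph_id)
qed

lemma lin_expansion:
  "lin h (expansion P lab c) = (\<Sum>f\<in>(\<Pi>\<^sub>E s\<in>P. supp A B (lab s)).
     scale (c * of_int (\<Prod>s\<in>P. \<kappa> (f s) (lab s))) (h (graph_of P f)))"
  by (simp only: expansion_def lin_sum lin_single)

text \<open>By multilinearity the expansion made in forming the inner product may be postponed until
  the unexpanded net has been inserted into the larger graph.\<close>

lemma expand_net_glue:
  fixes \<phi> :: "nat \<Rightarrow> nat" and \<Psi> :: "(nat \<times> nat \<times> 'a) set \<Rightarrow> laurent"
  assumes T: "T1 \<in> diagrams n B" "T2 \<in> diagrams n B"
    and \<phi>: "inj_on \<phi> (evens n)" "inj_on \<phi> (odds n)"
    and F: "label_graph F" "\<phi> ` evens n \<inter> srcs F = {}" "\<phi> ` odds n \<inter> tgts F = {}"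
    and \<Psi>: "\<And>D. D \<in> diagrams n B \<Longrightarrow> \<Psi> D = graph_coeff (map_graph \<phi> D \<union> F) Z"
  shows "(\<Sum>f\<in>(\<Pi>\<^sub>E s\<in>strands n (glue n T1 T2). supp A B (strand_label A (glue n T1 T2) s)).
      loop_factor A B (glue n T1 T2) * of_int (\<Prod>s\<in>strands n (glue n T1 T2). \<kappa> (f s) (strand_label A (glue n T1 T2) s))
       * \<Psi> (graph_of (strands n (glue n T1 T2)) f)) =
    loop_factor A B (glue n T1 T2) * graph_coeff (map_graph \<phi> (net (glue n T1 T2)) \<union> F) Z"
proof -
  note p = diagram_pre_diagram[OF T(1)] diagram_pre_diagram[OF T(2)]
  note s = strands_glue[OF p]
  have "graph_coeff (map_graph \<phi> (graph_of (strands n (glue n T1 T2)) (strand_label A (glue n T1 T2))) \<union> F) Z =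
    (\<Sum>f\<in>(\<Pi>\<^sub>E s\<in>strands n (glue n T1 T2). supp A B (strand_label A (glue n T1 T2) s)).
      of_int (\<Prod>s\<in>strands n (glue n T1 T2). \<kappa> (f s) (strand_label A (glue n T1 T2) s))
       * graph_coeff (map_graph \<phi> (graph_of (strands n (glue n T1 T2)) f) \<union> F) Z)"
  proof (rule graph_coeff_expand)
    show "inj_on (\<phi> \<circ> fst) (strands n (glue n T1 T2))" "inj_on (\<phi> \<circ> snd) (strands n (glue n T1 T2))"
      using s \<phi> by (auto intro: comp_inj_on)
    show "(\<phi> \<circ> fst) ` strands n (glue n T1 T2) \<inter> srcs F = {}"
      "(\<phi> \<circ> snd) ` strands n (glue n T1 T2) \<inter> tgts F = {}"
      using F(2,3) unfolding image_comp[symmetric] s(4,5) .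
  qed (use s F in auto)
  then have "loop_factor A B (glue n T1 T2) * graph_coeff (map_graph \<phi> (net (glue n T1 T2)) \<union> F) Z =
    (\<Sum>f\<in>(\<Pi>\<^sub>E s\<in>strands n (glue n T1 T2). supp A B (strand_label A (glue n T1 T2) s)).
      loop_factor A B (glue n T1 T2) * of_int (\<Prod>s\<in>strands n (glue n T1 T2). \<kappa> (f s) (strand_label A (glue n T1 T2) s))
       * graph_coeff (map_graph \<phi> (graph_of (strands n (glue n T1 T2)) f) \<union> F) Z)"
    unfolding graph_of_strands[OF p] by (simp only: sum_distrib_left mult.assoc)
  also have "\<dots> = (\<Sum>f\<in>(\<Pi>\<^sub>E s\<in>strands n (glue n T1 T2). supp A B (strand_label A (glue n T1 T2) s)).
      loop_factor A B (glue n T1 T2) * of_int (\<Prod>s\<in>strands n (glue n T1 T2). \<kappa> (f s) (strand_label A (glue n T1 T2) s))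
       * \<Psi> (graph_of (strands n (glue n T1 T2)) f))"
    by (rule sum.cong[OF refl]) (simp only: \<Psi>[OF choice_diagram[OF T]])
  finally show ?thesis by (rule sym)
qed

lemma label_graph_half:
  assumes "pre_diagram n T"
  shows "label_graph (map_graph (upper_point n) T)" "label_graph (map_graph (lower_point n) T)"
    "srcs (map_graph (upper_point n) T) = upper_point n ` evens n"
    "tgts (map_graph (upper_point n) T) = upper_point n ` odds n"
    "srcs (map_graph (lower_point n) T) = lower_point n ` evens n"
    "tgts (map_graph (lower_point n) T) = lower_point n ` odds n"
  using assms[unfolded pre_diagram_def] inj_upper[OF evens_odds_subset(1)] inj_upper[OF evens_odds_subset(2)]
      inj_lower[OF evens_odds_subset(1)] inj_lower[OF evens_odds_subset(2)]
  by (simp_all add: label_graph_map srcs_map_graph tgts_map_graph)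

lemma lookup_mult_mult_left:
  assumes T: "T1 \<in> diagrams n B" "T2 \<in> diagrams n B" "T3 \<in> diagrams n B" and Z: "partial_bij Z"
  shows "lookup (lin (\<lambda>w. diagram_mult n A B w T3) (diagram_mult n A B T1 T2)) Z =
    loop_factor A B (glue n T1 T2) * graph_coeff (glue n (net (glue n T1 T2)) T3) Z"
proof -
  note p3 = diagram_pre_diagram[OF T(3)]
  note h = label_graph_half[OF p3]
  show ?thesis
    unfolding diagram_mult_expansion[of n T1 T2] lin_expansion lookup_sum lookup_scale glue_map_graph[of n _ T3]
    by (rule expand_net_glue[OF T(1,2)])
      (use h inj_upper[OF evens_odds_subset(1)] inj_upper[OF evens_odds_subset(2)] image_points(3,4)
        lookup_diagram_mult[OF diagram_pre_diagram p3 Z] in \<open>simp_all add: glue_map_graph\<close>)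
qed

lemma lookup_mult_mult_right:
  assumes T: "T1 \<in> diagrams n B" "T2 \<in> diagrams n B" "T3 \<in> diagrams n B" and Z: "partial_bij Z"
  shows "lookup (lin (diagram_mult n A B T1) (diagram_mult n A B T2 T3)) Z =
    loop_factor A B (glue n T2 T3) * graph_coeff (glue n T1 (net (glue n T2 T3))) Z"
proof -
  note p1 = diagram_pre_diagram[OF T(1)]
  note h = label_graph_half[OF p1]
  have g: "glue n T1 D = map_graph (lower_point n) D \<union> map_graph (upper_point n) T1" for D
    by (auto simp: glue_map_graph)
  show ?thesis
    unfolding diagram_mult_expansion[of n T2 T3] lin_expansion lookup_sum lookup_scale g
    by (rule expand_net_glue[OF T(2,3)])
      (use h inj_lower[OF evens_odds_subset(1)] inj_lower[OF evens_odds_subset(2)] image_points(3,4)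
        lookup_diagram_mult[OF p1 diagram_pre_diagram Z] in \<open>simp_all add: g Int_commute\<close>)
qed

lemma verts_subset_bound: "verts E \<subseteq> {1..k} \<Longrightarrow> v \<in> verts E \<Longrightarrow> v \<le> k"
  by auto

lemma lin_mult_assoc:
  assumes T: "T1 \<in> diagrams n B" "T2 \<in> diagrams n B" "T3 \<in> diagrams n B"
  shows "lin (\<lambda>w. diagram_mult n A B w T3) (diagram_mult n A B T1 T2) =
    lin (diagram_mult n A B T1) (diagram_mult n A B T2 T3)"
proof (rule poly_mapping_eqI)
  fix Z
  let ?L = "lin (\<lambda>w. diagram_mult n A B w T3) (diagram_mult n A B T1 T2)"
  let ?R = "lin (diagram_mult n A B T1) (diagram_mult n A B T2 T3)"
  note p = diagram_pre_diagram[OF T(1)] diagram_pre_diagram[OF T(2)] diagram_pre_diagram[OF T(3)]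
  show "lookup ?L Z = lookup ?R Z"
  proof (cases "Z \<in> diagrams n B")
    case False
    have "keys ?L \<subseteq> diagrams n B" "keys ?R \<subseteq> diagrams n B"
      using keys_lin[of "\<lambda>w. diagram_mult n A B w T3" "diagram_mult n A B T1 T2"]
        keys_lin[of "diagram_mult n A B T1" "diagram_mult n A B T2 T3"] T keys_diagram_mult[of _ n] by blast+
    then have "Z \<notin> keys ?L" "Z \<notin> keys ?R" using False by auto
    then show ?thesis by (simp add: in_keys_iff)
  next
    case True
    then have Z: "partial_bij Z" by (simp add: diagrams_iff)
    let ?u = "upper_point n" and ?l = "lower_point n"
    \<comment> \<open>\<open>\<phi>\<close> and \<open>\<phi>'\<close> place the composites of the
      first two and of the last two diagrams inside the triple composite. In \<open>?G\<close> the
      lower interface is numbered from \<open>2n+1\<close> and the upper one from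
      \<open>3n+1\<close>, in \<open>?G'\<close> the other way round; \<open>\<psi>\<close>
      exchanges the two blocks.\<close>
    define \<phi> where "\<phi> v = (if v \<le> n then v else if v \<le> 2 * n then 4 * n + 1 - v else n + v)" for v
    define \<phi>' where "\<phi>' v = (if v \<le> n then 2 * n + v else if v \<le> 2 * n then v else n + v)" for v
    define \<psi> where "\<psi> v = (if v \<le> 2 * n then v else if v \<le> 3 * n then v + n else v - n)" for v
    let ?E = "glue n T1 T2" and ?E' = "glue n T2 T3"
    let ?F = "map_graph ?l T3" and ?F' = "map_graph ?u T1"
    let ?G = "map_graph \<phi> ?E \<union> ?F" and ?G' = "map_graph \<phi>' ?E' \<union> ?F'"
    note b = verts_subset_bound[OF verts_pre_diagram[OF p(1)]] verts_subset_bound[OF verts_pre_diagram[OF p(2)]]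
      verts_subset_bound[OF verts_pre_diagram[OF p(3)]]
    have pos: "v \<ge> 1" if "v \<in> verts T1 \<or> v \<in> verts T2 \<or> v \<in> verts T3" for v
      using that verts_pre_diagram[OF p(1)] verts_pre_diagram[OF p(2)] verts_pre_diagram[OF p(3)] by auto
    have map1: "map_graph \<psi> ?G = ?G'"
    proof -
      have 1: "map_graph (\<lambda>x. \<psi> (\<phi> (?u x))) T1 = map_graph ?u T1"
        by (rule map_graph_cong) (use b(1) pos in \<open>fastforce simp: \<psi>_def \<phi>_def upper_point_def\<close>)
      have 2: "map_graph (\<lambda>x. \<psi> (\<phi> (?l x))) T2 = map_graph (\<lambda>x. \<phi>' (?u x)) T2"
        by (rule map_graph_cong) (use b(2) pos in \<open>fastforce simp: \<psi>_def \<phi>_def \<phi>'_def upper_point_def lower_point_def\<close>)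
      have 3: "map_graph (\<lambda>x. \<psi> (?l x)) T3 = map_graph (\<lambda>x. \<phi>' (?l x)) T3"
        by (rule map_graph_cong) (use b(3) pos in \<open>fastforce simp: \<psi>_def \<phi>'_def lower_point_def\<close>)
      show ?thesis unfolding glue_map_graph map_graph_Un map_graph_comp 1 2 3 by blast
    qed
    have lE: "label_graph ?E" "label_graph ?E'" using label_graph_glue p by auto
    have vE: "verts ?E \<subseteq> {1..3 * n}" "verts ?E' \<subseteq> {1..3 * n}" using verts_glue p by auto
    have inj: "inj_on \<phi> {1..3 * n}" "inj_on \<phi>' {1..3 * n}"
      by (rule inj_onI, force simp: \<phi>_def \<phi>'_def split: if_splits)+
    have io: "srcs ?E \<subseteq> {1..3 * n}" "tgts ?E \<subseteq> {1..3 * n}" "srcs ?E' \<subseteq> {1..3 * n}" "tgts ?E' \<subseteq> {1..3 * n}"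
      using vE by (auto simp: verts_def)
    note hu = label_graph_half[OF p(1)] and hl = label_graph_half[OF p(3)]
    have img: "\<phi> ` srcs ?E \<inter> ?l ` evens n = {}" "\<phi> ` tgts ?E \<inter> ?l ` odds n = {}"
      "\<phi>' ` srcs ?E' \<inter> ?u ` evens n = {}" "\<phi>' ` tgts ?E' \<inter> ?u ` odds n = {}"
    proof -
      have e: "\<phi> v \<le> n \<or> 2 * n < \<phi> v \<and> odd (\<phi> v) \<or> 3 * n < \<phi> v" "n < \<phi>' v \<and> (\<phi>' v \<le> 2 * n \<or> even (\<phi>' v) \<or> 3 * n < \<phi>' v)"
        if "v \<in> evens n \<union> {2 * n + 1..3 * n}" for v
        using that by (auto simp: evens_def \<phi>_def \<phi>'_def)
      have o: "\<phi> v \<le> n \<or> 2 * n < \<phi> v \<and> even (\<phi> v) \<or> 3 * n < \<phi> v" "n < \<phi>' v \<and> (\<phi>' v \<le> 2 * n \<or> odd (\<phi>' v) \<or> 3 * n < \<phi>' v)"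
        if "v \<in> odds n \<union> {2 * n + 1..3 * n}" for v
        using that by (auto simp: odds_def \<phi>_def \<phi>'_def)
      have le: "n < ?l v \<and> (?l v \<le> 2 * n \<or> even (?l v) \<and> ?l v \<le> 3 * n)" "?u v \<le> n \<or> 2 * n < ?u v \<and> odd (?u v) \<and> ?u v \<le> 3 * n"
        if "v \<in> evens n" for v
        using that by (auto simp: evens_def upper_point_def lower_point_def)
      have lo: "n < ?l v \<and> (?l v \<le> 2 * n \<or> odd (?l v) \<and> ?l v \<le> 3 * n)" "?u v \<le> n \<or> 2 * n < ?u v \<and> even (?u v) \<and> ?u v \<le> 3 * n"
        if "v \<in> odds n" for v
        using that by (auto simp: odds_def upper_point_def lower_point_def)
      have nz: "\<phi> v \<noteq> ?l w" if "v \<in> evens n \<union> {2 * n + 1..3 * n}" "w \<in> evens n" for v w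
        using e(1)[OF that(1)] le(1)[OF that(2)] by auto
      then show "\<phi> ` srcs ?E \<inter> ?l ` evens n = {}" unfolding srcs_glue[OF p(1,2)] by blast
      have nz: "\<phi> v \<noteq> ?l w" if "v \<in> odds n \<union> {2 * n + 1..3 * n}" "w \<in> odds n" for v w
        using o(1)[OF that(1)] lo(1)[OF that(2)] by auto
      then show "\<phi> ` tgts ?E \<inter> ?l ` odds n = {}" unfolding tgts_glue[OF p(1,2)] by blast
      have nz: "\<phi>' v \<noteq> ?u w" if "v \<in> evens n \<union> {2 * n + 1..3 * n}" "w \<in> evens n" for v w
        using e(2)[OF that(1)] le(2)[OF that(2)] by auto
      then show "\<phi>' ` srcs ?E' \<inter> ?u ` evens n = {}" unfolding srcs_glue[OF p(2,3)] by blast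
      have nz: "\<phi>' v \<noteq> ?u w" if "v \<in> odds n \<union> {2 * n + 1..3 * n}" "w \<in> odds n" for v w
        using o(2)[OF that(1)] lo(2)[OF that(2)] by auto
      then show "\<phi>' ` tgts ?E' \<inter> ?u ` odds n = {}" unfolding tgts_glue[OF p(2,3)] by blast
    qed
    have lG: "label_graph ?G"
      by (rule label_graph_Un)
        (use img hl lE inj_on_subset[OF inj(1) io(1)] inj_on_subset[OF inj(1) io(2)] in
          \<open>auto simp: srcs_map_graph tgts_map_graph label_graph_map\<close>)
    have lG': "label_graph ?G'"
      by (rule label_graph_Un)
        (use img hu lE inj_on_subset[OF inj(2) io(3)] inj_on_subset[OF inj(2) io(4)] in
          \<open>auto simp: srcs_map_graph tgts_map_graph label_graph_map\<close>)
    have vF: "verts ?F \<subseteq> {1..3 * n}" "verts ?F' \<subseteq> {1..3 * n}"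
      unfolding verts_def hl hu by (auto simp: evens_def odds_def upper_point_def lower_point_def)
    have gG: "graph_coeff ?G Z = loop_factor A B ?E * graph_coeff (map_graph \<phi> (net ?E) \<union> ?F) Z"
    proof (rule graph_coeff_plug[OF lE(1) lG])
      fix m v assume m: "m \<in> inner ?E" "v \<in> verts ?E" "\<phi> v = \<phi> m"
      then have "m \<in> {1..3 * n}" "v \<in> {1..3 * n}" using vE(1) inner_glue[OF p(1,2)] by auto
      then show "v = m" using inj_onD[OF inj(1) m(3)] by blast
    next
      fix m assume "m \<in> inner ?E"
      then have "\<phi> m > 3 * n" using inner_glue[OF p(1,2)] by (auto simp: \<phi>_def)
      then show "\<phi> m \<notin> verts ?F" using vF(1) by auto
    qed
    have gG': "graph_coeff ?G' Z = loop_factor A B ?E' * graph_coeff (map_graph \<phi>' (net ?E') \<union> ?F') Z"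
    proof (rule graph_coeff_plug[OF lE(2) lG'])
      fix m v assume m: "m \<in> inner ?E'" "v \<in> verts ?E'" "\<phi>' v = \<phi>' m"
      then have "m \<in> {1..3 * n}" "v \<in> {1..3 * n}" using vE(2) inner_glue[OF p(2,3)] by auto
      then show "v = m" using inj_onD[OF inj(2) m(3)] by blast
    next
      fix m assume "m \<in> inner ?E'"
      then have "\<phi>' m > 3 * n" using inner_glue[OF p(2,3)] by (auto simp: \<phi>'_def)
      then show "\<phi>' m \<notin> verts ?F'" using vF(2) by auto
    qed
    have n1: "map_graph \<phi> (net ?E) \<union> ?F = glue n (net ?E) T3"
    proof -
      have "map_graph \<phi> (net ?E) = map_graph ?u (net ?E)"
        using verts_pre_diagram[OF pre_diagram_net_glue[OF p(1,2)]]
        by (intro map_graph_cong) (fastforce simp: \<phi>_def upper_point_def)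
      then show ?thesis by (simp add: glue_map_graph)
    qed
    have n2: "map_graph \<phi>' (net ?E') \<union> ?F' = glue n T1 (net ?E')"
    proof -
      have "map_graph \<phi>' (net ?E') = map_graph ?l (net ?E')"
        using verts_pre_diagram[OF pre_diagram_net_glue[OF p(2,3)]]
        by (intro map_graph_cong) (fastforce simp: \<phi>'_def lower_point_def)
      then show ?thesis by (auto simp: glue_map_graph)
    qed
    have vG: "verts ?G \<subseteq> {1..4 * n}"
    proof -
      have "\<phi> ` {1..3 * n} \<subseteq> {1..4 * n}" by (auto simp: \<phi>_def)
      then have "\<phi> ` verts ?E \<subseteq> {1..4 * n}" using vE(1) by blast
      then show ?thesis using vF(1) unfolding verts_Un verts_map_graph by auto
    qed
    have "graph_coeff (map_graph \<psi> ?G) Z = graph_coeff ?G Z"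
    proof (rule graph_coeff_relabel[OF lG])
      have "inj_on \<psi> {1..4 * n}" by (rule inj_onI) (auto simp: \<psi>_def split: if_splits)
      then show "inj_on \<psi> (verts ?G)" using vG by (rule inj_on_subset)
      fix v assume v: "v \<in> verts (net ?G)"
      have "net ?G = net (glue n (net ?E) T3)"
        unfolding n1[symmetric]
      proof (rule plug(2)[OF lE(1) lG])
        fix m v assume m: "m \<in> inner ?E" "v \<in> verts ?E" "\<phi> v = \<phi> m"
        then have "m \<in> {1..3 * n}" "v \<in> {1..3 * n}" using vE(1) inner_glue[OF p(1,2)] by auto
        then show "v = m" using inj_onD[OF inj(1) m(3)] by blast
      next
        fix m assume "m \<in> inner ?E"
        then have "\<phi> m > 3 * n" using inner_glue[OF p(1,2)] by (auto simp: \<phi>_def)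
        then show "\<phi> m \<notin> verts ?F" using vF(1) by auto
      qed
      then have "v \<le> 2 * n"
        using v verts_subset_bound[OF verts_pre_diagram[OF pre_diagram_net_glue[OF pre_diagram_net_glue[OF p(1,2)] p(3)]]]
        by simp
      then show "\<psi> v = v" by (simp add: \<psi>_def)
    qed
    then have "graph_coeff ?G Z = graph_coeff ?G' Z" unfolding map1 by simp
    then show ?thesis
      unfolding lookup_mult_mult_left[OF T Z] lookup_mult_mult_right[OF T Z] gG gG' n1 n2 .
  qed
qed

end

text \<open>\<open>crossing\<close> is not symmetric: its first arc begins further left. Reflection
  reverses the line, hence the two arcs change places.\<close>

lemma crossing_reflect:
  assumes "x \<le> N" "y \<le> N" "x' \<le> N" "y' \<le> N"
  shows "crossing (N + 1 - y, N + 1 - x) (N + 1 - y', N + 1 - x') \<longleftrightarrow> crossing (x', y') (x, y)"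
proof -
  have m: "min (N + 1 - b) (N + 1 - a) = N + 1 - max a b" "max (N + 1 - b) (N + 1 - a) = N + 1 - min a b"
    for a b by (auto simp: min_def max_def)
  have l: "N + 1 - a < N + 1 - b \<longleftrightarrow> b < a" if "a \<le> N" "b \<le> N" for a b using that by auto
  have b: "min a b \<le> N" "max a b \<le> N" if "a \<le> N" "b \<le> N" for a b using that by auto
  show ?thesis unfolding crossing_def case_prod_conv m
    using l[OF b(2)[OF assms(1,2)] b(2)[OF assms(3,4)]] l[OF b(2)[OF assms(3,4)] b(1)[OF assms(1,2)]]
      l[OF b(1)[OF assms(1,2)] b(1)[OF assms(3,4)]] by blast
qed

lemma reach_inner:
  assumes "partial_bij E" "x \<in> reach E x" shows "reach E x \<subseteq> inner E"
proof
  fix y assume y: "y \<in> reach E x"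
  then have "y \<in> reach E y" using reach_closed[OF assms y] by simp
  then show "y \<in> inner E" using walk_srcs[of E y] walk_tgts[of E y] by (auto simp: reach_def inner_def)
qed

text \<open>The last edge of a closed walk at \<open>x\<close> enters \<open>x\<close>, and only one
  edge does.\<close>

lemma reach_pred:
  assumes "partial_bij E" "x \<in> reach E x" "(p, x, a) \<in> E" shows "p \<in> reach E x"
proof -
  from assms(2) obtain w where w: "walk E x w x" by (auto simp: reach_def)
  show ?thesis
  proof (cases "length w = 1")
    case True
    then obtain b where "w = [b]" by (cases w) auto
    with w have "walk E x [b] x" by simp
    then have "(x, x, b) \<in> E" by (cases rule: walk.cases) (use walk_funpow(4)[OF assms(1)] in auto)
    then show ?thesis using partial_bijD(4)[OF assms(1,3)] assms(2) by metis
  next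
    case False
    have "w \<noteq> []" using walk_funpow(4)[OF assms(1) w] .
    with False have l: "0 < length w - 1" "length w - 1 < length w" by (cases w; auto)+
    from walk_split[OF w l] obtain z where z: "walk E x (take (length w - 1) w) z" "walk E z (drop (length w - 1) w) x"
      by blast
    have "\<exists>b. v = [b]" if "length v = 1" for v :: "'b list"
      using that by (cases v) auto
    moreover have "length (drop (length w - 1) w) = 1" using l by simp
    ultimately obtain b where "drop (length w - 1) w = [b]" by blast
    with z(2) have "walk E z [b] x" by simp
    then have "(z, x, b) \<in> E" by (cases rule: walk.cases) (use walk_funpow(4)[OF assms(1)] in auto)
    then have "z = p" using partial_bijD(4)[OF assms(1,3)] by metis
    then show ?thesis using z(1) by (auto simp: reach_def)
  qed
qed

lemma reach_succ:
  assumes "partial_bij E" "x \<in> reach E x" "(x, q, a) \<in> E" shows "q \<in> reach E x"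
  using walk.edge[OF assms(3)] by (auto simp: reach_def)

context int_table_algebra
begin

text \<open>One maximal walk from each initial vertex suffices, because such walks are
  unique.\<close>

lemma net_eqI:
  assumes "label_graph E"
    and "\<And>p q a. (p, q, a) \<in> N \<Longrightarrow> \<exists>w. walk E p w q \<and> a = word_label A w"
    and "srcs N = srcs E - tgts E" "tgts N \<subseteq> tgts E - srcs E"
  shows "net E = N"
proof (intro equalityI subsetI)
  fix e assume e: "e \<in> N"
  obtain p q a where [simp]: "e = (p, q, a)" by (cases e)
  have "p \<in> srcs N" "q \<in> tgts N" using e by (auto intro: srcsI tgtsI)
  then have "p \<notin> tgts E" "q \<notin> srcs E" using assms(3,4) by auto
  then show "e \<in> net E" using assms(2)[of p q a] e by (auto simp: net_def)
next
  fix e assume e: "e \<in> net E"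
  then obtain p q w where w: "e = (p, q, word_label A w)" "walk E p w q" "p \<notin> tgts E" "q \<notin> srcs E"
    by (auto simp: net_def)
  have "p \<in> srcs N" using w walk_srcs[OF w(2)] assms(3) by auto
  then obtain q' a' where e': "(p, q', a') \<in> N" by (auto simp: srcs_def)
  then obtain w' where w': "walk E p w' q'" "a' = word_label A w'" using assms(2) by blast
  have "q' \<notin> srcs E" using tgtsI[OF e'] assms(4) by auto
  then have "w = w' \<and> q = q'" using walk_ends_unique[OF label_graphD(1)[OF assms(1)] w(2) w'(1) w(4)] by simp
  then show "e \<in> N" using w(1) e' w'(2) by simp
qed

lemma match_coeff_basis:
  assumes "partial_bij N" "partial_bij Z" "\<And>p q a. (p, q, a) \<in> N \<Longrightarrow> a \<in> B"
  shows "match_coeff N Z = (if N = Z then 1 else 0)"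
proof (cases "shape N = shape Z")
  case True
  have "match_coeff N Z = (\<Prod>(p, q, a)\<in>N. if out_label Z p = a then 1 else 0)"
    unfolding match_coeff_def using True assms(3) by (auto intro!: prod.cong simp: kappa_basis)
  also have "\<dots> = (if \<forall>(p, q, a)\<in>N. out_label Z p = a then 1 else 0)"
  proof (cases "\<forall>(p, q, a)\<in>N. out_label Z p = a")
    case True
    then show ?thesis by (auto intro!: prod.neutral)
  next
    case False
    then obtain p q a where "(p, q, a) \<in> N" "out_label Z p \<noteq> a" by auto
    then have "\<exists>e\<in>N. (case e of (p, q, a) \<Rightarrow> if out_label Z p = a then 1 else (0::int)) = 0"
      by (intro bexI[of _ "(p, q, a)"]) auto
    from prod_zero[OF partial_bijD(1)[OF assms(1)] this] show ?thesis using False by (simp only: if_False)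
  qed
  also have "(\<forall>(p, q, a)\<in>N. out_label Z p = a) \<longleftrightarrow> N = Z"
  proof
    assume *: "\<forall>(p, q, a)\<in>N. out_label Z p = a"
    have "(p, q, a) \<in> N \<longleftrightarrow> (p, q, a) \<in> Z" for p q a
    proof
      assume e: "(p, q, a) \<in> N"
      then have "(p, q) \<in> shape Z" unfolding True[symmetric] by (auto simp: shape_def)
      then obtain a' where e': "(p, q, a') \<in> Z" by (auto simp: shape_def)
      then show "(p, q, a) \<in> Z" using out_label_eq[OF assms(2) e'] * e by auto
    next
      assume e: "(p, q, a) \<in> Z"
      then have "(p, q) \<in> shape N" unfolding True by (auto simp: shape_def)
      then obtain a' where e': "(p, q, a') \<in> N" by (auto simp: shape_def)
      then show "(p, q, a) \<in> N" using out_label_eq[OF assms(2) e] * by auto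
    qed
    then show "N = Z" by auto
  next
    assume "N = Z"
    then show "\<forall>(p, q, a)\<in>N. out_label Z p = a" using out_label_eq[OF assms(2)] by auto
  qed
  finally show ?thesis .
next
  case False
  then show ?thesis by (auto simp: match_coeff_def)
qed

section \<open>The unit\<close>

lemma noncrossing_identity: "noncrossing (\<lambda>p. p) (\<lambda>p. p) (identity_diagram n \<one>)"
  by (auto simp: noncrossing_def identity_diagram_def crossing_iff)

lemma identity_diagram_diagrams: "identity_diagram n \<one> \<in> diagrams n B"
  unfolding diagrams_iff
proof (intro conjI)
  show "partial_bij (identity_diagram n \<one>)"
    by (rule partial_bijI) (auto simp: identity_diagram_def)
  show "srcs (identity_diagram n \<one>) = evens n" by (auto simp: identity_diagram_def srcs_def evens_def)
  show "tgts (identity_diagram n \<one>) = odds n"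
  proof
    show "tgts (identity_diagram n \<one>) \<subseteq> odds n" by (auto simp: identity_diagram_def tgts_def odds_def)
    show "odds n \<subseteq> tgts (identity_diagram n \<one>)"
    proof
      fix q assume q: "q \<in> odds n"
      then have "(2 * n + 1 - q, 2 * n + 1 - (2 * n + 1 - q), \<one>) \<in> identity_diagram n \<one>"
        unfolding identity_diagram_def by (intro image_eqI[OF refl]) (auto simp: odds_def)
      moreover have "2 * n + 1 - (2 * n + 1 - q) = q" using q by (auto simp: odds_def)
      ultimately show "q \<in> tgts (identity_diagram n \<one>)" by (auto intro: tgtsI)
    qed
  qed
  show "noncrossing (\<lambda>p. p) (\<lambda>p. p) (identity_diagram n \<one>)" by (rule noncrossing_identity)
qed (auto simp: identity_diagram_def)

text \<open>Every strand is an edge of \<open>T\<close> prolonged by identity edges at its lower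
  ends. A loop would consist of middle vertices only, but the identity edge at a middle vertex joins
  it to an outer one.\<close>

lemma
  assumes T: "T \<in> diagrams n B"
  shows net_glue_identity: "net (glue n T (identity_diagram n \<one>)) = T"
    and loop_factor_glue_identity: "loop_factor A B (glue n T (identity_diagram n \<one>)) = 1"
proof -
  let ?I = "identity_diagram n \<one>" and ?E = "glue n T (identity_diagram n \<one>)"
  note p = diagram_pre_diagram[OF T] diagram_pre_diagram[OF identity_diagram_diagrams[of n]]
  note lE = label_graph_glue[OF p]
  note pb = label_graphD(1)[OF lE]
  have id1: "(2 * n + x, 2 * n + 1 - x, \<one>) \<in> ?E" if "even x" "1 \<le> x" "x \<le> n" for x
  proof -
    have "(x, 2 * n + 1 - x, \<one>) \<in> ?I" using that by (auto simp: identity_diagram_def)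
    from map_graphI[OF this, of "lower_point n"] have "(lower_point n x, lower_point n (2 * n + 1 - x), \<one>) \<in> ?E"
      by (simp add: glue_map_graph)
    moreover have "lower_point n x = 2 * n + x" "lower_point n (2 * n + 1 - x) = 2 * n + 1 - x"
      using that by (auto simp: lower_point_def)
    ultimately show ?thesis by simp
  qed
  have id2: "(x, 4 * n + 1 - x, \<one>) \<in> ?E" if "even x" "n < x" "x \<le> 2 * n" for x
  proof -
    have "(x, 2 * n + 1 - x, \<one>) \<in> ?I" using that by (auto simp: identity_diagram_def)
    from map_graphI[OF this, of "lower_point n"] have "(lower_point n x, lower_point n (2 * n + 1 - x), \<one>) \<in> ?E"
      by (simp add: glue_map_graph)
    moreover have "lower_point n x = x" "lower_point n (2 * n + 1 - x) = 4 * n + 1 - x"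
      using that by (auto simp: lower_point_def)
    ultimately show ?thesis by simp
  qed
  show "net ?E = T"
  proof (rule net_eqI[OF lE])
    show "srcs T = srcs ?E - tgts ?E" "tgts T \<subseteq> tgts ?E - srcs ?E"
      unfolding srcs_glue[OF p] tgts_glue[OF p] using p(1) evens_odds[of n] by (auto simp: pre_diagram_def)
    fix x y a assume e: "(x, y, a) \<in> T"
    have x: "x \<in> evens n" and y: "y \<in> odds n" using srcsI[OF e] tgtsI[OF e] p(1) by (auto simp: pre_diagram_def)
    have a: "a \<in> carrier A" using e p(1) label_graphD(2) by (auto simp: pre_diagram_def)
    have e': "(upper_point n x, upper_point n y, a) \<in> ?E"
      using map_graphI[OF e] by (auto simp: glue_map_graph)
    have start: "walk ?E x (u @ v) z \<and> word_label A (u @ v) = word_label A v"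
      if "walk ?E (upper_point n x) v z" "set v \<subseteq> carrier A" "u = (if x \<le> n then [] else [\<one>])" for u v z
    proof (cases "x \<le> n")
      case True then show ?thesis using that by (simp add: upper_point_def)
    next
      case False
      then have "(x, upper_point n x, \<one>) \<in> ?E" using id2[of x] x by (auto simp: evens_def upper_point_def)
      then show ?thesis using that False by (auto intro: walk.step simp: word_label_Cons)
    qed
    show "\<exists>w. walk ?E x w y \<and> a = word_label A w"
    proof (cases "y \<le> n")
      case True
      then have "walk ?E (upper_point n x) [a] y" using walk.edge[OF e'] by (simp add: upper_point_def)
      from start[OF this _ refl] a show ?thesis by (auto simp: word_label_Cons)
    next
      case False
      let ?z = "2 * n + 1 - y"
      have z: "even ?z" "1 \<le> ?z" "?z \<le> n" "2 * n + 1 - ?z = y" "upper_point n y = 2 * n + ?z"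
        using y False by (auto simp: odds_def upper_point_def)
      have "(upper_point n y, y, \<one>) \<in> ?E" using id1[OF z(1-3)] unfolding z(4,5) .
      then have "walk ?E (upper_point n x) [a, \<one>] y" by (intro walk.step[OF e'] walk.edge)
      from start[OF this _ refl] a show ?thesis by (auto simp: word_label_Cons)
    qed
  qed
  have "x \<notin> reach ?E x" for x
  proof
    assume x: "x \<in> reach ?E x"
    note ri = reach_inner[OF pb x, unfolded inner_glue[OF p]]
    have xm: "x \<in> {2 * n + 1..3 * n}" using ri x by blast
    show False
    proof (cases "even x")
      case True
      then have "(2 * n + (x - 2 * n), 2 * n + 1 - (x - 2 * n), \<one>) \<in> ?E" using xm by (intro id1) auto
      then have "(x, 2 * n + 1 - (x - 2 * n), \<one>) \<in> ?E" using xm by simp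
      from reach_succ[OF pb x this] ri have "2 * n + 1 - (x - 2 * n) \<in> {2 * n + 1..3 * n}" by blast
      with xm show False unfolding atLeastAtMost_iff by linarith
    next
      case False
      then have "(4 * n + 1 - x, 4 * n + 1 - (4 * n + 1 - x), \<one>) \<in> ?E" using xm by (intro id2) auto
      then have "(4 * n + 1 - x, x, \<one>) \<in> ?E" using xm by simp
      from reach_pred[OF pb x this] ri have "4 * n + 1 - x \<in> {2 * n + 1..3 * n}" by blast
      with xm show False unfolding atLeastAtMost_iff by linarith
    qed
  qed
  then have "loops ?E = {}" by (auto simp: loops_reach)
  then show "loop_factor A B ?E = 1" by (simp add: loop_factor_def)
qed

lemma poly_mapping_eq_on_diagrams:
  assumes "keys f \<subseteq> diagrams n B" "keys g \<subseteq> diagrams n B"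
    "\<And>Z. Z \<in> diagrams n B \<Longrightarrow> lookup f Z = lookup g Z"
  shows "f = g"
proof (rule poly_mapping_eqI)
  fix Z show "lookup f Z = lookup g Z"
  proof (cases "Z \<in> diagrams n B")
    case False
    then have "Z \<notin> keys f" "Z \<notin> keys g" using assms by auto
    then show ?thesis by (simp add: in_keys_iff)
  qed (rule assms(3))
qed

lemma diagram_mult_identity_right:
  assumes T: "T \<in> diagrams n B"
  shows "diagram_mult n A B T (identity_diagram n \<one>) = single T 1"
proof (rule poly_mapping_eq_on_diagrams)
  show "keys (diagram_mult n A B T (identity_diagram n \<one>)) \<subseteq> diagrams n B"
    by (rule keys_diagram_mult[OF T identity_diagram_diagrams])
  fix Z assume Z: "Z \<in> diagrams n B"
  have "match_coeff T Z = (if T = Z then 1 else 0)"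
    by (rule match_coeff_basis) (use T Z in \<open>auto simp: diagrams_iff\<close>)
  moreover have "lookup (diagram_mult n A B T (identity_diagram n \<one>)) Z =
     graph_coeff (glue n T (identity_diagram n \<one>)) Z"
    by (rule lookup_diagram_mult) (use T Z diagram_pre_diagram identity_diagram_diagrams in \<open>auto simp: diagrams_iff\<close>)
  ultimately show "lookup (diagram_mult n A B T (identity_diagram n \<one>)) Z =
     lookup (single T 1) Z"
    by (simp add: graph_coeff_def net_glue_identity[OF T] loop_factor_glue_identity[OF T] lookup_single when_def)
qed (use T in auto)

section \<open>Reflection of diagrams and the involution\<close>

definition flip :: "nat \<Rightarrow> 'a diagram \<Rightarrow> 'a diagram" where
  "flip n D = map_graph (\<lambda>p. 2 * n + 1 - p) (opposite D)"

lemma flip_image: "flip n D = (\<lambda>(p, q, a). (2 * n + 1 - q, 2 * n + 1 - p, bar a)) ` D"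
  unfolding flip_def opposite_def map_graph_def image_image by (rule image_cong) auto

text \<open>The reflection exchanges the parities; this is why \<open>flip\<close> also reverses the
  orientation.\<close>

lemma reflect_evens_odds:
  "(\<lambda>p. 2 * n + 1 - p) ` evens n = odds n" "(\<lambda>p. 2 * n + 1 - p) ` odds n = evens n"
proof -
  have 1: "(\<lambda>p. 2 * n + 1 - p) ` evens n \<subseteq> odds n" "(\<lambda>p. 2 * n + 1 - p) ` odds n \<subseteq> evens n"
    by (auto simp: evens_def odds_def)
  have 2: "2 * n + 1 - (2 * n + 1 - p) = p" if "p \<in> evens n \<or> p \<in> odds n" for p
    using that by (auto simp: evens_def odds_def)
  have "odds n \<subseteq> (\<lambda>p. 2 * n + 1 - p) ` evens n"
  proof
    fix q assume "q \<in> odds n"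
    then show "q \<in> (\<lambda>p. 2 * n + 1 - p) ` evens n"
      using 1 2 by (intro image_eqI[of _ _ "2 * n + 1 - q"]) auto
  qed
  moreover have "evens n \<subseteq> (\<lambda>p. 2 * n + 1 - p) ` odds n"
  proof
    fix q assume "q \<in> evens n"
    then show "q \<in> (\<lambda>p. 2 * n + 1 - p) ` odds n"
      using 1 2 by (intro image_eqI[of _ _ "2 * n + 1 - q"]) auto
  qed
  ultimately show "(\<lambda>p. 2 * n + 1 - p) ` evens n = odds n" "(\<lambda>p. 2 * n + 1 - p) ` odds n = evens n"
    using 1 by auto
qed

lemma inj_reflect:
  fixes n :: nat
  assumes "S \<subseteq> {1..2 * n}" shows "inj_on (\<lambda>p. 2 * n + 1 - p) S"
proof (rule inj_onI)
  fix x y assume "x \<in> S" "y \<in> S" "2 * n + 1 - x = 2 * n + 1 - y"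
  moreover from this assms have "x \<in> {1..2 * n}" "y \<in> {1..2 * n}" by blast+
  ultimately show "x = y" by auto
qed

lemma pre_diagram_flip: "pre_diagram n D \<Longrightarrow> pre_diagram n (flip n D)"
proof -
  assume D: "pre_diagram n D"
  then have "label_graph (opposite D)" "srcs (opposite D) = odds n" "tgts (opposite D) = evens n"
    by (simp_all add: pre_diagram_def label_graph_opposite)
  then show ?thesis
    unfolding pre_diagram_def flip_def srcs_map_graph tgts_map_graph
    using inj_reflect[OF evens_odds_subset(1)] inj_reflect[OF evens_odds_subset(2)] reflect_evens_odds
    by (metis label_graph_map)
qed

lemma flip_diagrams:
  assumes D: "D \<in> diagrams n B" shows "flip n D \<in> diagrams n B"
proof -
  have "pre_diagram n (flip n D)" by (intro pre_diagram_flip diagram_pre_diagram D)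
  moreover have "a \<in> B" if "(p, q, a) \<in> flip n D" for p q a
    using that D T2_basis by (auto simp: flip_image diagrams_iff)
  moreover have "noncrossing (\<lambda>p. p) (\<lambda>p. p) (flip n D)"
    unfolding noncrossing_def
  proof (intro allI impI)
    fix p q a p' q' a' assume "(p, q, a) \<in> flip n D" "(p', q', a') \<in> flip n D"
    then obtain x y b x' y' b' where e: "(x, y, b) \<in> D" "(x', y', b') \<in> D"
      "p = 2 * n + 1 - y" "q = 2 * n + 1 - x" "p' = 2 * n + 1 - y'" "q' = 2 * n + 1 - x'"
      by (auto simp: flip_image)
    have nc: "noncrossing (\<lambda>p. p) (\<lambda>p. p) D" using D by (simp add: diagrams_iff)
    have "x \<in> evens n" "x' \<in> evens n" "y \<in> odds n" "y' \<in> odds n"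
      using D srcsI[OF e(1)] srcsI[OF e(2)] tgtsI[OF e(1)] tgtsI[OF e(2)] by (auto simp: diagrams_iff)
    then have "x \<le> 2 * n" "x' \<le> 2 * n" "y \<le> 2 * n" "y' \<le> 2 * n" by (auto simp: evens_def odds_def)
    then show "\<not> crossing (p, q) (p', q')"
      unfolding e(3-6) using crossing_reflect noncrossingD[OF nc e(2,1)] by blast
  qed
  ultimately show ?thesis by (auto simp: diagrams_iff pre_diagram_def label_graphD)
qed

lemma flip_flip: "pre_diagram n D \<Longrightarrow> flip n (flip n D) = D"
proof -
  assume D: "pre_diagram n D"
  have "flip n (flip n D) = (\<lambda>e. e) ` D"
    unfolding flip_image image_image
  proof (rule image_cong[OF refl])
    fix e assume e: "e \<in> D"
    obtain p q a where [simp]: "e = (p, q, a)" by (cases e)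
    have "p \<in> verts D" "q \<in> verts D" "a \<in> carrier A"
      using e D by (auto simp: verts_def pre_diagram_def intro: srcsI tgtsI dest: label_graphD(2))
    then show "(case case e of (p, q, a) \<Rightarrow> (2 * n + 1 - q, 2 * n + 1 - p, bar a) of
          (p, q, a) \<Rightarrow> (2 * n + 1 - q, 2 * n + 1 - p, bar a)) = e"
      using verts_pre_diagram[OF D] by fastforce
  qed
  then show ?thesis by simp
qed

lemma match_coeff_flip:
  assumes N: "pre_diagram n N" and Z: "Z \<in> diagrams n B"
  shows "match_coeff (flip n N) (flip n Z) = match_coeff N Z"
proof -
  note pZ = diagram_pre_diagram[OF Z]
  let ?r = "\<lambda>p. 2 * n + 1 - p"
  have sh: "shape (flip n D) = (\<lambda>(p, q). (?r q, ?r p)) ` shape D" for D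
    by (force simp: shape_def flip_image)
  have sh': "shape D = (\<lambda>(p, q). (?r q, ?r p)) ` shape (flip n D)" if "pre_diagram n D" for D
    using sh[of "flip n D"] flip_flip[OF that] by simp
  have iff: "shape (flip n N) = shape (flip n Z) \<longleftrightarrow> shape N = shape Z"
    using sh sh'[OF N] sh'[OF pZ] by metis
  have pb: "partial_bij N" "partial_bij Z" "partial_bij (flip n Z)"
    using N pZ pre_diagram_flip[OF pZ] by (auto simp: pre_diagram_def label_graphD)
  show ?thesis
  proof (cases "shape N = shape Z")
    case True
    have inj: "inj_on (\<lambda>(p, q, a). (?r q, ?r p, bar a)) N"
    proof (rule inj_onI)
      fix e e' assume e: "e \<in> N" "e' \<in> N" "(case e of (p, q, a) \<Rightarrow> (?r q, ?r p, bar a)) = (case e' of (p, q, a) \<Rightarrow> (?r q, ?r p, bar a))"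
      obtain p q a p' q' a' where [simp]: "e = (p, q, a)" "e' = (p', q', a')" by (cases e, cases e')
      have m: "(p, q, a) \<in> N" "(p', q', a') \<in> N" using e(1,2) by simp_all
      have "p \<in> evens n" "p' \<in> evens n"
        using srcsI[OF m(1)] srcsI[OF m(2)] N by (simp_all add: pre_diagram_def)
      then have "p \<in> {1..2 * n}" "p' \<in> {1..2 * n}" using evens_odds_subset(1) by blast+
      then have [simp]: "p' = p" using e(3) by auto
      have "(p, q', a') \<in> N" using m(2) by simp
      from partial_bijD(2,3)[OF pb(1) m(1) this] show "e = e'" by simp
    qed
    have "match_coeff (flip n N) (flip n Z) = (\<Prod>(p, q, a)\<in>flip n N. \<kappa> (out_label (flip n Z) p) a)"
      using True iff by (simp add: match_coeff_def)
    also have "\<dots> = (\<Prod>(p, q, a)\<in>N. \<kappa> (out_label (flip n Z) (?r q)) (bar a))"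
      unfolding flip_image[of n N] by (subst prod.reindex[OF inj]) (simp add: case_prod_unfold)
    also have "\<dots> = (\<Prod>(p, q, a)\<in>N. \<kappa> (out_label Z p) a)"
    proof (rule prod.cong[OF refl])
      fix e assume e: "e \<in> N"
      obtain p q a where [simp]: "e = (p, q, a)" by (cases e)
      have "(p, q) \<in> shape Z" using e unfolding True[symmetric] by (auto simp: shape_def)
      then obtain b where b: "(p, q, b) \<in> Z" by (auto simp: shape_def)
      then have "(?r q, ?r p, bar b) \<in> flip n Z" by (force simp: flip_image)
      then have "out_label (flip n Z) (?r q) = bar b" by (rule out_label_eq[OF pb(3)])
      moreover have "out_label Z p = b" by (rule out_label_eq[OF pb(2) b])
      moreover have "b \<in> B" "a \<in> carrier A" using b Z e N label_graphD(2) by (auto simp: diagrams_iff pre_diagram_def)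
      ultimately show "(case e of (p, q, a) \<Rightarrow> \<kappa> (out_label (flip n Z) (?r q)) (bar a)) = (case e of (p, q, a) \<Rightarrow> \<kappa> (out_label Z p) a)"
        by (simp add: kappa_bar)
    qed
    also have "\<dots> = match_coeff N Z" using True by (simp add: match_coeff_def)
    finally show ?thesis .
  next
    case False
    then show ?thesis using iff by (simp add: match_coeff_def)
  qed
qed

lemma
  assumes T: "pre_diagram n T1" "pre_diagram n T2"
  shows loop_factor_glue_flip: "loop_factor A B (glue n (flip n T2) (flip n T1)) = loop_factor A B (glue n T1 T2)"
    and net_glue_flip: "net (glue n (flip n T2) (flip n T1)) = flip n (net (glue n T1 T2))"
proof -
  \<comment> \<open>Only the outer points are reflected: the middle vertices keep their numbers when
    the two factors change places.\<close>
  define \<psi> where "\<psi> v = (if v \<le> 2 * n then 2 * n + 1 - v else v)" for v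
  let ?G = "glue n T1 T2"
  note lG = label_graph_glue[OF T]
  have G: "glue n (flip n T2) (flip n T1) = map_graph \<psi> (opposite ?G)"
  proof -
    have v: "v \<ge> 1 \<and> v \<le> 2 * n" if "v \<in> verts T1 \<or> v \<in> verts T2" for v
      using that verts_pre_diagram[OF T(1)] verts_pre_diagram[OF T(2)] by auto
    have 1: "map_graph (\<lambda>x. upper_point n (2 * n + 1 - x)) (opposite T2) = map_graph (\<lambda>x. \<psi> (lower_point n x)) (opposite T2)"
      by (rule map_graph_cong) (use v in \<open>fastforce simp: \<psi>_def upper_point_def lower_point_def\<close>)
    have 2: "map_graph (\<lambda>x. lower_point n (2 * n + 1 - x)) (opposite T1) = map_graph (\<lambda>x. \<psi> (upper_point n x)) (opposite T1)"
      by (rule map_graph_cong) (use v in \<open>fastforce simp: \<psi>_def upper_point_def lower_point_def\<close>)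
    show ?thesis
      unfolding glue_map_graph opposite_Un opposite_map_graph map_graph_Un map_graph_comp flip_def 1 2 by blast
  qed
  have inj: "inj_on \<psi> (verts (opposite ?G))"
  proof (rule inj_on_subset)
    show "inj_on \<psi> {1..3 * n}" by (rule inj_onI) (auto simp: \<psi>_def split: if_splits)
    show "verts (opposite ?G) \<subseteq> {1..3 * n}" using verts_glue[OF T] by simp
  qed
  note lo = label_graph_opposite[OF lG]
  show "loop_factor A B (glue n (flip n T2) (flip n T1)) = loop_factor A B ?G"
    unfolding G loop_factor_relabel[OF lo inj] by (rule loop_factor_opposite[OF lG])
  have "map_graph \<psi> (opposite (net ?G)) = flip n (net ?G)"
    unfolding flip_def using verts_pre_diagram[OF pre_diagram_net_glue[OF T]]
    by (intro map_graph_cong) (auto simp: \<psi>_def)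
  then show "net (glue n (flip n T2) (flip n T1)) = flip n (net ?G)"
    unfolding G net_relabel[OF lo inj] net_opposite[OF lG] .
qed

lemma graph_coeff_flip:
  assumes T: "pre_diagram n T1" "pre_diagram n T2" and Z: "Z \<in> diagrams n B"
  shows "graph_coeff (glue n (flip n T2) (flip n T1)) (flip n Z) = graph_coeff (glue n T1 T2) Z"
  unfolding graph_coeff_def loop_factor_glue_flip[OF T] net_glue_flip[OF T]
    match_coeff_flip[OF pre_diagram_net_glue[OF T] Z] ..

definition star :: "nat \<Rightarrow> ('a diagram \<Rightarrow>\<^sub>0 laurent) \<Rightarrow> ('a diagram \<Rightarrow>\<^sub>0 laurent)" where
  "star n = lin (\<lambda>D. single (flip n D) 1)"

lemma star_single: "star n (single D c) = single (flip n D) c"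
  by (simp add: star_def)

lemma keys_star:
  assumes "keys f \<subseteq> diagrams n B" shows "keys (star n f) \<subseteq> diagrams n B"
  using keys_lin[of "\<lambda>D. single (flip n D) (1::laurent)" f] assms flip_diagrams
  unfolding star_def by fastforce

lemma lookup_star:
  assumes f: "keys f \<subseteq> diagrams n B" and Z: "Z \<in> diagrams n B"
  shows "lookup (star n f) (flip n Z) = lookup f Z"
proof -
  have "lookup (star n f) (flip n Z) =
    (\<Sum>D\<in>keys f. if D = Z then lookup f Z else 0)"
    unfolding star_def lookup_lin lookup_single
  proof (rule sum.cong[OF refl])
    fix D assume "D \<in> keys f"
    then have "flip n D = flip n Z \<longleftrightarrow> D = Z"
      using f Z flip_flip[OF diagram_pre_diagram] by (metis subsetD)
    then show "lookup f D * (1 when flip n D = flip n Z) = (if D = Z then lookup f Z else 0)"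
      by (simp add: when_def)
  qed
  also have "\<dots> = lookup f Z" by (simp add: in_keys_iff)
  finally show ?thesis .
qed

lemma star_star:
  assumes f: "keys f \<subseteq> diagrams n B" shows "star n (star n f) = f"
proof -
  have "star n (star n f) = lin (\<lambda>D. single (flip n (flip n D)) 1) f"
    by (simp add: star_def lin_lin)
  also have "\<dots> = lin (\<lambda>D. single D 1) f"
    using f by (intro lin_cong) (auto simp: flip_flip[OF diagram_pre_diagram])
  finally show ?thesis by (simp add: lin_basis)
qed

lemma star_diagram_mult:
  assumes T: "T1 \<in> diagrams n B" "T2 \<in> diagrams n B"
  shows "star n (diagram_mult n A B T1 T2) = diagram_mult n A B (flip n T2) (flip n T1)"
proof (rule poly_mapping_eq_on_diagrams)
  note p = diagram_pre_diagram[OF T(1)] diagram_pre_diagram[OF T(2)]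
  show "keys (star n (diagram_mult n A B T1 T2)) \<subseteq> diagrams n B"
    by (intro keys_star keys_diagram_mult T)
  show "keys (diagram_mult n A B (flip n T2) (flip n T1)) \<subseteq> diagrams n B"
    by (intro keys_diagram_mult flip_diagrams T)
  fix Z assume Z: "Z \<in> diagrams n B"
  \<comment> \<open>Coefficients of a starred element are known at reflected diagrams, so
    \<open>Z\<close> is written as the reflection of \<open>?Z\<close>.\<close>
  let ?Z = "flip n Z"
  have Z': "?Z \<in> diagrams n B" "flip n ?Z = Z"
    using flip_diagrams[OF Z] flip_flip[OF diagram_pre_diagram[OF Z]] by auto
  have pb: "partial_bij Z" "partial_bij ?Z" using Z Z' by (auto simp: diagrams_iff)
  have "lookup (star n (diagram_mult n A B T1 T2)) (flip n ?Z) = lookup (diagram_mult n A B T1 T2) ?Z"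
    by (rule lookup_star[OF keys_diagram_mult[OF T] Z'(1)])
  also have "\<dots> = graph_coeff (glue n T1 T2) ?Z" by (rule lookup_diagram_mult[OF p pb(2)])
  also have "\<dots> = graph_coeff (glue n (flip n T2) (flip n T1)) (flip n ?Z)"
    by (rule graph_coeff_flip[OF p Z'(1), symmetric])
  also have "\<dots> = lookup (diagram_mult n A B (flip n T2) (flip n T1)) (flip n ?Z)"
    unfolding Z'(2) by (rule lookup_diagram_mult[symmetric]) (use pb p pre_diagram_flip in auto)
  finally show "lookup (star n (diagram_mult n A B T1 T2)) Z =
      lookup (diagram_mult n A B (flip n T2) (flip n T1)) Z" unfolding Z'(2) .
qed

lemma flip_identity: "flip n (identity_diagram n \<one>) = identity_diagram n \<one>"
  unfolding flip_image identity_diagram_def image_image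
proof (rule image_cong[OF refl])
  fix p assume "p \<in> {p \<in> {1..2 * n}. even p}"
  then show "(case (p, 2 * n + 1 - p, \<one>) of (p, q, a) \<Rightarrow> (2 * n + 1 - q, 2 * n + 1 - p, bar a)) = (p, 2 * n + 1 - p, \<one>)"
    by simp
qed

text \<open>The reflection fixes the identity diagram, so the left unit law is the image of the
  right one under \<open>star\<close>.\<close>

lemma diagram_mult_identity_left:
  assumes T: "T \<in> diagrams n B"
  shows "diagram_mult n A B (identity_diagram n \<one>) T = single T 1"
proof -
  have "diagram_mult n A B (identity_diagram n \<one>) T =
      diagram_mult n A B (flip n (identity_diagram n \<one>)) (flip n (flip n T))"
    by (simp add: flip_identity flip_flip[OF diagram_pre_diagram[OF T]])
  also have "\<dots> = star n (diagram_mult n A B (flip n T) (identity_diagram n \<one>))"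
    by (rule star_diagram_mult[symmetric]) (intro flip_diagrams identity_diagram_diagrams T)+
  also have "\<dots> = single T 1"
    by (simp add: diagram_mult_identity_right[OF flip_diagrams[OF T]] star_single flip_flip[OF diagram_pre_diagram[OF T]])
  finally show ?thesis .
qed

lemma diagram_algebra: "free_algebra_data (diagrams n B) (diagram_mult n A B) (identity_diagram n \<one>)"
  by unfold_locales
    (simp_all add: identity_diagram_diagrams keys_diagram_mult diagram_mult_identity_left
      diagram_mult_identity_right lin_mult_assoc)

section \<open>The trace\<close>

definition tr :: "nat \<Rightarrow> ('a diagram \<Rightarrow>\<^sub>0 laurent) \<Rightarrow> laurent" where
  "tr n f = (\<Sum>D\<in>keys f. lookup f D * loop_factor A B (close_up n D))"

lemma P_trace_tr: "P_trace n A B f = vpow (- int n) * tr n f"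
  by (simp add: P_trace_def tr_def)

lemma tr_superset:
  "finite W \<Longrightarrow> keys f \<subseteq> W \<Longrightarrow>
     tr n f = (\<Sum>D\<in>W. lookup f D * loop_factor A B (close_up n D))"
  unfolding tr_def by (rule sum.mono_neutral_left) (auto simp: in_keys_iff)

lemma tr_add: "tr n (f + g) = tr n f + tr n g"
proof -
  let ?W = "keys f \<union> keys g"
  have "finite ?W" by simp
  then show ?thesis using keys_add[of f g]
    by (simp add: tr_superset[of ?W f] tr_superset[of ?W g] tr_superset[of ?W "f + g"] lookup_add
        distrib_right sum.distrib)
qed

lemma tr_scale: "tr n (scale r f) = r * tr n f"
  unfolding tr_superset[OF finite_keys keys_scale] by (simp add: tr_def sum_distrib_left mult.assoc)

lemma tr_zero [simp]: "tr n 0 = 0"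
  by (simp add: tr_def)

lemma tr_sum: "tr n (sum h S) = (\<Sum>x\<in>S. tr n (h x))"
  by (induction S rule: infinite_finite_induct) (auto simp: tr_add)

lemma tr_single: "tr n (single D c) = c * loop_factor A B (close_up n D)"
  by (simp add: tr_def)

lemma tr_lin: "tr n (lin h f) = (\<Sum>D\<in>keys f. lookup f D * tr n (h D))"
  by (simp add: lin_def tr_sum tr_scale)

lemma close_up_map_graph: "close_up n D = map_graph (closure_point n) D"
  by (simp add: close_up_def map_graph_def)

text \<open>The points \<open>i\<close> and \<open>2n+1-i\<close> have opposite parity, so each
  vertex of the closure is the image of one source and of one target.\<close>

lemma closure_points:
  "inj_on (closure_point n) (evens n)" "inj_on (closure_point n) (odds n)"
  "closure_point n ` evens n = {1..n}" "closure_point n ` odds n = {1..n}"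
proof -
  have e: "closure_point n p = q \<longleftrightarrow> p = (if even q then q else 2 * n + 1 - q)" if "p \<in> evens n" "q \<in> {1..n}" for p q
    using that by (auto simp: evens_def closure_point_def)
  have o: "closure_point n p = q \<longleftrightarrow> p = (if odd q then q else 2 * n + 1 - q)" if "p \<in> odds n" "q \<in> {1..n}" for p q
    using that by (auto simp: odds_def closure_point_def)
  have r: "closure_point n p \<in> {1..n}" if "p \<in> {1..2 * n}" for p using that by (auto simp: closure_point_def)
  have r': "closure_point n p \<in> {1..n}" if "p \<in> evens n \<or> p \<in> odds n" for p
    using that r evens_odds_subset by blast
  show "inj_on (closure_point n) (evens n)"
  proof (rule inj_onI)
    fix x y assume "x \<in> evens n" "y \<in> evens n" "closure_point n x = closure_point n y"
    then show "x = y" using e[of x "closure_point n y"] e[of y "closure_point n y"] r'[of y] by simp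
  qed
  show "inj_on (closure_point n) (odds n)"
  proof (rule inj_onI)
    fix x y assume "x \<in> odds n" "y \<in> odds n" "closure_point n x = closure_point n y"
    then show "x = y" using o[of x "closure_point n y"] o[of y "closure_point n y"] r'[of y] by simp
  qed
  have "q \<in> closure_point n ` evens n" "q \<in> closure_point n ` odds n" if q: "q \<in> {1..n}" for q
  proof -
    let ?e = "if even q then q else 2 * n + 1 - q" and ?o = "if odd q then q else 2 * n + 1 - q"
    have eo: "?e \<in> evens n" "?o \<in> odds n" using q by (auto simp: evens_def odds_def)
    have "closure_point n ?e = q" "closure_point n ?o = q" using e[OF eo(1) q] o[OF eo(2) q] by simp_all
    then show "q \<in> closure_point n ` evens n" "q \<in> closure_point n ` odds n"
      using eo by (metis imageI)+
  qed
  then show "closure_point n ` evens n = {1..n}" "closure_point n ` odds n = {1..n}"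
    using r' by blast+
qed

lemma
  assumes "pre_diagram n D"
  shows label_graph_close_up: "label_graph (close_up n D)"
    and srcs_close_up: "srcs (close_up n D) = {1..n}"
    and tgts_close_up: "tgts (close_up n D) = {1..n}"
  using assms closure_points[of n]
  by (auto simp: close_up_map_graph pre_diagram_def label_graph_map srcs_map_graph tgts_map_graph)

text \<open>A closed graph has an empty net. Viewing its loop factor as a coefficient at the empty
  diagram makes the multilinear expansion available for traces.\<close>

lemma graph_coeff_closed:
  assumes "label_graph E" "srcs E = tgts E"
  shows "graph_coeff E {} = loop_factor A B E"
proof -
  have "srcs (net E) = {}" using srcs_net[OF assms(1)] assms(2) by simp
  then have "net E = {}" by (auto simp: srcs_def)
  then show ?thesis by (simp add: graph_coeff_def match_coeff_def)
qed

lemma label_graph_annular: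
  assumes p: "pre_diagram n T1" "pre_diagram n T2"
  shows "label_graph (map_graph (\<lambda>v. if v \<le> 2 * n then closure_point n v else v) (glue n T1 T2))"
proof -
    let ?c = "\<lambda>v. if v \<le> 2 * n then closure_point n v else v" and ?E = "glue n T1 T2"
    note lE = label_graph_glue[OF p]
    have le: "p \<le> 2 * n" if "p \<in> evens n \<or> p \<in> odds n" for p using that by (auto simp: evens_def odds_def)
    have cr: "closure_point n v \<in> {1..n}" if "v \<in> evens n \<or> v \<in> odds n" for v
      using that closure_points(3,4) by blast
    have "inj_on ?c (srcs ?E)" unfolding srcs_glue[OF p]
    proof (rule inj_onI)
      fix x y assume xy: "x \<in> evens n \<union> {2 * n + 1..3 * n}" "y \<in> evens n \<union> {2 * n + 1..3 * n}" "?c x = ?c y"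
      show "x = y"
        using xy inj_onD[OF closure_points(1), of n x y] cr[of x] cr[of y] le[of x] le[of y] by auto
    qed
    moreover have "inj_on ?c (tgts ?E)" unfolding tgts_glue[OF p]
    proof (rule inj_onI)
      fix x y assume xy: "x \<in> odds n \<union> {2 * n + 1..3 * n}" "y \<in> odds n \<union> {2 * n + 1..3 * n}" "?c x = ?c y"
      show "x = y"
        using xy inj_onD[OF closure_points(2), of n x y] cr[of x] cr[of y] le[of x] le[of y] by auto
    qed
    ultimately show ?thesis using label_graph_map[OF lE] by simp
qed

text \<open>By \<open>expand_net_glue\<close> and \<open>plug\<close> the intermediate expansion can
  be skipped. What remains is a graph on an annulus with the two interfaces \<open>1..n\<close> and
  \<open>2n+1..3n\<close>.\<close>

lemma tr_diagram_mult:
  assumes T: "T1 \<in> diagrams n B" "T2 \<in> diagrams n B"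
  shows "tr n (diagram_mult n A B T1 T2) =
     loop_factor A B (map_graph (\<lambda>v. if v \<le> 2 * n then closure_point n v else v) (glue n T1 T2))"
proof -
  note p = diagram_pre_diagram[OF T(1)] diagram_pre_diagram[OF T(2)]
  let ?c = "\<lambda>v. if v \<le> 2 * n then closure_point n v else v" and ?E = "glue n T1 T2"
  note pN = pre_diagram_net_glue[OF p]
  have cl: "graph_coeff (map_graph (closure_point n) D \<union> {}) {} = loop_factor A B (close_up n D)"
    if "pre_diagram n D" for D
    using graph_coeff_closed[OF label_graph_close_up[OF that]] srcs_close_up[OF that] tgts_close_up[OF that]
    by (simp add: close_up_map_graph)
  have "tr n (diagram_mult n A B T1 T2) =
    (\<Sum>f\<in>(\<Pi>\<^sub>E s\<in>strands n ?E. supp A B (strand_label A ?E s)).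
      loop_factor A B ?E * of_int (\<Prod>s\<in>strands n ?E. \<kappa> (f s) (strand_label A ?E s))
       * loop_factor A B (close_up n (graph_of (strands n ?E) f)))"
    unfolding diagram_mult_expansion expansion_def tr_sum tr_single ..
  also have "\<dots> = loop_factor A B ?E * graph_coeff (map_graph (closure_point n) (net ?E) \<union> {}) {}"
  proof (rule expand_net_glue[OF T closure_points(1,2)])
    show "label_graph {}" by (simp add: label_graph_def partial_bij_def)
    fix D assume "D \<in> diagrams n B"
    then show "loop_factor A B (close_up n D) = graph_coeff (map_graph (closure_point n) D \<union> {}) {}"
      using cl diagram_pre_diagram by simp
  qed auto
  also have "\<dots> = loop_factor A B ?E * loop_factor A B (map_graph ?c (net ?E) \<union> {})"
  proof -
    have "map_graph ?c (net ?E) = close_up n (net ?E)"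
      unfolding close_up_map_graph using verts_pre_diagram[OF pN] by (intro map_graph_cong) auto
    then show ?thesis using cl[OF pN] by simp
  qed
  also have "\<dots> = loop_factor A B (map_graph ?c ?E \<union> {})"
  proof (rule plug(1)[symmetric])
    show "label_graph ?E" by (rule label_graph_glue[OF p])
    show "label_graph (map_graph ?c ?E \<union> {})" using label_graph_annular[OF p] by simp
    fix m assume m: "m \<in> inner ?E"
    show "?c m \<notin> verts {}" by (simp add: verts_def)
    fix v assume v: "v \<in> verts ?E" "?c v = ?c m"
    have "2 * n < m" using m inner_glue[OF p] by auto
    then show "v = m" using v(2) by (auto simp: closure_point_def split: if_splits)
  qed
  finally show ?thesis by simp
qed

lemma tr_commute:
  assumes T: "T1 \<in> diagrams n B" "T2 \<in> diagrams n B"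
  shows "tr n (diagram_mult n A B T1 T2) = tr n (diagram_mult n A B T2 T1)"
proof -
  note p = diagram_pre_diagram[OF T(1)] diagram_pre_diagram[OF T(2)]
  let ?c = "\<lambda>v. if v \<le> 2 * n then closure_point n v else v"
  \<comment> \<open>Exchanges the two interfaces of the annulus.\<close>
  define \<psi> where "\<psi> v = (if v \<le> n then 2 * n + v else v - 2 * n)" for v
  let ?G = "map_graph ?c (glue n T1 T2)" and ?G' = "map_graph ?c (glue n T2 T1)"
  have v: "v \<ge> 1 \<and> v \<le> 2 * n" if "v \<in> verts T1 \<or> v \<in> verts T2" for v
    using that verts_pre_diagram[OF p(1)] verts_pre_diagram[OF p(2)] by auto
  have "map_graph \<psi> ?G = ?G'"
  proof -
    have 1: "map_graph (\<lambda>x. \<psi> (?c (upper_point n x))) T1 = map_graph (\<lambda>x. ?c (lower_point n x)) T1"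
      by (rule map_graph_cong) (use v in \<open>fastforce simp: \<psi>_def upper_point_def lower_point_def closure_point_def\<close>)
    have 2: "map_graph (\<lambda>x. \<psi> (?c (lower_point n x))) T2 = map_graph (\<lambda>x. ?c (upper_point n x)) T2"
      by (rule map_graph_cong) (use v in \<open>fastforce simp: \<psi>_def upper_point_def lower_point_def closure_point_def\<close>)
    show ?thesis unfolding glue_map_graph map_graph_Un map_graph_comp 1 2 by blast
  qed
  moreover have "loop_factor A B (map_graph \<psi> ?G) = loop_factor A B ?G"
  proof (rule loop_factor_relabel)
    show "label_graph ?G" by (rule label_graph_annular[OF p])
    have "verts ?G \<subseteq> {1..n} \<union> {2 * n + 1..3 * n}"
    proof -
      have "?c ` {1..3 * n} \<subseteq> {1..n} \<union> {2 * n + 1..3 * n}" by (auto simp: closure_point_def)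
      then show ?thesis using verts_glue[OF p] unfolding verts_map_graph by blast
    qed
    moreover have "inj_on \<psi> ({1..n} \<union> {2 * n + 1..3 * n})" by (rule inj_onI) (auto simp: \<psi>_def split: if_splits)
    ultimately show "inj_on \<psi> (verts ?G)" by (rule inj_on_subset[rotated])
  qed
  ultimately show ?thesis unfolding tr_diagram_mult[OF T] tr_diagram_mult[OF T(2,1)] by simp
qed

text \<open>Reflected points have the same image under \<open>closure_point\<close>; only
  orientation and labels change, and \<open>loop_factor_opposite\<close> removes that difference in
  the trace.\<close>

lemma close_up_flip:
  assumes "pre_diagram n D" shows "close_up n (flip n D) = opposite (close_up n D)"
proof -
  have "map_graph (\<lambda>x. closure_point n (2 * n + 1 - x)) (opposite D) = map_graph (closure_point n) (opposite D)"
    by (rule map_graph_cong) (use verts_pre_diagram[OF assms] in \<open>fastforce simp: closure_point_def\<close>)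
  then show ?thesis by (simp add: close_up_map_graph flip_def map_graph_comp opposite_map_graph)
qed

lemma tr_star:
  assumes "keys f \<subseteq> diagrams n B" shows "tr n (star n f) = tr n f"
  unfolding star_def tr_lin tr_single tr_def[of n f]
proof (rule sum.cong[OF refl])
  fix D assume "D \<in> keys f"
  then have p: "pre_diagram n D" using assms diagram_pre_diagram by blast
  show "lookup f D * (1 * loop_factor A B (close_up n (flip n D))) =
      lookup f D * loop_factor A B (close_up n D)"
    by (simp add: close_up_flip[OF p] loop_factor_opposite[OF label_graph_close_up[OF p]])
qed

end

section \<open>Tensor powers\<close>

context int_table_algebra
begin

text \<open>
  Through strings are alternately oriented upwards and downwards, so in the tensor power
  belonging to \<open>l\<close> through strings every second factor is the opposite algebra of \<open>A\<close>.
\<close>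

fun twist_mult :: "bool \<Rightarrow> 'a list \<Rightarrow> 'a list \<Rightarrow> 'a list" where
  "twist_mult c (x # xs) (y # ys) = (if c then x \<otimes> y else y \<otimes> x) # twist_mult (\<not> c) xs ys"
| "twist_mult c _ _ = []"

text \<open>A list of elements of \<open>A\<close> stands for a pure tensor. This is the coefficient
  in it of the basis tensor given by the first list.\<close>

fun list_coeff :: "'a list \<Rightarrow> 'a list \<Rightarrow> int" where
  "list_coeff (z # zs) (a # as) = \<kappa> z a * list_coeff zs as"
| "list_coeff [] [] = 1"
| "list_coeff _ _ = 0"

definition basis_lists :: "nat \<Rightarrow> 'a list set" where
  "basis_lists l = {xs. length xs = l \<and> set xs \<subseteq> B}"

definition list_expansion :: "'a list \<Rightarrow> 'a list \<Rightarrow>\<^sub>0 int" where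
  "list_expansion as = (\<Sum>zs\<in>listset (map (supp A B) as). single zs (list_coeff zs as))"

definition tensor_mult :: "'a list \<Rightarrow> 'a list \<Rightarrow> 'a list \<Rightarrow>\<^sub>0 int" where
  "tensor_mult xs ys = list_expansion (twist_mult True xs ys)"

lemma length_twist_mult: "length xs = length ys \<Longrightarrow> length (twist_mult c xs ys) = length xs"
  by (induction c xs ys rule: twist_mult.induct) auto

lemma set_twist_mult:
  "set xs \<subseteq> carrier A \<Longrightarrow> set ys \<subseteq> carrier A \<Longrightarrow> set (twist_mult c xs ys) \<subseteq> carrier A"
  by (induction c xs ys rule: twist_mult.induct) auto

lemma nth_twist_mult:
  "length xs = length ys \<Longrightarrow> i < length xs \<Longrightarrow>
     twist_mult c xs ys ! i = (if even i = c then xs ! i \<otimes> ys ! i else ys ! i \<otimes> xs ! i)"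
proof (induction c xs ys arbitrary: i rule: twist_mult.induct)
  case (1 c x xs y ys)
  then show ?case by (cases i) auto
qed auto

lemma finite_listset_supp: "finite (listset (map (supp A B) as))"
  by (induction as) (auto simp: set_Cons_def intro!: finite_image_set2)

lemma sum_listset_Cons:
  fixes h :: "'a list \<Rightarrow> 'c::comm_monoid_add"
  shows "(\<Sum>zs\<in>listset (map (supp A B) (a # as)). h zs) =
    (\<Sum>z\<in>supp A B a. \<Sum>zs\<in>listset (map (supp A B) as). h (z # zs))"
proof -
  have "listset (map (supp A B) (a # as)) =
      (\<lambda>(z, zs). z # zs) ` (supp A B a \<times> listset (map (supp A B) as))"
    by (auto simp: set_Cons_def)
  moreover have "inj_on (\<lambda>(z, zs). z # zs) (supp A B a \<times> listset (map (supp A B) as))"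
    by (auto intro!: inj_onI)
  ultimately show ?thesis
    by (simp add: sum.reindex sum.cartesian_product case_prod_unfold)
qed

lemma list_coeff_eq_0: "zs \<notin> listset (map (supp A B) as) \<Longrightarrow> list_coeff zs as = 0"
  by (induction zs as rule: list_coeff.induct) (auto simp: set_Cons_def supp_iff)

lemma list_coeff_neq_0: "zs \<in> listset (map (supp A B) as) \<Longrightarrow> list_coeff zs as \<noteq> 0"
  by (induction as arbitrary: zs) (auto simp: set_Cons_def supp_iff)

lemma lookup_list_expansion: "lookup (list_expansion as) zs = list_coeff zs as"
proof -
  have "lookup (list_expansion as) zs =
    (\<Sum>z\<in>listset (map (supp A B) as). if z = zs then list_coeff z as else 0)"
    by (simp add: list_expansion_def lookup_sum lookup_single when_def)
  then show ?thesis using list_coeff_eq_0 finite_listset_supp by simp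
qed

lemma keys_list_expansion: "keys (list_expansion as) = listset (map (supp A B) as)"
proof -
  have "zs \<in> keys (list_expansion as) \<longleftrightarrow> zs \<in> listset (map (supp A B) as)" for zs
    unfolding in_keys_iff lookup_list_expansion using list_coeff_eq_0 list_coeff_neq_0 by blast
  then show ?thesis by blast
qed

lemma listset_supp_basis:
  "set as \<subseteq> carrier A \<Longrightarrow> zs \<in> listset (map (supp A B) as) \<Longrightarrow> zs \<in> basis_lists (length as)"
proof (induction as arbitrary: zs)
  case (Cons a as)
  then obtain z zs' where z: "zs = z # zs'" "z \<in> supp A B a" "zs' \<in> listset (map (supp A B) as)"
    by (auto simp: set_Cons_def)
  have "zs' \<in> basis_lists (length as)" using Cons.prems z by (intro Cons.IH) auto
  moreover have "z \<in> B" using z(2) supp_subset[of a] Cons.prems by auto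
  ultimately show ?case using z(1) by (simp add: basis_lists_def)
qed (simp add: basis_lists_def)

lemma lin_list_expansion:
  "lin h (list_expansion as) = (\<Sum>zs\<in>listset (map (supp A B) as). scale (list_coeff zs as) (h zs))"
  by (simp add: list_expansion_def lin_sum)

text \<open>The sum over \<open>listset\<close> is a product of sums over the factors, and each of
  these is \<open>linear_functional_expand\<close> for multiplication by a fixed element. This is
  what associativity of \<open>tensor_mult\<close> needs.\<close>

lemma list_coeff_twist_left:
  assumes "set as \<subseteq> carrier A" "set us \<subseteq> carrier A" "length us = length as"
  shows "(\<Sum>zs\<in>listset (map (supp A B) as). list_coeff zs as * list_coeff ws (twist_mult c zs us)) =
    list_coeff ws (twist_mult c as us)"
  using assms
proof (induction as arbitrary: us ws c)
  case (Cons a as)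
  then obtain u us' where us: "us = u # us'" by (cases us) auto
  show ?case
  proof (cases ws)
    case (Cons w ws')
    have "\<kappa> w (if c then a \<otimes> u else u \<otimes> a) =
       (\<Sum>z\<in>supp A B a. \<kappa> z a * \<kappa> w (if c then z \<otimes> u else u \<otimes> z))"
    proof (cases c)
      case True
      have "linear_functional (\<lambda>x. \<kappa> w (x \<otimes> u))"
        by (rule linear_mult_right[OF linear_kappa']) (use Cons.prems us in simp)
      from linear_functional_expand[OF this, of a] show ?thesis using Cons.prems True by simp
    next
      case False
      have "linear_functional (\<lambda>x. \<kappa> w (u \<otimes> x))"
        by (rule linear_mult_left[OF linear_kappa']) (use Cons.prems us in simp)
      from linear_functional_expand[OF this, of a] show ?thesis using Cons.prems False by simp
    qed
    moreover have "(\<Sum>zs\<in>listset (map (supp A B) as). list_coeff zs as * list_coeff ws' (twist_mult (\<not> c) zs us')) =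
        list_coeff ws' (twist_mult (\<not> c) as us')"
      using Cons.prems us by (intro Cons.IH) auto
    ultimately have "list_coeff ws (twist_mult c (a # as) us) =
       (\<Sum>z\<in>supp A B a. \<kappa> z a * \<kappa> w (if c then z \<otimes> u else u \<otimes> z)) *
       (\<Sum>zs\<in>listset (map (supp A B) as). list_coeff zs as * list_coeff ws' (twist_mult (\<not> c) zs us'))"
      by (simp only: us Cons twist_mult.simps list_coeff.simps)
    also have "\<dots> = (\<Sum>z\<in>supp A B a. \<Sum>zs\<in>listset (map (supp A B) as).
        list_coeff (z # zs) (a # as) * list_coeff ws (twist_mult c (z # zs) us))"
      unfolding us Cons twist_mult.simps list_coeff.simps sum_product by (simp only: ac_simps)
    finally show ?thesis unfolding sum_listset_Cons by simp
  next
    case Nil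
    then show ?thesis unfolding us sum_listset_Cons by simp
  qed
qed simp

text \<open>Passing to the opposite algebra in every factor exchanges the arguments; statements
  about left factors thus yield those about right factors.\<close>

lemma twist_mult_commute: "twist_mult c xs ys = twist_mult (\<not> c) ys xs"
  by (induction c xs ys rule: twist_mult.induct) auto

lemma list_coeff_twist_right:
  assumes "set as \<subseteq> carrier A" "set us \<subseteq> carrier A" "length us = length as"
  shows "(\<Sum>zs\<in>listset (map (supp A B) as). list_coeff zs as * list_coeff ws (twist_mult c us zs)) =
    list_coeff ws (twist_mult c us as)"
  unfolding twist_mult_commute[of c us] by (rule list_coeff_twist_left[OF assms])

lemma twist_mult_assoc:
  assumes "set xs \<subseteq> carrier A" "set ys \<subseteq> carrier A" "set zs \<subseteq> carrier A"
  shows "twist_mult c (twist_mult c xs ys) zs = twist_mult c xs (twist_mult c ys zs)"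
  using assms
proof (induction c xs ys arbitrary: zs rule: twist_mult.induct)
  case (1 c x xs y ys)
  then show ?case by (cases zs) (auto simp: m_assoc)
qed auto

lemma twist_mult_one:
  "set xs \<subseteq> carrier A \<Longrightarrow> twist_mult c (replicate (length xs) \<one>) xs = xs"
  "set xs \<subseteq> carrier A \<Longrightarrow> twist_mult c xs (replicate (length xs) \<one>) = xs"
  by (induction xs arbitrary: c) auto

lemma list_coeff_basis:
  "set as \<subseteq> B \<Longrightarrow> list_coeff zs as = (if zs = as then 1 else 0)"
  by (induction zs as rule: list_coeff.induct) (auto simp: kappa_basis)

lemma list_expansion_basis: "set as \<subseteq> B \<Longrightarrow> list_expansion as = single as 1"
  by (rule poly_mapping_eqI) (simp add: lookup_list_expansion list_coeff_basis lookup_single when_def)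

lemma basis_list_carrier: "xs \<in> basis_lists l \<Longrightarrow> set xs \<subseteq> carrier A"
  by (auto simp: basis_lists_def)

lemma tensor_algebra: "free_algebra_data (basis_lists l) tensor_mult (replicate l \<one>)"
proof
  show "replicate l \<one> \<in> basis_lists l" by (auto simp: basis_lists_def)
  fix x y assume xy: "x \<in> basis_lists l" "y \<in> basis_lists l"
  note c = basis_list_carrier[OF xy(1)] basis_list_carrier[OF xy(2)]
  have len: "length x = l" "length y = l" using xy by (auto simp: basis_lists_def)
  show "keys (tensor_mult x y) \<subseteq> basis_lists l"
    unfolding tensor_mult_def keys_list_expansion
    using listset_supp_basis[OF set_twist_mult[OF c]] len by (auto simp: length_twist_mult)
  fix z assume z: "z \<in> basis_lists l"
  note cz = basis_list_carrier[OF z]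
  have lz: "length z = l" using z by (auto simp: basis_lists_def)
  show "lin (\<lambda>w. tensor_mult w z) (tensor_mult x y) = lin (tensor_mult x) (tensor_mult y z)"
  proof (rule poly_mapping_eqI)
    fix w
    show "lookup (lin (\<lambda>w. tensor_mult w z) (tensor_mult x y)) w =
        lookup (lin (tensor_mult x) (tensor_mult y z)) w"
      unfolding tensor_mult_def lin_list_expansion lookup_sum lookup_scale lookup_list_expansion
      using c cz len lz
      by (simp add: list_coeff_twist_left list_coeff_twist_right set_twist_mult length_twist_mult twist_mult_assoc)
  qed
next
  fix x assume x: "x \<in> basis_lists l"
  then have "set x \<subseteq> B" "length x = l" by (auto simp: basis_lists_def)
  then show "tensor_mult (replicate l \<one>) x = single x 1"
    "tensor_mult x (replicate l \<one>) = single x 1"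
    using twist_mult_one[OF basis_list_carrier[OF x]] by (auto simp: tensor_mult_def list_expansion_basis)
qed

definition tensor :: "nat \<Rightarrow> (int, 'a list \<Rightarrow>\<^sub>0 int) module" where
  "tensor l = free_algebra (basis_lists l) tensor_mult (replicate l \<one>)"

definition tensor_basis :: "nat \<Rightarrow> ('a list \<Rightarrow>\<^sub>0 int) set" where
  "tensor_basis l = (\<lambda>xs. single xs 1) ` basis_lists l"

definition tensor_bar :: "('a list \<Rightarrow>\<^sub>0 int) \<Rightarrow> ('a list \<Rightarrow>\<^sub>0 int)" where
  "tensor_bar = lin (\<lambda>xs. single (map bar xs) 1)"

lemma tensor_bar_single: "tensor_bar (single xs c) = single (map bar xs) c"
  by (simp add: tensor_bar_def)

lemma map_bar_basis: "xs \<in> basis_lists l \<Longrightarrow> map bar xs \<in> basis_lists l"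
  using T2_basis by (auto simp: basis_lists_def)

lemma map_bar_bar: "set xs \<subseteq> carrier A \<Longrightarrow> map bar (map bar xs) = xs"
  by (induction xs) auto

lemma map_bar_twist_mult:
  "set xs \<subseteq> carrier A \<Longrightarrow> set ys \<subseteq> carrier A \<Longrightarrow>
     map bar (twist_mult c xs ys) = twist_mult c (map bar ys) (map bar xs)"
  by (induction c xs ys rule: twist_mult.induct) (auto simp: bar_mult)

lemma list_coeff_bar:
  "set zs \<subseteq> B \<Longrightarrow> set as \<subseteq> carrier A \<Longrightarrow> list_coeff (map bar zs) (map bar as) = list_coeff zs as"
  by (induction zs as rule: list_coeff.induct) (auto simp: kappa_bar)

lemma tensor_bar_list_expansion:
  assumes "set as \<subseteq> carrier A"
  shows "tensor_bar (list_expansion as) = list_expansion (map bar as)"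
proof (rule poly_mapping_eqI)
  fix ws
  have "lookup (tensor_bar (list_expansion as)) ws =
    (\<Sum>zs\<in>listset (map (supp A B) as). if map bar zs = ws then list_coeff zs as else 0)"
    by (simp add: tensor_bar_def lin_list_expansion lookup_sum lookup_single when_def)
  also have "\<dots> = list_coeff ws (map bar as)"
  proof (cases "\<exists>zs\<in>listset (map (supp A B) as). ws = map bar zs")
    case True
    then obtain zs where zs: "zs \<in> listset (map (supp A B) as)" "ws = map bar zs" by auto
    have c: "set zs' \<subseteq> B" if "zs' \<in> listset (map (supp A B) as)" for zs'
      using listset_supp_basis[OF assms that] by (simp add: basis_lists_def)
    have "(map bar zs' = ws) = (zs' = zs)" if "zs' \<in> listset (map (supp A B) as)" for zs'
      using map_bar_bar[of zs] map_bar_bar[of zs'] c[OF zs(1)] c[OF that] zs(2)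
      by (metis basis_carrier subset_iff)
    then have "(\<Sum>zs\<in>listset (map (supp A B) as). if map bar zs = ws then list_coeff zs as else 0) =
       (\<Sum>zs'\<in>listset (map (supp A B) as). if zs' = zs then list_coeff zs' as else 0)"
      by (intro sum.cong) auto
    also have "\<dots> = list_coeff zs as" using zs(1) finite_listset_supp by simp
    finally show ?thesis using list_coeff_bar[OF c[OF zs(1)] assms] zs(2) by simp
  next
    case False
    have "list_coeff ws (map bar as) = 0"
    proof (rule ccontr)
      assume nz: "list_coeff ws (map bar as) \<noteq> 0"
      have as': "set (map bar as) \<subseteq> carrier A" using assms by auto
      have "ws \<in> listset (map (supp A B) (map bar as))" using nz list_coeff_eq_0 by blast
      from listset_supp_basis[OF as' this] have ws: "set ws \<subseteq> B" by (simp add: basis_lists_def)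
      then have "list_coeff (map bar ws) (map bar (map bar as)) \<noteq> 0"
        using list_coeff_bar[OF ws as'] nz by simp
      then have "map bar ws \<in> listset (map (supp A B) as)"
        using list_coeff_eq_0 map_bar_bar[OF assms] by metis
      moreover have "ws = map bar (map bar ws)" using ws by (subst map_bar_bar) auto
      ultimately show False using False by blast
    qed
    then show ?thesis using False by (auto intro!: sum.neutral)
  qed
  finally show "lookup (tensor_bar (list_expansion as)) ws =
      lookup (list_expansion (map bar as)) ws" by (simp add: lookup_list_expansion)
qed

text \<open>In the reversed factors the mirror image of (T3) is needed,
  \<open>\<kappa> z (y \<otimes> x) = \<kappa> x (bar y \<otimes> z)\<close>. It follows through
  \<open>kappa_trace\<close>, as \<open>t\<close> is invariant under \<open>bar\<close> and under
  cyclic rotation.\<close>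

lemma list_coeff_T3:
  assumes "set xs \<subseteq> B" "set ys \<subseteq> B" "set zs \<subseteq> B" "length xs = length ys" "length zs = length ys"
  shows "list_coeff zs (twist_mult c xs ys) = list_coeff xs (twist_mult c zs (map bar ys))"
  using assms(4,5,1-3)
proof (induction ys arbitrary: c xs zs)
  case (Cons y ys)
  then obtain x xs' z zs' where [simp]: "xs = x # xs'" "zs = z # zs'"
    by (cases xs; cases zs; auto)
  have B: "x \<in> B" "y \<in> B" "z \<in> B" using Cons.prems by auto
  have "\<kappa> z (y \<otimes> x) = t (y \<otimes> x \<otimes> bar z)" using B by (simp add: kappa_trace)
  also have "\<dots> = t (bar (y \<otimes> x \<otimes> bar z))" using B T2_basis by (simp add: trace_bar)
  also have "\<dots> = t (z \<otimes> (bar x \<otimes> bar y))" using B T2_basis by (simp add: bar_mult)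
  also have "\<dots> = t (bar y \<otimes> (z \<otimes> bar x))"
    using B T2_basis by (subst trace_commute[of "bar y"]) (auto simp: m_assoc)
  also have "\<dots> = \<kappa> x (bar y \<otimes> z)" using B T2_basis by (simp add: kappa_trace m_assoc)
  finally show ?case using Cons T3[OF B] by auto
qed simp

lemma list_coeff_nonneg:
  "set zs \<subseteq> B \<Longrightarrow> set xs \<subseteq> B \<Longrightarrow> set ys \<subseteq> B \<Longrightarrow> list_coeff zs (twist_mult c xs ys) \<in> \<nat>"
proof (induction c xs ys arbitrary: zs rule: twist_mult.induct)
  case (1 c x xs y ys)
  show ?case
  proof (cases zs)
    case (Cons z zs')
    then show ?thesis using 1 by (auto intro!: Nats_mult T1)
  qed simp
next
  case ("2_1" c ys)
  then show ?case by (cases zs) auto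
next
  case ("2_2" c xs)
  then show ?case by (cases zs; cases xs) auto
qed

lemma tensor_bar_anti: "involutory_anti_automorphism (tensor l) tensor_bar"
proof -
  interpret F: free_algebra_data "basis_lists l" tensor_mult "replicate l \<one>" by (rule tensor_algebra)
  have closed: "keys (tensor_bar f) \<subseteq> basis_lists l" if "keys f \<subseteq> basis_lists l" for f
    using keys_lin[of "\<lambda>xs. single (map bar xs) (1::int)" f] that map_bar_basis
    unfolding tensor_bar_def by fastforce
  have bb: "tensor_bar (tensor_bar f) = f" if f: "keys f \<subseteq> basis_lists l" for f
  proof -
    have "tensor_bar (tensor_bar f) = lin (\<lambda>xs. single (map bar (map bar xs)) 1) f"
      by (simp add: tensor_bar_def lin_lin)
    also have "\<dots> = lin (\<lambda>xs. single xs 1) f"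
      by (rule lin_cong[OF refl]) (use f map_bar_bar basis_list_carrier in auto)
    finally show ?thesis by (simp add: lin_basis)
  qed
  have mult: "tensor_bar (lin (\<lambda>x. lin (tensor_mult x) g) f) = lin (\<lambda>x. lin (tensor_mult x) (tensor_bar f)) (tensor_bar g)"
    if f: "keys f \<subseteq> basis_lists l" and g: "keys g \<subseteq> basis_lists l" for f g
  proof -
    have 1: "tensor_bar (tensor_mult x y) = tensor_mult (map bar y) (map bar x)"
      if "x \<in> basis_lists l" "y \<in> basis_lists l" for x y
      using basis_list_carrier that
      by (simp add: tensor_mult_def tensor_bar_list_expansion set_twist_mult map_bar_twist_mult)
    have "tensor_bar (lin (\<lambda>x. lin (tensor_mult x) g) f) = lin (\<lambda>x. lin (\<lambda>y. tensor_bar (tensor_mult x y)) g) f"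
      unfolding tensor_bar_def lin_lin ..
    also have "\<dots> = lin (\<lambda>x. lin (\<lambda>y. tensor_mult (map bar y) (map bar x)) g) f"
      by (intro lin_cong[OF refl] 1) (use f g in auto)
    also have "\<dots> = lin (\<lambda>y. lin (\<lambda>x. tensor_mult (map bar y) (map bar x)) f) g"
      by (rule lin_swap)
    also have "\<dots> = lin (\<lambda>x. lin (tensor_mult x) (tensor_bar f)) (tensor_bar g)"
      unfolding tensor_bar_def lin_lin lin_single scale_one ..
    finally show ?thesis .
  qed
  show ?thesis
    unfolding involutory_anti_automorphism_def tensor_def
    using closed bb mult by (auto simp: mult_free_algebra lin_add lin_scale tensor_bar_def[symmetric]
        simp flip: tensor_bar_def) (simp_all add: tensor_bar_def lin_add lin_scale)
qed

lemma tensor_table_algebra: "normalized_table_algebra (tensor l) (tensor_basis l) tensor_bar"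
proof -
  interpret F: free_algebra_data "basis_lists l" tensor_mult "replicate l \<one>" by (rule tensor_algebra)
  have k: "kappa (tensor l) (tensor_basis l) (single z 1) (single x 1 \<otimes>\<^bsub>tensor l\<^esub> single y 1) =
     list_coeff z (twist_mult True x y)" if "x \<in> basis_lists l" "y \<in> basis_lists l" for x y z
    unfolding tensor_def tensor_basis_def mult_single_free_algebra
    using F.kappa_free[OF F.keys_mul[OF that]] by (simp add: tensor_mult_def lookup_list_expansion)
  show ?thesis
  proof (intro normalized_table_algebra.intro normalized_table_algebra_axioms.intro)
    show "associative_algebra (tensor l)" unfolding tensor_def by (rule F.associative_algebra_free)
    show "free_basis (tensor l) (tensor_basis l)"
      unfolding tensor_def tensor_basis_def by (rule F.free_basis_free)
    show "\<one>\<^bsub>tensor l\<^esub> \<in> tensor_basis l"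
      using F.unit_mem by (simp add: tensor_def tensor_basis_def)
    show "involutory_anti_automorphism (tensor l) tensor_bar" by (rule tensor_bar_anti)
    show "tensor_bar b \<in> tensor_basis l" if "b \<in> tensor_basis l" for b
      using that map_bar_basis by (auto simp: tensor_basis_def tensor_bar_single)
    fix b b' b'' assume "b \<in> tensor_basis l" "b' \<in> tensor_basis l" "b'' \<in> tensor_basis l"
    then obtain x y z where [simp]: "b = single x 1" "b' = single y 1" "b'' = single z 1"
      and xyz: "x \<in> basis_lists l" "y \<in> basis_lists l" "z \<in> basis_lists l"
      by (auto simp: tensor_basis_def)
    show "kappa (tensor l) (tensor_basis l) b'' (b \<otimes>\<^bsub>tensor l\<^esub> b') \<in> \<nat>"
      using xyz by (simp add: k basis_lists_def list_coeff_nonneg)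
    show "kappa (tensor l) (tensor_basis l) b'' (b \<otimes>\<^bsub>tensor l\<^esub> b') =
        kappa (tensor l) (tensor_basis l) b (b'' \<otimes>\<^bsub>tensor l\<^esub> tensor_bar b')"
      using xyz map_bar_basis[OF xyz(2)] by (simp add: k tensor_bar_single) (simp add: basis_lists_def list_coeff_T3)
  qed
qed

end

section \<open>Half diagrams\<close>

lemma crossing_swap:
  "crossing (p, q) e \<longleftrightarrow> crossing (q, p) e" "crossing e (p, q) \<longleftrightarrow> crossing e (q, p)"
proof -
  obtain r s where [simp]: "e = (r, s)" by (cases e)
  have "crossing (p, q) (r, s) \<longleftrightarrow> crossing (q, p) (r, s)" "crossing (r, s) (p, q) \<longleftrightarrow> crossing (r, s) (q, p)"
    unfolding crossing_iff by blast+
  then show "crossing (p, q) e \<longleftrightarrow> crossing (q, p) e" "crossing e (p, q) \<longleftrightarrow> crossing e (q, p)"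
    by (simp_all only: \<open>e = (r, s)\<close>)
qed

lemma card_below_nth_sorted_list_of_set:
  fixes F :: "nat set"
  assumes "finite F" "i < card F"
  shows "card {x \<in> F. x < sorted_list_of_set F ! i} = i"
proof -
  let ?xs = "sorted_list_of_set F"
  have s: "sorted_wrt (<) ?xs" "set ?xs = F" "length ?xs = card F" "distinct ?xs"
    using assms by (auto simp: strict_sorted_list_of_set)
  have "{x \<in> F. x < ?xs ! i} = set (take i ?xs)"
  proof (intro equalityI subsetI)
    fix x assume "x \<in> {x \<in> F. x < ?xs ! i}"
    then obtain j where j: "j < length ?xs" "x = ?xs ! j" "?xs ! j < ?xs ! i"
      using s(2) by (metis (mono_tags, lifting) in_set_conv_nth mem_Collect_eq)
    have "j < i"
    proof (rule ccontr)
      assume "\<not> j < i"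
      then have "i = j \<or> ?xs ! i < ?xs ! j"
        using sorted_wrt_nth_less[OF s(1), of i j] j(1) by linarith
      then show False using j(3) by auto
    qed
    then show "x \<in> set (take i ?xs)" using j by (auto simp: in_set_conv_nth intro!: exI[of _ j])
  next
    fix x assume "x \<in> set (take i ?xs)"
    then obtain j where j: "j < i" "j < length ?xs" "x = ?xs ! j" by (auto simp: in_set_conv_nth)
    then show "x \<in> {x \<in> F. x < ?xs ! i}"
      using sorted_wrt_nth_less[OF s(1), of j i] assms(2) s(2,3) nth_mem[OF j(2)] by auto
  qed
  then show ?thesis using s assms(2) by (simp add: distinct_card)
qed

context int_table_algebra
begin

definition top_half :: "nat \<Rightarrow> 'a diagram \<Rightarrow> 'a diagram" where
  "top_half n D = {(p, q, a) \<in> D. p \<le> n \<and> q \<le> n}"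

definition through :: "nat \<Rightarrow> 'a diagram \<Rightarrow> 'a diagram" where
  "through n D = {(p, q, a) \<in> D. (p \<le> n) \<noteq> (q \<le> n)}"

definition free_points :: "nat \<Rightarrow> 'a diagram \<Rightarrow> nat set" where
  "free_points n S = {1..n} - verts S"

abbreviation free_list :: "nat \<Rightarrow> 'a diagram \<Rightarrow> nat list" where
  "free_list n S \<equiv> sorted_list_of_set (free_points n S)"

text \<open>
  The upper half of a diagram with \<open>l\<close> through strings.  The through strings end at the free
  points, so no arc may enclose a free point.
\<close>

definition half_diagram :: "nat \<Rightarrow> nat \<Rightarrow> 'a diagram \<Rightarrow> bool" where
  "half_diagram n l S \<longleftrightarrow> partial_bij S \<and> verts S \<subseteq> {1..n} \<and> (\<forall>p\<in>srcs S. even p) \<and> (\<forall>q\<in>tgts S. odd q) \<and>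
     (\<forall>p q a. (p, q, a) \<in> S \<longrightarrow> a \<in> B) \<and> noncrossing (\<lambda>p. p) (\<lambda>p. p) S \<and>
     (\<forall>p q a. (p, q, a) \<in> S \<longrightarrow> (\<forall>u\<in>free_points n S. \<not> (min p q < u \<and> u < max p q))) \<and>
     card (free_points n S) = l"

lemma half_diagramD:
  assumes "half_diagram n l S"
  shows "partial_bij S" "verts S \<subseteq> {1..n}" "label_graph S"
    "(p, q, a) \<in> S \<Longrightarrow> a \<in> B" "(p, q, a) \<in> S \<Longrightarrow> even p \<and> odd q \<and> p \<in> {1..n} \<and> q \<in> {1..n}"
    "noncrossing (\<lambda>p. p) (\<lambda>p. p) S"
    "(p, q, a) \<in> S \<Longrightarrow> u \<in> free_points n S \<Longrightarrow> u < min p q \<or> u > max p q"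
    "card (free_points n S) = l" "length (free_list n S) = l"
proof -
  note h = assms[unfolded half_diagram_def]
  show pb: "partial_bij S" "verts S \<subseteq> {1..n}" "noncrossing (\<lambda>p. p) (\<lambda>p. p) S" "card (free_points n S) = l"
    using h by blast+
  show B: "(p, q, a) \<in> S \<Longrightarrow> a \<in> B" for p q a using h by blast
  show "label_graph S" using pb(1) B by (auto simp: label_graph_def)
  show e: "(p, q, a) \<in> S \<Longrightarrow> even p \<and> odd q \<and> p \<in> {1..n} \<and> q \<in> {1..n}" for p q a
  proof -
    assume e: "(p, q, a) \<in> S"
    have "p \<in> srcs S" "q \<in> tgts S" by (rule srcsI[OF e], rule tgtsI[OF e])
    moreover from this have "p \<in> verts S" "q \<in> verts S" by (auto simp: verts_def)
    ultimately show ?thesis using h by blast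
  qed
  show "(p, q, a) \<in> S \<Longrightarrow> u \<in> free_points n S \<Longrightarrow> u < min p q \<or> u > max p q"
  proof -
    assume e': "(p, q, a) \<in> S" and u: "u \<in> free_points n S"
    have "p \<in> verts S" "q \<in> verts S" using srcsI[OF e'] tgtsI[OF e'] by (auto simp: verts_def)
    then have "u \<noteq> p" "u \<noteq> q" using u by (auto simp: free_points_def)
    moreover have "\<not> (min p q < u \<and> u < max p q)" using h e' u by blast
    ultimately show ?thesis by (auto simp: min_def max_def split: if_splits)
  qed
  have "finite (free_points n S)" by (simp add: free_points_def)
  then show "length (free_list n S) = l" using pb(4) by simp
qed

lemma finite_free_points [simp]: "finite (free_points n S)"
  by (simp add: free_points_def)

lemma set_free_list: "set (free_list n S) = free_points n S"
  by simp

lemma card_partial_bij: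
  assumes "partial_bij S" shows "card (srcs S) = card S" "card (tgts S) = card S"
proof -
  have "srcs S = fst ` S" "tgts S = (fst \<circ> snd) ` S" by (force simp: srcs_def tgts_def)+
  moreover have "inj_on fst S" "inj_on (fst \<circ> snd) S"
    using partial_bijD(2-5)[OF assms] by (auto intro!: inj_onI)
  ultimately show "card (srcs S) = card S" "card (tgts S) = card S" by (metis card_image)+
qed

lemma half_disjoint: "half_diagram n l S \<Longrightarrow> srcs S \<inter> tgts S = {}"
  unfolding half_diagram_def by blast

text \<open>Each arc uses two points. Consequently the number of arcs and the number of free points
  determine each other, and comparisons of through strings become comparisons of arcs.\<close>

lemma card_half: "half_diagram n l S \<Longrightarrow> n = 2 * card S + l"
proof -
  assume S: "half_diagram n l S"
  note h = half_diagramD[OF S]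
  have fin: "finite (srcs S)" "finite (tgts S)"
    using h(2) unfolding verts_def by (meson finite_atLeastAtMost finite_subset le_sup_iff)+
  have "card (verts S) = 2 * card S"
    unfolding verts_def card_Un_disjoint[OF fin half_disjoint[OF S]] card_partial_bij[OF h(1)] by simp
  moreover have "card (free_points n S) = n - card (verts S)"
    unfolding free_points_def using h(2) by (simp add: card_Diff_subset finite_subset[OF h(2)])
  moreover have "card (verts S) \<le> n" using card_mono[OF _ h(2)] by simp
  ultimately show ?thesis using h(8) by simp
qed

text \<open>No arc encloses a free point, so to its left lie \<open>i\<close> free points and both
  ends of some number of arcs. Indices start at \<open>0\<close>, hence the first free point is odd.
  In particular equally indexed free points of two halves have the same parity.\<close>

lemma half_parity:
  assumes S: "half_diagram n l S" and i: "i < l"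
  shows "even (free_list n S ! i) \<longleftrightarrow> odd i"
proof -
  note h = half_diagramD[OF S]
  let ?u = "free_list n S ! i"
  let ?S = "{(p, q, a) \<in> S. p < ?u}"
  have u: "?u \<in> free_points n S" using i h(9) set_free_list nth_mem by metis
  then have u': "?u \<in> {1..n}" by (auto simp: free_points_def)
  have pb: "partial_bij ?S" by (rule partial_bij_subset[OF h(1)]) auto
  have iff: "p < ?u \<longleftrightarrow> q < ?u" if "(p, q, a) \<in> S" for p q a
    using h(7)[OF that u] by (auto simp: min_def max_def split: if_splits)
  have s: "srcs ?S = {p \<in> srcs S. p < ?u}" by (auto simp: srcs_def)
  have t: "tgts ?S = {q \<in> tgts S. q < ?u}" using iff by (auto simp: tgts_def)
  have c: "card {p \<in> srcs S. p < ?u} = card ?S" "card {q \<in> tgts S. q < ?u} = card ?S"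
    using card_partial_bij[OF pb] s t by auto
  have f: "card {x \<in> free_points n S. x < ?u} = i"
    by (rule card_below_nth_sorted_list_of_set) (use i h(8) in auto)
  have dec: "{1..<?u} = {x \<in> free_points n S. x < ?u} \<union> ({p \<in> srcs S. p < ?u} \<union> {q \<in> tgts S. q < ?u})"
    using u' h(2) by (auto simp: free_points_def verts_def)
  have "card {1..<?u} = i + (card ?S + card ?S)"
    unfolding dec
  proof (subst card_Un_disjoint)
    show "card {x \<in> free_points n S. x < ?u} + card ({p \<in> srcs S. p < ?u} \<union> {q \<in> tgts S. q < ?u}) = i + (card ?S + card ?S)"
      using half_disjoint[OF S] by (subst card_Un_disjoint) (auto simp: f c)
  qed (auto simp: free_points_def verts_def)
  moreover have "card {1..<?u} = ?u - 1" by simp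
  moreover have "1 \<le> ?u" using u' by simp
  ultimately have "?u = Suc i + 2 * card ?S" by linarith
  then obtain c where "?u = Suc i + 2 * c" by blast
  then show ?thesis by simp
qed

text \<open>
  The lower half of a diagram is encoded by its mirror image, the upper half of the flipped
  diagram.  Even points being sources, the parity of \<open>u\<close> determines the orientation of the
  through string between \<open>u\<close> and the mirror image of \<open>v\<close>.
\<close>

definition thr_edge :: "nat \<Rightarrow> nat \<Rightarrow> nat \<Rightarrow> 'a \<Rightarrow> nat \<times> nat \<times> 'a" where
  "thr_edge n u v a = (if even u then (u, 2 * n + 1 - v, a) else (2 * n + 1 - v, u, a))"

definition thr_edges :: "nat \<Rightarrow> 'a diagram \<Rightarrow> 'a list \<Rightarrow> 'a diagram \<Rightarrow> 'a diagram" where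
  "thr_edges n S xs T = (\<lambda>i. thr_edge n (free_list n S ! i) (free_list n T ! i) (xs ! i)) ` {..<length xs}"

definition diag :: "nat \<Rightarrow> 'a diagram \<Rightarrow> 'a list \<Rightarrow> 'a diagram \<Rightarrow> 'a diagram" where
  "diag n S xs T = S \<union> flip n T \<union> thr_edges n S xs T"

lemma free_nth:
  assumes "half_diagram n l S" "i < l"
  shows "free_list n S ! i \<in> free_points n S" "free_list n S ! i \<in> {1..n}" "free_list n S ! i \<notin> verts S"
proof -
  show *: "free_list n S ! i \<in> free_points n S" using assms half_diagramD(9) set_free_list nth_mem by metis
  then show "free_list n S ! i \<in> {1..n}" "free_list n S ! i \<notin> verts S" by (auto simp: free_points_def)
qed

lemma free_nth_less:
  assumes "half_diagram n l S" "i < j" "j < l"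
  shows "free_list n S ! i < free_list n S ! j"
proof (rule sorted_wrt_nth_less[OF strict_sorted_list_of_set assms(2)])
  show "j < length (free_list n S)" using assms(3) half_diagramD(9)[OF assms(1)] by simp
qed

lemma free_nth_inj:
  assumes "half_diagram n l S" "i < l" "j < l" "free_list n S ! i = free_list n S ! j"
  shows "i = j"
  using free_nth_less[OF assms(1), of i j] free_nth_less[OF assms(1), of j i] assms(2-4)
  by (metis less_irrefl linorder_neqE_nat)

lemma free_points_nth: "half_diagram n l S \<Longrightarrow> u \<in> free_points n S \<Longrightarrow> \<exists>i<l. u = free_list n S ! i"
  using set_free_list half_diagramD(9) by (metis in_set_conv_nth)

lemma thr_edges_iff:
  assumes "half_diagram n l S" "half_diagram n l T" "length xs = l"
  shows "(p, q, a) \<in> thr_edges n S xs T \<longleftrightarrow>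
    (\<exists>i<l. a = xs ! i \<and> (if odd i then p = free_list n S ! i \<and> q = 2 * n + 1 - free_list n T ! i
        else p = 2 * n + 1 - free_list n T ! i \<and> q = free_list n S ! i))"
  using half_parity[OF assms(1)] assms(3)
  unfolding thr_edges_def thr_edge_def by (auto split: if_splits)

lemma flip_iff: "label_graph T \<Longrightarrow> verts T \<subseteq> {1..2 * n} \<Longrightarrow>
    (p, q, a) \<in> flip n T \<longleftrightarrow> p \<in> {1..2 * n} \<and> q \<in> {1..2 * n} \<and> a \<in> carrier A \<and> (2 * n + 1 - q, 2 * n + 1 - p, bar a) \<in> T"
proof
  assume T: "label_graph T" "verts T \<subseteq> {1..2 * n}"
  assume "(p, q, a) \<in> flip n T"
  then obtain x y b where e: "(x, y, b) \<in> T" "p = 2 * n + 1 - y" "q = 2 * n + 1 - x" "a = bar b"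
    by (auto simp: flip_image)
  have "x \<in> verts T" "y \<in> verts T" using srcsI[OF e(1)] tgtsI[OF e(1)] by (auto simp: verts_def)
  then have xy: "x \<in> {1..2 * n}" "y \<in> {1..2 * n}" using T(2) by blast+
  then have "2 * n + 1 - q = x" "2 * n + 1 - p = y" using e by auto
  then show "p \<in> {1..2 * n} \<and> q \<in> {1..2 * n} \<and> a \<in> carrier A \<and> (2 * n + 1 - q, 2 * n + 1 - p, bar a) \<in> T"
    using e xy label_graphD(2)[OF T(1) e(1)] by auto
next
  assume *: "p \<in> {1..2 * n} \<and> q \<in> {1..2 * n} \<and> a \<in> carrier A \<and> (2 * n + 1 - q, 2 * n + 1 - p, bar a) \<in> T"
  then have "(2 * n + 1 - (2 * n + 1 - p), 2 * n + 1 - (2 * n + 1 - q), bar (bar a)) \<in> flip n T"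
    unfolding flip_image by force
  then show "(p, q, a) \<in> flip n T" using * by auto
qed

lemma half_verts: "half_diagram n l S \<Longrightarrow> verts S \<subseteq> {1..2 * n}"
  using half_diagramD(2) by fastforce

lemma flip_half_iff: "half_diagram n l T \<Longrightarrow>
    (p, q, a) \<in> flip n T \<longleftrightarrow> p \<in> {n + 1..2 * n} \<and> q \<in> {n + 1..2 * n} \<and> a \<in> carrier A \<and> (2 * n + 1 - q, 2 * n + 1 - p, bar a) \<in> T"
  using half_diagramD(5)[of n l T "2 * n + 1 - q" "2 * n + 1 - p" "bar a"]
  by (subst flip_iff[OF half_diagramD(3) half_verts]) auto

lemma diag_iff:
  assumes "half_diagram n l S" "half_diagram n l T" "length xs = l"
  shows "(p, q, a) \<in> diag n S xs T \<longleftrightarrow> (p, q, a) \<in> S \<or>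
    p \<in> {n + 1..2 * n} \<and> q \<in> {n + 1..2 * n} \<and> a \<in> carrier A \<and> (2 * n + 1 - q, 2 * n + 1 - p, bar a) \<in> T \<or>
    (\<exists>i<l. a = xs ! i \<and> (if odd i then p = free_list n S ! i \<and> q = 2 * n + 1 - free_list n T ! i
        else p = 2 * n + 1 - free_list n T ! i \<and> q = free_list n S ! i))"
  unfolding diag_def Un_iff thr_edges_iff[OF assms] flip_half_iff[OF assms(2)] by blast

text \<open>Each point is an arc end or a free point of its half, on the lower side after
  reflection. Since the \<open>i\<close>-th free points of both halves have the same parity, each
  through string joins an even to an odd point.\<close>

lemma pre_diagram_diag:
  assumes S: "half_diagram n l S" and T: "half_diagram n l T"
    and xs: "length xs = l" "set xs \<subseteq> carrier A"
  shows "pre_diagram n (diag n S xs T)"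
proof -
  note hS = half_diagramD[OF S] and hT = half_diagramD[OF T]
  let ?u = "\<lambda>i. free_list n S ! i" and ?v = "\<lambda>i. free_list n T ! i"
  let ?W = "thr_edges n S xs T"
  note W = thr_edges_iff[OF S T xs(1)]
  note u = free_nth[OF S] and v = free_nth[OF T]
  note pu = half_parity[OF S] and pv = half_parity[OF T]
  have d: "?u i \<noteq> 2 * n + 1 - ?v j" if "i < l" "j < l" for i j
    using u(2)[OF that(1)] v(2)[OF that(2)] by auto
  have iv: "i = j" if "i < l" "j < l" "2 * n + 1 - ?v i = 2 * n + 1 - ?v j" for i j
    by (rule free_nth_inj[OF T that(1,2)]) (use v(2)[OF that(1)] v(2)[OF that(2)] that(3) in auto)
  have lW: "label_graph ?W"
    unfolding label_graph_def
  proof (intro conjI allI impI)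
    show "partial_bij ?W"
    proof (rule partial_bijI)
      show "finite ?W" by (simp add: thr_edges_def)
      fix p q a q' a' assume "(p, q, a) \<in> ?W" "(p, q', a') \<in> ?W"
      then obtain i j where ij: "i < l" "j < l" "a = xs ! i" "a' = xs ! j"
        "if odd i then p = ?u i \<and> q = 2 * n + 1 - ?v i else p = 2 * n + 1 - ?v i \<and> q = ?u i"
        "if odd j then p = ?u j \<and> q' = 2 * n + 1 - ?v j else p = 2 * n + 1 - ?v j \<and> q' = ?u j"
        unfolding W by blast
      have "i = j"
        using ij(5,6) free_nth_inj[OF S ij(1,2)] iv[OF ij(1,2)] d[OF ij(1,2)] d[OF ij(2,1)] by metis
      then show "q = q' \<and> a = a'" using ij(3-6) by (metis (full_types))
    next
      fix p q a p' a' assume "(p, q, a) \<in> ?W" "(p', q, a') \<in> ?W"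
      then obtain i j where ij: "i < l" "j < l" "a = xs ! i" "a' = xs ! j"
        "if odd i then p = ?u i \<and> q = 2 * n + 1 - ?v i else p = 2 * n + 1 - ?v i \<and> q = ?u i"
        "if odd j then p' = ?u j \<and> q = 2 * n + 1 - ?v j else p' = 2 * n + 1 - ?v j \<and> q = ?u j"
        unfolding W by blast
      have "i = j"
        using ij(5,6) free_nth_inj[OF S ij(1,2)] iv[OF ij(1,2)] d[OF ij(1,2)] d[OF ij(2,1)] by metis
      then show "p = p'" using ij(5,6) by (metis (full_types))
    qed
    fix p q a assume "(p, q, a) \<in> ?W"
    then show "a \<in> carrier A" unfolding W using xs by (auto simp: subset_iff)
  qed
  have fS: "free_points n S = {1..n} - srcs S - tgts S" "free_points n T = {1..n} - srcs T - tgts T"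
    by (auto simp: free_points_def verts_def)
  have lF: "label_graph (flip n T)"
  proof -
    have "inj_on (\<lambda>p. 2 * n + 1 - p) (srcs (opposite T))" "inj_on (\<lambda>p. 2 * n + 1 - p) (tgts (opposite T))"
      using half_verts[OF T] unfolding srcs_opposite tgts_opposite verts_def
      by (intro inj_reflect; blast)+
    then show ?thesis unfolding flip_def by (intro label_graph_map label_graph_opposite hT(3))
  qed
  have sW: "p \<in> {1..n} \<and> even p \<and> p \<notin> verts S \<or> p \<in> {n + 1..2 * n} \<and> even p \<and> 2 * n + 1 - p \<notin> verts T"
    if p: "p \<in> srcs ?W" for p
  proof -
    obtain q a where "(p, q, a) \<in> ?W" using p by (auto simp: srcs_def)
    then obtain i where i: "i < l" "if odd i then p = ?u i \<and> q = 2 * n + 1 - ?v i else p = 2 * n + 1 - ?v i \<and> q = ?u i"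
      unfolding W by blast
    show ?thesis
    proof (cases "odd i")
      case True then show ?thesis using i u[OF i(1)] pu[OF i(1)] by auto
    next
      case False
      then have "2 * n + 1 - p = ?v i" "even p" "p \<in> {n + 1..2 * n}" using i v[OF i(1)] pv[OF i(1)] by auto
      then show ?thesis using v[OF i(1)] by auto
    qed
  qed
  have tW: "p \<in> {1..n} \<and> odd p \<and> p \<notin> verts S \<or> p \<in> {n + 1..2 * n} \<and> odd p \<and> 2 * n + 1 - p \<notin> verts T"
    if p: "p \<in> tgts ?W" for p
  proof -
    obtain q a where "(q, p, a) \<in> ?W" using p by (auto simp: tgts_def)
    then obtain i where i: "i < l" "if odd i then q = ?u i \<and> p = 2 * n + 1 - ?v i else q = 2 * n + 1 - ?v i \<and> p = ?u i"
      unfolding W by blast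
    show ?thesis
    proof (cases "odd i")
      case False then show ?thesis using i u[OF i(1)] pu[OF i(1)] by auto
    next
      case True
      then have "2 * n + 1 - p = ?v i" "odd p" "p \<in> {n + 1..2 * n}" using i v[OF i(1)] pv[OF i(1)] by auto
      then show ?thesis using v[OF i(1)] by auto
    qed
  qed
  have sF: "p \<in> {n + 1..2 * n} \<and> even p \<and> 2 * n + 1 - p \<in> tgts T" if p: "p \<in> srcs (flip n T)" for p
  proof -
    obtain q a where "(p, q, a) \<in> flip n T" using p by (auto simp: srcs_def)
    then have e: "p \<in> {n + 1..2 * n}" "(2 * n + 1 - q, 2 * n + 1 - p, bar a) \<in> T" by (auto simp: flip_half_iff[OF T])
    then show ?thesis using hT(5)[OF e(2)] tgtsI[OF e(2)] by auto
  qed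
  have tF: "p \<in> {n + 1..2 * n} \<and> odd p \<and> 2 * n + 1 - p \<in> srcs T" if p: "p \<in> tgts (flip n T)" for p
  proof -
    obtain q a where "(q, p, a) \<in> flip n T" using p by (auto simp: tgts_def)
    then have e: "p \<in> {n + 1..2 * n}" "(2 * n + 1 - p, 2 * n + 1 - q, bar a) \<in> T" by (auto simp: flip_half_iff[OF T])
    then show ?thesis using hT(5)[OF e(2)] srcsI[OF e(2)] by auto
  qed
  have sS: "p \<in> {1..n} \<and> even p" if "p \<in> srcs S" for p
    using that hS(5) by (auto simp: srcs_def)
  have tS: "p \<in> {1..n} \<and> odd p" if "p \<in> tgts S" for p
    using that hS(5) by (auto simp: tgts_def)
  have sT: "even p" if "p \<in> srcs T" for p using that hT(5) by (auto simp: srcs_def)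
  have tT: "odd p" if "p \<in> tgts T" for p using that hT(5) by (auto simp: tgts_def)
  have "label_graph (S \<union> flip n T)"
    using sS sF tS tF by (intro label_graph_Un hS(3) lF) fastforce+
  moreover have "srcs (S \<union> flip n T) \<inter> srcs ?W = {}" "tgts (S \<union> flip n T) \<inter> tgts ?W = {}"
    using sS sF tS tF sW tW unfolding srcs_Un tgts_Un verts_def by fastforce+
  ultimately have "label_graph (diag n S xs T)"
    unfolding diag_def using lW by (metis label_graph_Un)
  moreover have "srcs (diag n S xs T) = evens n"
  proof
    show "srcs (diag n S xs T) \<subseteq> evens n"
      unfolding diag_def srcs_Un evens_def using sS sF sW by fastforce
    show "evens n \<subseteq> srcs (diag n S xs T)"
    proof
      fix p assume p: "p \<in> evens n"
      show "p \<in> srcs (diag n S xs T)"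
      proof (cases "p \<le> n")
        case True
        show ?thesis
        proof (cases "p \<in> free_points n S")
          case True
          then obtain i where i: "i < l" "p = ?u i" using free_points_nth[OF S] by blast
          then have "odd i" using pu p by (auto simp: evens_def)
          then have "(p, 2 * n + 1 - ?v i, xs ! i) \<in> diag n S xs T" unfolding diag_iff[OF S T xs(1)] using i by auto
          then show ?thesis by (rule srcsI)
        next
          case False
          moreover have "p \<in> {1..n}" "p \<notin> tgts S" using True p tS by (auto simp: evens_def)
          ultimately have "p \<in> srcs S" using fS(1) by blast
          then show ?thesis by (simp add: diag_def srcs_Un)
        qed
      next
        case False
        let ?p = "2 * n + 1 - p"
        have p': "?p \<in> {1..n}" "odd ?p" "2 * n + 1 - ?p = p" using p False by (auto simp: evens_def)
        show ?thesis
        proof (cases "?p \<in> free_points n T")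
          case True
          then obtain i where i: "i < l" "?p = ?v i" using free_points_nth[OF T] by blast
          then have "even i" using pv p' by auto
          then have "(p, ?u i, xs ! i) \<in> diag n S xs T" unfolding diag_iff[OF S T xs(1)] using i p' by auto
          then show ?thesis by (rule srcsI)
        next
          case False
          moreover have "?p \<notin> srcs T" using sT p'(2) by blast
          ultimately have "?p \<in> tgts T" using p'(1) fS(2) by blast
          then obtain q a where e: "(q, ?p, a) \<in> T" by (auto simp: tgts_def)
          then have "(2 * n + 1 - ?p, 2 * n + 1 - q, bar a) \<in> flip n T" unfolding flip_image by force
          then show ?thesis using p' by (auto simp: diag_def intro: srcsI)
        qed
      qed
    qed
  qed
  moreover have "tgts (diag n S xs T) = odds n"
  proof
    show "tgts (diag n S xs T) \<subseteq> odds n"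
      unfolding diag_def tgts_Un odds_def using tS tF tW by fastforce
    show "odds n \<subseteq> tgts (diag n S xs T)"
    proof
      fix p assume p: "p \<in> odds n"
      show "p \<in> tgts (diag n S xs T)"
      proof (cases "p \<le> n")
        case True
        show ?thesis
        proof (cases "p \<in> free_points n S")
          case True
          then obtain i where i: "i < l" "p = ?u i" using free_points_nth[OF S] by blast
          then have "even i" using pu p by (auto simp: odds_def)
          then have "(2 * n + 1 - ?v i, p, xs ! i) \<in> diag n S xs T" unfolding diag_iff[OF S T xs(1)] using i by auto
          then show ?thesis by (rule tgtsI)
        next
          case False
          moreover have "p \<in> {1..n}" "p \<notin> srcs S" using True p sS by (auto simp: odds_def)
          ultimately have "p \<in> tgts S" using fS(1) by blast
          then show ?thesis by (simp add: diag_def tgts_Un)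
        qed
      next
        case False
        let ?p = "2 * n + 1 - p"
        have p': "?p \<in> {1..n}" "even ?p" "2 * n + 1 - ?p = p" using p False by (auto simp: odds_def)
        show ?thesis
        proof (cases "?p \<in> free_points n T")
          case True
          then obtain i where i: "i < l" "?p = ?v i" using free_points_nth[OF T] by blast
          then have "odd i" using pv p' by auto
          then have "(?u i, p, xs ! i) \<in> diag n S xs T" unfolding diag_iff[OF S T xs(1)] using i p' by auto
          then show ?thesis by (rule tgtsI)
        next
          case False
          moreover have "?p \<notin> tgts T" using tT p'(2) by blast
          ultimately have "?p \<in> srcs T" using p'(1) fS(2) by blast
          then obtain q a where e: "(?p, q, a) \<in> T" by (auto simp: srcs_def)
          then have "(2 * n + 1 - q, 2 * n + 1 - ?p, bar a) \<in> flip n T" unfolding flip_image by force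
          then show ?thesis using p' by (auto simp: diag_def intro: tgtsI)
        qed
      qed
    qed
  qed
  ultimately show ?thesis by (simp add: pre_diagram_def)
qed

text \<open>The condition on free points in \<open>half_diagram\<close> is what keeps arcs and
  through strings apart.\<close>

lemma noncrossing_diag:
  assumes S: "half_diagram n l S" and T: "half_diagram n l T" and xs: "length xs = l"
  shows "noncrossing (\<lambda>p. p) (\<lambda>p. p) (diag n S xs T)"
  unfolding noncrossing_def
proof (intro allI impI)
  note hS = half_diagramD[OF S] and hT = half_diagramD[OF T]
  let ?u = "\<lambda>i. free_list n S ! i" and ?v = "\<lambda>i. free_list n T ! i"
  note u = free_nth[OF S] and v = free_nth[OF T]
  have split: "(p, q, a) \<in> S \<or> p \<in> {n + 1..2 * n} \<and> q \<in> {n + 1..2 * n} \<and> (2 * n + 1 - q, 2 * n + 1 - p, bar a) \<in> T \<or>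
      (\<exists>i<l. (p, q) \<in> {(?u i, 2 * n + 1 - ?v i), (2 * n + 1 - ?v i, ?u i)})"
    if "(p, q, a) \<in> diag n S xs T" for p q a
    using that unfolding diag_iff[OF S T xs] by (auto split: if_splits)
  have ST: "\<not> crossing (p, q) (p', q') \<and> \<not> crossing (p', q') (p, q)"
    if "p \<in> {1..n}" "q \<in> {1..n}" "p' \<in> {n + 1..2 * n}" "q' \<in> {n + 1..2 * n}" for p q p' q'
    using that by (auto simp: crossing_iff)
  have SW: "\<not> crossing (p, q) (?u i, 2 * n + 1 - ?v i) \<and> \<not> crossing (?u i, 2 * n + 1 - ?v i) (p, q)"
    if e: "(p, q, a) \<in> S" "i < l" for p q a i
  proof -
    have "?u i < min p q \<or> ?u i > max p q" by (rule hS(7)[OF e(1) u(1)[OF e(2)]])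
    moreover have "p \<le> n" "q \<le> n" "?u i \<le> n" "2 * n + 1 - ?v i > n"
      using hS(5)[OF e(1)] u(2)[OF e(2)] v(2)[OF e(2)] by auto
    ultimately show ?thesis unfolding crossing_def by (auto simp: min_def max_def split: if_splits)
  qed
  have TW: "\<not> crossing (p, q) (?u i, 2 * n + 1 - ?v i) \<and> \<not> crossing (?u i, 2 * n + 1 - ?v i) (p, q)"
    if e: "p \<in> {n + 1..2 * n}" "q \<in> {n + 1..2 * n}" "(2 * n + 1 - q, 2 * n + 1 - p, a) \<in> T" "i < l" for p q a i
  proof -
    have "?v i < min (2 * n + 1 - q) (2 * n + 1 - p) \<or> ?v i > max (2 * n + 1 - q) (2 * n + 1 - p)"
      by (rule hT(7)[OF e(3) v(1)[OF e(4)]])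
    then have "2 * n + 1 - ?v i < min p q \<or> 2 * n + 1 - ?v i > max p q"
      using e(1,2) v(2)[OF e(4)] by (auto simp: min_def max_def split: if_splits)
    moreover have "?u i \<le> n" using u(2)[OF e(4)] by auto
    ultimately show ?thesis using e(1,2) unfolding crossing_def by (auto simp: min_def max_def split: if_splits)
  qed
  \<comment> \<open>Both lists of free points increase, while the reflection reverses the order on
    the lower side; a crossing would require \<open>i < j\<close> and \<open>j < i\<close>.\<close>
  have WW: "\<not> crossing (?u i, 2 * n + 1 - ?v i) (?u j, 2 * n + 1 - ?v j)" if ij: "i < l" "j < l" for i j
  proof
    assume c: "crossing (?u i, 2 * n + 1 - ?v i) (?u j, 2 * n + 1 - ?v j)"
    have b: "?u i \<le> n" "?u j \<le> n" "?v i \<le> n" "?v j \<le> n" "1 \<le> ?v i" "1 \<le> ?v j"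
      using u(2)[OF ij(1)] u(2)[OF ij(2)] v(2)[OF ij(1)] v(2)[OF ij(2)] by auto
    then have "?u i < ?u j" "2 * n + 1 - ?v i < 2 * n + 1 - ?v j"
      using c unfolding crossing_def by (auto simp: min_def max_def split: if_splits)
    then have "?u i < ?u j" "?v j < ?v i" by auto
    then have "i < j" "j < i"
      using free_nth_less[OF S _ ij(1), of j] free_nth_less[OF T _ ij(2), of i] by (metis linorder_neqE_nat less_asym)+
    then show False by simp
  qed
  have SS: "\<not> crossing (p, q) (p', q')" if "(p, q, a) \<in> S" "(p', q', a') \<in> S" for p q a p' q' a'
    by (rule noncrossingD[OF hS(6) that])
  have TT: "\<not> crossing (p, q) (p', q')"
    if e: "p \<in> {n + 1..2 * n}" "q \<in> {n + 1..2 * n}" "(2 * n + 1 - q, 2 * n + 1 - p, a) \<in> T"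
      "p' \<in> {n + 1..2 * n}" "q' \<in> {n + 1..2 * n}" "(2 * n + 1 - q', 2 * n + 1 - p', a') \<in> T" for p q a p' q' a'
  proof -
    have "\<not> crossing (2 * n + 1 - q', 2 * n + 1 - p') (2 * n + 1 - q, 2 * n + 1 - p)"
      by (rule noncrossingD[OF hT(6) e(6,3)])
    moreover have "crossing (2 * n + 1 - q', 2 * n + 1 - p') (2 * n + 1 - q, 2 * n + 1 - p) \<longleftrightarrow> crossing (p, q) (p', q')"
      by (rule crossing_reflect) (use e in auto)
    ultimately show ?thesis by simp
  qed
  fix p q a p' q' a' assume e: "(p, q, a) \<in> diag n S xs T" and e': "(p', q', a') \<in> diag n S xs T"
  note W = SW TW WW crossing_swap
  from split[OF e] show "\<not> crossing (p, q) (p', q')"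
  proof (elim disjE conjE exE)
    assume 1: "(p, q, a) \<in> S"
    then have r: "p \<in> {1..n}" "q \<in> {1..n}" using hS(5) by blast+
    from split[OF e'] show ?thesis
      using SS[OF 1] ST[OF r] SW[OF 1] crossing_swap(2)[of "(p, q)"] by (elim disjE conjE exE) auto
  next
    assume 1: "p \<in> {n + 1..2 * n}" "q \<in> {n + 1..2 * n}" "(2 * n + 1 - q, 2 * n + 1 - p, bar a) \<in> T"
    from split[OF e'] show ?thesis
    proof (elim disjE conjE exE)
      assume 2: "(p', q', a') \<in> S"
      then have "p' \<in> {1..n}" "q' \<in> {1..n}" using hS(5) by blast+
      from ST[OF this 1(1,2)] show ?thesis by blast
    next
      assume "p' \<in> {n + 1..2 * n}" "q' \<in> {n + 1..2 * n}" "(2 * n + 1 - q', 2 * n + 1 - p', bar a') \<in> T"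
      from TT[OF 1 this] show ?thesis .
    next
      fix j assume "j < l" "(p', q') \<in> {(?u j, 2 * n + 1 - ?v j), (2 * n + 1 - ?v j, ?u j)}"
      then show ?thesis using TW[OF 1] crossing_swap(2)[of "(p, q)"] by auto
    qed
  next
    fix i assume i: "i < l"
    assume "(p, q) \<in> {(?u i, 2 * n + 1 - ?v i), (2 * n + 1 - ?v i, ?u i)}"
    then have "p = ?u i \<and> q = 2 * n + 1 - ?v i \<or> q = ?u i \<and> p = 2 * n + 1 - ?v i" by auto
    then have pq: "crossing (p, q) f = crossing (?u i, 2 * n + 1 - ?v i) f" for f
      using crossing_swap(1)[of p q f] by metis
    from split[OF e'] show ?thesis unfolding pq
    proof (elim disjE conjE exE)
      assume "(p', q', a') \<in> S"
      from SW[OF this i] show "\<not> crossing (?u i, 2 * n + 1 - ?v i) (p', q')" by blast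
    next
      assume "p' \<in> {n + 1..2 * n}" "q' \<in> {n + 1..2 * n}" "(2 * n + 1 - q', 2 * n + 1 - p', bar a') \<in> T"
      from TW[OF this i] show "\<not> crossing (?u i, 2 * n + 1 - ?v i) (p', q')" by blast
    next
      fix j assume "j < l" "(p', q') \<in> {(?u j, 2 * n + 1 - ?v j), (2 * n + 1 - ?v j, ?u j)}"
      then show "\<not> crossing (?u i, 2 * n + 1 - ?v i) (p', q')"
        using WW[OF i] crossing_swap(2)[of "(?u i, 2 * n + 1 - ?v i)"] by auto
    qed
  qed
qed

lemma diag_diagrams:
  assumes "half_diagram n l S" "half_diagram n l T" "xs \<in> basis_lists l"
  shows "diag n S xs T \<in> diagrams n B"
proof -
  have xs: "length xs = l" "set xs \<subseteq> B" using assms(3) by (auto simp: basis_lists_def)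
  have p: "pre_diagram n (diag n S xs T)" by (rule pre_diagram_diag[OF assms(1,2) xs(1)]) (use xs in auto)
  have "a \<in> B" if "(p, q, a) \<in> diag n S xs T" for p q a
    using that unfolding diag_iff[OF assms(1,2) xs(1)]
  proof (elim disjE conjE exE)
    assume "(p, q, a) \<in> S"
    then show "a \<in> B" by (rule half_diagramD(4)[OF assms(1)])
  next
    assume a: "a \<in> carrier A" and "(2 * n + 1 - q, 2 * n + 1 - p, bar a) \<in> T"
    from half_diagramD(4)[OF assms(2) this(2)] show "a \<in> B" using bar_basis_iff[OF a] by simp
  next
    fix i assume "i < l" "a = xs ! i"
    then show "a \<in> B" using xs nth_mem[of i xs] by auto
  qed
  then show ?thesis
    using p noncrossing_diag[OF assms(1,2) xs(1)] by (auto simp: diagrams_iff pre_diagram_def label_graphD)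
qed

text \<open>Together with \<open>flip_diag\<close> this recovers both halves from the diagram, as
  needed for \<open>diag_inject\<close>.\<close>

lemma top_half_diag:
  assumes "half_diagram n l S" "half_diagram n l T" "length xs = l"
  shows "top_half n (diag n S xs T) = S"
proof -
  have "p \<le> n \<and> q \<le> n \<and> (p, q, a) \<in> diag n S xs T \<longleftrightarrow> (p, q, a) \<in> S" for p q a
    unfolding diag_iff[OF assms]
    using half_diagramD(5)[OF assms(1), of p q a] free_nth(2)[OF assms(2)] by (fastforce split: if_splits)
  then show ?thesis by (auto simp: top_half_def)
qed

lemma through_diag:
  assumes "half_diagram n l S" "half_diagram n l T" "length xs = l"
  shows "through n (diag n S xs T) = thr_edges n S xs T" "card (through n (diag n S xs T)) = l"
proof -
  have "(p \<le> n) \<noteq> (q \<le> n) \<and> (p, q, a) \<in> diag n S xs T \<longleftrightarrow> (p, q, a) \<in> thr_edges n S xs T" for p q a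
    unfolding diag_iff[OF assms] thr_edges_iff[OF assms]
    using half_diagramD(5)[OF assms(1), of p q a] free_nth(2)[OF assms(2)] free_nth(2)[OF assms(1)]
    by (fastforce split: if_splits)
  then show 1: "through n (diag n S xs T) = thr_edges n S xs T" by (auto simp: through_def)
  have "inj_on (\<lambda>i. thr_edge n (free_list n S ! i) (free_list n T ! i) (xs ! i)) {..<length xs}"
  proof (rule inj_onI)
    fix i j assume ij: "i \<in> {..<length xs}" "j \<in> {..<length xs}"
      "thr_edge n (free_list n S ! i) (free_list n T ! i) (xs ! i) = thr_edge n (free_list n S ! j) (free_list n T ! j) (xs ! j)"
    then have "i < l" "j < l" using assms(3) by auto
    then show "i = j"
      using ij(3) free_nth(2)[OF assms(1)] free_nth(2)[OF assms(2)] free_nth_inj[OF assms(1), of i j]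
      unfolding thr_edge_def by (fastforce split: if_splits)
  qed
  from card_image[OF this] show "card (through n (diag n S xs T)) = l"
    unfolding 1 thr_edges_def using assms(3) by simp
qed

lemma flip_diag:
  assumes "half_diagram n l S" "half_diagram n l T" "length xs = l" "set xs \<subseteq> carrier A"
  shows "flip n (diag n S xs T) = diag n T (map bar xs) S"
proof -
  have 1: "flip n (D \<union> D') = flip n D \<union> flip n D'" for D D'
    by (simp add: flip_image image_Un)
  have 2: "flip n (flip n T) = T"
  proof -
    have "flip n (flip n T) = (\<lambda>e. e) ` T"
      unfolding flip_image image_image
    proof (rule image_cong[OF refl])
      fix e assume e: "e \<in> T"
      obtain p q a where [simp]: "e = (p, q, a)" by (cases e)
      have "p \<in> {1..n}" "q \<in> {1..n}" "a \<in> B" using e half_diagramD(4,5)[OF assms(2)] by auto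
      then show "(case case e of (p, q, a) \<Rightarrow> (2 * n + 1 - q, 2 * n + 1 - p, bar a) of
          (p, q, a) \<Rightarrow> (2 * n + 1 - q, 2 * n + 1 - p, bar a)) = e" by auto
    qed
    then show ?thesis by simp
  qed
  have 3: "flip n (thr_edges n S xs T) = thr_edges n T (map bar xs) S"
    unfolding flip_image thr_edges_def image_image length_map
  proof (rule image_cong[OF refl])
    fix i assume i: "i \<in> {..<length xs}"
    then have i': "i < l" using assms(3) by simp
    then show "(case thr_edge n (free_list n S ! i) (free_list n T ! i) (xs ! i) of (p, q, a) \<Rightarrow> (2 * n + 1 - q, 2 * n + 1 - p, bar a)) =
        thr_edge n (free_list n T ! i) (free_list n S ! i) (map bar xs ! i)"
      using free_nth(2)[OF assms(1) i'] free_nth(2)[OF assms(2) i'] half_parity[OF assms(1) i'] half_parity[OF assms(2) i'] i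
      by (auto simp: thr_edge_def)
  qed
  show ?thesis unfolding diag_def 1 2 3 by blast
qed

end

section \<open>Decomposition of a diagram into halves and through strings\<close>

context int_table_algebra
begin

text \<open>For a through string: its end on the upper side of the box, where the point numbers are
  low. \<open>mirror_end\<close> is the reflection of the end on the lower side.\<close>

definition low_end :: "nat \<Rightarrow> nat \<times> nat \<times> 'a \<Rightarrow> nat" where
  "low_end n = (\<lambda>(p, q, a). if p \<le> n then p else q)"

definition mirror_end :: "nat \<Rightarrow> nat \<times> nat \<times> 'a \<Rightarrow> nat" where
  "mirror_end n = (\<lambda>(p, q, a). 2 * n + 1 - (if p \<le> n then q else p))"

lemma diagram_edge:
  assumes "D \<in> diagrams n B" "(p, q, a) \<in> D"
  shows "even p" "odd q" "p \<in> {1..2 * n}" "q \<in> {1..2 * n}" "a \<in> B"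
  using assms srcsI[OF assms(2)] tgtsI[OF assms(2)] by (auto simp: diagrams_iff evens_def odds_def)

lemma free_points_top_half:
  assumes D: "D \<in> diagrams n B"
  shows "free_points n (top_half n D) = low_end n ` through n D" "inj_on (low_end n) (through n D)"
proof -
  have pb: "partial_bij D" using D by (simp add: diagrams_iff)
  note e = diagram_edge[OF D]
  show "free_points n (top_half n D) = low_end n ` through n D"
  proof (intro equalityI subsetI)
    fix u assume u: "u \<in> free_points n (top_half n D)"
    then have u1: "u \<in> {1..n}" "u \<notin> srcs (top_half n D)" "u \<notin> tgts (top_half n D)"
      by (auto simp: free_points_def verts_def)
    show "u \<in> low_end n ` through n D"
    proof (cases "even u")
      case True
      then have "u \<in> srcs D" using D u1(1) by (auto simp: diagrams_iff evens_def)
      then obtain q a where q: "(u, q, a) \<in> D" by (auto simp: srcs_def)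
      then have "\<not> q \<le> n" using u1 by (auto simp: top_half_def srcs_def)
      then have "(u, q, a) \<in> through n D" using q u1(1) by (simp add: through_def)
      then show ?thesis using u1(1) by (intro image_eqI[of _ _ "(u, q, a)"]) (auto simp: low_end_def)
    next
      case False
      then have "u \<in> tgts D" using D u1(1) by (auto simp: diagrams_iff odds_def)
      then obtain q a where q: "(q, u, a) \<in> D" by (auto simp: tgts_def)
      then have "\<not> q \<le> n" using u1 by (auto simp: top_half_def tgts_def)
      then have "(q, u, a) \<in> through n D" "\<not> q \<le> n" using q u1(1) by (simp_all add: through_def)
      then show ?thesis by (intro image_eqI[of _ _ "(q, u, a)"]) (auto simp: low_end_def)
    qed
  next
    fix u assume "u \<in> low_end n ` through n D"
    then obtain x where x: "x \<in> through n D" "u = low_end n x" by blast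
    obtain p q a where "x = (p, q, a)" by (cases x)
    with x have pq: "(p, q, a) \<in> D" "(p \<le> n) \<noteq> (q \<le> n)" "u = (if p \<le> n then p else q)"
      by (simp_all add: through_def low_end_def)
    have "u \<notin> srcs (top_half n D)"
    proof
      assume "u \<in> srcs (top_half n D)"
      then obtain q' a' where q': "(u, q', a') \<in> D" "u \<le> n" "q' \<le> n" by (auto simp: srcs_def top_half_def)
      show False
      proof (cases "p \<le> n")
        case True
        then have "(p, q', a') \<in> D" using q'(1) pq(3) by simp
        from partial_bijD(2)[OF pb pq(1) this] show ?thesis using True pq(2) q'(3) by simp
      next
        case False
        then show ?thesis using e(2)[OF pq(1)] e(1)[OF q'(1)] pq(3) by simp
      qed
    qed
    moreover have "u \<notin> tgts (top_half n D)"
    proof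
      assume "u \<in> tgts (top_half n D)"
      then obtain q' a' where q': "(q', u, a') \<in> D" "u \<le> n" "q' \<le> n" by (auto simp: tgts_def top_half_def)
      show False
      proof (cases "p \<le> n")
        case False
        then have "(q', q, a') \<in> D" using q'(1) pq(3) by simp
        from partial_bijD(4)[OF pb pq(1) this] show ?thesis using False q'(3) by simp
      next
        case True
        then show ?thesis using e(1)[OF pq(1)] e(2)[OF q'(1)] pq(3) by simp
      qed
    qed
    ultimately show "u \<in> free_points n (top_half n D)"
      using e(3,4)[OF pq(1)] pq(2,3) by (auto simp: free_points_def verts_def)
  qed
  show "inj_on (low_end n) (through n D)"
  proof (rule inj_onI)
    fix x y assume xy: "x \<in> through n D" "y \<in> through n D" "low_end n x = low_end n y"
    obtain p q a p' q' a' where [simp]: "x = (p, q, a)" "y = (p', q', a')" by (cases x, cases y)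
    have m: "(p, q, a) \<in> D" "(p', q', a') \<in> D" "(p \<le> n) \<noteq> (q \<le> n)" "(p' \<le> n) \<noteq> (q' \<le> n)"
      using xy by (auto simp: through_def)
    have l: "(if p \<le> n then p else q) = (if p' \<le> n then p' else q')" using xy(3) by (simp add: low_end_def)
    consider "p = p'" | "q = q'"
      using l e(1,2)[OF m(1)] e(1,2)[OF m(2)] by (auto split: if_splits)
    then show "x = y"
    proof cases
      case 1 with m(2) have "(p, q', a') \<in> D" by simp
      then show ?thesis using partial_bijD(2,3)[OF pb m(1)] 1 by auto
    next
      case 2 with m(2) have "(p', q, a') \<in> D" by simp
      then show ?thesis using partial_bijD(4,5)[OF pb m(1)] 2 by auto
    qed
  qed
qed

lemma half_diagram_top_half:
  assumes D: "D \<in> diagrams n B"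
  shows "half_diagram n (card (through n D)) (top_half n D)"
  unfolding half_diagram_def
proof (intro conjI allI impI ballI)
  have sub: "top_half n D \<subseteq> D" by (auto simp: top_half_def)
  have pb: "partial_bij D" and nc: "noncrossing (\<lambda>p. p) (\<lambda>p. p) D" using D by (auto simp: diagrams_iff)
  note e = diagram_edge[OF D]
  show "partial_bij (top_half n D)" by (rule partial_bij_subset[OF pb sub])
  show "verts (top_half n D) \<subseteq> {1..n}"
    using e(3,4) by (fastforce simp: verts_def srcs_def tgts_def top_half_def)
  show "even p" if "p \<in> srcs (top_half n D)" for p using that e(1) by (auto simp: srcs_def top_half_def)
  show "odd p" if "p \<in> tgts (top_half n D)" for p using that e(2) by (auto simp: tgts_def top_half_def)
  show "a \<in> B" if "(p, q, a) \<in> top_half n D" for p q a using that e(5) by (auto simp: top_half_def)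
  show "noncrossing (\<lambda>p. p) (\<lambda>p. p) (top_half n D)"
    unfolding noncrossing_def using noncrossingD[OF nc] sub by blast
  show "card (free_points n (top_half n D)) = card (through n D)"
    unfolding free_points_top_half(1)[OF D] by (rule card_image[OF free_points_top_half(2)[OF D]])
  fix p q a u assume pq: "(p, q, a) \<in> top_half n D" and u: "u \<in> free_points n (top_half n D)"
  then obtain p' q' a' where t: "(p', q', a') \<in> through n D" "u = low_end n (p', q', a')"
    unfolding free_points_top_half(1)[OF D] by auto
  have m: "(p, q, a) \<in> D" "p \<le> n" "q \<le> n" "(p', q', a') \<in> D" "(p' \<le> n) \<noteq> (q' \<le> n)"
    using pq t by (auto simp: top_half_def through_def)
  have "\<not> crossing (p, q) (p', q')" by (rule noncrossingD[OF nc m(1,4)])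
  moreover have "u = min p' q'" "max p' q' > n" using t(2) m(5) by (auto simp: low_end_def)
  moreover have "max p q \<le> n" using m by simp
  ultimately show "\<not> (min p q < u \<and> u < max p q)" by (auto simp: crossing_def)
qed

lemma through_flip:
  assumes D: "D \<in> diagrams n B"
  shows "through n (flip n D) = (\<lambda>(p, q, a). (2 * n + 1 - q, 2 * n + 1 - p, bar a)) ` through n D"
    and "card (through n (flip n D)) = card (through n D)"
    and "low_end n ` through n (flip n D) = mirror_end n ` through n D"
    and "inj_on (mirror_end n) (through n D)"
proof -
  let ?f = "\<lambda>(p, q, a). (2 * n + 1 - q, 2 * n + 1 - p, bar a)"
  note e = diagram_edge[OF D]
  have F: "flip n D \<in> diagrams n B" by (rule flip_diagrams[OF D])
  have thr: "((2 * n + 1 - q \<le> n) \<noteq> (2 * n + 1 - p \<le> n)) \<longleftrightarrow> ((p \<le> n) \<noteq> (q \<le> n))" if "(p, q, a) \<in> D" for p q a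
    using e(3,4)[OF that] by auto
  show 1: "through n (flip n D) = ?f ` through n D"
  proof (intro equalityI subsetI)
    fix x assume "x \<in> through n (flip n D)"
    then obtain p q a where m: "(p, q, a) \<in> D" "x = ?f (p, q, a)" "(2 * n + 1 - q \<le> n) \<noteq> (2 * n + 1 - p \<le> n)"
      by (auto simp: through_def flip_image)
    then have "(p, q, a) \<in> through n D" using thr[OF m(1)] by (simp add: through_def)
    then show "x \<in> ?f ` through n D" unfolding m(2) by (rule imageI)
  next
    fix x assume "x \<in> ?f ` through n D"
    then obtain p q a where m: "(p, q, a) \<in> D" "x = ?f (p, q, a)" "(p \<le> n) \<noteq> (q \<le> n)"
      by (auto simp: through_def)
    moreover from m(1) have "?f (p, q, a) \<in> flip n D" unfolding flip_image by (rule imageI)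
    ultimately show "x \<in> through n (flip n D)" using thr[OF m(1)] by (simp add: through_def)
  qed
  have lm: "low_end n (?f x) = mirror_end n x" if "x \<in> through n D" for x
  proof -
    obtain p q a where [simp]: "x = (p, q, a)" by (cases x)
    have m: "(p, q, a) \<in> D" "(p \<le> n) \<noteq> (q \<le> n)" using that by (auto simp: through_def)
    then show ?thesis using e(3,4)[OF m(1)] by (auto simp: low_end_def mirror_end_def)
  qed
  show 2: "low_end n ` through n (flip n D) = mirror_end n ` through n D"
    unfolding 1 image_image by (rule image_cong[OF refl lm])
  have fin: "finite (through n D)"
    by (rule finite_subset[of _ D]) (use D in \<open>auto simp: through_def diagrams_iff partial_bijD\<close>)
  have inj: "inj_on ?f (through n D)"
  proof (rule inj_onI)
    fix x y assume xy: "x \<in> through n D" "y \<in> through n D" "?f x = ?f y"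
    obtain p q a p' q' a' where [simp]: "x = (p, q, a)" "y = (p', q', a')" by (cases x, cases y)
    have m: "(p, q, a) \<in> D" "(p', q', a') \<in> D" using xy by (auto simp: through_def)
    have "p = p'" using xy(3) e(3)[OF m(1)] e(3)[OF m(2)] by auto
    then show "x = y" using m D partial_bijD(2,3)[of D p q a q' a'] by (auto simp: diagrams_iff)
  qed
  then show 3: "card (through n (flip n D)) = card (through n D)" unfolding 1 by (rule card_image)
  have "inj_on (low_end n \<circ> ?f) (through n D)"
    by (rule comp_inj_on[OF inj]) (use free_points_top_half(2)[OF F] in \<open>simp add: 1\<close>)
  then show "inj_on (mirror_end n) (through n D)"
    by (rule inj_on_cong[THEN iffD1, rotated]) (use lm in simp)
qed

text \<open>Otherwise the two through strings would cross.\<close>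

lemma ends_mono:
  assumes D: "D \<in> diagrams n B" and e: "x \<in> through n D" "y \<in> through n D" "low_end n x < low_end n y"
  shows "mirror_end n x < mirror_end n y"
proof (rule ccontr)
  assume nl: "\<not> mirror_end n x < mirror_end n y"
  obtain p q a p' q' a' where [simp]: "x = (p, q, a)" "y = (p', q', a')" by (cases x, cases y)
  have m: "(p, q, a) \<in> D" "(p', q', a') \<in> D" "(p \<le> n) \<noteq> (q \<le> n)" "(p' \<le> n) \<noteq> (q' \<le> n)"
    using e by (auto simp: through_def)
  have "mirror_end n x \<noteq> mirror_end n y" using inj_onD[OF through_flip(4)[OF D] _ e(1,2)] e(3) by auto
  then have "mirror_end n y < mirror_end n x" using nl by simp
  then have "crossing (p, q) (p', q')"
    using e(3) m(3,4) diagram_edge(3,4)[OF D m(1)] diagram_edge(3,4)[OF D m(2)]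
    unfolding crossing_def mirror_end_def low_end_def by (auto simp: min_def max_def split: if_splits)
  moreover have "noncrossing (\<lambda>p. p) (\<lambda>p. p) D" using D by (simp add: diagrams_iff)
  ultimately show False using noncrossingD[OF _ m(1,2)] by blast
qed

text \<open>The through strings are listed by their upper ends. By \<open>ends_mono\<close> the same
  list is sorted by reflected lower ends, so the \<open>i\<close>-th string joins the
  \<open>i\<close>-th free points of both halves.\<close>

lemma diagram_decomposition:
  assumes D: "D \<in> diagrams n B"
  obtains l S xs T where "l \<le> n" "half_diagram n l S" "half_diagram n l T" "xs \<in> basis_lists l" "D = diag n S xs T"
proof -
  let ?S = "top_half n D" and ?T = "top_half n (flip n D)" and ?l = "card (through n D)"
  note F = flip_diagrams[OF D]
  have S: "half_diagram n ?l ?S" by (rule half_diagram_top_half[OF D])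
  have T: "half_diagram n ?l ?T" using half_diagram_top_half[OF F] through_flip(2)[OF D] by simp
  note e = diagram_edge[OF D]
  define es where "es = map (inv_into (through n D) (low_end n)) (free_list n ?S)"
  note fs = free_points_top_half[OF D]
  have set: "set es = through n D"
  proof -
    have "set (free_list n ?S) = low_end n ` through n D" unfolding set_free_list by (rule fs(1))
    then show ?thesis unfolding es_def set_map by (simp only: inv_into_image_cancel[OF fs(2) subset_refl])
  qed
  have low: "map (low_end n) es = free_list n ?S"
    unfolding es_def map_map
  proof (rule map_idI)
    fix u assume "u \<in> set (free_list n ?S)"
    then have "u \<in> free_points n ?S" by simp
    then have "u \<in> low_end n ` through n D" unfolding fs(1) .
    then show "(low_end n \<circ> inv_into (through n D) (low_end n)) u = u" by (simp add: f_inv_into_f)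
  qed
  have mirror: "map (mirror_end n) es = free_list n ?T"
  proof (rule strict_sorted_equal)
    have "sorted_wrt (<) (map (low_end n) es)" unfolding low by (rule strict_sorted_list_of_set)
    then have "sorted_wrt (\<lambda>x y. low_end n x < low_end n y) es" by (simp add: sorted_wrt_map)
    then have "sorted_wrt (\<lambda>x y. mirror_end n x < mirror_end n y) es"
      by (rule sorted_wrt_mono_rel[rotated]) (use set ends_mono[OF D] in auto)
    then show "sorted_wrt (<) (map (mirror_end n) es)" by (simp add: sorted_wrt_map)
    show "sorted_wrt (<) (free_list n ?T)" by (rule strict_sorted_list_of_set)
    show "set (map (mirror_end n) es) = set (free_list n ?T)"
    proof -
      have "set (free_list n ?T) = low_end n ` through n (flip n D)"
        unfolding set_free_list by (rule free_points_top_half(1)[OF F])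
      then show ?thesis unfolding through_flip(3)[OF D] set_map set by (rule sym)
    qed
  qed
  let ?xs = "map (\<lambda>(p, q, a). a) es"
  have len: "length es = ?l" unfolding es_def using half_diagramD(9)[OF S] by simp
  have xs: "?xs \<in> basis_lists ?l"
  proof -
    have "set ?xs \<subseteq> B" using set e(5) by (auto simp: through_def)
    then show ?thesis using len by (simp add: basis_lists_def)
  qed
  have lxs: "length ?xs = ?l" using len by simp
  have thr: "thr_edges n ?S ?xs ?T = through n D"
  proof -
    have edge: "thr_edge n (low_end n x) (mirror_end n x) (case x of (p, q, a) \<Rightarrow> a) = x" if x: "x \<in> through n D" for x
    proof -
      obtain p q a where [simp]: "x = (p, q, a)" by (cases x)
      have m: "(p, q, a) \<in> D" "(p \<le> n) \<noteq> (q \<le> n)" using x by (auto simp: through_def)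
      show ?thesis using m(2) e(1-4)[OF m(1)] by (auto simp: thr_edge_def low_end_def mirror_end_def)
    qed
    have "thr_edges n ?S ?xs ?T = (\<lambda>i. es ! i) ` {..<length es}"
      unfolding thr_edges_def low[symmetric] mirror[symmetric] length_map
    proof (rule image_cong[OF refl])
      fix i assume i: "i \<in> {..<length es}"
      then have "es ! i \<in> through n D" using set nth_mem by auto
      from edge[OF this] show "thr_edge n (map (low_end n) es ! i) (map (mirror_end n) es ! i) (?xs ! i) = es ! i"
        using i by simp
    qed
    also have "\<dots> = set es" by (auto simp: set_conv_nth)
    finally show ?thesis unfolding set .
  qed
  have "(p, q, a) \<in> D \<longleftrightarrow> (p, q, a) \<in> diag n ?S ?xs ?T" for p q a
  proof -
    have "(p, q, a) \<in> flip n ?T \<longleftrightarrow> (p, q, a) \<in> D \<and> \<not> p \<le> n \<and> \<not> q \<le> n"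
    proof
      assume "(p, q, a) \<in> flip n ?T"
      then have *: "p \<in> {n + 1..2 * n}" "q \<in> {n + 1..2 * n}" "a \<in> carrier A" "(2 * n + 1 - q, 2 * n + 1 - p, bar a) \<in> flip n D"
        unfolding flip_half_iff[OF T] by (auto simp: top_half_def)
      have "label_graph D" "verts D \<subseteq> {1..2 * n}"
        using diagram_pre_diagram[OF D] verts_pre_diagram by (auto simp: pre_diagram_def)
      from *(4)[unfolded flip_iff[OF this]] * show "(p, q, a) \<in> D \<and> \<not> p \<le> n \<and> \<not> q \<le> n" by auto
    next
      assume *: "(p, q, a) \<in> D \<and> \<not> p \<le> n \<and> \<not> q \<le> n"
      then have m: "(p, q, a) \<in> D" by simp
      have "(2 * n + 1 - q, 2 * n + 1 - p, bar a) \<in> flip n D"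
        unfolding flip_image using image_eqI[OF _ m] by force
      then show "(p, q, a) \<in> flip n ?T"
        unfolding flip_half_iff[OF T] using * e(3-5)[OF m] by (auto simp: top_half_def)
    qed
    then show ?thesis unfolding diag_def Un_iff thr by (auto simp: top_half_def through_def)
  qed
  then have "D = diag n ?S ?xs ?T" by auto
  moreover have "?l \<le> n" using card_half[OF S] by simp
  ultimately show thesis using that S T xs by blast
qed

lemma diag_inject:
  assumes "half_diagram n l S" "half_diagram n l T" "xs \<in> basis_lists l"
    and "half_diagram n l' S'" "half_diagram n l' T'" "xs' \<in> basis_lists l'"
    and eq: "diag n S xs T = diag n S' xs' T'"
  shows "l = l'" "S = S'" "xs = xs'" "T = T'"
proof -
  have len: "length xs = l" "length xs' = l'" and c: "set xs \<subseteq> carrier A" "set xs' \<subseteq> carrier A"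
    using assms by (auto simp: basis_lists_def)
  show l: "l = l'"
    using through_diag(2)[OF assms(1,2) len(1)] through_diag(2)[OF assms(4,5) len(2)] eq by simp
  show S: "S = S'"
    using top_half_diag[OF assms(1,2) len(1)] top_half_diag[OF assms(4,5) len(2)] eq by simp
  have "diag n T (map bar xs) S = diag n T' (map bar xs') S'"
    using flip_diag[OF assms(1,2) len(1) c(1)] flip_diag[OF assms(4,5) len(2) c(2)] eq by simp
  then show T: "T = T'"
    using top_half_diag[OF assms(2,1), of "map bar xs"] top_half_diag[OF assms(5,4), of "map bar xs'"] len by simp
  have pb: "partial_bij (diag n S xs T)"
    using diag_diagrams[OF assms(1-3)] by (simp add: diagrams_iff)
  show "xs = xs'"
  proof (rule nth_equalityI)
    show "length xs = length xs'" using len l by simp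
    fix i assume "i < length xs"
    then have i: "i < l" using len by simp
    let ?e = "\<lambda>x. if odd i then (free_list n S ! i, 2 * n + 1 - free_list n T ! i, x)
        else (2 * n + 1 - free_list n T ! i, free_list n S ! i, x)"
    have "?e (xs ! i) \<in> diag n S xs T"
      using i by (cases "odd i") (auto simp: diag_iff[OF assms(1,2) len(1)])
    moreover have "?e (xs' ! i) \<in> diag n S xs T"
      unfolding eq using i l S T by (cases "odd i") (auto simp: diag_iff[OF assms(4,5) len(2)])
    ultimately show "xs ! i = xs' ! i"
      using partial_bijD(3)[OF pb] by (cases "odd i") auto
  qed
qed

end

section \<open>Counting loops\<close>

lemma finite_loops:
  assumes "partial_bij E" shows "finite (loops E)"
proof -
  have "loops E = reach E ` {x \<in> inner E. x \<in> reach E x}"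
    unfolding loops_reach using reach_inner[OF assms] by blast
  then show ?thesis using finite_inner[OF assms] by simp
qed

text \<open>Distinct loops are disjoint, so choosing a point of \<open>Q\<close> on each loop is
  injective. In case of equality every point of \<open>Q\<close> lies on a loop of its own.\<close>

lemma
  assumes pb: "partial_bij E" and fin: "finite Q"
    and meets: "\<And>x. x \<in> reach E x \<Longrightarrow> \<exists>y\<in>Q. y \<in> reach E x"
  shows card_loops_le: "card (loops E) \<le> card Q"
    and card_loops_eqD: "card (loops E) = card Q \<Longrightarrow> y \<in> Q \<Longrightarrow> y \<in> reach E y"
      "card (loops E) = card Q \<Longrightarrow> y \<in> Q \<Longrightarrow> z \<in> Q \<Longrightarrow> z \<in> reach E y \<Longrightarrow> z = y"
proof -
  let ?Q = "{y \<in> Q. y \<in> reach E y}"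
  have l: "loops E = reach E ` ?Q"
  proof
    show "loops E \<subseteq> reach E ` ?Q"
    proof
      fix L assume "L \<in> loops E"
      then obtain x where x: "x \<in> reach E x" "L = reach E x" by (auto simp: loops_reach)
      from meets[OF x(1)] obtain y where y: "y \<in> Q" "y \<in> reach E x" by blast
      have "reach E y = L" using reach_closed(1)[OF pb x(1) y(2)] x by simp
      then show "L \<in> reach E ` ?Q" using y x by (intro image_eqI[of _ _ y]) auto
    qed
  qed (auto simp: loops_reach)
  have le: "card (loops E) \<le> card ?Q" "card ?Q \<le> card Q"
    unfolding l using fin by (auto intro: card_image_le card_mono)
  then show "card (loops E) \<le> card Q" by simp
  assume eq: "card (loops E) = card Q"
  then have Q: "?Q = Q" using le fin by (intro card_subset_eq) auto
  show r: "y \<in> Q \<Longrightarrow> y \<in> reach E y" for y using Q by blast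
  have inj: "inj_on (reach E) Q"
    using eq l fin unfolding Q by (intro eq_card_imp_inj_on) auto
  assume y: "y \<in> Q" "z \<in> Q" "z \<in> reach E y"
  show "z = y" using inj_onD[OF inj reach_closed(1)[OF pb r[OF y(1)] y(3)] y(2,1)] .
qed

context int_table_algebra
begin

lemma loop_factor_power:
  "loop_factor A B E = delta ^ card (loops E) * of_int (\<Prod>L\<in>loops E. t (loop_label A E L))"
  by (simp add: loop_factor_def prod.distrib)

lemma loop_value_neq_0:
  assumes E: "label_graph E" and nz: "loop_factor A B E \<noteq> 0" and x: "x \<in> reach E x"
  shows "loop_value E x \<noteq> 0"
proof
  assume "loop_value E x = 0"
  then have "t (loop_label A E (reach E x)) = 0" using loop_label_value[OF E x] by simp
  moreover have "reach E x \<in> loops E" using x by (auto simp: loops_reach)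
  ultimately have "(\<Prod>L\<in>loops E. t (loop_label A E L)) = 0"
    using finite_loops[OF label_graphD(1)[OF E]] by (intro prod_zero) auto
  then show False using nz by (simp add: loop_factor_power)
qed

lemma
  assumes E: "label_graph E" and e: "(x, x, a) \<in> E"
  shows one_cycle: "reach E x = {x}" "loop_value E x = t a"
proof -
  note pb = label_graphD(1)[OF E]
  have "(next_vertex E ^^ 1) x = x" using next_vertex_eq[OF pb e] by simp
  from orbit_altdef_bounded[OF this] have o: "orbit (next_vertex E) x = {x}" by auto
  have "x \<in> reach E x" using walk.edge[OF e] by (auto simp: reach_def)
  from reach_orbit[OF pb this] show r: "reach E x = {x}" unfolding o .
  have "round_trip E x = [a]" by (rule round_trip_eqI[OF pb walk.edge[OF e]]) (simp add: r)
  then show "loop_value E x = t a"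
    using label_graphD(2)[OF E e] by (simp add: loop_value_def word_label_Cons)
qed

lemma
  assumes E: "label_graph E" and e: "(x, y, a) \<in> E" "(y, x, b) \<in> E" "x \<noteq> y"
  shows two_cycle: "reach E x = {x, y}" "loop_value E x = t (b \<otimes> a)"
proof -
  note pb = label_graphD(1)[OF E]
  have n: "next_vertex E x = y" "next_vertex E y = x" using next_vertex_eq[OF pb] e by auto
  have "(next_vertex E ^^ 2) x = x" using n by (simp add: numeral_2_eq_2)
  from orbit_altdef_bounded[OF this] have "orbit (next_vertex E) x = {(next_vertex E ^^ m) x |m. m < 2}" by simp
  also have "\<dots> = {x, y}" using n by (auto simp: less_2_cases_iff intro: exI[of _ 0] exI[of _ 1])
  finally have o: "orbit (next_vertex E) x = {x, y}" .
  have w: "walk E x [a, b] x" using e by (intro walk.step[OF e(1)] walk.edge)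
  then have "x \<in> reach E x" by (auto simp: reach_def)
  from reach_orbit[OF pb this] show r: "reach E x = {x, y}" unfolding o .
  have "round_trip E x = [a, b]" by (rule round_trip_eqI[OF pb w]) (use e in \<open>simp add: r\<close>)
  then show "loop_value E x = t (b \<otimes> a)"
    using label_graphD(2)[OF E e(1)] label_graphD(2)[OF E e(2)] by (simp add: loop_value_def word_label_Cons)
qed

lemma glue_upperI: "(p, q, a) \<in> D \<Longrightarrow> (upper_point n p, upper_point n q, a) \<in> glue n D D'"
  and glue_lowerI: "(p, q, a) \<in> D' \<Longrightarrow> (lower_point n p, lower_point n q, a) \<in> glue n D D'"
  by (auto simp: glue_map_graph intro: map_graphI)

lemma glueE:
  assumes "(x, y, a) \<in> glue n D D'"
  obtains p q where "(p, q, a) \<in> D" "x = upper_point n p" "y = upper_point n q"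
    | p q where "(p, q, a) \<in> D'" "x = lower_point n p" "y = lower_point n q"
  using assms unfolding glue_map_graph by (auto elim: map_graphE)

lemma trace_bar_mult: "a \<in> B \<Longrightarrow> b \<in> B \<Longrightarrow> t (bar a \<otimes> b) = (if a = b then 1 else 0)"
  using trace_mult_basis[of "bar a" b] T2_basis[of a] bar_bar[of a] by auto

lemma trace_mult_bar: "a \<in> B \<Longrightarrow> b \<in> B \<Longrightarrow> t (b \<otimes> bar a) = (if a = b then 1 else 0)"
  using trace_commute[of b "bar a"] trace_bar_mult[of a b] by simp

section \<open>Loops in the product of two diagrams\<close>

context
  fixes n l l' S T xs S' V ys
  assumes S: "half_diagram n l S" and T: "half_diagram n l T" and xs: "length xs = l" "set xs \<subseteq> carrier A"
    and S': "half_diagram n l' S'" and V: "half_diagram n l' V" and ys: "length ys = l'" "set ys \<subseteq> carrier A"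
begin

abbreviation "G \<equiv> glue n (diag n S xs T) (diag n S' ys V)"

lemma pre_K: "pre_diagram n (diag n S xs T)" "pre_diagram n (diag n S' ys V)"
  by (rule pre_diagram_diag[OF S T xs], rule pre_diagram_diag[OF S' V ys])

lemma G_label: "label_graph G" and G_pb: "partial_bij G"
  and G_inner: "inner G = {2 * n + 1..3 * n}"
  and G_srcs: "srcs G = evens n \<union> {2 * n + 1..3 * n}"
  and G_tgts: "tgts G = odds n \<union> {2 * n + 1..3 * n}"
  by (rule label_graph_glue[OF pre_K], rule label_graphD(1)[OF label_graph_glue[OF pre_K]],
      rule inner_glue[OF pre_K], rule srcs_glue[OF pre_K], rule tgts_glue[OF pre_K])

text \<open>\<open>T\<close> is stored reflected, and the gluing reflects the lower side once more;
  what remains of the reflection is the reversed orientation and the \<open>bar\<close>.\<close>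

lemma G_bottom_arc: "(p, q, a) \<in> T \<Longrightarrow> (2 * n + q, 2 * n + p, bar a) \<in> G"
proof -
  assume e: "(p, q, a) \<in> T"
  note h = half_diagramD(4,5)[OF T e]
  have "bar a \<in> carrier A" "bar (bar a) = a" "2 * n + 1 - (2 * n + 1 - p) = p" "2 * n + 1 - (2 * n + 1 - q) = q"
    "2 * n + 1 - p \<in> {n + 1..2 * n}" "2 * n + 1 - q \<in> {n + 1..2 * n}"
    using h by auto
  then have "(2 * n + 1 - q, 2 * n + 1 - p, bar a) \<in> flip n T"
    unfolding flip_half_iff[OF T] using e by (simp only: conj_absorb simp_thms)
  then have "(2 * n + 1 - q, 2 * n + 1 - p, bar a) \<in> diag n S xs T" by (simp add: diag_def)
  moreover have "upper_point n (2 * n + 1 - q) = 2 * n + q" "upper_point n (2 * n + 1 - p) = 2 * n + p"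
    using h by (auto simp: upper_point_def)
  ultimately show ?thesis using glue_upperI[of _ _ _ "diag n S xs T" n "diag n S' ys V"] by metis
qed

lemma G_top_arc: "(p, q, a) \<in> S' \<Longrightarrow> (2 * n + p, 2 * n + q, a) \<in> G"
proof -
  assume e: "(p, q, a) \<in> S'"
  note h = half_diagramD(4,5)[OF S' e]
  have "(p, q, a) \<in> diag n S' ys V" using e by (simp add: diag_def)
  from glue_lowerI[OF this, of n "diag n S xs T"] show ?thesis using h by (simp add: lower_point_def)
qed

lemma G_outer_top: "(p, q, a) \<in> S \<Longrightarrow> (p, q, a) \<in> G"
proof -
  assume e: "(p, q, a) \<in> S"
  note h = half_diagramD(4,5)[OF S e]
  have "(p, q, a) \<in> diag n S xs T" using e by (simp add: diag_def)
  from glue_upperI[OF this, of n "diag n S' ys V"] show ?thesis using h by (simp add: upper_point_def)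
qed

lemma G_outer_bottom: "(p, q, a) \<in> flip n V \<Longrightarrow> (p, q, a) \<in> G"
proof -
  assume e: "(p, q, a) \<in> flip n V"
  then have h: "p > n" "q > n" by (auto simp: flip_half_iff[OF V])
  have "(p, q, a) \<in> diag n S' ys V" using e by (simp add: diag_def)
  from glue_lowerI[OF this, of n "diag n S xs T"] show ?thesis using h by (simp add: lower_point_def)
qed

text \<open>An edge between outer points is already a maximal walk. Hence the arcs of
  \<open>S\<close> and the reflected arcs of \<open>V\<close> survive the composition.\<close>

lemma G_net_outer:
  assumes "(p, q, a) \<in> G" "p \<notin> {2 * n + 1..3 * n}" "q \<notin> {2 * n + 1..3 * n}"
  shows "(p, q, a) \<in> net G"
proof -
  have "p \<notin> tgts G" "q \<notin> srcs G"
    using srcsI[OF assms(1)] tgtsI[OF assms(1)] assms(2,3) evens_odds(1)[of n] unfolding G_srcs G_tgts by blast+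
  moreover have "word_label A [a] = a" using label_graphD(2)[OF G_label assms(1)] by (simp add: word_label_Cons)
  ultimately show ?thesis
    unfolding net_def using walk.edge[OF assms(1)] by (intro CollectI exI[of _ p] exI[of _ q] exI[of _ "[a]"]) simp
qed

lemma S_net: "(p, q, a) \<in> S \<Longrightarrow> (p, q, a) \<in> net G"
  using half_diagramD(5)[OF S, of p q a] G_outer_top[of p q a] by (intro G_net_outer) auto

lemma V_net: "(p, q, a) \<in> flip n V \<Longrightarrow> (p, q, a) \<in> net G"
  using flip_half_iff[OF V, of p q a] G_outer_bottom[of p q a] by (intro G_net_outer) auto

text \<open>An odd middle vertex is a source in the first factor only, and on a loop the next vertex
  is a middle one too; so the outgoing edge is an arc of the lower half.\<close>

lemma odd_in_loop:
  assumes x: "x \<in> reach G x" and odd: "odd x"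
  shows "\<exists>p q a. (p, q, a) \<in> T \<and> x = 2 * n + q"
proof -
  have inn: "reach G x \<subseteq> {2 * n + 1..3 * n}" using reach_inner[OF G_pb x] unfolding G_inner .
  then have xm: "x \<in> {2 * n + 1..3 * n}" using x by blast
  then have "x \<in> srcs G" unfolding G_srcs by blast
  then obtain y a where e: "(x, y, a) \<in> G" unfolding srcs_def by blast
  have y: "y \<in> {2 * n + 1..3 * n}" using reach_succ[OF G_pb x e] inn by blast
  from e show ?thesis
  proof (cases rule: glueE)
    case (1 p q)
    have pq: "p \<in> evens n" "q \<in> odds n" using srcsI[OF 1(1)] tgtsI[OF 1(1)] pre_K(1) by (auto simp: pre_diagram_def)
    then have p: "p > n" "p \<le> 2 * n" "q > n" "q \<le> 2 * n" "x = 4 * n + 1 - p"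
      using 1 xm y by (auto simp: upper_point_def evens_def odds_def split: if_splits)
    from 1(1)[unfolded diag_iff[OF S T xs(1)]] have "(2 * n + 1 - q, 2 * n + 1 - p, bar a) \<in> T"
    proof (elim disjE conjE exE)
      assume "(p, q, a) \<in> S"
      then show ?thesis using half_diagramD(5)[OF S, of p q a] p by auto
    next
      fix i assume "i < l" "if odd i then p = free_list n S ! i \<and> q = 2 * n + 1 - free_list n T ! i
           else p = 2 * n + 1 - free_list n T ! i \<and> q = free_list n S ! i"
      then show ?thesis using free_nth(2)[OF S, of i] p by (auto split: if_splits)
    qed
    moreover have "x = 2 * n + (2 * n + 1 - p)" using p by auto
    ultimately show ?thesis by blast
  next
    case (2 p q)
    have "p \<in> evens n" using srcsI[OF 2(1)] pre_K(2) by (auto simp: pre_diagram_def)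
    then have "even x" using 2(2) by (auto simp: lower_point_def evens_def)
    then show ?thesis using odd by simp
  qed
qed

lemma even_in_loop:
  assumes x: "x \<in> reach G x" and even: "even x"
  shows "\<exists>p q a. (p, q, a) \<in> S' \<and> x = 2 * n + p"
proof -
  have inn: "reach G x \<subseteq> {2 * n + 1..3 * n}" using reach_inner[OF G_pb x] unfolding G_inner .
  then have xm: "x \<in> {2 * n + 1..3 * n}" using x by blast
  then have "x \<in> srcs G" unfolding G_srcs by blast
  then obtain y a where e: "(x, y, a) \<in> G" unfolding srcs_def by blast
  have y: "y \<in> {2 * n + 1..3 * n}" using reach_succ[OF G_pb x e] inn by blast
  from e show ?thesis
  proof (cases rule: glueE)
    case (1 p q)
    have "p \<in> evens n" using srcsI[OF 1(1)] pre_K(1) by (auto simp: pre_diagram_def)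
    then have "odd x" using 1(2) xm by (auto simp: upper_point_def evens_def split: if_splits)
    then show ?thesis using even by simp
  next
    case (2 p q)
    have pq: "p \<in> evens n" "q \<in> odds n" using srcsI[OF 2(1)] tgtsI[OF 2(1)] pre_K(2) by (auto simp: pre_diagram_def)
    then have p: "p \<le> n" "q \<le> n" "x = 2 * n + p" "1 \<le> p"
      using 2 xm y by (auto simp: lower_point_def evens_def odds_def split: if_splits)
    from 2(1)[unfolded diag_iff[OF S' V ys(1)]] have "(p, q, a) \<in> S'"
    proof (elim disjE conjE exE)
      fix i assume "i < l'" "if odd i then p = free_list n S' ! i \<and> q = 2 * n + 1 - free_list n V ! i
           else p = 2 * n + 1 - free_list n V ! i \<and> q = free_list n S' ! i"
      then show ?thesis using free_nth(2)[OF V, of i] p by (auto split: if_splits)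
    qed (use p in auto)
    then show ?thesis using p by blast
  qed
qed

text \<open>Arcs of \<open>S'\<close> lead from even to odd middle vertices and arcs of
  \<open>T\<close> lead back, so a loop alternates between the two.\<close>

lemma loop_meets:
  assumes x: "x \<in> reach G x"
  shows "\<exists>y\<in>(\<lambda>q. 2 * n + q) ` tgts T. y \<in> reach G x" "\<exists>y\<in>(\<lambda>p. 2 * n + p) ` srcs S'. y \<in> reach G x"
proof -
  have odd: "\<exists>y\<in>reach G x. odd y"
  proof (cases "odd x")
    case False
    then obtain p q a where e: "(p, q, a) \<in> S'" "x = 2 * n + p" using even_in_loop[OF x] by auto
    have "2 * n + q \<in> reach G x" using reach_succ[OF G_pb x] G_top_arc[OF e(1)] e(2) by blast
    moreover have "odd (2 * n + q)" using half_diagramD(5)[OF S' e(1)] by simp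
    ultimately show ?thesis by blast
  qed (use x in blast)
  then obtain y where y: "y \<in> reach G x" "odd y" by blast
  have ry: "y \<in> reach G y" "reach G y = reach G x" using reach_closed[OF G_pb x y(1)] y(1) by auto
  from odd_in_loop[OF ry(1) y(2)] obtain p q a where e: "(p, q, a) \<in> T" "y = 2 * n + q" by auto
  then show "\<exists>y\<in>(\<lambda>q. 2 * n + q) ` tgts T. y \<in> reach G x" using y(1) by (auto intro: tgtsI)
  have z: "2 * n + p \<in> reach G x" using reach_succ[OF G_pb ry(1)] G_bottom_arc[OF e(1)] e(2) ry(2) by blast
  have rz: "2 * n + p \<in> reach G (2 * n + p)" using reach_closed(1)[OF G_pb x z] z by auto
  have "even (2 * n + p)" using half_diagramD(5)[OF T e(1)] by simp
  from even_in_loop[OF rz this] show "\<exists>y\<in>(\<lambda>p. 2 * n + p) ` srcs S'. y \<in> reach G x"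
    using z by (auto intro: srcsI)
qed

lemma card_shift: "card ((\<lambda>q. 2 * n + q) ` tgts T) = card T" "card ((\<lambda>p. 2 * n + p) ` srcs S') = card S'"
  using card_partial_bij half_diagramD(1)[OF T] half_diagramD(1)[OF S'] by (simp_all add: card_image)

lemma finite_shift: "finite ((\<lambda>q. 2 * n + q) ` tgts T)" "finite ((\<lambda>p. 2 * n + p) ` srcs S')"
proof -
  have "tgts T \<subseteq> {1..n}" "srcs S' \<subseteq> {1..n}"
    using half_diagramD(2)[OF T] half_diagramD(2)[OF S'] by (auto simp: verts_def)
  then show "finite ((\<lambda>q. 2 * n + q) ` tgts T)" "finite ((\<lambda>p. 2 * n + p) ` srcs S')"
    by (auto intro: finite_subset)
qed

lemma card_loops_glue: "card (loops G) \<le> card T" "card (loops G) \<le> card S'"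
  using card_loops_le[OF G_pb finite_shift(1) loop_meets(1)] card_loops_le[OF G_pb finite_shift(2) loop_meets(2)]
  unfolding card_shift by auto

lemma halves_agree:
  assumes eq: "card (loops G) = card T" "card T = card S'" and nz: "loop_factor A B G \<noteq> 0"
  shows "T = S'"
proof -
  let ?Q = "(\<lambda>q. 2 * n + q) ` tgts T"
  have eqQ: "card (loops G) = card ?Q" unfolding card_shift(1) by (rule eq(1))
  have D: "y \<in> ?Q \<Longrightarrow> y \<in> reach G y" "y \<in> ?Q \<Longrightarrow> z \<in> ?Q \<Longrightarrow> z \<in> reach G y \<Longrightarrow> z = y" for y z
    using card_loops_eqD[OF G_pb finite_shift(1) _ eqQ] loop_meets(1) by blast+
  note val = loop_value_neq_0[OF G_label nz]
  have "T \<subseteq> S'"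
  proof
    fix e assume "e \<in> T"
    moreover obtain p q a where [simp]: "e = (p, q, a)" by (cases e)
    ultimately have e: "(p, q, a) \<in> T" by simp
    have y: "2 * n + q \<in> ?Q" using e by (auto intro: tgtsI)
    have ry: "2 * n + q \<in> reach G (2 * n + q)" by (rule D(1)[OF y])
    have px: "2 * n + p \<in> reach G (2 * n + q)" by (rule reach_succ[OF G_pb ry G_bottom_arc[OF e]])
    have rp: "reach G (2 * n + p) = reach G (2 * n + q)" by (rule reach_closed(1)[OF G_pb ry px])
    then have rp': "2 * n + p \<in> reach G (2 * n + p)" using px by simp
    have "even (2 * n + p)" using half_diagramD(5)[OF T e] by simp
    from even_in_loop[OF rp' this] obtain r c where c: "(p, r, c) \<in> S'" by auto
    have "2 * n + r \<in> reach G (2 * n + q)" using reach_succ[OF G_pb rp' G_top_arc[OF c]] rp by simp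
    then have rr: "2 * n + r \<in> reach G (2 * n + r)" "2 * n + r \<in> reach G (2 * n + q)"
      using reach_closed(1)[OF G_pb ry] by auto
    have "odd (2 * n + r)" using half_diagramD(5)[OF S' c] by simp
    from odd_in_loop[OF rr(1) this] have "2 * n + r \<in> ?Q" by (auto intro: tgtsI)
    \<comment> \<open>A loop contains only one vertex of \<open>?Q\<close>, so it closes after one
      arc of each half.\<close>
    from D(2)[OF y this rr(2)] have [simp]: "r = q" by simp
    have ne: "2 * n + q \<noteq> 2 * n + p" using half_diagramD(5)[OF T e] by auto
    have "(2 * n + p, 2 * n + q, c) \<in> G" using G_top_arc[OF c] by simp
    from two_cycle(2)[OF G_label G_bottom_arc[OF e] this ne] val[OF ry] have "t (c \<otimes> bar a) \<noteq> 0" by simp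
    then have "a = c"
      using trace_mult_bar[OF half_diagramD(4)[OF T e] half_diagramD(4)[OF S' c]] by (auto split: if_splits)
    then show "e \<in> S'" using c by simp
  qed
  moreover have "finite S'" using half_diagramD(1)[OF S'] by (rule partial_bijD)
  ultimately show ?thesis using eq(2) by (metis card_subset_eq)
qed

end

section \<open>Products with matching halves\<close>

context
  fixes n l S T V xs ys
  assumes S: "half_diagram n l S" and T: "half_diagram n l T" and xs: "length xs = l" "set xs \<subseteq> carrier A"
    and V: "half_diagram n l V" and ys: "length ys = l" "set ys \<subseteq> carrier A"
begin

abbreviation "H \<equiv> glue n (diag n S xs T) (diag n T ys V)"

lemma H_through:
  assumes i: "i < l"
  defines "u \<equiv> free_list n S ! i" and "w \<equiv> free_list n T ! i" and "v \<equiv> free_list n V ! i"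
  shows "odd i \<Longrightarrow> (u, 2 * n + w, xs ! i) \<in> H" "odd i \<Longrightarrow> (2 * n + w, 2 * n + 1 - v, ys ! i) \<in> H"
    "even i \<Longrightarrow> (2 * n + w, u, xs ! i) \<in> H" "even i \<Longrightarrow> (2 * n + 1 - v, 2 * n + w, ys ! i) \<in> H"
proof -
  have r: "u \<in> {1..n}" "w \<in> {1..n}" "v \<in> {1..n}"
    unfolding u_def w_def v_def using free_nth(2)[OF S i] free_nth(2)[OF T i] free_nth(2)[OF V i] .
  have up: "upper_point n u = u" "upper_point n (2 * n + 1 - w) = 2 * n + w"
    and low: "lower_point n w = 2 * n + w" "lower_point n (2 * n + 1 - v) = 2 * n + 1 - v"
    using r by (auto simp: upper_point_def lower_point_def)
  show "(u, 2 * n + w, xs ! i) \<in> H" if "odd i"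
  proof -
    have "(u, 2 * n + 1 - w, xs ! i) \<in> diag n S xs T"
      
      unfolding diag_iff[OF S T xs(1)] u_def w_def by (intro disjI2 exI[of _ i]) (use i that in simp)
    from glue_upperI[OF this, of n "diag n T ys V"] show ?thesis unfolding up .
  qed
  show "(2 * n + w, u, xs ! i) \<in> H" if "even i"
  proof -
    have "(2 * n + 1 - w, u, xs ! i) \<in> diag n S xs T"
      
      unfolding diag_iff[OF S T xs(1)] u_def w_def by (intro disjI2 exI[of _ i]) (use i that in simp)
    from glue_upperI[OF this, of n "diag n T ys V"] show ?thesis unfolding up .
  qed
  show "(2 * n + w, 2 * n + 1 - v, ys ! i) \<in> H" if "odd i"
  proof -
    have "(w, 2 * n + 1 - v, ys ! i) \<in> diag n T ys V"
      
      unfolding diag_iff[OF T V ys(1)] v_def w_def by (intro disjI2 exI[of _ i]) (use i that in simp)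
    from glue_lowerI[OF this, of n "diag n S xs T"] show ?thesis unfolding low .
  qed
  show "(2 * n + 1 - v, 2 * n + w, ys ! i) \<in> H" if "even i"
  proof -
    have "(2 * n + 1 - v, w, ys ! i) \<in> diag n T ys V"
      
      unfolding diag_iff[OF T V ys(1)] v_def w_def by (intro disjI2 exI[of _ i]) (use i that in simp)
    from glue_lowerI[OF this, of n "diag n S xs T"] show ?thesis unfolding low .
  qed
qed

text \<open>Through string \<open>i\<close> runs downwards for odd \<open>i\<close> and upwards for
  even \<open>i\<close>, and thus meets \<open>xs ! i\<close> first or last. As later labels are
  left factors, its label is the \<open>i\<close>-th entry of
  \<open>twist_mult True xs ys\<close>.\<close>

lemma net_glue_diag: "net H = diag n S (twist_mult True xs ys) V"
proof (rule net_eqI[OF G_label[OF S T xs T V ys]])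
  let ?zs = "twist_mult True xs ys"
  have zs: "length ?zs = l" "set ?zs \<subseteq> carrier A"
    using length_twist_mult xs ys set_twist_mult by auto
  have p: "pre_diagram n (diag n S ?zs V)" by (rule pre_diagram_diag[OF S V zs])
  show "srcs (diag n S ?zs V) = srcs H - tgts H" "tgts (diag n S ?zs V) \<subseteq> tgts H - srcs H"
    unfolding G_srcs[OF S T xs T V ys] G_tgts[OF S T xs T V ys]
    using p evens_odds[of n] by (auto simp: pre_diagram_def)
  fix p q a assume e: "(p, q, a) \<in> diag n S ?zs V"
  have single: "\<exists>w. walk H p w q \<and> a = word_label A w" if "(p, q, a) \<in> H"
    using walk.edge[OF that] label_graphD(2)[OF G_label[OF S T xs T V ys] that]
    by (intro exI[of _ "[a]"]) (simp add: word_label_Cons)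
  from e consider "(p, q, a) \<in> S" | "(p, q, a) \<in> flip n V" | "(p, q, a) \<in> thr_edges n S ?zs V"
    by (auto simp: diag_def)
  then show "\<exists>w. walk H p w q \<and> a = word_label A w"
  proof cases
    case 1
    show ?thesis by (rule single[OF G_outer_top[OF S T xs T V ys 1]])
  next
    case 2
    show ?thesis by (rule single[OF G_outer_bottom[OF S T xs T V ys 2]])
  next
    case 3
    then obtain i where i: "i < l" "a = ?zs ! i" "if odd i then p = free_list n S ! i \<and> q = 2 * n + 1 - free_list n V ! i
        else p = 2 * n + 1 - free_list n V ! i \<and> q = free_list n S ! i"
      unfolding thr_edges_iff[OF S V zs(1)] by blast
    have c: "xs ! i \<in> carrier A" "ys ! i \<in> carrier A" using i(1) xs ys nth_mem by (metis subsetD)+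
    have z: "?zs ! i = (if even i then xs ! i \<otimes> ys ! i else ys ! i \<otimes> xs ! i)"
      using nth_twist_mult[of xs ys i True] xs ys i by simp
    show ?thesis
    proof (cases "odd i")
      case True
      then have "walk H p [xs ! i, ys ! i] q"
        using i(3) walk.step[OF H_through(1)[OF i(1)] walk.edge[OF H_through(2)[OF i(1)]]] by simp
      then show ?thesis using True c z i(2) by (intro exI[of _ "[xs ! i, ys ! i]"]) (simp add: word_label_Cons)
    next
      case False
      then have "walk H p [ys ! i, xs ! i] q"
        using i(3) walk.step[OF H_through(4)[OF i(1)] walk.edge[OF H_through(3)[OF i(1)]]] by simp
      then show ?thesis using False c z i(2) by (intro exI[of _ "[ys ! i, xs ! i]"]) (simp add: word_label_Cons)
    qed
  qed
qed

text \<open>Each arc of \<open>T\<close> forms with its own reflected copy a loop of two edges, of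
  value \<open>t (bar a \<otimes> a) = 1\<close>.\<close>

lemma loop_factor_glue_diag: "loop_factor A B H = delta ^ card T"
proof -
  note pb = G_pb[OF S T xs T V ys] and lg = G_label[OF S T xs T V ys]
  have cyc: "reach H (2 * n + p) = {2 * n + p, 2 * n + q} \<and> reach H (2 * n + q) = {2 * n + p, 2 * n + q}
      \<and> loop_value H (2 * n + p) = 1" if e: "(p, q, a) \<in> T" for p q a
  proof -
    have ne: "2 * n + p \<noteq> 2 * n + q" using half_diagramD(5)[OF T e] by auto
    note b = G_bottom_arc[OF S T xs T V ys e] and tp = G_top_arc[OF S T xs T V ys e]
    have "t (bar a \<otimes> a) = 1" using trace_bar_mult half_diagramD(4)[OF T e] by simp
    then show ?thesis using two_cycle[OF lg tp b ne] two_cycle(1)[OF lg b tp ne[symmetric]] by auto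
  qed
  have lx: "\<exists>p q a. (p, q, a) \<in> T \<and> reach H x = {2 * n + p, 2 * n + q}" if x: "x \<in> reach H x" for x
  proof (cases "odd x")
    case True
    from odd_in_loop[OF S T xs T V ys x True] show ?thesis using cyc by blast
  next
    case False
    then have "even x" by simp
    from even_in_loop[OF S T xs T V ys x this] show ?thesis using cyc by blast
  qed
  have l: "loops H = (\<lambda>(p, q, a). {2 * n + p, 2 * n + q}) ` T"
  proof (intro equalityI subsetI)
    fix L assume "L \<in> loops H"
    then obtain x where x: "x \<in> reach H x" "L = reach H x" by (auto simp: loops_reach)
    from lx[OF x(1)] show "L \<in> (\<lambda>(p, q, a). {2 * n + p, 2 * n + q}) ` T" using x(2) by force
  next
    fix L assume "L \<in> (\<lambda>(p, q, a). {2 * n + p, 2 * n + q}) ` T"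
    then obtain p q a where e: "(p, q, a) \<in> T" "L = {2 * n + p, 2 * n + q}" by auto
    then show "L \<in> loops H" using cyc[OF e(1)] unfolding loops_reach by blast
  qed
  have inj: "inj_on (\<lambda>(p, q, a). {2 * n + p, 2 * n + q}) T"
  proof (rule inj_onI)
    fix e e' assume e: "e \<in> T" "e' \<in> T" "(case e of (p, q, a) \<Rightarrow> {2 * n + p, 2 * n + q}) = (case e' of (p, q, a) \<Rightarrow> {2 * n + p, 2 * n + q})"
    obtain p q a p' q' a' where [simp]: "e = (p, q, a)" "e' = (p', q', a')" by (cases e, cases e')
    have m: "(p, q, a) \<in> T" "(p', q', a') \<in> T" using e by auto
    have "p' = p" using e(3) half_diagramD(5)[OF T m(1)] half_diagramD(5)[OF T m(2)] by (auto simp: doubleton_eq_iff)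
    then have "(p, q', a') \<in> T" using m(2) by simp
    then show "e = e'" using partial_bijD(2,3)[OF half_diagramD(1)[OF T] m(1)] \<open>p' = p\<close> by auto
  qed
  have "t (loop_label A H L) = 1" if L: "L \<in> loops H" for L
  proof -
    from L obtain p q a where e: "(p, q, a) \<in> T" "L = {2 * n + p, 2 * n + q}" unfolding l by auto
    then have r: "L = reach H (2 * n + p)" "2 * n + p \<in> reach H (2 * n + p)" using cyc[OF e(1)] by auto
    show ?thesis using loop_label_value[OF lg r(2)] cyc[OF e(1)] r(1) by simp
  qed
  then have "(\<Prod>L\<in>loops H. t (loop_label A H L)) = 1" by simp
  moreover have "card (loops H) = card T" unfolding l by (rule card_image[OF inj])
  ultimately show ?thesis by (simp add: loop_factor_power)
qed

end

end

section \<open>Structure constants\<close>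

lemma lookup_vpow_mult: "lookup (vpow k * p) j = lookup p (j - k)"
proof -
  have "vpow k * p = (\<Sum>x\<in>keys p. single (k + x) (lookup p x))"
    by (subst lin_basis[of p, symmetric]) (simp add: lin_def vpow_def sum_distrib_left mult_single)
  also have "lookup \<dots> j = (\<Sum>x\<in>keys p. if x = j - k then lookup p x else 0)"
    unfolding lookup_sum by (rule sum.cong) (auto simp: lookup_single when_def)
  finally show ?thesis by (simp add: in_keys_iff)
qed

lemma lookup_mult_of_int: "lookup (p * of_int c :: laurent) j = lookup p j * c"
  by (induction c rule: int_induct[of _ 0]) (simp_all add: algebra_simps lookup_add lookup_minus)

text \<open>Only the leading term of \<open>delta ^ k\<close> matters for degrees, for
  \<open>gamma_const\<close> and for the congruence in (A5).\<close>

lemma delta_power: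
  "lookup (delta ^ k) (int k) = 1" "j > int k \<Longrightarrow> lookup (delta ^ k) j = 0"
proof (induction k arbitrary: j)
  case (Suc k)
  have *: "lookup (delta ^ Suc k) i = lookup (delta ^ k) (i - 1) + lookup (delta ^ k) (i + 1)" for i
    by (simp add: delta_def distrib_right lookup_add lookup_vpow_mult)
  {
    case 1 then show ?case using Suc.IH(1) Suc.IH(2)[of "int k + 2"] unfolding * by (simp add: add.commute)
  next
    case 2 then show ?case using Suc.IH(2)[of "j - 1"] Suc.IH(2)[of "j + 1"] unfolding * by simp
  }
qed (simp_all add: lookup_one when_def)

lemma delta_neq_0 [simp]: "delta \<noteq> 0"
  using delta_power(1)[of 1] by auto

lemma ldeg_delta_power:
  fixes c :: int and k :: nat
  defines "p \<equiv> delta ^ k * of_int c"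
  assumes "p \<noteq> 0"
  shows "ldeg p = int k"
proof -
  have c: "c \<noteq> 0" using assms by auto
  have l: "lookup p j = lookup (delta ^ k) j * c" for j
    unfolding p_def by (rule lookup_mult_of_int)
  have "int k \<in> keys p" using c by (simp add: in_keys_iff l delta_power)
  moreover have "j \<le> int k" if "j \<in> keys p" for j
    using that delta_power(2)[of k j] by (auto simp: in_keys_iff l not_less[symmetric])
  ultimately show "ldeg p = int k" unfolding ldeg_def by (intro Max_eqI) auto
qed

context int_table_algebra
begin

text \<open>On basis labels \<open>\<kappa>\<close> is the Kronecker symbol, so such an edge cannot
  change its label in the expansion.\<close>

lemma match_coeff_persist:
  assumes "partial_bij N" "partial_bij Z" "match_coeff N Z \<noteq> 0" "(p, q, a) \<in> N" "a \<in> B"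
  shows "(p, q, a) \<in> Z"
proof -
  have sh: "shape N = shape Z" using assms(3) by (auto simp: match_coeff_def split: if_splits)
  have "(p, q) \<in> shape N" using assms(4) by (auto simp: shape_def)
  then obtain c where c: "(p, q, c) \<in> Z" unfolding sh by (auto simp: shape_def)
  have "\<kappa> (out_label Z p) a \<noteq> 0"
  proof
    assume "\<kappa> (out_label Z p) a = 0"
    then have "(\<Prod>(p, q, a)\<in>N. \<kappa> (out_label Z p) a) = 0"
      using partial_bijD(1)[OF assms(1)] assms(4) by (intro prod_zero bexI[of _ "(p, q, a)"]) auto
    then show False using assms(3) by (simp add: match_coeff_def split: if_splits)
  qed
  then have "c = a" using out_label_eq[OF assms(2) c] assms(5) by (simp add: kappa_basis split: if_splits)
  then show ?thesis using c by simp
qed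

lemma diag_bottomD:
  assumes "half_diagram n l S" "half_diagram n l T" "length xs = l" "(p, q, a) \<in> diag n S xs T" "p > n" "q > n"
  shows "(p, q, a) \<in> flip n T"
proof -
  have "(p, q, a) \<notin> S" using half_diagramD(5)[OF assms(1), of p q a] assms(5) by auto
  moreover have "(p, q, a) \<notin> thr_edges n S xs T"
    unfolding through_diag(1)[OF assms(1-3), symmetric] using assms(5,6) by (simp add: through_def)
  ultimately show ?thesis using assms(4) by (simp add: diag_def)
qed

text \<open>More arcs leave fewer free points, by \<open>card_half\<close>.\<close>

lemma half_subset:
  assumes "half_diagram n l S" "half_diagram n l' S'" "S \<subseteq> S'"
  shows "l' \<le> l" "l' = l \<Longrightarrow> S' = S" "card S \<le> card S'"
proof -
  have fin: "finite S'" by (rule partial_bijD(1)[OF half_diagramD(1)[OF assms(2)]])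
  show le: "card S \<le> card S'" using fin assms(3) by (rule card_mono)
  note c = card_half[OF assms(1)] card_half[OF assms(2)]
  show "l' \<le> l" using c le by linarith
  show "l' = l \<Longrightarrow> S' = S" using card_subset_eq[OF fin assms(3)] c by simp
qed

lemma halves_persist:
  assumes N: "partial_bij N" and SV: "half_diagram n l1 S" "half_diagram n l2 V" "S \<subseteq> N" "flip n V \<subseteq> N"
    and half: "half_diagram n l S'" "half_diagram n l V'" and zs: "zs \<in> basis_lists l"
    and nz: "match_coeff N (diag n S' zs V') \<noteq> 0"
  shows "S \<subseteq> S'" "V \<subseteq> V'"
proof -
  let ?Z = "diag n S' zs V'"
  have Z: "partial_bij ?Z" using diag_diagrams[OF half zs] by (simp add: diagrams_iff)
  have len: "length zs = l" using zs by (simp add: basis_lists_def)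
  note persist = match_coeff_persist[OF N Z nz]
  show "S \<subseteq> S'"
  proof
    fix e assume e': "e \<in> S"
    obtain p q a where [simp]: "e = (p, q, a)" by (cases e)
    have e: "(p, q, a) \<in> S" using e' by simp
    have "(p, q, a) \<in> ?Z" using persist e SV(3) half_diagramD(4)[OF SV(1) e] by blast
    then have "(p, q, a) \<in> top_half n ?Z" using half_diagramD(5)[OF SV(1) e] by (simp add: top_half_def)
    then show "e \<in> S'" unfolding top_half_diag[OF half len] by simp
  qed
  show "V \<subseteq> V'"
  proof
    fix e assume e': "e \<in> V"
    obtain p q a where [simp]: "e = (p, q, a)" by (cases e)
    have e: "(p, q, a) \<in> V" using e' by simp
    note h = half_diagramD(4,5)[OF SV(2) e]
    have b: "bar a \<in> B" "bar (bar a) = a" "2 * n + 1 - (2 * n + 1 - p) = p" "2 * n + 1 - (2 * n + 1 - q) = q"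
      "2 * n + 1 - p > n" "2 * n + 1 - q > n"
      using h T2_basis by auto
    have "(2 * n + 1 - q, 2 * n + 1 - p, bar a) \<in> flip n V"
      unfolding flip_image using image_eqI[OF _ e] by force
    then have "(2 * n + 1 - q, 2 * n + 1 - p, bar a) \<in> ?Z" using persist SV(4) b(1) by blast
    from diag_bottomD[OF half len this b(6,5)] show "e \<in> V'"
      unfolding flip_half_iff[OF half(2)] b by simp
  qed
qed

lemma list_coeff_prod: "length zs = length as \<Longrightarrow> list_coeff zs as = (\<Prod>i<length as. \<kappa> (zs ! i) (as ! i))"
  by (induction zs as rule: list_induct2) (simp_all add: prod.lessThan_Suc_shift del: prod.lessThan_Suc)

text \<open>Arcs carry the same basis labels in both diagrams and contribute \<open>1\<close>; each
  through string contributes one factor \<open>\<kappa>\<close>.\<close>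

lemma match_coeff_diag:
  assumes S: "half_diagram n l S" and V: "half_diagram n l V" and as: "length as = l"
    and zs: "zs \<in> basis_lists l"
  shows "match_coeff (diag n S as V) (diag n S zs V) = list_coeff zs as"
proof -
  let ?N = "diag n S as V" and ?Z = "diag n S zs V"
  let ?f = "\<lambda>(p, q, a). \<kappa> (out_label ?Z p) a"
  let ?e = "\<lambda>i. thr_edge n (free_list n S ! i) (free_list n V ! i) (as ! i)"
  have lz: "length zs = l" using zs by (simp add: basis_lists_def)
  have Z: "partial_bij ?Z" using diag_diagrams[OF S V zs] by (simp add: diagrams_iff)
  have sh: "shape (diag n S xs V) = {(p, q). (\<exists>a. (p, q, a) \<in> S) \<or> (\<exists>a. (p, q, a) \<in> flip n V) \<or>
      (\<exists>i<l. if odd i then p = free_list n S ! i \<and> q = 2 * n + 1 - free_list n V ! i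
        else p = 2 * n + 1 - free_list n V ! i \<and> q = free_list n S ! i)}" if "length xs = l" for xs
    unfolding shape_def diag_def Un_iff thr_edges_iff[OF S V that] by blast
  have fin: "finite S" "finite (flip n V)"
    using partial_bijD(1)[OF half_diagramD(1)[OF S]] partial_bijD(1)[OF half_diagramD(1)[OF V]]
    by (auto simp: flip_image)
  have one: "?f e = 1" if "e \<in> S \<union> flip n V" for e
  proof -
    obtain p q a where [simp]: "e = (p, q, a)" by (cases e)
    have "a \<in> B"
      using that half_diagramD(4)[OF S, of p q a] half_diagramD(4)[OF V, of "2 * n + 1 - q" "2 * n + 1 - p" "bar a"]
      by (auto simp: flip_half_iff[OF V] bar_basis_iff)
    moreover have "out_label ?Z p = a" using that by (intro out_label_eq[OF Z, of _ q]) (auto simp: diag_def)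
    ultimately show ?thesis by (simp add: kappa_basis)
  qed
  have disj: "(S \<union> flip n V) \<inter> thr_edges n S as V = {}"
  proof -
    have "(p, q, a) \<notin> thr_edges n S as V" if "(p, q, a) \<in> S \<union> flip n V" for p q a
    proof
      assume "(p, q, a) \<in> thr_edges n S as V"
      then have "(p \<le> n) \<noteq> (q \<le> n)"
        unfolding through_diag(1)[OF S V as, symmetric] by (simp add: through_def)
      then show False using that half_diagramD(5)[OF S, of p q a] by (auto simp: flip_half_iff[OF V])
    qed
    then show ?thesis by auto
  qed
  have inj: "inj_on ?e {..<l}"
  proof (rule eq_card_imp_inj_on)
    show "card (?e ` {..<l}) = card {..<l}"
      using through_diag[OF S V as] as by (simp add: thr_edges_def)
  qed simp
  have "match_coeff ?N ?Z = prod ?f ?N" unfolding match_coeff_def sh[OF as] sh[OF lz] by simp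
  also have "\<dots> = prod ?f (S \<union> flip n V) * prod ?f (thr_edges n S as V)"
    unfolding diag_def[of n S as V] by (rule prod.union_disjoint) (use fin disj in \<open>auto simp: thr_edges_def\<close>)
  also have "prod ?f (S \<union> flip n V) = 1" by (rule prod.neutral) (use one in blast)
  also have "prod ?f (thr_edges n S as V) = (\<Prod>i<l. ?f (?e i))"
    unfolding thr_edges_def as by (rule prod.reindex_cong[OF inj]) auto
  also have "\<dots> = (\<Prod>i<l. \<kappa> (zs ! i) (as ! i))"
  proof (rule prod.cong[OF refl])
    fix i assume "i \<in> {..<l}"
    then have "thr_edge n (free_list n S ! i) (free_list n V ! i) (zs ! i) \<in> ?Z"
      by (auto simp: diag_def thr_edges_def lz)
    then show "?f (?e i) = \<kappa> (zs ! i) (as ! i)"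
      using out_label_eq[OF Z] by (auto simp: thr_edge_def split: if_splits)
  qed
  also have "\<dots> = list_coeff zs as" using list_coeff_prod lz as by simp
  finally show ?thesis by simp
qed

text \<open>Here \<open>k\<close> is the number of closed loops in the composite.\<close>

lemma structure_coeff:
  assumes S: "half_diagram n l S" and T: "half_diagram n l T" and xs: "xs \<in> basis_lists l"
    and S': "half_diagram n l' S'" and V: "half_diagram n l' V" and ys: "ys \<in> basis_lists l'"
    and S'': "half_diagram n l'' S''" and V'': "half_diagram n l'' V''" and zs: "zs \<in> basis_lists l''"
  defines "g \<equiv> lookup (diagram_mult n A B (diag n S xs T) (diag n S' ys V)) (diag n S'' zs V'')"
  obtains k c where "g = delta ^ k * of_int c" "k \<le> card T" "k \<le> card S'" "g \<noteq> 0 \<Longrightarrow> S \<subseteq> S'' \<and> V \<subseteq> V''"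
    "g \<noteq> 0 \<Longrightarrow> k = card T \<Longrightarrow> card T = card S' \<Longrightarrow> T = S'"
proof -
  have x: "length xs = l" "set xs \<subseteq> carrier A" and y: "length ys = l'" "set ys \<subseteq> carrier A"
    using xs ys by (auto simp: basis_lists_def)
  let ?G = "glue n (diag n S xs T) (diag n S' ys V)" and ?Z = "diag n S'' zs V''"
  note p = pre_diagram_diag[OF S T x] pre_diagram_diag[OF S' V y]
  have Z: "partial_bij ?Z" using diag_diagrams[OF S'' V'' zs] by (simp add: diagrams_iff)
  have N: "partial_bij (net ?G)" using label_graph_net[OF label_graph_glue[OF p]] by (rule label_graphD(1))
  have g: "g = loop_factor A B ?G * of_int (match_coeff (net ?G) ?Z)"
    unfolding g_def lookup_diagram_mult[OF p Z] graph_coeff_def ..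
  have sub: "S \<subseteq> net ?G" "flip n V \<subseteq> net ?G"
    by (auto intro: S_net[OF S T x S' V y] V_net[OF S T x S' V y])
  show thesis
  proof (rule that)
    show "g = delta ^ card (loops ?G) * of_int ((\<Prod>L\<in>loops ?G. t (loop_label A ?G L)) * match_coeff (net ?G) ?Z)"
      unfolding g loop_factor_power by simp
    show "card (loops ?G) \<le> card T" "card (loops ?G) \<le> card S'" by (rule card_loops_glue[OF S T x S' V y])+
    assume nz: "g \<noteq> 0"
    then have "match_coeff (net ?G) ?Z \<noteq> 0" "loop_factor A B ?G \<noteq> 0" unfolding g by auto
    then show "S \<subseteq> S'' \<and> V \<subseteq> V''"
      using halves_persist[OF N S V sub S'' V'' zs] by simp
    show "T = S'" if "card (loops ?G) = card T" "card T = card S'"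
      by (rule halves_agree[OF S T x S' V y that]) fact
  qed
qed

lemma structure_coeff_persist:
  assumes S: "half_diagram n l S" and T: "half_diagram n l T" and xs: "xs \<in> basis_lists l"
    and S': "half_diagram n l' S'" and V: "half_diagram n l' V" and ys: "ys \<in> basis_lists l'"
    and S'': "half_diagram n l'' S''" and V'': "half_diagram n l'' V''" and zs: "zs \<in> basis_lists l''"
    and nz: "lookup (diagram_mult n A B (diag n S xs T) (diag n S' ys V)) (diag n S'' zs V'') \<noteq> 0"
  shows "l'' \<le> l" "l'' = l \<Longrightarrow> S'' = S" "l'' \<le> l'" "l'' = l' \<Longrightarrow> V'' = V"
proof -
  from structure_coeff[OF S T xs S' V ys S'' V'' zs] nz have "S \<subseteq> S''" "V \<subseteq> V''" by metis+
  then show "l'' \<le> l" "l'' = l \<Longrightarrow> S'' = S" "l'' \<le> l'" "l'' = l' \<Longrightarrow> V'' = V"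
    using half_subset[OF S S''] half_subset[OF V V''] by auto
qed

text \<open>For matching halves the net of the composite is again of the form \<open>diag\<close>,
  with the same outer halves, so no terms with fewer through strings occur.\<close>

lemma structure_coeff_matching:
  assumes S: "half_diagram n l S" and T: "half_diagram n l T" and xs: "xs \<in> basis_lists l"
    and V: "half_diagram n l V" and ys: "ys \<in> basis_lists l"
    and S'': "half_diagram n l'' S''" and V'': "half_diagram n l'' V''" and zs: "zs \<in> basis_lists l''"
  shows "lookup (diagram_mult n A B (diag n S xs T) (diag n T ys V)) (diag n S'' zs V'') =
    (if l'' = l \<and> S'' = S \<and> V'' = V then delta ^ card T * of_int (list_coeff zs (twist_mult True xs ys)) else 0)"
proof -
  have x: "length xs = l" "set xs \<subseteq> carrier A" and y: "length ys = l" "set ys \<subseteq> carrier A"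
    using xs ys by (auto simp: basis_lists_def)
  note p = pre_diagram_diag[OF S T x] pre_diagram_diag[OF T V y]
  have m: "length (twist_mult True xs ys) = l" "set (twist_mult True xs ys) \<subseteq> carrier A"
    using length_twist_mult[of xs ys] set_twist_mult x y by auto
  have Z: "partial_bij (diag n S'' zs V'')" using diag_diagrams[OF S'' V'' zs] by (simp add: diagrams_iff)
  have g: "lookup (diagram_mult n A B (diag n S xs T) (diag n T ys V)) (diag n S'' zs V'') =
      delta ^ card T * of_int (match_coeff (diag n S (twist_mult True xs ys) V) (diag n S'' zs V''))"
    unfolding lookup_diagram_mult[OF p Z] graph_coeff_def loop_factor_glue_diag[OF S T x V y] net_glue_diag[OF S T x V y] ..
  show ?thesis
  proof (cases "l'' = l \<and> S'' = S \<and> V'' = V")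
    case True
    then show ?thesis unfolding g using match_coeff_diag[OF S V m(1)] zs by simp
  next
    case False
    let ?N = "diag n S (twist_mult True xs ys) V" and ?Z = "diag n S'' zs V''"
    have "match_coeff ?N ?Z = 0"
    proof (rule ccontr)
      assume nz: "match_coeff ?N ?Z \<noteq> 0"
      have N: "partial_bij ?N" using pre_diagram_diag[OF S V m] by (simp add: pre_diagram_def label_graphD)
      have sub: "S \<subseteq> S''" "V \<subseteq> V''"
        using halves_persist[OF N S V _ _ S'' V'' zs nz] by (auto simp: diag_def)
      have lz: "length zs = l''" using zs by (simp add: basis_lists_def)
      have sh: "shape ?N = shape ?Z" using nz by (auto simp: match_coeff_def split: if_splits)
      \<comment> \<open>As the shapes agree, every arc of \<open>S''\<close> has the same ends as an
        arc of \<open>S\<close>; the labels agree because \<open>S \<subseteq> S''\<close>.\<close>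
      have "S'' \<subseteq> S"
      proof
        fix e assume e': "e \<in> S''"
        obtain p q a where [simp]: "e = (p, q, a)" by (cases e)
        have e: "(p, q, a) \<in> S''" using e' by simp
        then have "(p, q) \<in> shape ?Z" by (auto simp: shape_def diag_def)
        then obtain b where b: "(p, q, b) \<in> ?N" unfolding sh[symmetric] by (auto simp: shape_def)
        then have "(p, q, b) \<in> top_half n ?N" using half_diagramD(5)[OF S'' e] by (simp add: top_half_def)
        then have b: "(p, q, b) \<in> S" unfolding top_half_diag[OF S V m(1)] .
        then have "(p, q, b) \<in> S''" using sub by blast
        then have "b = a" using partial_bijD(3)[OF half_diagramD(1)[OF S''] e] by blast
        then show "e \<in> S" using b by simp
      qed
      then have "S'' = S" using sub by blast
      moreover from this have "l'' = l" using card_half[OF S] card_half[OF S''] by simp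
      ultimately show False using half_subset(2)[OF V V'' sub(2)] False by simp
    qed
    then show ?thesis unfolding g if_not_P[OF False] by simp
  qed
qed

end

section \<open>The table datum\<close>

lemma sum_mult_neq_0D:
  fixes g h :: "'x \<Rightarrow> 'r::semiring_0"
  assumes "(\<Sum>x\<in>W. g x * h x) \<noteq> 0" obtains x where "x \<in> W" "h x \<noteq> 0"
  using assms by (metis (no_types, lifting) sum.neutral mult_zero_right)

context int_table_algebra
begin

text \<open>Empty by \<open>card_half\<close> if \<open>n - l\<close> is odd. Such \<open>l\<close>
  are kept in the index set, as (A1) only asks that \<open>M(l)\<close> be finite.\<close>

definition halves :: "nat \<Rightarrow> nat \<Rightarrow> 'a diagram set" where
  "halves n l = {S. half_diagram n l S}"

text \<open>Elements of \<open>tensor_basis l\<close> are vectors \<open>single xs 1\<close>; this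
  inverts the embedding of lists.\<close>

definition middle :: "('a list \<Rightarrow>\<^sub>0 int) \<Rightarrow> 'a list" where
  "middle b = the_elem (keys b)"

definition tabular_C :: "nat \<Rightarrow> nat \<times> 'a diagram \<times> ('a list \<Rightarrow>\<^sub>0 int) \<times> 'a diagram \<Rightarrow> ('a diagram \<Rightarrow>\<^sub>0 laurent)" where
  "tabular_C n = (\<lambda>(l, S, b, T). single (diag n S (middle b) T) 1)"

abbreviation tabular_index :: "nat \<Rightarrow> (nat \<times> 'a diagram \<times> ('a list \<Rightarrow>\<^sub>0 int) \<times> 'a diagram) set" where
  "tabular_index n \<equiv> table_index {..n} tensor_basis (halves n)"

lemma middle_single [simp]: "middle (single xs 1) = xs"
  by (simp add: middle_def)

lemma middle_tensor_basis: "b \<in> tensor_basis l \<Longrightarrow> middle b \<in> basis_lists l \<and> b = single (middle b) 1"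
  by (auto simp: tensor_basis_def)

lemma tabular_index_iff: "(l, S, b, T) \<in> tabular_index n \<longleftrightarrow>
    l \<le> n \<and> half_diagram n l S \<and> half_diagram n l T \<and> b \<in> tensor_basis l"
  by (auto simp: table_index_def halves_def)

lemma tabular_C_diagram: "(l, S, b, T) \<in> tabular_index n \<Longrightarrow> diag n S (middle b) T \<in> diagrams n B"
  unfolding tabular_index_iff using diag_diagrams middle_tensor_basis by blast

lemma tabular_basis_C: "tabular_basis {..n} tensor_basis (halves n) (tabular_C n) = canonical_basis n B"
proof (intro equalityI subsetI)
  fix x assume "x \<in> tabular_basis {..n} tensor_basis (halves n) (tabular_C n)"
  then obtain l S b T where i: "(l, S, b, T) \<in> tabular_index n" "x = tabular_C n (l, S, b, T)"
    unfolding tabular_basis_def by auto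
  then show "x \<in> canonical_basis n B"
    using tabular_C_diagram[OF i(1)] by (simp add: tabular_C_def canonical_basis_def)
next
  fix x assume "x \<in> canonical_basis n B"
  then obtain D where D: "D \<in> diagrams n B" "x = single D 1" by (auto simp: canonical_basis_def)
  obtain l S xs T where d: "l \<le> n" "half_diagram n l S" "half_diagram n l T" "xs \<in> basis_lists l" "D = diag n S xs T"
    using diagram_decomposition[OF D(1)] .
  then have "(l, S, single xs 1, T) \<in> tabular_index n"
    unfolding tabular_index_iff by (simp add: tensor_basis_def)
  moreover have "x = tabular_C n (l, S, single xs 1, T)"
    using D d by (simp add: tabular_C_def)
  ultimately show "x \<in> tabular_basis {..n} tensor_basis (halves n) (tabular_C n)"
    unfolding tabular_basis_def by blast
qed

lemma tabular_C_inj: "inj_on (tabular_C n) (tabular_index n)"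
proof (rule inj_onI)
  fix i j assume ij: "i \<in> tabular_index n" "j \<in> tabular_index n" "tabular_C n i = tabular_C n j"
  obtain l S b T l' S' b' T' where [simp]: "i = (l, S, b, T)" "j = (l', S', b', T')"
    by (cases i, cases j)
  have h: "half_diagram n l S" "half_diagram n l T" "b \<in> tensor_basis l"
    "half_diagram n l' S'" "half_diagram n l' T'" "b' \<in> tensor_basis l'"
    using ij(1,2) by (simp_all add: tabular_index_iff)
  note m = middle_tensor_basis[OF h(3)] middle_tensor_basis[OF h(6)]
  have "keys (tabular_C n i) = keys (tabular_C n j)" using ij(3) by simp
  then have "diag n S (middle b) T = diag n S' (middle b') T'" by (simp add: tabular_C_def)
  from diag_inject[OF h(1,2) _ h(4,5) _ this] m show "i = j" by auto
qed

text \<open>The arcs of a half are labelled by \<open>B\<close>, hence the case of finite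
  \<open>B\<close>. For \<open>n \<le> 1\<close> there is no room for an arc, and the empty half is
  the only possible one.\<close>

lemma finite_halves:
  assumes "finite B \<or> n \<le> 1" shows "finite (halves n l)"
proof (cases "finite B")
  case True
  have "halves n l \<subseteq> Pow ({1..n} \<times> {1..n} \<times> B)"
    unfolding halves_def using half_diagramD(4,5) by fast
  then show ?thesis using True by (auto intro: finite_subset)
next
  case False
  then have n: "n \<le> 1" using assms by simp
  have "S = {}" if "half_diagram n l S" for S
    using card_half[OF that] n partial_bijD(1)[OF half_diagramD(1)[OF that]] by (cases "card S") auto
  then have "halves n l \<subseteq> {{}}" by (auto simp: halves_def)
  then show ?thesis by (rule finite_subset) simp
qed

lemma C_ext_lin:
  assumes h: "keys h \<subseteq> tensor_basis l" and ST: "half_diagram n l S" "half_diagram n l T"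
  shows "C_ext (P_algebra n A B) (tabular_C n) l S h T = lin (\<lambda>b. single (diag n S (middle b) T) 1) h"
proof -
  interpret P: free_algebra_data "diagrams n B" "diagram_mult n A B" "identity_diagram n \<one>" by (rule diagram_algebra)
  have "diag n S (middle b) T \<in> diagrams n B" if "b \<in> keys h" for b
    using that h middle_tensor_basis diag_diagrams[OF ST] by blast
  then show ?thesis
    unfolding C_ext_def P_algebra_def smult_free_algebra lin_def tabular_C_def prod.case
    by (intro P.finsum_free) auto
qed

lemma lookup_C_ext:
  assumes h: "keys h \<subseteq> tensor_basis l" and ST: "half_diagram n l S" "half_diagram n l T"
    and Z: "half_diagram n l' S'" "half_diagram n l' V'" "zs \<in> basis_lists l'"
  shows "lookup (lin (\<lambda>b. single (diag n S (middle b) T) (1::laurent)) h) (diag n S' zs V') =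
    (if l' = l \<and> S' = S \<and> V' = T then lookup h (single zs 1) else 0)"
proof -
  have "diag n S (middle b) T = diag n S' zs V' \<longleftrightarrow> l' = l \<and> S' = S \<and> V' = T \<and> b = single zs 1"
    if "b \<in> keys h" for b
  proof -
    have b: "middle b \<in> basis_lists l" "b = single (middle b) 1" using that h middle_tensor_basis by blast+
    show ?thesis using diag_inject[OF ST b(1) Z] b(2) by (metis middle_single)
  qed
  then have "lookup (lin (\<lambda>b. single (diag n S (middle b) T) (1::laurent)) h) (diag n S' zs V') =
    (\<Sum>b\<in>keys h. if b = single zs 1 then
       if l' = l \<and> S' = S \<and> V' = T then lookup h b else 0 else 0)"
    unfolding lookup_lin by (intro sum.cong) (auto simp: lookup_single when_def)
  then show ?thesis by (simp add: in_keys_iff)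
qed

text \<open>
  The coefficients \<open>r\<^sub>a(S', S)\<close> of axiom A3 are read off from \<open>f = a C(S, 1, S)\<close>.
\<close>

definition left_action :: "nat \<Rightarrow> nat \<Rightarrow> ('a diagram \<Rightarrow>\<^sub>0 laurent) \<Rightarrow> 'a diagram \<Rightarrow> 'a diagram \<Rightarrow> (('a list \<Rightarrow>\<^sub>0 int) \<Rightarrow>\<^sub>0 laurent)" where
  "left_action n l f S' S = (\<Sum>ws\<in>{ws \<in> basis_lists l. diag n S' ws S \<in> keys f}.
     single (single ws 1) (lookup f (diag n S' ws S)))"

lemma keys_left_action: "keys (left_action n l f S' S) \<subseteq> tensor_basis l"
  unfolding left_action_def by (rule order_trans[OF keys_sum]) (auto simp: tensor_basis_def split: if_splits)

lemma extended_structure_coeff: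
  assumes "ws \<in> basis_lists l" "xs \<in> basis_lists l"
  shows "lookup (of_int_coords (tensor l) (tensor_basis l)
     (single ws 1 \<otimes>\<^bsub>tensor l\<^esub> single xs 1)) (single zs 1) =
    of_int (list_coeff zs (twist_mult True ws xs))"
proof -
  interpret F: free_algebra_data "basis_lists l" tensor_mult "replicate l \<one>" by (rule tensor_algebra)
  have "coords (tensor l) (tensor_basis l) (single ws 1 \<otimes>\<^bsub>tensor l\<^esub> single xs 1) = F.emb (tensor_mult ws xs)"
    unfolding tensor_def tensor_basis_def mult_single_free_algebra by (rule F.coords_free[OF F.keys_mul[OF assms]])
  then show ?thesis
    by (simp add: of_int_coords_def Poly_Mapping.map.rep_eq when_def F.lookup_emb tensor_mult_def lookup_list_expansion)
qed

lemma diagram_mult_unit_left: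
  assumes S: "half_diagram n l S" and T: "half_diagram n l T" and xs: "xs \<in> basis_lists l"
  shows "diagram_mult n A B (diag n S (replicate l \<one>) S) (diag n S xs T) = scale (delta ^ card S) (single (diag n S xs T) 1)"
proof (rule poly_mapping_eq_on_diagrams)
  have one: "replicate l \<one> \<in> basis_lists l" by (auto simp: basis_lists_def)
  note d = diag_diagrams[OF S S one] diag_diagrams[OF S T xs]
  show "keys (diagram_mult n A B (diag n S (replicate l \<one>) S) (diag n S xs T)) \<subseteq> diagrams n B"
    by (rule keys_diagram_mult[OF d])
  show "keys (scale (delta ^ card S) (single (diag n S xs T) 1)) \<subseteq> diagrams n B"
    using d by simp
  fix Z assume Z: "Z \<in> diagrams n B"
  obtain l' S' zs V' where z: "half_diagram n l' S'" "half_diagram n l' V'" "zs \<in> basis_lists l'" "Z = diag n S' zs V'"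
    using diagram_decomposition[OF Z] by metis
  have x: "length xs = l" "set xs \<subseteq> B" "set xs \<subseteq> carrier A" using xs by (auto simp: basis_lists_def)
  have t: "twist_mult True (replicate l \<one>) xs = xs" using twist_mult_one(1)[OF x(3)] x(1) by simp
  have iff: "diag n S xs T = Z \<longleftrightarrow> l' = l \<and> S' = S \<and> V' = T \<and> zs = xs"
    using diag_inject[OF S T xs z(1-3)] z(4) by blast
  show "lookup (diagram_mult n A B (diag n S (replicate l \<one>) S) (diag n S xs T)) Z =
      lookup (scale (delta ^ card S) (single (diag n S xs T) 1)) Z"
    unfolding z(4) structure_coeff_matching[OF S S one T xs z(1-3)] t list_coeff_basis[OF x(2)]
    using iff unfolding z(4) by (simp add: lookup_single when_def)
qed

text \<open>
  Since \<open>C(S, 1, S) C(S, g, T) = \<delta>\<^sup>k C(S, g, T)\<close>, associativity gives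
  \<open>f C(S, g, T) = \<delta>\<^sup>k a C(S, g, T)\<close>, and the power of \<open>\<delta>\<close> can be cancelled.
\<close>

lemma left_action_coeff:
  assumes a: "keys a \<subseteq> diagrams n B" and S: "half_diagram n l S" and T: "half_diagram n l T"
    and h: "keys h \<subseteq> tensor_basis l"
    and S'': "half_diagram n l'' S''" and V'': "half_diagram n l'' V''" and zs: "zs \<in> basis_lists l''" and le: "l \<le> l''"
  defines "f \<equiv> a \<otimes>\<^bsub>P_algebra n A B\<^esub> single (diag n S (replicate l \<one>) S) 1"
    and "y \<equiv> lin (\<lambda>b. single (diag n S (middle b) T) 1) h"
  shows "lookup (a \<otimes>\<^bsub>P_algebra n A B\<^esub> y) (diag n S'' zs V'') =
    (if l'' = l \<and> V'' = T then
       lookup (left_action n l f S'' S \<otimes>\<^bsub>extend_scalars (tensor l) (tensor_basis l)\<^esub> h) (single zs 1)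
     else 0)"
proof -
  interpret P: free_algebra_data "diagrams n B" "diagram_mult n A B" "identity_diagram n \<one>" by (rule diagram_algebra)
  let ?Z = "diag n S'' zs V''" and ?D = "diag n S (replicate l \<one>) S"
  let ?d = "delta ^ card S :: laurent"
  have one: "replicate l \<one> \<in> basis_lists l" by (auto simp: basis_lists_def)
  note D = diag_diagrams[OF S S one]
  have mb: "middle b \<in> basis_lists l" "b = single (middle b) 1" if "b \<in> keys h" for b
    using that h middle_tensor_basis by blast+
  have ky: "keys y \<subseteq> diagrams n B"
    unfolding y_def using keys_lin[of "\<lambda>b. single (diag n S (middle b) T) (1::laurent)" h]
      mb diag_diagrams[OF S T] by fastforce
  have f: "f = lin (\<lambda>x. diagram_mult n A B x ?D) a" by (simp add: f_def P_algebra_def mult_free_algebra)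
  have kf: "keys f \<subseteq> diagrams n B"
    unfolding f using keys_lin[of "\<lambda>x. diagram_mult n A B x ?D" a] keys_diagram_mult[OF _ D] a by blast
  have Dy: "single ?D 1 \<otimes>\<^bsub>P_algebra n A B\<^esub> y = scale ?d y"
    unfolding P_algebra_def mult_free_algebra y_def lin_single lin_lin scale_one lin_fun_scale[symmetric]
    by (rule lin_cong[OF refl diagram_mult_unit_left[OF S T mb(1)]])
  have "f \<otimes>\<^bsub>P_algebra n A B\<^esub> y = a \<otimes>\<^bsub>P_algebra n A B\<^esub> (single ?D 1 \<otimes>\<^bsub>P_algebra n A B\<^esub> y)"
    unfolding f_def P_algebra_def using a D ky by (intro P.mult_assoc_free) auto
  also have "\<dots> = scale ?d (a \<otimes>\<^bsub>P_algebra n A B\<^esub> y)"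
    unfolding Dy by (simp add: P_algebra_def mult_free_algebra lin_scale lin_fun_scale)
  finally have fy: "f \<otimes>\<^bsub>P_algebra n A B\<^esub> y = scale ?d (a \<otimes>\<^bsub>P_algebra n A B\<^esub> y)" .
  define q where "q = (\<lambda>D'. \<Sum>b\<in>keys h. lookup h b *
      lookup (diagram_mult n A B D' (diag n S (middle b) T)) ?Z)"
  have sum: "?d * lookup (a \<otimes>\<^bsub>P_algebra n A B\<^esub> y) ?Z = (\<Sum>D'\<in>keys f. lookup f D' * q D')"
  proof -
    have "?d * lookup (a \<otimes>\<^bsub>P_algebra n A B\<^esub> y) ?Z = lookup (f \<otimes>\<^bsub>P_algebra n A B\<^esub> y) ?Z"
      unfolding fy lookup_scale ..
    then show ?thesis unfolding P_algebra_def mult_free_algebra y_def lin_lin lookup_lin q_def by simp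
  qed
  \<comment> \<open>Through strings never increase: \<open>D'\<close> has at most \<open>l\<close>
    of them, since the second factor of \<open>f\<close> has \<open>l\<close>, and \<open>?Z\<close>
    has at most as many as \<open>D'\<close>. With \<open>l \<le> l''\<close> all numbers agree,
    which fixes the lower half of \<open>D'\<close> as \<open>S\<close> and its upper half as
    \<open>S''\<close>.\<close>
  have claim: "l'' = l \<and> V'' = T \<and> (\<exists>ws\<in>basis_lists l. D' = diag n S'' ws S)"
    if D': "D' \<in> keys f" and nz: "q D' \<noteq> 0" for D'
  proof -
    from D' kf have "D' \<in> diagrams n B" by blast
    then obtain l' S' ws V' where d: "half_diagram n l' S'" "half_diagram n l' V'" "ws \<in> basis_lists l'" "D' = diag n S' ws V'"
      using diagram_decomposition by metis
    from D' have "(\<Sum>x\<in>keys a. lookup a x * lookup (diagram_mult n A B x ?D) D') \<noteq> 0"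
      unfolding f in_keys_iff lookup_lin .
    then obtain x where x: "x \<in> keys a" "lookup (diagram_mult n A B x ?D) D' \<noteq> 0"
      by (rule sum_mult_neq_0D)
    then have "x \<in> diagrams n B" using a by blast
    then obtain m S1 us V1 where x': "half_diagram n m S1" "half_diagram n m V1" "us \<in> basis_lists m" "x = diag n S1 us V1"
      using diagram_decomposition by metis
    note 1 = structure_coeff_persist[OF x'(1-3) S S one d(1-3) x(2)[unfolded x'(4) d(4)]]
    from nz obtain b where b: "b \<in> keys h" "lookup (diagram_mult n A B D' (diag n S (middle b) T)) ?Z \<noteq> 0"
      unfolding q_def by (rule sum_mult_neq_0D)
    note 2 = structure_coeff_persist[OF d(1-3) S T mb(1)[OF b(1)] S'' V'' zs b(2)[unfolded d(4)]]
    have "l' = l" "l'' = l" using 1(3) 2(1) le by auto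
    then show ?thesis using 1(4) 2(2,4) d(3,4) by auto
  qed
  show ?thesis
  proof (cases "l'' = l \<and> V'' = T")
    case False
    then have "?d * lookup (a \<otimes>\<^bsub>P_algebra n A B\<^esub> y) ?Z = 0"
      unfolding sum using claim by (intro sum.neutral) auto
    then show ?thesis unfolding if_not_P[OF False] by simp
  next
    case True
    have S2: "half_diagram n l S''" using True S'' by auto
    let ?W = "{ws \<in> basis_lists l. diag n S'' ws S \<in> keys f}"
    define L where "L = (\<lambda>ws. \<Sum>b\<in>keys h. lookup h b * of_int (list_coeff zs (twist_mult True ws (middle b))))"
    have inj: "inj_on (\<lambda>ws. diag n S'' ws S) ?W"
      by (rule inj_onI) (use diag_inject(3)[OF S2 S _ S2 S] in blast)
    have finW: "finite ?W"
      by (rule inj_on_finite[OF inj]) auto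
    have q: "q (diag n S'' ws S) = ?d * L ws" if "ws \<in> basis_lists l" for ws
      unfolding q_def L_def sum_distrib_left
    proof (rule sum.cong[OF refl])
      fix b assume b: "b \<in> keys h"
      show "lookup h b * lookup (diagram_mult n A B (diag n S'' ws S) (diag n S (middle b) T)) ?Z =
          ?d * (lookup h b * of_int (list_coeff zs (twist_mult True ws (middle b))))"
        unfolding structure_coeff_matching[OF S2 S that T mb(1)[OF b] S'' V'' zs] using True by simp
    qed
    have "(\<Sum>D'\<in>keys f. lookup f D' * q D') =
        (\<Sum>D'\<in>(\<lambda>ws. diag n S'' ws S) ` ?W. lookup f D' * q D')"
      by (rule sum.mono_neutral_right) (use claim in fastforce)+
    also have "\<dots> = ?d * (\<Sum>ws\<in>?W. lookup f (diag n S'' ws S) * L ws)"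
      unfolding sum.reindex[OF inj] sum_distrib_left by (rule sum.cong) (auto simp: q)
    \<comment> \<open>The common factor \<open>?d\<close>, a power of the nonzero element
      \<open>delta\<close>, is cancelled.\<close>
    finally have "lookup (a \<otimes>\<^bsub>P_algebra n A B\<^esub> y) ?Z = (\<Sum>ws\<in>?W. lookup f (diag n S'' ws S) * L ws)"
      unfolding sum[symmetric] by simp
    also have "\<dots> = lookup (left_action n l f S'' S \<otimes>\<^bsub>extend_scalars (tensor l) (tensor_basis l)\<^esub> h) (single zs 1)"
      unfolding extend_scalars_def mult_free_algebra left_action_def lin_sum lookup_sum lin_single lookup_scale lookup_lin L_def
    proof (intro sum.cong refl arg_cong2[of _ _ _ _ "(*)"])
      fix ws b assume ws: "ws \<in> ?W" and b: "b \<in> keys h"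
      show "of_int (list_coeff zs (twist_mult True ws (middle b))) =
        lookup (of_int_coords (tensor l) (tensor_basis l) (single ws 1 \<otimes>\<^bsub>tensor l\<^esub> b)) (single zs 1)"
        using extended_structure_coeff[of ws l "middle b" zs] ws mb[OF b] by simp
    qed
    finally show ?thesis using True by simp
  qed
qed

lemma keys_of_int_coords:
  assumes "x \<in> carrier (tensor l)"
  shows "keys (of_int_coords (tensor l) (tensor_basis l) x) \<subseteq> tensor_basis l"
proof -
  have "\<exists>!c. keys c \<subseteq> tensor_basis l \<and> lincomb (tensor l) c = x"
    using normalized_table_algebra.basis[OF tensor_table_algebra, of l] assms by (auto simp: free_basis_def)
  from theI'[OF this] have "keys (coords (tensor l) (tensor_basis l) x) \<subseteq> tensor_basis l"
    unfolding coords_def by blast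
  then show ?thesis unfolding of_int_coords_def by (auto simp: in_keys_iff Poly_Mapping.map.rep_eq when_def subset_iff)
qed

text \<open>At diagrams with at least \<open>l\<close> through strings,
  \<open>left_action_coeff\<close> computes the product and \<open>lookup_C_ext\<close> the sum,
  with equal results; the difference is supported on the remaining diagrams. The elements
  \<open>r S' S\<close> are built from \<open>a\<close> and the halves \<open>S'\<close> and
  \<open>S\<close>, without \<open>T\<close> and \<open>h\<close>.\<close>

lemma axiom_A3:
  assumes fin: "finite (halves n l)" and a: "keys a \<subseteq> diagrams n B" and ln: "l \<le> n"
    and S: "half_diagram n l S" and T: "half_diagram n l T" and h: "keys h \<subseteq> tensor_basis l"
  defines "r \<equiv> left_action n l (a \<otimes>\<^bsub>P_algebra n A B\<^esub> single (diag n S (replicate l \<one>) S) 1)"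
  shows "a \<otimes>\<^bsub>P_algebra n A B\<^esub> C_ext (P_algebra n A B) (tabular_C n) l S h T
      \<ominus>\<^bsub>P_algebra n A B\<^esub> (\<Oplus>\<^bsub>P_algebra n A B\<^esub>S'\<in>halves n l.
          C_ext (P_algebra n A B) (tabular_C n) l S' (r S' S \<otimes>\<^bsub>extend_scalars (tensor l) (tensor_basis l)\<^esub> h) T)
    \<in> lin_span (P_algebra n A B) (tabular_C n ` {(m, q) \<in> tabular_index n. m < l})"
proof -
  interpret P: free_algebra_data "diagrams n B" "diagram_mult n A B" "identity_diagram n \<one>" by (rule diagram_algebra)
  let ?E = "extend_scalars (tensor l) (tensor_basis l)"
  let ?y = "\<lambda>S' h. lin (\<lambda>b. single (diag n S' (middle b) T) (1::laurent)) h"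
  have kr: "keys (r S' S \<otimes>\<^bsub>?E\<^esub> h) \<subseteq> tensor_basis l" for S'
  proof -
    interpret E: normalized_table_algebra "tensor l" "tensor_basis l" tensor_bar by (rule tensor_table_algebra)
    have "keys (of_int_coords (tensor l) (tensor_basis l) (x \<otimes>\<^bsub>tensor l\<^esub> b)) \<subseteq> tensor_basis l"
      if "x \<in> tensor_basis l" "b \<in> tensor_basis l" for x b
      using that E.basis by (intro keys_of_int_coords) (auto simp: free_basis_def)
    then have "keys (lin (\<lambda>b. of_int_coords (tensor l) (tensor_basis l) (x \<otimes>\<^bsub>tensor l\<^esub> b)) h) \<subseteq> tensor_basis l"
      if "x \<in> tensor_basis l" for x
      using that h keys_lin[of "\<lambda>b. of_int_coords (tensor l) (tensor_basis l) (x \<otimes>\<^bsub>tensor l\<^esub> b)" h] by blast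
    then show ?thesis
      unfolding extend_scalars_def mult_free_algebra r_def
      using keys_left_action keys_lin[of "\<lambda>x. lin (\<lambda>b. of_int_coords (tensor l) (tensor_basis l) (x \<otimes>\<^bsub>tensor l\<^esub> b)) h"] by blast
  qed
  have ky: "keys (?y S' k) \<subseteq> diagrams n B" if "half_diagram n l S'" "keys k \<subseteq> tensor_basis l" for S' k
    using keys_lin[of "\<lambda>b. single (diag n S' (middle b) T) (1::laurent)" k] that(2)
      middle_tensor_basis diag_diagrams[OF that(1) T] by fastforce
  let ?x = "a \<otimes>\<^bsub>P_algebra n A B\<^esub> ?y S h - (\<Sum>S'\<in>halves n l. ?y S' (r S' S \<otimes>\<^bsub>?E\<^esub> h))"
  have k1: "keys (a \<otimes>\<^bsub>P_algebra n A B\<^esub> ?y S h) \<subseteq> diagrams n B"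
    unfolding P_algebra_def mult_free_algebra by (rule P.mult_closed_free[OF a ky[OF S h]])
  have k2: "keys (\<Sum>S'\<in>halves n l. ?y S' (r S' S \<otimes>\<^bsub>?E\<^esub> h)) \<subseteq> diagrams n B"
    by (rule order_trans[OF keys_sum]) (use ky kr in \<open>auto simp: halves_def\<close>)
  have fs: "(\<Oplus>\<^bsub>P_algebra n A B\<^esub>S'\<in>halves n l. C_ext (P_algebra n A B) (tabular_C n) l S' (r S' S \<otimes>\<^bsub>?E\<^esub> h) T) =
      (\<Sum>S'\<in>halves n l. ?y S' (r S' S \<otimes>\<^bsub>?E\<^esub> h))"
  proof -
    have "(\<Oplus>\<^bsub>P_algebra n A B\<^esub>S'\<in>halves n l. C_ext (P_algebra n A B) (tabular_C n) l S' (r S' S \<otimes>\<^bsub>?E\<^esub> h) T) =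
      (\<Sum>S'\<in>halves n l. C_ext (P_algebra n A B) (tabular_C n) l S' (r S' S \<otimes>\<^bsub>?E\<^esub> h) T)"
      unfolding P_algebra_def
      by (rule P.finsum_free) (use C_ext_lin[OF kr _ T] ky[OF _ kr] in \<open>simp add: halves_def P_algebra_def\<close>)
    also have "\<dots> = (\<Sum>S'\<in>halves n l. ?y S' (r S' S \<otimes>\<^bsub>?E\<^esub> h))"
      by (rule sum.cong[OF refl]) (use C_ext_lin[OF kr _ T] in \<open>simp add: halves_def\<close>)
    finally show ?thesis .
  qed
  let ?K = "{diag n S' zs V' | m S' zs V'. m < l \<and> half_diagram n m S' \<and> half_diagram n m V' \<and> zs \<in> basis_lists m}"
  have "tabular_C n ` {(m, q) \<in> tabular_index n. m < l} = (\<lambda>D. single D 1) ` ?K"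
  proof (intro equalityI subsetI)
    fix x assume "x \<in> tabular_C n ` {(m, q) \<in> tabular_index n. m < l}"
    then obtain m S' b V' where i: "(m, S', b, V') \<in> tabular_index n" "m < l" "x = tabular_C n (m, S', b, V')" by auto
    then show "x \<in> (\<lambda>D. single D 1) ` ?K"
      unfolding tabular_index_iff using middle_tensor_basis[of b m]
      by (auto simp: tabular_C_def intro!: imageI)
  next
    fix x assume "x \<in> (\<lambda>D. single D (1::laurent)) ` ?K"
    then obtain m S' zs V' where i: "m < l" "half_diagram n m S'" "half_diagram n m V'" "zs \<in> basis_lists m"
      "x = single (diag n S' zs V') 1" by blast
    have "(m, S', single zs 1, V') \<in> tabular_index n"
      unfolding tabular_index_iff using i ln by (simp add: tensor_basis_def)
    moreover have "x = tabular_C n (m, S', single zs 1, V')" using i by (simp add: tabular_C_def)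
    ultimately show "x \<in> tabular_C n ` {(m, q) \<in> tabular_index n. m < l}" using i(1) by blast
  qed
  moreover have "?K \<subseteq> diagrams n B" using diag_diagrams by blast
  ultimately have span: "lin_span (P_algebra n A B) (tabular_C n ` {(m, q) \<in> tabular_index n. m < l}) = {f. keys f \<subseteq> ?K}"
    unfolding P_algebra_def using P.lin_span_free[of ?K] by simp
  have "keys ?x \<subseteq> ?K"
  proof
    fix Z assume Z: "Z \<in> keys ?x"
    then have "Z \<in> diagrams n B" using keys_diff[of "a \<otimes>\<^bsub>P_algebra n A B\<^esub> ?y S h"] k1 k2 by blast
    then obtain l'' S'' zs V'' where z: "half_diagram n l'' S''" "half_diagram n l'' V''" "zs \<in> basis_lists l''" "Z = diag n S'' zs V''"
      using diagram_decomposition by metis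
    have "l'' < l"
    proof (rule ccontr)
      assume "\<not> l'' < l"
      then have le: "l \<le> l''" by simp
      have "lookup (\<Sum>S'\<in>halves n l. ?y S' (r S' S \<otimes>\<^bsub>?E\<^esub> h)) Z =
        (\<Sum>S'\<in>halves n l. if S' = S'' then if l'' = l \<and> V'' = T then lookup (r S' S \<otimes>\<^bsub>?E\<^esub> h) (single zs 1) else 0 else 0)"
        unfolding lookup_sum z(4)
        by (rule sum.cong[OF refl]) (use lookup_C_ext[OF kr _ T z(1-3)] in \<open>auto simp: halves_def\<close>)
      also have "\<dots> = (if l'' = l \<and> V'' = T then lookup (r S'' S \<otimes>\<^bsub>?E\<^esub> h) (single zs 1) else 0)"
        using fin z(1) by (auto simp: halves_def)
      finally have "lookup ?x Z = 0"
        unfolding lookup_minus z(4) left_action_coeff[OF a S T h z(1-3) le] r_def by simp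
      then show False using Z by (simp add: in_keys_iff)
    qed
    then show "Z \<in> ?K" using z by blast
  qed
  moreover have "a \<otimes>\<^bsub>P_algebra n A B\<^esub> ?y S h \<ominus>\<^bsub>P_algebra n A B\<^esub> (\<Sum>S'\<in>halves n l. ?y S' (r S' S \<otimes>\<^bsub>?E\<^esub> h)) = ?x"
    unfolding P_algebra_def by (rule P.minus_free) (use k1 k2 in \<open>simp_all add: P_algebra_def\<close>)
  ultimately show ?thesis unfolding span fs C_ext_lin[OF h S T] by simp
qed

end

section \<open>Closed diagrams\<close>

lemma loops_eq_image:
  assumes pb: "partial_bij E" and meets: "\<And>x. x \<in> reach E x \<Longrightarrow> \<exists>y\<in>Q. y \<in> reach E x"
    and Q: "\<And>y. y \<in> Q \<Longrightarrow> y \<in> reach E y"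
  shows "loops E = reach E ` Q"
proof
  show "loops E \<subseteq> reach E ` Q"
  proof
    fix L assume "L \<in> loops E"
    then obtain x where x: "x \<in> reach E x" "L = reach E x" by (auto simp: loops_reach)
    from meets[OF x(1)] obtain y where y: "y \<in> Q" "y \<in> reach E x" by blast
    have "reach E y = L" using reach_closed(1)[OF pb x(1) y(2)] x by simp
    then show "L \<in> reach E ` Q" using y by blast
  qed
qed (use Q in \<open>auto simp: loops_reach\<close>)

text \<open>Multiplication by \<open>v\<close> turns negative exponents into exponents at most
  \<open>0\<close>.\<close>

lemma vpow_mult_Aminus:
  assumes "\<And>j. j \<ge> 0 \<Longrightarrow> lookup f j = 0"
  shows "f \<in> (\<lambda>p. vpow (- 1) * p) ` Aminus"
proof
  have "j \<le> 0" if "j \<in> keys (vpow 1 * f)" for j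
    using that assms[of "j - 1"] by (force simp: in_keys_iff lookup_vpow_mult)
  then show "vpow 1 * f \<in> Aminus" by (auto simp: Aminus_def)
  show "f = vpow (- 1) * (vpow 1 * f)"
    by (rule poly_mapping_eqI) (simp add: lookup_vpow_mult)
qed

context int_table_algebra
begin

context
  fixes n l S T xs
  assumes S: "half_diagram n l S" and T: "half_diagram n l T" and xs: "xs \<in> basis_lists l"
begin

abbreviation "E \<equiv> close_up n (diag n S xs T)"
text \<open>A set met by every loop of the closure: it contains all even points, by
  \<open>even_Q\<close>, and in addition the odd free points of \<open>S\<close>. Its size
  \<open>card S + l\<close> bounds the number of loops.\<close>

abbreviation "Q \<equiv> srcs S \<union> free_points n S"

lemma len: "length xs = l" and xs_B: "i < l \<Longrightarrow> xs ! i \<in> B"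
  using xs nth_mem by (fastforce simp: basis_lists_def)+

lemma pre_D: "pre_diagram n (diag n S xs T)"
  using diagram_pre_diagram[OF diag_diagrams[OF S T xs]] .

lemma E_label: "label_graph E" and E_pb: "partial_bij E" and E_inner: "inner E = {1..n}"
  using label_graph_close_up[OF pre_D] srcs_close_up[OF pre_D] tgts_close_up[OF pre_D]
  by (simp_all add: inner_def label_graphD(1))

lemma E_edge: "(p, q, a) \<in> diag n S xs T \<Longrightarrow> (closure_point n p, closure_point n q, a) \<in> E"
  unfolding close_up_map_graph by (rule map_graphI)

lemma E_top: "(p, q, a) \<in> S \<Longrightarrow> (p, q, a) \<in> E"
  using E_edge[of p q a] half_diagramD(5)[OF S, of p q a] by (simp add: diag_def closure_point_def)

lemma E_bottom: "(p, q, a) \<in> T \<Longrightarrow> (q, p, bar a) \<in> E"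
proof -
  assume e: "(p, q, a) \<in> T"
  have "(2 * n + 1 - q, 2 * n + 1 - p, bar a) \<in> flip n T"
    unfolding flip_image using image_eqI[OF _ e] by force
  then have "(2 * n + 1 - q, 2 * n + 1 - p, bar a) \<in> diag n S xs T" by (simp add: diag_def)
  moreover have "closure_point n (2 * n + 1 - q) = q" "closure_point n (2 * n + 1 - p) = p"
    using half_diagramD(5)[OF T e] by (auto simp: closure_point_def)
  ultimately show ?thesis using E_edge by metis
qed

lemma E_through:
  assumes i: "i < l"
  shows "odd i \<Longrightarrow> (free_list n S ! i, free_list n T ! i, xs ! i) \<in> E"
    "even i \<Longrightarrow> (free_list n T ! i, free_list n S ! i, xs ! i) \<in> E"
proof -
  let ?u = "free_list n S ! i" and ?v = "free_list n T ! i"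
  have "thr_edge n ?u ?v (xs ! i) \<in> diag n S xs T" using i len by (auto simp: diag_def thr_edges_def)
  moreover have "closure_point n ?u = ?u" "closure_point n (2 * n + 1 - ?v) = ?v"
    using free_nth(2)[OF S i] free_nth(2)[OF T i] by (auto simp: closure_point_def)
  ultimately show "odd i \<Longrightarrow> (?u, ?v, xs ! i) \<in> E" "even i \<Longrightarrow> (?v, ?u, xs ! i) \<in> E"
    using E_edge half_parity[OF S i] unfolding thr_edge_def by metis+
qed

text \<open>Arcs of \<open>S\<close> start at even points, so an odd vertex of the closure is left
  along a reflected arc of \<open>T\<close> or along an upward through string.\<close>

lemma E_odd:
  assumes "x \<in> {1..n}" "odd x"
  obtains p a where "(p, x, a) \<in> T" "(x, p, bar a) \<in> E"
    | i where "i < l" "even i" "x = free_list n T ! i" "(x, free_list n S ! i, xs ! i) \<in> E"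
proof (cases "x \<in> free_points n T")
  case True
  then obtain i where i: "i < l" "x = free_list n T ! i" using free_points_nth[OF T] by blast
  then have "even i" using half_parity[OF T i(1)] assms(2) by simp
  then show thesis using that(2) i E_through(2)[OF i(1)] by blast
next
  case False
  then have "x \<in> srcs T \<union> tgts T" using assms(1) by (simp add: free_points_def verts_def)
  moreover have "x \<notin> srcs T" using half_diagramD(5)[OF T] assms(2) by (auto simp: srcs_def)
  ultimately obtain p a where e: "(p, x, a) \<in> T" by (auto simp: tgts_def)
  then show thesis using that(1) E_bottom[OF e] by blast
qed

lemma even_Q: "x \<in> {1..n} \<Longrightarrow> even x \<Longrightarrow> x \<in> Q"
  using half_diagramD(5)[OF S] by (auto simp: free_points_def verts_def tgts_def)

lemma reach_E: "x \<in> reach E x \<Longrightarrow> y \<in> reach E x \<Longrightarrow> y \<in> {1..n}"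
  using reach_inner[OF E_pb, of x] unfolding E_inner by blast

lemma E_meets:
  assumes x: "x \<in> reach E x"
  shows "\<exists>y\<in>Q. y \<in> reach E x"
proof (cases "even x")
  case True
  then show ?thesis using even_Q reach_E[OF x x] x by blast
next
  case False
  from reach_E[OF x x] False show ?thesis
  proof (cases rule: E_odd)
    case (1 p a)
    have "p \<in> Q" using even_Q half_diagramD(5)[OF T 1(1)] by blast
    then show ?thesis using reach_succ[OF E_pb x 1(2)] by blast
  next
    case (2 i)
    then show ?thesis using reach_succ[OF E_pb x 2(4)] free_nth(1)[OF S 2(1)] by blast
  qed
qed

lemma finite_Q: "finite Q" and card_Q: "card Q = card S + l"
proof -
  have fin: "finite (srcs S)" using half_diagramD(2)[OF S] by (auto simp: verts_def intro: finite_subset)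
  then show "finite Q" by simp
  have "srcs S \<inter> free_points n S = {}" by (auto simp: free_points_def verts_def)
  then show "card Q = card S + l"
    using card_Un_disjoint[OF fin finite_free_points] half_diagramD(8)[OF S]
      card_partial_bij(1)[OF half_diagramD(1)[OF S]] by simp
qed

lemma card_loops_close_up: "card (loops E) \<le> card S + l"
  using card_loops_le[OF E_pb finite_Q E_meets] unfolding card_Q .

text \<open>Every loop contains exactly one point of \<open>Q\<close>. Hence every through string
  closes up on itself, with a label of nonzero trace, and every arc of \<open>S\<close> closes up
  with an arc of \<open>T\<close> between the same points.\<close>

lemma close_up_maximal:
  assumes eq: "card (loops E) = card S + l" and nz: "loop_factor A B E \<noteq> 0"
  shows "S = T" "xs = replicate l \<one>"
proof -
  have eqQ: "card (loops E) = card Q" using eq unfolding card_Q .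
  have D: "y \<in> Q \<Longrightarrow> y \<in> reach E y" "y \<in> Q \<Longrightarrow> z \<in> Q \<Longrightarrow> z \<in> reach E y \<Longrightarrow> z = y" for y z
    using card_loops_eqD[OF E_pb finite_Q _ eqQ] E_meets by blast+
  have fixed: "free_list n T ! i = free_list n S ! i" if i: "i < l" for i
  proof -
    let ?u = "free_list n S ! i" and ?v = "free_list n T ! i"
    have u: "?u \<in> Q" "?u \<in> {1..n}" using free_nth[OF S i] by auto
    have r: "?u \<in> reach E ?u" using D(1)[OF u(1)] .
    show ?thesis
    \<comment> \<open>A downward string leads from \<open>?u\<close> to an even point, which lies in
      \<open>Q\<close>. For an upward string the edge leaving the odd point \<open>?u\<close> is
      examined: an arc of \<open>T\<close> would lead to an even point of \<open>Q\<close> on the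
      same loop, which is impossible; a through string leads to a free point of \<open>S\<close>,
      which must be \<open>?u\<close>.\<close>
    proof (cases "odd i")
      case True
      then have "even ?v" using half_parity[OF T i] by simp
      then have "?v \<in> Q" using even_Q free_nth(2)[OF T i] by blast
      then show ?thesis using D(2)[OF u(1)] reach_succ[OF E_pb r E_through(1)[OF i True]] by blast
    next
      case False
      then have "odd ?u" using half_parity[OF S i] by simp
      from u(2) this show ?thesis
      proof (cases rule: E_odd)
        case (1 p a)
        have "p \<in> Q" "even p" using even_Q half_diagramD(5)[OF T 1(1)] by blast+
        then have "p = ?u" using D(2)[OF u(1)] reach_succ[OF E_pb r 1(2)] by blast
        then show ?thesis using \<open>even p\<close> \<open>odd ?u\<close> by simp
      next
        case (2 j)
        have "free_list n S ! j \<in> Q" using free_nth(1)[OF S 2(1)] by blast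
        then have "free_list n S ! j = ?u" using D(2)[OF u(1)] reach_succ[OF E_pb r 2(4)] by blast
        then have "j = i" by (rule free_nth_inj[OF S 2(1) i])
        then show ?thesis using 2(3) by simp
      qed
    qed
  qed
  have "xs ! i = \<one>" if i: "i < l" for i
  proof -
    have "(free_list n S ! i, free_list n S ! i, xs ! i) \<in> E"
      using E_through[OF i] unfolding fixed[OF i] by (cases "odd i") auto
    from one_cycle[OF E_label this] have "reach E (free_list n S ! i) = {free_list n S ! i}"
      "loop_value E (free_list n S ! i) = t (xs ! i)" by auto
    then have "t (xs ! i) \<noteq> 0" using loop_value_neq_0[OF E_label nz, of "free_list n S ! i"] by simp
    then show ?thesis using trace_basis[OF xs_B[OF i]] by (simp split: if_splits)
  qed
  then show "xs = replicate l \<one>" using len by (intro nth_equalityI) auto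
  have "S \<subseteq> T"
  proof
    fix e assume e': "e \<in> S"
    obtain p q a where [simp]: "e = (p, q, a)" by (cases e)
    have e: "(p, q, a) \<in> S" using e' by simp
    note h = half_diagramD(5)[OF S e]
    have p: "p \<in> Q" using e by (auto intro: srcsI)
    have rp: "p \<in> reach E p" by (rule D(1)[OF p])
    have q: "q \<in> reach E p" by (rule reach_succ[OF E_pb rp E_top[OF e]])
    have rq: "reach E q = reach E p" by (rule reach_closed(1)[OF E_pb rp q])
    then have rqq: "q \<in> reach E q" using q by simp
    have "q \<in> {1..n}" "odd q" using h by auto
    then show "e \<in> T"
    proof (cases rule: E_odd)
      case (1 p' b)
      have "p' \<in> Q" using even_Q half_diagramD(5)[OF T 1(1)] by blast
      then have "p' = p" using D(2)[OF p] reach_succ[OF E_pb rqq 1(2)] rq by blast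
      then have b: "(p, q, b) \<in> T" "(q, p, bar b) \<in> E" using 1 by auto
      have "p \<noteq> q" using h by auto
      from two_cycle(2)[OF E_label E_top[OF e] b(2) this] have "t (bar b \<otimes> a) \<noteq> 0"
        using loop_value_neq_0[OF E_label nz rp] by simp
      then have "b = a"
        using trace_bar_mult[OF half_diagramD(4)[OF T b(1)] half_diagramD(4)[OF S e]] by (auto split: if_splits)
      then show ?thesis using b by simp
    next
      case (2 i)
      then have "q \<in> free_points n S" using fixed[OF 2(1)] free_nth(1)[OF S 2(1)] by simp
      then show ?thesis using tgtsI[OF e] by (simp add: free_points_def verts_def)
    qed
  qed
  then show "S = T" using half_subset(2)[OF S T] by simp
qed

end

lemma loop_factor_close_up:
  assumes S: "half_diagram n l S"
  shows "loop_factor A B (close_up n (diag n S (replicate l \<one>) S)) = delta ^ (card S + l)"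
proof -
  have one: "replicate l \<one> \<in> basis_lists l" by (auto simp: basis_lists_def)
  let ?E = "close_up n (diag n S (replicate l \<one>) S)" and ?Q = "srcs S \<union> free_points n S"
  note lg = E_label[OF S S one] and pb = E_pb[OF S S one]
  have arc: "reach ?E p = {p, q} \<and> loop_value ?E p = 1" if e: "(p, q, a) \<in> S" for p q a
  proof -
    have "p \<noteq> q" using half_diagramD(5)[OF S e] by auto
    from two_cycle[OF lg E_top[OF S S one e] E_bottom[OF S S one e] this] show ?thesis
      using trace_bar_mult[OF half_diagramD(4)[OF S e] half_diagramD(4)[OF S e]] by simp
  qed
  have pt: "reach ?E u = {u} \<and> loop_value ?E u = 1" if u: "u \<in> free_points n S" for u
  proof -
    obtain i where i: "i < l" "u = free_list n S ! i" using free_points_nth[OF S u] by blast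
    have "(u, u, \<one>) \<in> ?E" using E_through[OF S S one i(1)] i by (cases "odd i") auto
    from one_cycle[OF lg this] show ?thesis using trace_basis[OF one_basis] by simp
  qed
  have Q: "y \<in> reach ?E y \<and> loop_value ?E y = 1 \<and> reach ?E y \<inter> ?Q = {y}" if y: "y \<in> ?Q" for y
  proof (cases "y \<in> free_points n S")
    case True
    then show ?thesis using pt[OF True] by auto
  next
    case False
    then obtain q a where e: "(y, q, a) \<in> S" using y by (auto simp: srcs_def)
    have "q \<notin> ?Q" using tgtsI[OF e] half_disjoint[OF S] by (auto simp: free_points_def verts_def)
    then show ?thesis using arc[OF e] y by auto
  qed
  have l: "loops ?E = reach ?E ` ?Q"
    by (rule loops_eq_image[OF pb E_meets[OF S S one]]) (use Q in blast)+
  have "inj_on (reach ?E) ?Q"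
  proof (rule inj_onI)
    fix x y assume xy: "x \<in> ?Q" "y \<in> ?Q" "reach ?E x = reach ?E y"
    have "reach ?E x \<inter> ?Q = {x}" "reach ?E y \<inter> ?Q = {y}" using Q[OF xy(1)] Q[OF xy(2)] by blast+
    then have "{x} = {y}" unfolding xy(3) by (rule trans[OF sym])
    then show "x = y" by (rule singleton_inject)
  qed
  then have c: "card (loops ?E) = card S + l" unfolding l card_Q[OF S S one, symmetric] by (rule card_image)
  have "t (loop_label A ?E L) = 1" if "L \<in> loops ?E" for L
  proof -
    from that[unfolded l] obtain y where y: "L = reach ?E y" "y \<in> ?Q" by (rule imageE)
    then show ?thesis using loop_label_value[OF lg] Q[OF y(2)] by simp
  qed
  then have "(\<Prod>L\<in>loops ?E. t (loop_label A ?E L)) = 1" by simp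
  then show ?thesis unfolding loop_factor_power c by simp
qed

text \<open>By \<open>card_half\<close> the exponents \<open>-n\<close> from the trace and
  \<open>card S\<close> from \<open>a\<close> are balanced by exactly \<open>card S + l\<close>
  loops. Fewer loops give only negative powers; with the maximal number,
  \<open>close_up_maximal\<close> lets a nonzero value occur only for \<open>S = T\<close> and unit
  labels.\<close>

lemma trace_congruence:
  assumes S: "half_diagram n l S" and T: "half_diagram n l T" and xs: "xs \<in> basis_lists l"
  shows "vpow (- int n) * (vpow (int (card S)) * loop_factor A B (close_up n (diag n S xs T))) -
      (if S = T \<and> xs = replicate l \<one> then 1 else 0) \<in> (\<lambda>p. vpow (- 1) * p) ` Aminus"
proof -
  let ?E = "close_up n (diag n S xs T)" and ?b = "S = T \<and> xs = replicate l \<one>"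
  let ?k = "card (loops ?E)" and ?c = "\<Prod>L\<in>loops ?E. t (loop_label A ?E L)"
  let ?f = "vpow (- int n) * (vpow (int (card S)) * loop_factor A B ?E) - (if ?b then 1 else 0)"
  have lf: "lookup (loop_factor A B ?E) j = lookup (delta ^ ?k) j * ?c" for j
    unfolding loop_factor_power by (rule lookup_mult_of_int)
  have n: "int n = 2 * int (card S) + int l" using card_half[OF S] by simp
  have k: "?k \<le> card S + l" by (rule card_loops_close_up[OF S T xs])
  have f: "lookup ?f j =
      lookup (loop_factor A B ?E) (j + (int (card S) + int l)) - (if ?b \<and> j = 0 then 1 else 0)" for j
    unfolding lookup_minus lookup_vpow_mult by (simp add: n lookup_one when_def algebra_simps)
  have "lookup ?f j = 0" if j: "j \<ge> 0" for j
  proof (cases "j = 0")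
    case False
    then show ?thesis using j k unfolding f lf by (simp add: delta_power(2))
  next
    case [simp]: True
    show ?thesis
    proof (cases ?b)
      case True
      then have "loop_factor A B ?E = delta ^ (card S + l)" using loop_factor_close_up[OF S] by simp
      then show ?thesis using True delta_power(1)[of "card S + l"] unfolding f by simp
    next
      case False
      then have "?k \<noteq> card S + l \<or> loop_factor A B ?E = 0" using close_up_maximal[OF S T xs] by blast
      then have "lookup (loop_factor A B ?E) (int (card S) + int l) = 0"
      proof
        assume "?k \<noteq> card S + l"
        then show ?thesis using k unfolding lf by (simp add: delta_power(2))
      qed simp
      then show ?thesis using False unfolding f by simp
    qed
  qed
  then show ?thesis by (rule vpow_mult_Aminus)
qed

end

section \<open>The tabular structure\<close>

context int_table_algebra
begin

lemma structure_const_P: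
  assumes "(l, S, b, T) \<in> tabular_index n" "(l', S', b', T') \<in> tabular_index n"
  shows "structure_const (P_algebra n A B) (canonical_basis n B) (tabular_C n (l, S, b, T)) (tabular_C n (l', S', b', T'))
      (tabular_C n (l'', S'', b'', T'')) =
    lookup (diagram_mult n A B (diag n S (middle b) T) (diag n S' (middle b') T')) (diag n S'' (middle b'') T'')"
proof -
  interpret P: free_algebra_data "diagrams n B" "diagram_mult n A B" "identity_diagram n \<one>" by (rule diagram_algebra)
  show ?thesis
    unfolding structure_const_def tabular_C_def prod.case canonical_basis_def P_algebra_def mult_single_free_algebra
    by (rule P.kappa_free[OF P.keys_mul]) (use assms tabular_C_diagram in blast)+
qed

lemma supp_tensor:
  assumes "b \<in> tensor_basis l" "b' \<in> tensor_basis l" "b'' \<in> tensor_basis l"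
  shows "b'' \<in> supp (tensor l) (tensor_basis l) (b \<otimes>\<^bsub>tensor l\<^esub> b') \<longleftrightarrow>
    list_coeff (middle b'') (twist_mult True (middle b) (middle b')) \<noteq> 0"
proof -
  interpret F: free_algebra_data "basis_lists l" tensor_mult "replicate l \<one>" by (rule tensor_algebra)
  obtain x y z where [simp]: "b = single x 1" "b' = single y 1" "b'' = single z 1"
    and xyz: "x \<in> basis_lists l" "y \<in> basis_lists l"
    using assms by (auto simp: tensor_basis_def)
  have "b'' \<in> supp (tensor l) (tensor_basis l) (b \<otimes>\<^bsub>tensor l\<^esub> b') \<longleftrightarrow> z \<in> keys (tensor_mult x y)"
    using F.supp_free[OF F.keys_mul[OF xyz]] by (auto simp: tensor_def tensor_basis_def)
  then show ?thesis by (simp add: in_keys_iff tensor_mult_def lookup_list_expansion)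
qed

lemma card_halves_eq:
  assumes "half_diagram n l S" "half_diagram n l T" shows "card S = card T"
  using card_half[OF assms(1)] card_half[OF assms(2)] by linarith

lemma one_tensor: "\<one>\<^bsub>tensor l\<^esub> = single (replicate l \<one>) 1" "\<one>\<^bsub>tensor l\<^esub> \<in> tensor_basis l"
    "middle \<one>\<^bsub>tensor l\<^esub> = replicate l \<one>"
  by (auto simp: tensor_def tensor_basis_def basis_lists_def)

lemma structure_const_unit:
  assumes "(l, S, b, T) \<in> tabular_index n"
  shows "structure_const (P_algebra n A B) (canonical_basis n B) (tabular_C n (l, S, \<one>\<^bsub>tensor l\<^esub>, S)) (tabular_C n (l, S, b, T))
      (tabular_C n (l, S, b, T)) = delta ^ card S"
proof -
  have h: "half_diagram n l S" "half_diagram n l T" "middle b \<in> basis_lists l" and i: "(l, S, \<one>\<^bsub>tensor l\<^esub>, S) \<in> tabular_index n"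
    using assms middle_tensor_basis one_tensor by (auto simp: tabular_index_iff)
  show ?thesis
    unfolding structure_const_P[OF i assms] one_tensor(3) diagram_mult_unit_left[OF h] by simp
qed

text \<open>The number of loops is at most \<open>card T1 = card S1\<close>, and \<open>S1\<close>
  persists as a part of \<open>S\<close>.\<close>

lemma degree_le:
  assumes i: "(l, S, b, T) \<in> tabular_index n"
    and j: "j \<in> degrees (P_algebra n A B) (canonical_basis n B) (tabular_C n (l, S, b, T))"
  shows "j \<le> int (card S)"
proof -
  note h = i[unfolded tabular_index_iff]
  from j obtain K L where KL: "K \<in> canonical_basis n B" "L \<in> canonical_basis n B"
    and g: "structure_const (P_algebra n A B) (canonical_basis n B) K L (tabular_C n (l, S, b, T)) \<noteq> 0"
    and j: "j = ldeg (structure_const (P_algebra n A B) (canonical_basis n B) K L (tabular_C n (l, S, b, T)))"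
    by (auto simp: degrees_def)
  from KL obtain l1 S1 b1 T1 l2 S2 b2 T2 where
    K: "(l1, S1, b1, T1) \<in> tabular_index n" "K = tabular_C n (l1, S1, b1, T1)" and
    L: "(l2, S2, b2, T2) \<in> tabular_index n" "L = tabular_C n (l2, S2, b2, T2)"
    unfolding tabular_basis_C[symmetric] tabular_basis_def by auto
  note k = K(1)[unfolded tabular_index_iff] and m = L(1)[unfolded tabular_index_iff]
  have ms: "middle b1 \<in> basis_lists l1" "middle b2 \<in> basis_lists l2" "middle b \<in> basis_lists l"
    using h k m middle_tensor_basis by blast+
  obtain e c where e: "structure_const (P_algebra n A B) (canonical_basis n B) K L (tabular_C n (l, S, b, T)) = delta ^ e * of_int c"
    "e \<le> card T1" "S1 \<subseteq> S"
    unfolding K(2) L(2) structure_const_P[OF K(1) L(1)]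
    by (rule structure_coeff[of n l1 S1 T1 "middle b1" l2 S2 T2 "middle b2" l S T "middle b"])
      (use h k m ms g[unfolded K(2) L(2) structure_const_P[OF K(1) L(1)]] in blast)+
  have "j = int e" using ldeg_delta_power[of e c] g j unfolding e(1) by simp
  moreover have "card T1 = card S1" using card_halves_eq k by blast
  moreover have "card S1 \<le> card S" using half_subset(3) k h e(3) by blast
  ultimately show ?thesis using e(2) by simp
qed

text \<open>Multiplication by \<open>C(S,1,S)\<close> on the left reproduces \<open>C(S,b,T)\<close>
  with the factor \<open>delta ^ card S\<close>.\<close>

lemma degree_attained:
  assumes i: "(l, S, b, T) \<in> tabular_index n"
  shows "int (card S) \<in> degrees (P_algebra n A B) (canonical_basis n B) (tabular_C n (l, S, b, T))"
proof -
  let ?K = "tabular_C n (l, S, \<one>\<^bsub>tensor l\<^esub>, S)" and ?L = "tabular_C n (l, S, b, T)"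
  have "(l, S, \<one>\<^bsub>tensor l\<^esub>, S) \<in> tabular_index n" using i one_tensor by (auto simp: tabular_index_iff)
  then have "?K \<in> canonical_basis n B" "?L \<in> canonical_basis n B"
    unfolding tabular_basis_C[symmetric] tabular_basis_def using i by blast+
  moreover have "structure_const (P_algebra n A B) (canonical_basis n B) ?K ?L ?L \<noteq> 0"
    "ldeg (structure_const (P_algebra n A B) (canonical_basis n B) ?K ?L ?L) = int (card S)"
    unfolding structure_const_unit[OF i] using ldeg_delta_power[of "card S" 1] by simp_all
  ultimately show ?thesis unfolding degrees_def by (intro CollectI exI[of _ ?K] exI[of _ ?L]) simp
qed

lemma a_fun_tabular_C:
  assumes "(l, S, b, T) \<in> tabular_index n"
  shows "a_fun (P_algebra n A B) (canonical_basis n B) (tabular_C n (l, S, b, T)) = int (card S)"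
  unfolding a_fun_def by (intro Greatest_equality degree_attained[OF assms] degree_le[OF assms])

lemma axiom_A4:
  assumes i: "(l, S, b, T) \<in> tabular_index n" and i': "(l', S', b', T') \<in> tabular_index n"
    and i'': "(l'', S'', b'', T'') \<in> tabular_index n"
    and g: "g = structure_const (P_algebra n A B) (canonical_basis n B) (tabular_C n (l, S, b, T)) (tabular_C n (l', S', b', T'))
      (tabular_C n (l'', S'', b'', T''))"
  shows "g \<noteq> 0 \<and> ldeg g = int (card S'') \<longleftrightarrow>
    l' = l \<and> l'' = l \<and> S'' = S \<and> T = S' \<and> T'' = T' \<and> b'' \<in> supp (tensor l) (tensor_basis l) (b \<otimes>\<^bsub>tensor l\<^esub> b')"
proof -
  have h: "half_diagram n l S" "half_diagram n l T" "b \<in> tensor_basis l"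
    and h': "half_diagram n l' S'" "half_diagram n l' T'" "b' \<in> tensor_basis l'"
    and h'': "half_diagram n l'' S''" "half_diagram n l'' T''" "b'' \<in> tensor_basis l''"
    using i i' i'' by (simp_all add: tabular_index_iff)
  note m = middle_tensor_basis[OF h(3), THEN conjunct1] and m' = middle_tensor_basis[OF h'(3), THEN conjunct1]
    and m'' = middle_tensor_basis[OF h''(3), THEN conjunct1]
  note g' = g[unfolded structure_const_P[OF i i']]
  have matching: "g = delta ^ card T * of_int (list_coeff (middle b'') (twist_mult True (middle b) (middle b')))"
    if "l' = l" "l'' = l" "S'' = S" "T = S'" "T'' = T'"
    using structure_coeff_matching[OF h(1,2) m _ _ h'' (1,2) m'', of T' "middle b'"] h' m' that unfolding g' by simp
  have supp: "b'' \<in> supp (tensor l) (tensor_basis l) (b \<otimes>\<^bsub>tensor l\<^esub> b') \<longleftrightarrow>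
      list_coeff (middle b'') (twist_mult True (middle b) (middle b')) \<noteq> 0" if "l' = l" "l'' = l"
    by (rule supp_tensor) (use h h' h'' that in simp_all)
  show ?thesis
  proof (intro iffI; elim conjE)
    assume nz: "g \<noteq> 0" and deg: "ldeg g = int (card S'')"
    obtain k c where k: "g = delta ^ k * of_int c" "k \<le> card T" "k \<le> card S'" "S \<subseteq> S''" "T' \<subseteq> T''"
      "k = card T \<Longrightarrow> card T = card S' \<Longrightarrow> T = S'"
      by (rule structure_coeff[OF h(1,2) m h'(1,2) m' h''(1,2) m'', folded g']) (use nz in blast)
    have "k = card S''" using deg nz ldeg_delta_power[of k c] unfolding k(1) by simp
    \<comment> \<open>The chains \<open>k \<le> card T = card S \<le> card S''\<close> and
      \<open>k \<le> card S' = card T' \<le> card T'' = card S''\<close> collapse, since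
      \<open>k = card S''\<close>.\<close>
    moreover note card_halves_eq[OF h(1,2)] card_halves_eq[OF h'(1,2)] card_halves_eq[OF h''(1,2)]
      half_subset(3)[OF h(1) h''(1) k(4)] half_subset(3)[OF h'(2) h''(2) k(5)]
    ultimately have c: "k = card T" "card T = card S'" "card S'' = card S" "card T'' = card T'"
      using k(2,3) by linarith+
    have l: "l'' = l" "l'' = l'"
      using c card_half[OF h(1)] card_half[OF h'(2)] card_half[OF h''(1)] card_half[OF h''(2)] by linarith+
    have e: "S'' = S" "T'' = T'" "T = S'"
      using half_subset(2)[OF h(1) h''(1) k(4) l(1)] half_subset(2)[OF h'(2) h''(2) k(5) l(2)] k(6)[OF c(1,2)] .
    have "list_coeff (middle b'') (twist_mult True (middle b) (middle b')) \<noteq> 0"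
      using nz unfolding matching[OF l(2)[unfolded l(1), symmetric] l(1) e(1,3,2)] by auto
    then show "l' = l \<and> l'' = l \<and> S'' = S \<and> T = S' \<and> T'' = T' \<and> b'' \<in> supp (tensor l) (tensor_basis l) (b \<otimes>\<^bsub>tensor l\<^esub> b')"
      using supp l e by simp
  next
    assume e: "l' = l" "l'' = l" "S'' = S" "T = S'" "T'' = T'" "b'' \<in> supp (tensor l) (tensor_basis l) (b \<otimes>\<^bsub>tensor l\<^esub> b')"
    let ?c = "list_coeff (middle b'') (twist_mult True (middle b) (middle b'))"
    have "?c \<noteq> 0" using supp[OF e(1,2)] e(6) by simp
    then have "g \<noteq> 0" unfolding matching[OF e(1-5)] by simp
    moreover from this have "ldeg g = int (card T)"
      unfolding matching[OF e(1-5)] by (rule ldeg_delta_power)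
    ultimately show "g \<noteq> 0 \<and> ldeg g = int (card S'')" using card_halves_eq[OF h(1,2)] e(3) by simp
  qed
qed

lemma axiom_A4_gamma:
  assumes "half_diagram n l S" "half_diagram n l T" "half_diagram n l V" "l \<le> n"
  shows "gamma_const (P_algebra n A B) (canonical_basis n B)
    (tabular_C n (l, S, \<one>\<^bsub>tensor l\<^esub>, T)) (tabular_C n (l, T, \<one>\<^bsub>tensor l\<^esub>, V)) (tabular_C n (l, S, \<one>\<^bsub>tensor l\<^esub>, V)) = 1"
proof -
  have i: "(l, S, \<one>\<^bsub>tensor l\<^esub>, T) \<in> tabular_index n" "(l, T, \<one>\<^bsub>tensor l\<^esub>, V) \<in> tabular_index n"
      "(l, S, \<one>\<^bsub>tensor l\<^esub>, V) \<in> tabular_index n"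
    using assms one_tensor by (simp_all add: tabular_index_iff)
  have one: "replicate l \<one> \<in> basis_lists l" "set (replicate l \<one>) \<subseteq> B" "set (replicate l \<one>) \<subseteq> carrier A"
    by (auto simp: basis_lists_def)
  have "twist_mult True (replicate l \<one>) (replicate l \<one>) = replicate l \<one>"
    using twist_mult_one(1)[OF one(3)] by simp
  then have "structure_const (P_algebra n A B) (canonical_basis n B)
    (tabular_C n (l, S, \<one>\<^bsub>tensor l\<^esub>, T)) (tabular_C n (l, T, \<one>\<^bsub>tensor l\<^esub>, V)) (tabular_C n (l, S, \<one>\<^bsub>tensor l\<^esub>, V)) = delta ^ card T"
    unfolding structure_const_P[OF i(1,2)] one_tensor(3)
      structure_coeff_matching[OF assms(1,2) one(1) assms(3) one(1) assms(1,3) one(1)]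
    by (simp add: list_coeff_basis one(2))
  then show ?thesis
    unfolding gamma_const_def a_fun_tabular_C[OF i(3)] card_halves_eq[OF assms(1,2)] by (simp add: delta_power)
qed

lemma star_anti: "involutory_anti_automorphism (P_algebra n A B) (star n)"
  unfolding involutory_anti_automorphism_def
proof (intro conjI ballI allI)
  show "star n \<in> carrier (P_algebra n A B) \<rightarrow> carrier (P_algebra n A B)"
    using keys_star by (simp add: P_algebra_def)
  fix x assume "x \<in> carrier (P_algebra n A B)"
  then have x: "keys x \<subseteq> diagrams n B" by (simp add: P_algebra_def)
  show "star n (star n x) = x" by (rule star_star[OF x])
  show "star n (r \<odot>\<^bsub>P_algebra n A B\<^esub> x) = r \<odot>\<^bsub>P_algebra n A B\<^esub> star n x" for r
    by (simp add: P_algebra_def star_def lin_scale)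
  fix y assume "y \<in> carrier (P_algebra n A B)"
  then have y: "keys y \<subseteq> diagrams n B" by (simp add: P_algebra_def)
  show "star n (x \<oplus>\<^bsub>P_algebra n A B\<^esub> y) = star n x \<oplus>\<^bsub>P_algebra n A B\<^esub> star n y"
    by (simp add: P_algebra_def star_def lin_add)
  have "star n (x \<otimes>\<^bsub>P_algebra n A B\<^esub> y) = lin (\<lambda>D. lin (\<lambda>D'. star n (diagram_mult n A B D D')) y) x"
    by (simp add: P_algebra_def mult_free_algebra star_def lin_lin)
  also have "\<dots> = lin (\<lambda>D. lin (\<lambda>D'. diagram_mult n A B (flip n D') (flip n D)) y) x"
    by (intro lin_cong refl star_diagram_mult) (use x y in auto)
  also have "\<dots> = star n y \<otimes>\<^bsub>P_algebra n A B\<^esub> star n x"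
    by (subst lin_swap) (simp add: P_algebra_def mult_free_algebra star_def lin_lin)
  finally show "star n (x \<otimes>\<^bsub>P_algebra n A B\<^esub> y) = star n y \<otimes>\<^bsub>P_algebra n A B\<^esub> star n x" .
qed

lemma star_tabular_C:
  assumes "(l, S, b, T) \<in> tabular_index n"
  shows "star n (tabular_C n (l, S, b, T)) = tabular_C n (l, T, tensor_bar b, S)"
proof -
  have h: "half_diagram n l S" "half_diagram n l T" "b \<in> tensor_basis l" using assms by (simp_all add: tabular_index_iff)
  obtain xs where b: "b = single xs 1" "xs \<in> basis_lists l" using h(3) by (auto simp: tensor_basis_def)
  then show ?thesis
    using flip_diag[OF h(1,2), of xs] basis_list_carrier[OF b(2)]
    by (simp add: tabular_C_def star_single tensor_bar_single basis_lists_def)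
qed

lemma P_trace_commute:
  assumes "x \<in> carrier (P_algebra n A B)" "y \<in> carrier (P_algebra n A B)"
  shows "P_trace n A B (x \<otimes>\<^bsub>P_algebra n A B\<^esub> y) = P_trace n A B (y \<otimes>\<^bsub>P_algebra n A B\<^esub> x)"
proof -
  have k: "keys x \<subseteq> diagrams n B" "keys y \<subseteq> diagrams n B"
    using assms by (simp_all add: P_algebra_def)
  have e: "tr n (f \<otimes>\<^bsub>P_algebra n A B\<^esub> g) = (\<Sum>D\<in>keys f. \<Sum>D'\<in>keys g.
      lookup f D * (lookup g D' * tr n (diagram_mult n A B D D')))" for f g
    by (simp add: P_algebra_def mult_free_algebra tr_lin sum_distrib_left)
  have "tr n (x \<otimes>\<^bsub>P_algebra n A B\<^esub> y) = tr n (y \<otimes>\<^bsub>P_algebra n A B\<^esub> x)"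
    unfolding e by (subst sum.swap, intro sum.cong refl) (use k in \<open>simp add: tr_commute[of _ n] subset_iff mult.left_commute\<close>)
  then show ?thesis by (simp add: P_trace_tr)
qed

text \<open>The submodule below \<open>l\<close> is thus spanned by the diagrams with fewer than
  \<open>l\<close> through strings. The bound \<open>l \<le> n\<close> keeps the relation inside the
  index set.\<close>

definition tabular_order :: "nat \<Rightarrow> nat rel" where
  "tabular_order n = {(m, l). m \<le> l \<and> l \<le> n}"

lemma tabular:
  assumes "finite B \<or> n \<le> 1"
  shows "tabular_algebra (P_algebra n A B) {..n} (tabular_order n) tensor tensor_basis (\<lambda>_. tensor_bar)
    (halves n) (tabular_C n) (star n)"
proof -
  interpret P: free_algebra_data "diagrams n B" "diagram_mult n A B" "identity_diagram n \<one>" by (rule diagram_algebra)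
  have P: "P_algebra n A B = P.F" by (simp add: P_algebra_def)
  show ?thesis
  proof (intro tabular_algebra.intro tabular_algebra_axioms.intro)
    show "associative_algebra (P_algebra n A B)" unfolding P by (rule P.associative_algebra_free)
    show "finite {..n}" by simp
    show "partial_order_on {..n} (tabular_order n)"
      by (auto simp: partial_order_on_def preorder_on_def refl_on_def trans_def antisym_def tabular_order_def)
    show "normalized_table_algebra (tensor l) (tensor_basis l) tensor_bar" for l by (rule tensor_table_algebra)
    show "finite (halves n l)" for l by (rule finite_halves[OF assms])
    show "inj_on (tabular_C n) (tabular_index n)" by (rule tabular_C_inj)
    show "free_basis (P_algebra n A B) (tabular_basis {..n} tensor_basis (halves n) (tabular_C n))"
      unfolding tabular_basis_C canonical_basis_def P by (rule P.free_basis_free)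
    show "involutory_anti_automorphism (P_algebra n A B) (star n)" by (rule star_anti)
    show "star n (tabular_C n (l, S, b, T)) = tabular_C n (l, T, tensor_bar b, S)"
      if "(l, S, b, T) \<in> tabular_index n" for l S b T by (rule star_tabular_C[OF that])
    show "\<exists>E \<subseteq> tabular_basis {..n} tensor_basis (halves n) (tabular_C n).
         (\<forall>e\<in>E. e \<otimes>\<^bsub>P_algebra n A B\<^esub> e = e) \<and>
         (\<forall>e\<in>E. \<forall>f\<in>E. e \<noteq> f \<longrightarrow> e \<otimes>\<^bsub>P_algebra n A B\<^esub> f = \<zero>\<^bsub>P_algebra n A B\<^esub>) \<and>
         carrier (P_algebra n A B) = lin_span (P_algebra n A B)
           {e \<otimes>\<^bsub>P_algebra n A B\<^esub> a \<otimes>\<^bsub>P_algebra n A B\<^esub> f | e a f. e \<in> E \<and> a \<in> carrier (P_algebra n A B) \<and> f \<in> E} \<and>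
         (\<forall>K \<in> tabular_basis {..n} tensor_basis (halves n) (tabular_C n).
           \<exists>e\<in>E. \<exists>f\<in>E. K = e \<otimes>\<^bsub>P_algebra n A B\<^esub> K \<otimes>\<^bsub>P_algebra n A B\<^esub> f)"
    \<comment> \<open>The unit is itself a diagram, hence an element of the tabular basis, and
      serves as the only idempotent.\<close>
    proof (intro exI[of _ "{\<one>\<^bsub>P_algebra n A B\<^esub>}"] conjI)
      let ?o = "\<one>\<^bsub>P_algebra n A B\<^esub>"
      have o: "?o \<otimes>\<^bsub>P_algebra n A B\<^esub> a \<otimes>\<^bsub>P_algebra n A B\<^esub> ?o = a" if "a \<in> carrier (P_algebra n A B)" for a
        using that monoid.l_one[OF P.monoid_free] monoid.r_one[OF P.monoid_free] unfolding P by metis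
      show "{?o} \<subseteq> tabular_basis {..n} tensor_basis (halves n) (tabular_C n)"
        unfolding tabular_basis_C canonical_basis_def using P.unit_mem by (simp add: P)
      show "\<forall>e\<in>{?o}. e \<otimes>\<^bsub>P_algebra n A B\<^esub> e = e"
        using monoid.l_one[OF P.monoid_free monoid.one_closed[OF P.monoid_free]] unfolding P by blast
      show "\<forall>e\<in>{?o}. \<forall>f\<in>{?o}. e \<noteq> f \<longrightarrow> e \<otimes>\<^bsub>P_algebra n A B\<^esub> f = \<zero>\<^bsub>P_algebra n A B\<^esub>" by blast
      have "{e \<otimes>\<^bsub>P_algebra n A B\<^esub> a \<otimes>\<^bsub>P_algebra n A B\<^esub> f | e a f. e \<in> {?o} \<and> a \<in> carrier (P_algebra n A B) \<and> f \<in> {?o}} =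
          carrier (P_algebra n A B)"
        using o by (intro equalityI subsetI) (auto, metis)
      then show "carrier (P_algebra n A B) = lin_span (P_algebra n A B)
          {e \<otimes>\<^bsub>P_algebra n A B\<^esub> a \<otimes>\<^bsub>P_algebra n A B\<^esub> f | e a f. e \<in> {?o} \<and> a \<in> carrier (P_algebra n A B) \<and> f \<in> {?o}}"
        using P.lin_span_carrier by (simp add: P)
      show "\<forall>K \<in> tabular_basis {..n} tensor_basis (halves n) (tabular_C n).
           \<exists>e\<in>{?o}. \<exists>f\<in>{?o}. K = e \<otimes>\<^bsub>P_algebra n A B\<^esub> K \<otimes>\<^bsub>P_algebra n A B\<^esub> f"
      proof
        fix K assume "K \<in> tabular_basis {..n} tensor_basis (halves n) (tabular_C n)"
        then have "K \<in> carrier (P_algebra n A B)"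
          unfolding tabular_basis_C canonical_basis_def by (auto simp: P)
        then show "\<exists>e\<in>{?o}. \<exists>f\<in>{?o}. K = e \<otimes>\<^bsub>P_algebra n A B\<^esub> K \<otimes>\<^bsub>P_algebra n A B\<^esub> f" using o by simp
      qed
    qed
    fix l a assume l: "l \<in> {..n}" and "a \<in> carrier (P_algebra n A B)"
    then have a: "keys a \<subseteq> diagrams n B" and ln: "l \<le> n" by (simp_all add: P)
    let ?r = "\<lambda>S' S. left_action n l (a \<otimes>\<^bsub>P_algebra n A B\<^esub> single (diag n S (replicate l \<one>) S) 1) S' S"
    have K: "{(m, q) \<in> tabular_index n. (m, l) \<in> tabular_order n \<and> m \<noteq> l} = {(m, q) \<in> tabular_index n. m < l}"
      using ln by (auto simp: tabular_order_def)
    show "\<exists>r. (\<forall>S'\<in>halves n l. \<forall>S\<in>halves n l. r S' S \<in> carrier (extend_scalars (tensor l) (tensor_basis l))) \<and>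
             (\<forall>S\<in>halves n l. \<forall>T\<in>halves n l. \<forall>g\<in>carrier (tensor l).
                a \<otimes>\<^bsub>P_algebra n A B\<^esub> C_ext (P_algebra n A B) (tabular_C n) l S (of_int_coords (tensor l) (tensor_basis l) g) T
                \<ominus>\<^bsub>P_algebra n A B\<^esub> (\<Oplus>\<^bsub>P_algebra n A B\<^esub>S'\<in>halves n l. C_ext (P_algebra n A B) (tabular_C n) l S'
                      (r S' S \<otimes>\<^bsub>extend_scalars (tensor l) (tensor_basis l)\<^esub> of_int_coords (tensor l) (tensor_basis l) g) T)
                \<in> lin_span (P_algebra n A B) (tabular_C n ` {(m, q) \<in> tabular_index n. (m, l) \<in> tabular_order n \<and> m \<noteq> l}))"
      unfolding K
    proof (intro exI[of _ ?r] conjI ballI)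
      show "?r S' S \<in> carrier (extend_scalars (tensor l) (tensor_basis l))" for S' S
        using keys_left_action by (simp add: extend_scalars_def)
      fix S T g assume "S \<in> halves n l" "T \<in> halves n l" and g: "g \<in> carrier (tensor l)"
      then have ST: "half_diagram n l S" "half_diagram n l T" by (simp_all add: halves_def)
      show "a \<otimes>\<^bsub>P_algebra n A B\<^esub> C_ext (P_algebra n A B) (tabular_C n) l S (of_int_coords (tensor l) (tensor_basis l) g) T
          \<ominus>\<^bsub>P_algebra n A B\<^esub> (\<Oplus>\<^bsub>P_algebra n A B\<^esub>S'\<in>halves n l. C_ext (P_algebra n A B) (tabular_C n) l S'
                (?r S' S \<otimes>\<^bsub>extend_scalars (tensor l) (tensor_basis l)\<^esub> of_int_coords (tensor l) (tensor_basis l) g) T)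
          \<in> lin_span (P_algebra n A B) (tabular_C n ` {(m, q) \<in> tabular_index n. m < l})"
        by (rule axiom_A3[OF finite_halves[OF assms] a ln ST keys_of_int_coords[OF g]])
    qed
  qed
qed

lemma tabular_with_trace:
  assumes "finite B \<or> n \<le> 1"
  shows "tabular_algebra_with_trace (P_algebra n A B) {..n} (tabular_order n) tensor tensor_basis (\<lambda>_. tensor_bar)
    (halves n) (tabular_C n) (star n) (P_trace n A B)"
proof (intro tabular_algebra_with_trace.intro tabular_algebra_with_trace_axioms.intro tabular[OF assms],
    unfold tabular_basis_C)
  fix N assume "N \<in> canonical_basis n B"
  then obtain l S b T where i: "(l, S, b, T) \<in> tabular_index n" "N = tabular_C n (l, S, b, T)"
    unfolding tabular_basis_C[symmetric] tabular_basis_def by auto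
  show "\<exists>k\<in>degrees (P_algebra n A B) (canonical_basis n B) N. \<forall>j\<in>degrees (P_algebra n A B) (canonical_basis n B) N. j \<le> k"
    unfolding i(2) using degree_attained[OF i(1)] degree_le[OF i(1)] by blast
next
  fix l S b T l' S' b' T' l'' S'' b'' T'' g
  assume i: "(l, S, b, T) \<in> tabular_index n" "(l', S', b', T') \<in> tabular_index n" "(l'', S'', b'', T'') \<in> tabular_index n"
    and g: "g = structure_const (P_algebra n A B) (canonical_basis n B) (tabular_C n (l, S, b, T)) (tabular_C n (l', S', b', T'))
      (tabular_C n (l'', S'', b'', T''))"
  show "(g \<noteq> 0 \<and> ldeg g = a_fun (P_algebra n A B) (canonical_basis n B) (tabular_C n (l'', S'', b'', T''))) =
    (l' = l \<and> l'' = l \<and> S'' = S \<and> T = S' \<and> T'' = T' \<and> b'' \<in> supp (tensor l) (tensor_basis l) (b \<otimes>\<^bsub>tensor l\<^esub> b'))"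
    unfolding a_fun_tabular_C[OF i(3)] by (rule axiom_A4[OF i g])
next
  fix l S T V assume "l \<in> {..n}" "S \<in> halves n l" "T \<in> halves n l" "V \<in> halves n l"
  then show "gamma_const (P_algebra n A B) (canonical_basis n B) (tabular_C n (l, S, \<one>\<^bsub>tensor l\<^esub>, T))
      (tabular_C n (l, T, \<one>\<^bsub>tensor l\<^esub>, V)) (tabular_C n (l, S, \<one>\<^bsub>tensor l\<^esub>, V)) = 1"
    by (intro axiom_A4_gamma) (simp_all add: halves_def)
next
  fix x y r assume x: "x \<in> carrier (P_algebra n A B)"
  show "P_trace n A B (r \<odot>\<^bsub>P_algebra n A B\<^esub> x) = r * P_trace n A B x"
    by (simp add: P_trace_tr P_algebra_def tr_scale)
  show "P_trace n A B (star n x) = P_trace n A B x"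
    using x tr_star[of x n] by (simp add: P_trace_tr P_algebra_def)
  assume y: "y \<in> carrier (P_algebra n A B)"
  show "P_trace n A B (x \<oplus>\<^bsub>P_algebra n A B\<^esub> y) = P_trace n A B x + P_trace n A B y"
    by (simp add: P_trace_tr P_algebra_def tr_add distrib_left)
  show "P_trace n A B (x \<otimes>\<^bsub>P_algebra n A B\<^esub> y) = P_trace n A B (y \<otimes>\<^bsub>P_algebra n A B\<^esub> x)"
    by (rule P_trace_commute[OF x y])
next
  fix l S b T K assume i: "(l, S, b, T) \<in> tabular_index n" and K: "K = tabular_C n (l, S, b, T)"
  have h: "half_diagram n l S" "half_diagram n l T" "b \<in> tensor_basis l" using i by (simp_all add: tabular_index_iff)
  note m = middle_tensor_basis[OF h(3)]
  have b: "b = \<one>\<^bsub>tensor l\<^esub> \<longleftrightarrow> middle b = replicate l \<one>"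
    using m middle_single unfolding one_tensor(1) by metis
  show "P_trace n A B (vpow (a_fun (P_algebra n A B) (canonical_basis n B) K) \<odot>\<^bsub>P_algebra n A B\<^esub> K)
      - (if S = T \<and> b = \<one>\<^bsub>tensor l\<^esub> then 1 else 0) \<in> (\<lambda>p. vpow (-1) * p) ` Aminus"
    using trace_congruence[OF h(1,2) m[THEN conjunct1]]
    unfolding K a_fun_tabular_C[OF i] b P_trace_tr
    unfolding P_algebra_def smult_free_algebra tr_scale tabular_C_def prod.case tr_single mult_1_left .
qed

end

theorem theorem3p2p3:
  fixes A :: "(int, 'a) module" and \<B> :: "'a set" and bar :: "'a \<Rightarrow> 'a" and n :: nat
  assumes "normalized_table_algebra A \<B> bar"
    and "finite \<B> \<or> n \<le> 1"
  shows "\<exists>(\<Lambda> :: nat set) (le :: nat rel)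
           (\<Gamma> :: nat \<Rightarrow> (int, 'a list \<Rightarrow>\<^sub>0 int) module)
           (B :: nat \<Rightarrow> ('a list \<Rightarrow>\<^sub>0 int) set)
           (bar' :: nat \<Rightarrow> ('a list \<Rightarrow>\<^sub>0 int) \<Rightarrow> ('a list \<Rightarrow>\<^sub>0 int))
           (M :: nat \<Rightarrow> 'a diagram set)
           (C :: nat \<times> 'a diagram \<times> ('a list \<Rightarrow>\<^sub>0 int) \<times> 'a diagram \<Rightarrow> ('a diagram \<Rightarrow>\<^sub>0 laurent))
           (star :: ('a diagram \<Rightarrow>\<^sub>0 laurent) \<Rightarrow> ('a diagram \<Rightarrow>\<^sub>0 laurent)).
           tabular_basis \<Lambda> B M C = canonical_basis n \<B> \<and>
           tabular_algebra_with_trace (P_algebra n A \<B>) \<Lambda> le \<Gamma> B bar' M C star (P_trace n A \<B>)"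
proof -
  interpret int_table_algebra A \<B> bar using assms(1) by (simp add: int_table_algebra_def)
  show ?thesis using tabular_basis_C tabular_with_trace[OF assms(2)] by blast
qed

end
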